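(* Consider the product structure, regular local likelihood process $X$, data-generating law $P_\theta$ and Gaussian location counterpart $Y$ defined in the context. Suppose the local moment bounds stated in the context hold with $\delta_n(\theta)$ and $r_n\lesssim\sqrt{n/M_n}$. Let $H=\bigoplus_mH_m^{(n)}$, $\Sigma=\bigoplus_m\Sigma_m^{(n)}$, $B=\bigoplus_mB_m^{(n)}$ be the product operators of the context (with $H_m^{(n)}=\Sigma_m^{(n)}B_m^{(n)}$), let $a\in\{-1,0\}$, and let $\phi_\theta,\Phi_n(\theta),\Phi_n^{\mathrm G}(\theta,\beta)$ be as defined there. Set $$\mathfrak h_n=\max_{m\le M_n}\bigl(\|H_m^{(n)}\|_{\mathrm{op}}+\|B_m^{(n)}\|_{\mathrm{op}}\bigr),\qquad\widetilde\delta_n(\theta)=\delta_n(\theta)\{1+\delta_n(\theta)\}.$$ If $\mathfrak h_n=O(1)$, then, for every fixed sufficiently small $\epsilon>0$ and every $\theta\in\Theta_n$, $$\Phi_n^{\mathrm G}(\theta,-\epsilon)-C\Bigl(\epsilon+\frac{\widetilde\delta_n(\theta)}{\epsilon}\Bigr)\le\Phi_n(\theta)\le\Phi_n^{\mathrm G}(\theta,\epsilon)+C\Bigl(\epsilon+\frac{\widetilde\delta_n(\theta)}{\epsilon}\Bigr),$$ where $C<\infty$ is independent of $n$, $\theta$, and $\epsilon$.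
   Context: For each $n$: $\Theta_n$ is a compact parameter space, $T_n\subseteq\Theta_n$ a compact metric space with a Borel probability measure $\pi$ (prior), $M_n$ a number of local components, $\Omega=\prod_{m=1}^{M_n}\Omega_m$ the sample space; all may depend on $n$. For $m\le M_n$, $\mathcal H_m$ is a real separable Hilbert space and $\eta_m:\Theta_n\to\mathcal H_m$ a continuous feature map; $\mathcal H=\bigoplus_m\mathcal H_m$ and $\eta=(\eta_1,\dots,\eta_{M_n}):\Theta_n\to\mathcal H$. The feature radius is $r_n=\max_{m\le M_n}\sup_{u\in\Theta_n}\|\eta_m(u)\|_{\mathcal H_m}$, with $r_n>0$. The notation $\lesssim$ means $\le$ up to a finite constant independent of $n$, $m$, $\theta$. Likelihood process: $X(t,\omega)=\sum_{m=1}^{M_n}X_m^{(n)}(t,\omega_m)$, $t\in T_n$, with continuous sample paths, where $$X_m^{(n)}(t,\omega_m)=\langle U_m^{(n)}(\omega_m),\eta_m(t)\rangle_{\mathcal H_m}-\tfrac12\langle V_m^{(n)}(\omega_m)\eta_m(t),\eta_m(t)\rangle_{\mathcal H_m}+R_m^{(n)}(t,\omega_m),$$ $U_m^{(n)}$ is a random element of $\mathcal H_m$, $V_m^{(n)}$ a random (bounded) self-adjoint operator on $\mathcal H_m$, and $R_m^{(n)}$ a remainder. Data-generating laws: $P_0=\bigotimes_mP_{0,m}^{(n)}$ is a null product probability measure independent of $\theta$, $P_\theta=\bigotimes_mP_{\theta,m}^{(n)}$, and $$\log\frac{\mathrm dP_{\theta,m}^{(n)}}{\mathrm dP_{0,m}^{(n)}}(\omega_m)=\langle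 S_m^{(n)}(\omega_m),\eta_m(\theta)\rangle_{\mathcal H_m}+\Delta_m^{(n)}(\theta,\omega_m),\qquad\theta\in\Theta_n,$$ with $S_m^{(n)}$ a random element of $\mathcal H_m$ and $\Delta_m^{(n)}$ a (real-valued) remainder. $\mathbb E_0,\mathbb E_\theta$ denote expectation under $P_{0,m}^{(n)}$ and $P_{\theta,m}^{(n)}$. Local moment bounds (superscripts $(n)$ dropped). Put $\mathsf L_{m,n}=\mathbb E_0\|U_m\|^2+\mathbb E_0\|S_m\|^2$, $$\mathcal E^U_{m,n}(\theta)=r_n(\mathbb E_0\|U_m\|^3+\mathbb E_\theta\|U_m\|^3),\qquad\mathcal E^S_{m,n}(\theta)=r_n(\mathbb E_0\|S_m\|^3+\mathbb E_\theta\|S_m\|^3),$$ $$\mathcal E^V_{m,n}(\theta)=r_n\sqrt{\mathbb E_0\|V_m\|_{\mathrm{op}}^2}+r_n^4(\mathbb E_0\|V_m\|_{\mathrm{op}}^3+\mathbb E_\theta\|V_m\|_{\mathrm{op}}^3),$$ $$\mathcal E^R_{m,n}(\theta)=\sup_{t\in T_n}\Bigl\{r_n^{-2}|\mathbb E_0R_m(t)|+r_n^{-1}\sqrt{\mathbb E_0|R_m(t)|^2}+r_n^{-2}\mathbb E_0|R_m(t)|^3\Bigr\}+r_n^{-2}\mathbb E_\theta\Bigl[\sup_{t\in T_n}|R_m(t)|^3\Bigr],$$ $$\mathcal E^\Delta_{m,n}(\theta)=r_n^{-1}\sqrt{\mathbb E_0|\Delta_m(\theta)|^2}+r_n^{-2}(\mathbb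 E_0|\Delta_m(\theta)|^3+\mathbb E_\theta|\Delta_m(\theta)|^3).$$ The assumption is: $\delta_n(\theta)\ge0$ is a (finite) deterministic quantity such that, uniformly over $m\le M_n$ and $\theta\in\Theta_n$, $$\mathbb E_0[U_m]=0,\qquad\mathsf L_{m,n}\lesssim1,\qquad\mathcal E^U_{m,n}(\theta)+\mathcal E^S_{m,n}(\theta)+\mathcal E^V_{m,n}(\theta)+\mathcal E^R_{m,n}(\theta)+\mathcal E^\Delta_{m,n}(\theta)\lesssim\delta_n(\theta).$$ Gaussian counterpart: bounded operators on $\mathcal H_m$ are defined by $$\langle A_mh,g\rangle=\mathbb E_0[\langle S_m,h\rangle\langle U_m,g\rangle],\quad\langle\Sigma_mh,g\rangle=\mathbb E_0[\langle U_m,h\rangle\langle U_m,g\rangle],\quad\langle K_mh,g\rangle=\mathbb E_0[\langle V_mh,g\rangle],$$ and $A=\bigoplus_mA_m$, $\Sigma=\bigoplus_m\Sigma_m$, $K=\bigoplus_mK_m$. Under $Q_\theta$, with $\xi\sim N(0,\Sigma)$ in $\mathcal H$, $$Y(t)=\langle\xi,\eta(t)\rangle+\langle A\eta(\theta),\eta(t)\rangle-\tfrac12\langle K\eta(t),\eta(t)\rangle.$$ Directions: $H_m^{(n)}:\mathcal H_m\to\mathcal H_m$ are self-adjoint bounded operators, independent of $\theta$, with $\mathrm{Range}(H_m^{(n)})\subseteq\mathrm{Range}(\Sigma_m^{(n)})$, and $B_m^{(n)}$ are bounded operators with $H_m^{(n)}=\Sigma_m^{(n)}B_m^{(n)}$.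 The perturbed Gaussian process is $Y_\beta(t)=Y(t)+\beta\widetilde Y(t)$ with $$\widetilde Y(t)=\langle\xi,B\eta(t)\rangle+a\langle H[\eta(\theta)-\eta(t)],\eta(\theta)-\eta(t)\rangle,$$ and the test function is $$\phi_\theta(s,t)=a\langle H[\eta(\theta)-\eta(t)],\eta(\theta)-\eta(t)\rangle+\langle H\eta(t),\eta(t)\rangle-\langle H\eta(s),\eta(t)\rangle.$$ With $\pi_Z(\mathrm dt)=e^{Z(t)}\pi(\mathrm dt)/\int_{T_n}e^{Z(s)}\pi(\mathrm ds)$, $$\Phi_n(\theta)=\frac1n\iint\phi_\theta(s,t)\,\mathbb E_{P_\theta}[\pi_X^{\otimes2}](\mathrm ds,\mathrm dt),\qquad\Phi_n^{\mathrm G}(\theta,\beta)=\frac1n\iint\phi_\theta(s,t)\,\mathbb E_{Q_\theta}[\pi_{Y_\beta}^{\otimes2}](\mathrm ds,\mathrm dt).$$ "For every fixed sufficiently small $\epsilon>0$" means for all $\epsilon\in(0,\epsilon_0)$ with $\epsilon_0$ independent of $n$ and $\theta$. *)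

theory Defs
  imports "HOL-Probability.Probability" "HOL-Library.Landau_Symbols"
begin

section \<open>Operators on closed subspaces and direct sums\<close>

text \<open>
  All Hilbert spaces are closed subspaces of one separable Hilbert space type \<open>'h\<close>; countably many
  separable Hilbert spaces can always be realised in this way.  A bounded operator on a closed
  subspace \<open>W\<close> is represented by its extension by zero on the orthogonal complement of \<open>W\<close>, which
  has the same operator norm and the same range.
\<close>

definition operator_on :: "('h::real_inner) set \<Rightarrow> ('h \<Rightarrow>\<^sub>L 'h) \<Rightarrow> bool" where
  "operator_on W T \<longleftrightarrow>
     (\<forall>x. blinfun_apply T x \<in> W) \<and> (\<forall>x\<in>orthogonal_comp W. blinfun_apply T x = 0)"

definition selfadjoint_op :: "('h::real_inner \<Rightarrow>\<^sub>L 'h) \<Rightarrow> bool" where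
  "selfadjoint_op T \<longleftrightarrow> (\<forall>x y. blinfun_apply T x \<bullet> y = x \<bullet> blinfun_apply T y)"

text \<open>The bounded operator on \<open>W\<close> representing a bounded bilinear form \<open>b\<close> on \<open>W\<close>.\<close>

definition form_op :: "('h::real_inner) set \<Rightarrow> ('h \<Rightarrow> 'h \<Rightarrow> real) \<Rightarrow> ('h \<Rightarrow>\<^sub>L 'h)" where
  "form_op W b =
     (THE T. operator_on W T \<and> (\<forall>h\<in>W. \<forall>g\<in>W. blinfun_apply T h \<bullet> g = b h g))"

text \<open>
  Elements of the direct sum of the spaces \<open>W 1, \<dots>, W M\<close> are families \<open>x\<close> with \<open>x m \<in> W m\<close> for
  \<open>m \<in> {1..M}\<close>; the values outside \<open>{1..M}\<close> are irrelevant.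
\<close>

definition dsum_inner :: "nat \<Rightarrow> (nat \<Rightarrow> 'h::real_inner) \<Rightarrow> (nat \<Rightarrow> 'h) \<Rightarrow> real" where
  "dsum_inner M x y = (\<Sum>m\<in>{1..M}. x m \<bullet> y m)"

definition dsum_op ::
  "(nat \<Rightarrow> 'h::real_inner \<Rightarrow>\<^sub>L 'h) \<Rightarrow> (nat \<Rightarrow> 'h) \<Rightarrow> (nat \<Rightarrow> 'h)" where
  "dsum_op T x = (\<lambda>m. blinfun_apply (T m) (x m))"

section \<open>Moments and Gibbs measures\<close>

definition ennsqrt :: "ennreal \<Rightarrow> ennreal" where
  "ennsqrt x = (if x = \<top> then \<top> else ennreal (sqrt (enn2real x)))"

definition abs_moment :: "'w measure \<Rightarrow> nat \<Rightarrow> ('w \<Rightarrow> 'b::real_normed_vector) \<Rightarrow> ennreal" where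
  "abs_moment P k f = (\<integral>\<^sup>+\<omega>. ennreal (norm (f \<omega>) ^ k) \<partial>P)"

definition gibbs :: "'p measure \<Rightarrow> ('p \<Rightarrow> real) \<Rightarrow> 'p measure" where
  "gibbs \<pi> Z = density \<pi> (\<lambda>t. ennreal (exp (Z t) / (\<integral>s. exp (Z s) \<partial>\<pi>)))"

text \<open>The averaged two-replica Gibbs measure of a random potential \<open>Z\<close> under \<open>P\<close>.\<close>

definition mean_gibbs2 ::
  "'w measure \<Rightarrow> 'p measure \<Rightarrow> ('w \<Rightarrow> 'p \<Rightarrow> real) \<Rightarrow> ('p \<times> 'p) measure" where
  "mean_gibbs2 P \<pi> Z = bind P (\<lambda>\<omega>. gibbs \<pi> (Z \<omega>) \<Otimes>\<^sub>M gibbs \<pi> (Z \<omega>))"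

definition centred_normal :: "real \<Rightarrow> real measure" where
  "centred_normal v =
     (if v = 0 then return borel 0 else density lborel (\<lambda>x. ennreal (normal_density 0 (sqrt v) x)))"

section \<open>The local likelihood model\<close>

record (overloaded) ('p, 'w, 'h::real_inner) lik_model =
  params :: "'p set"
  idx :: "'p set"
  prior :: "'p measure"
  ncomp :: nat
  hspace :: "nat \<Rightarrow> 'h set"
  feat :: "nat \<Rightarrow> 'p \<Rightarrow> 'h"
  null_law :: "nat \<Rightarrow> 'w measure"
  Uvec :: "nat \<Rightarrow> 'w \<Rightarrow> 'h"
  Vop :: "nat \<Rightarrow> 'w \<Rightarrow> ('h \<Rightarrow>\<^sub>L 'h)"
  Rrem :: "nat \<Rightarrow> 'p \<Rightarrow> 'w \<Rightarrow> real"
  Svec :: "nat \<Rightarrow> 'w \<Rightarrow> 'h"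
  Drem :: "nat \<Rightarrow> 'p \<Rightarrow> 'w \<Rightarrow> real"

definition comps :: "('p, 'w, 'h::real_inner) lik_model \<Rightarrow> nat set" where
  "comps E = {1..ncomp E}"

definition radius :: "('p, 'w, 'h::real_inner) lik_model \<Rightarrow> real" where
  "radius E = (MAX m\<in>comps E. SUP u\<in>params E. norm (feat E m u))"

definition eta :: "('p, 'w, 'h::real_inner) lik_model \<Rightarrow> 'p \<Rightarrow> (nat \<Rightarrow> 'h)" where
  "eta E t = (\<lambda>m. feat E m t)"

definition local_process ::
  "('p, 'w, 'h::real_inner) lik_model \<Rightarrow> nat \<Rightarrow> 'p \<Rightarrow> 'w \<Rightarrow> real" where
  "local_process E m t w =
     Uvec E m w \<bullet> feat E m t
     - 1 / 2 * (blinfun_apply (Vop E m w) (feat E m t) \<bullet> feat E m t)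
     + Rrem E m t w"

definition process ::
  "('p, 'w, 'h::real_inner) lik_model \<Rightarrow> (nat \<Rightarrow> 'w) \<Rightarrow> 'p \<Rightarrow> real" where
  "process E \<omega> t = (\<Sum>m\<in>comps E. local_process E m t (\<omega> m))"

definition law ::
  "('p, 'w, 'h::real_inner) lik_model \<Rightarrow> 'p \<Rightarrow> nat \<Rightarrow> 'w measure" where
  "law E \<theta> m =
     density (null_law E m) (\<lambda>w. ennreal (exp (Svec E m w \<bullet> feat E m \<theta> + Drem E m \<theta> w)))"

definition joint_law ::
  "('p, 'w, 'h::real_inner) lik_model \<Rightarrow> 'p \<Rightarrow> (nat \<Rightarrow> 'w) measure" where
  "joint_law E \<theta> = PiM (comps E) (law E \<theta>)"

text \<open>
  Random operators are only required to be strongly measurable: the space of bounded operators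
  with its norm topology is not separable in general.
\<close>

locale local_likelihood_model =
  fixes E ::
    "('p::topological_space, 'w, 'h::{real_inner, banach, second_countable_topology}) lik_model"
  assumes compact_params: "compact (params E)"
    and idx_subset: "idx E \<subseteq> params E"
    and compact_idx: "compact (idx E)"
    and metrizable_idx: "metrizable_space (top_of_set (idx E))"
    and sets_prior: "sets (prior E) = sets (restrict_space borel (idx E))"
    and prob_prior: "prob_space (prior E)"
    and ncomp_pos: "1 \<le> ncomp E"
    and subspace_hspace: "m \<in> comps E \<Longrightarrow> subspace (hspace E m)"
    and closed_hspace: "m \<in> comps E \<Longrightarrow> closed (hspace E m)"
    and feat_in: "m \<in> comps E \<Longrightarrow> t \<in> params E \<Longrightarrow> feat E m t \<in> hspace E m"
    and feat_cont: "m \<in> comps E \<Longrightarrow> continuous_on (params E) (feat E m)"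
    and radius_pos: "0 < radius E"
    and prob_null: "m \<in> comps E \<Longrightarrow> prob_space (null_law E m)"
    and U_meas: "m \<in> comps E \<Longrightarrow> Uvec E m \<in> borel_measurable (null_law E m)"
    and U_in: "m \<in> comps E \<Longrightarrow> w \<in> space (null_law E m) \<Longrightarrow> Uvec E m w \<in> hspace E m"
    and V_meas:
      "m \<in> comps E \<Longrightarrow> (\<lambda>w. blinfun_apply (Vop E m w) h) \<in> borel_measurable (null_law E m)"
    and V_op: "m \<in> comps E \<Longrightarrow> w \<in> space (null_law E m) \<Longrightarrow> operator_on (hspace E m) (Vop E m w)"
    and V_selfadjoint: "m \<in> comps E \<Longrightarrow> w \<in> space (null_law E m) \<Longrightarrow> selfadjoint_op (Vop E m w)"
    and R_meas: "m \<in> comps E \<Longrightarrow> t \<in> idx E \<Longrightarrow> Rrem E m t \<in> borel_measurable (null_law E m)"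
    and S_meas: "m \<in> comps E \<Longrightarrow> Svec E m \<in> borel_measurable (null_law E m)"
    and S_in: "m \<in> comps E \<Longrightarrow> w \<in> space (null_law E m) \<Longrightarrow> Svec E m w \<in> hspace E m"
    and D_meas: "m \<in> comps E \<Longrightarrow> \<theta> \<in> params E \<Longrightarrow> Drem E m \<theta> \<in> borel_measurable (null_law E m)"
    and prob_law: "m \<in> comps E \<Longrightarrow> \<theta> \<in> params E \<Longrightarrow> prob_space (law E \<theta> m)"
    and process_cont:
      "\<omega> \<in> space (PiM (comps E) (null_law E)) \<Longrightarrow> continuous_on (idx E) (process E \<omega>)"

section \<open>Local moment bounds\<close>

definition momL :: "('p, 'w, 'h::real_inner) lik_model \<Rightarrow> nat \<Rightarrow> ennreal" where
  "momL E m = abs_moment (null_law E m) 2 (Uvec E m) + abs_moment (null_law E m) 2 (Svec E m)"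

definition errU :: "('p, 'w, 'h::real_inner) lik_model \<Rightarrow> 'p \<Rightarrow> nat \<Rightarrow> ennreal" where
  "errU E \<theta> m =
     ennreal (radius E) *
       (abs_moment (null_law E m) 3 (Uvec E m) + abs_moment (law E \<theta> m) 3 (Uvec E m))"

definition errS :: "('p, 'w, 'h::real_inner) lik_model \<Rightarrow> 'p \<Rightarrow> nat \<Rightarrow> ennreal" where
  "errS E \<theta> m =
     ennreal (radius E) *
       (abs_moment (null_law E m) 3 (Svec E m) + abs_moment (law E \<theta> m) 3 (Svec E m))"

definition errV :: "('p, 'w, 'h::real_inner) lik_model \<Rightarrow> 'p \<Rightarrow> nat \<Rightarrow> ennreal" where
  "errV E \<theta> m =
     ennreal (radius E) * ennsqrt (abs_moment (null_law E m) 2 (Vop E m))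
     + ennreal (radius E ^ 4) *
       (abs_moment (null_law E m) 3 (Vop E m) + abs_moment (law E \<theta> m) 3 (Vop E m))"

definition errR :: "('p, 'w, 'h::real_inner) lik_model \<Rightarrow> 'p \<Rightarrow> nat \<Rightarrow> ennreal" where
  "errR E \<theta> m =
     (SUP t\<in>idx E.
        ennreal (1 / radius E ^ 2) * ennreal \<bar>\<integral>w. Rrem E m t w \<partial>null_law E m\<bar>
        + ennreal (1 / radius E) * ennsqrt (abs_moment (null_law E m) 2 (Rrem E m t))
        + ennreal (1 / radius E ^ 2) * abs_moment (null_law E m) 3 (Rrem E m t))
     + ennreal (1 / radius E ^ 2) *
       (\<integral>\<^sup>+w. (SUP t\<in>idx E. ennreal (\<bar>Rrem E m t w\<bar> ^ 3)) \<partial>law E \<theta> m)"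

definition errD :: "('p, 'w, 'h::real_inner) lik_model \<Rightarrow> 'p \<Rightarrow> nat \<Rightarrow> ennreal" where
  "errD E \<theta> m =
     ennreal (1 / radius E) * ennsqrt (abs_moment (null_law E m) 2 (Drem E m \<theta>))
     + ennreal (1 / radius E ^ 2) *
       (abs_moment (null_law E m) 3 (Drem E m \<theta>) + abs_moment (law E \<theta> m) 3 (Drem E m \<theta>))"

definition local_moment_bounds ::
  "(nat \<Rightarrow> ('p, 'w, 'h::{real_inner, banach, second_countable_topology}) lik_model)
    \<Rightarrow> (nat \<Rightarrow> 'p \<Rightarrow> real) \<Rightarrow> bool" where
  "local_moment_bounds E \<delta> \<longleftrightarrow>
     (\<forall>n\<ge>1. \<forall>\<theta>\<in>params (E n). 0 \<le> \<delta> n \<theta>) \<and>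
     (\<forall>n\<ge>1. \<forall>m\<in>comps (E n). (\<integral>w. Uvec (E n) m w \<partial>null_law (E n) m) = 0) \<and>
     (\<exists>c::real. \<forall>n\<ge>1. \<forall>m\<in>comps (E n). momL (E n) m \<le> ennreal c) \<and>
     (\<exists>c::real. \<forall>n\<ge>1. \<forall>\<theta>\<in>params (E n). \<forall>m\<in>comps (E n).
        errU (E n) \<theta> m + errS (E n) \<theta> m + errV (E n) \<theta> m + errR (E n) \<theta> m + errD (E n) \<theta> m
        \<le> ennreal (c * \<delta> n \<theta>))"

section \<open>Gaussian counterpart\<close>

definition Aop ::
  "('p, 'w, 'h::{real_inner, banach, second_countable_topology}) lik_model \<Rightarrow> nat \<Rightarrow> ('h \<Rightarrow>\<^sub>L 'h)"
  where
  "Aop E m =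
     form_op (hspace E m) (\<lambda>h g. \<integral>w. (Svec E m w \<bullet> h) * (Uvec E m w \<bullet> g) \<partial>null_law E m)"

definition Sigmaop ::
  "('p, 'w, 'h::{real_inner, banach, second_countable_topology}) lik_model \<Rightarrow> nat \<Rightarrow> ('h \<Rightarrow>\<^sub>L 'h)"
  where
  "Sigmaop E m =
     form_op (hspace E m) (\<lambda>h g. \<integral>w. (Uvec E m w \<bullet> h) * (Uvec E m w \<bullet> g) \<partial>null_law E m)"

definition Kop ::
  "('p, 'w, 'h::{real_inner, banach, second_countable_topology}) lik_model \<Rightarrow> nat \<Rightarrow> ('h \<Rightarrow>\<^sub>L 'h)"
  where
  "Kop E m =
     form_op (hspace E m) (\<lambda>h g. \<integral>w. blinfun_apply (Vop E m w) h \<bullet> g \<partial>null_law E m)"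

text \<open>
  \<open>\<xi>\<close> is a random element of the direct sum with law \<open>N(0, \<Sigma>)\<close> under \<open>Q\<close>: every continuous linear
  functional of \<open>\<xi>\<close> is a (possibly degenerate) centred normal variable.
\<close>

definition gaussian_element ::
  "('p, 'w, 'h::{real_inner, banach, second_countable_topology}) lik_model
    \<Rightarrow> 'q measure \<Rightarrow> ('q \<Rightarrow> nat \<Rightarrow> 'h) \<Rightarrow> bool" where
  "gaussian_element E Q \<xi> \<longleftrightarrow>
     (\<forall>m\<in>comps E. (\<lambda>q. \<xi> q m) \<in> borel_measurable Q \<and> (\<forall>q\<in>space Q. \<xi> q m \<in> hspace E m)) \<and>
     (\<forall>h. (\<forall>m\<in>comps E. h m \<in> hspace E m) \<longrightarrow>
        distr Q borel (\<lambda>q. dsum_inner (ncomp E) (\<xi> q) h) =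
        centred_normal (dsum_inner (ncomp E) (dsum_op (Sigmaop E) h) h))"

definition gauss_process ::
  "('p, 'w, 'h::{real_inner, banach, second_countable_topology}) lik_model
    \<Rightarrow> 'p \<Rightarrow> (nat \<Rightarrow> 'h) \<Rightarrow> 'p \<Rightarrow> real" where
  "gauss_process E \<theta> x t =
     dsum_inner (ncomp E) x (eta E t)
     + dsum_inner (ncomp E) (dsum_op (Aop E) (eta E \<theta>)) (eta E t)
     - 1 / 2 * dsum_inner (ncomp E) (dsum_op (Kop E) (eta E t)) (eta E t)"

text \<open>The quadratic form of \<open>H\<close> at \<open>\<eta>(\<theta>) - \<eta>(t)\<close>.\<close>

definition loss_form ::
  "('p, 'w, 'h::real_inner) lik_model \<Rightarrow> (nat \<Rightarrow> 'h \<Rightarrow>\<^sub>L 'h) \<Rightarrow> 'p \<Rightarrow> 'p \<Rightarrow> real" where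
  "loss_form E H \<theta> t =
     dsum_inner (ncomp E) (dsum_op H (\<lambda>m. eta E \<theta> m - eta E t m)) (\<lambda>m. eta E \<theta> m - eta E t m)"

definition perturbed_process ::
  "('p, 'w, 'h::{real_inner, banach, second_countable_topology}) lik_model
    \<Rightarrow> (nat \<Rightarrow> 'h \<Rightarrow>\<^sub>L 'h) \<Rightarrow> (nat \<Rightarrow> 'h \<Rightarrow>\<^sub>L 'h) \<Rightarrow> real \<Rightarrow> 'p \<Rightarrow> real
    \<Rightarrow> (nat \<Rightarrow> 'h) \<Rightarrow> 'p \<Rightarrow> real" where
  "perturbed_process E H B a \<theta> \<beta> x t =
     gauss_process E \<theta> x t
     + \<beta> * (dsum_inner (ncomp E) x (dsum_op B (eta E t)) + a * loss_form E H \<theta> t)"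

section \<open>Test function and its averages\<close>

definition test_fun ::
  "('p, 'w, 'h::real_inner) lik_model \<Rightarrow> (nat \<Rightarrow> 'h \<Rightarrow>\<^sub>L 'h) \<Rightarrow> real \<Rightarrow> 'p \<Rightarrow> 'p \<Rightarrow> 'p \<Rightarrow> real"
  where
  "test_fun E H a \<theta> s t =
     a * loss_form E H \<theta> t
     + dsum_inner (ncomp E) (dsum_op H (eta E t)) (eta E t)
     - dsum_inner (ncomp E) (dsum_op H (eta E s)) (eta E t)"

definition Phi ::
  "nat \<Rightarrow> ('p, 'w, 'h::{real_inner, banach, second_countable_topology}) lik_model
    \<Rightarrow> (nat \<Rightarrow> 'h \<Rightarrow>\<^sub>L 'h) \<Rightarrow> real \<Rightarrow> 'p \<Rightarrow> real" where
  "Phi n E H a \<theta> =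
     1 / real n *
       (\<integral>(s, t). test_fun E H a \<theta> s t \<partial>mean_gibbs2 (joint_law E \<theta>) (prior E) (process E))"

definition PhiG ::
  "nat \<Rightarrow> ('p, 'w, 'h::{real_inner, banach, second_countable_topology}) lik_model
    \<Rightarrow> ('p \<Rightarrow> 'q measure) \<Rightarrow> ('q \<Rightarrow> nat \<Rightarrow> 'h)
    \<Rightarrow> (nat \<Rightarrow> 'h \<Rightarrow>\<^sub>L 'h) \<Rightarrow> (nat \<Rightarrow> 'h \<Rightarrow>\<^sub>L 'h) \<Rightarrow> real \<Rightarrow> 'p \<Rightarrow> real \<Rightarrow> real" where
  "PhiG n E Q \<xi> H B a \<theta> \<beta> =
     1 / real n *
       (\<integral>(s, t). test_fun E H a \<theta> s t
          \<partial>mean_gibbs2 (Q \<theta>) (prior E) (\<lambda>q. perturbed_process E H B a \<theta> \<beta> (\<xi> q)))"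

definition op_size ::
  "('p, 'w, 'h::real_inner) lik_model \<Rightarrow> (nat \<Rightarrow> 'h \<Rightarrow>\<^sub>L 'h) \<Rightarrow> (nat \<Rightarrow> 'h \<Rightarrow>\<^sub>L 'h) \<Rightarrow> real" where
  "op_size E H B = (MAX m\<in>comps E. norm (H m) + norm (B m))"

definition delta_tilde :: "(nat \<Rightarrow> 'p \<Rightarrow> real) \<Rightarrow> nat \<Rightarrow> 'p \<Rightarrow> real" where
  "delta_tilde \<delta> n \<theta> = \<delta> n \<theta> * (1 + \<delta> n \<theta>)"

end

theory Submission
  imports Defs
begin

text \<open>
  Both averages are derivatives of mean log-partition functions, and mean log-partition functions of
  sums of independent components depend, up to third moments, only on first and second moments.

  Write \<open>L(Z)\<close> for the logarithm of the integral of \<open>exp Z\<close> against the prior and \<open><W>\<close> for the Gibbs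
  average of \<open>W\<close>. In the potential \<open>X\<close> one adds \<open>\<beta>\<close> times the perturbation
  \<open>W = \<Sum>m. (U\<^sub>m \<bullet> B\<^sub>m \<eta>\<^sub>m(t) - its leading mean) + a * loss(t)\<close>, the analogue of the perturbation of \<open>Y\<close>.
  Convexity of \<open>L\<close> along lines bounds \<open>\<beta> * E<W>\<close> in the unperturbed potential \<open>X\<close> from above by
  \<open>E L(X + \<beta> W) - E L(X)\<close>; at the perturbed Gaussian potential it gives the opposite bound for the
  increment from \<open>Y\<close> to \<open>Y\<^sub>\<beta>\<close>. So \<open>\<beta>\<close> times the difference of the two Gibbs averages of the
  perturbations is at most \<open>|E L(X + \<beta> W) - E L(Y\<^sub>\<beta>)| + |E L(X) - E L(Y)|\<close>. The components are
  exchanged one at a time (\<open>lindeberg_exchange\<close>): relative to the Gibbs measure of the other components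
  a single component enters through \<open>log_laplace_taylor\<close>, whose second-order part involves only the mean
  and the covariance. With \<open>M\<close> components the total error is \<open>O(M r\<^sup>2 \<delta>)\<close>; division by
  \<open>\<beta> = \<epsilon>\<close> or \<open>\<beta> = - \<epsilon>\<close> produces the term \<open>\<delta> / \<epsilon>\<close> and the two directions of the comparison.

  It remains to replace the Gibbs average of the perturbation by the average of the test function over two
  replicas. This is Gaussian integration by parts in approximate form (\<open>mean_ibp_defect\<close>): the covariance
  of \<open>U\<^sub>m \<bullet> B\<^sub>m \<eta>\<^sub>m(t)\<close> with the potential at \<open>s\<close> is \<open>\<Sigma>\<^sub>m B\<^sub>m \<eta>\<^sub>m(t) \<bullet> \<eta>\<^sub>m(s) = H\<^sub>m \<eta>\<^sub>m(s) \<bullet> \<eta>\<^sub>m(t)\<close>,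
  so the replica identity produces exactly the two \<open>H\<close>-terms of the test function. At \<open>Y\<^sub>\<beta>\<close> the
  covariance carries the additional term \<open>\<beta> * (\<Sigma>\<^sub>m B\<^sub>m \<eta>\<^sub>m(t) \<bullet> B\<^sub>m \<eta>\<^sub>m(s))\<close>, which is the error \<open>\<epsilon>\<close>.

  The moments under \<open>P\<^sub>\<theta>\<close> come from the null law by expanding the likelihood ratio
  (\<open>tilted_mean\<close>, \<open>tilted_covariance\<close>): the mean of \<open>U\<^sub>m \<bullet> \<eta>\<^sub>m(t)\<close> becomes \<open>A\<^sub>m \<eta>\<^sub>m(\<theta>) \<bullet> \<eta>\<^sub>m(t)\<close>
  and covariances are unchanged, up to \<open>O(r\<^sup>2 \<delta>)\<close>. The mean of the remainder is removed as a
  deterministic potential. The moment bounds are used at the scale \<open>lam\<close> with \<open>lam\<^sup>3 = r\<^sup>2 \<delta>\<close>. When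
  \<open>\<delta>\<close> or \<open>lam\<close> exceeds one, the claim holds because the test function itself is \<open>O(M r\<^sup>2 \<delta>)\<close>.
\<close>

section \<open>Orthonormal expansions and operators defined by moments\<close>

lemma norm_integral_le:
  fixes f :: "'a \<Rightarrow> 'b::{banach, second_countable_topology}"
  assumes "integrable M f" "integrable M g" "\<And>x. x \<in> space M \<Longrightarrow> norm (f x) \<le> g x"
  shows "norm (\<integral>x. f x \<partial>M) \<le> (\<integral>x. g x \<partial>M)"
proof -
  have "norm (\<integral>x. f x \<partial>M) \<le> (\<integral>x. norm (f x) \<partial>M)" by (rule integral_norm_bound)
  also have "\<dots> \<le> (\<integral>x. g x \<partial>M)"
    using assms by (intro integral_mono) auto
  finally show ?thesis .
qed

text \<open>
  Since \<open>sgn 0 = 0\<close>, a vector that depends linearly on its predecessors contributes the zero vector.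
  Zero entries are kept, which treats finite-dimensional subspaces together with infinite-dimensional ones.
\<close>

fun gram_schmidt :: "(nat \<Rightarrow> 'h::real_inner) \<Rightarrow> nat \<Rightarrow> 'h" where
  "gram_schmidt d n =
     sgn (d n - (\<Sum>i<n. (d n \<bullet> gram_schmidt d i) *\<^sub>R gram_schmidt d i))"

declare gram_schmidt.simps [simp del]

definition fourier_sum :: "(nat \<Rightarrow> 'h::real_inner) \<Rightarrow> nat \<Rightarrow> 'h \<Rightarrow> 'h" where
  "fourier_sum e k x = (\<Sum>i<k. (x \<bullet> e i) *\<^sub>R e i)"

definition orthonormal_or_zero :: "(nat \<Rightarrow> 'h::real_inner) \<Rightarrow> bool" where
  "orthonormal_or_zero e \<longleftrightarrow> (\<forall>i j. i \<noteq> j \<longrightarrow> e i \<bullet> e j = 0) \<and> (\<forall>i. e i \<noteq> 0 \<longrightarrow> e i \<bullet> e i = 1)"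

lemma inner_sgn_self: "v \<noteq> 0 \<Longrightarrow> sgn v \<bullet> sgn v = (1::real)" for v :: "'h::real_inner"
  by (metis norm_eq_1 norm_sgn)

lemma gram_schmidt_zero_or_unit: "gram_schmidt d i \<bullet> gram_schmidt d i = 1 \<or> gram_schmidt d i = 0"
proof -
  obtain v where "gram_schmidt d i = sgn v"
    using gram_schmidt.simps[of d i] by blast
  then show ?thesis using inner_sgn_self[of v] by (cases "v = 0") simp_all
qed

lemma gram_schmidt_orthogonal: "i < n \<Longrightarrow> gram_schmidt d n \<bullet> gram_schmidt d i = 0"
proof (induction n arbitrary: i rule: less_induct)
  case (less n)
  let ?e = "gram_schmidt d"
  have ii: "?e i \<bullet> ?e i = 1 \<or> ?e i = 0"
    by (rule gram_schmidt_zero_or_unit)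
  have orth: "?e j \<bullet> ?e i = (if j = i then ?e i \<bullet> ?e i else 0)" if "j < n" for j
    using less.IH[OF that, of i] less.IH[OF less.prems, of j]
    by (cases j i rule: linorder_cases) (simp_all add: inner_commute)
  have "(\<Sum>j<n. (d n \<bullet> ?e j) *\<^sub>R ?e j) \<bullet> ?e i = (\<Sum>j<n. if j = i then (d n \<bullet> ?e i) * (?e i \<bullet> ?e i) else 0)"
    unfolding inner_sum_left
  proof (intro sum.cong refl)
    fix j assume "j \<in> {..<n}"
    then show "((d n \<bullet> ?e j) *\<^sub>R ?e j) \<bullet> ?e i = (if j = i then (d n \<bullet> ?e i) * (?e i \<bullet> ?e i) else 0)"
      using orth[of j] by (cases "j = i") simp_all
  qed
  also have "\<dots> = d n \<bullet> ?e i"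
    using less.prems ii by auto
  finally have "(d n - (\<Sum>j<n. (d n \<bullet> ?e j) *\<^sub>R ?e j)) \<bullet> ?e i = 0"
    by (simp add: inner_diff_left)
  then show ?case
    by (subst gram_schmidt.simps) (simp add: sgn_div_norm)
qed

lemma orthonormal_or_zero_gram_schmidt: "orthonormal_or_zero (gram_schmidt d)"
  unfolding orthonormal_or_zero_def
proof (intro conjI allI impI)
  show "gram_schmidt d i \<bullet> gram_schmidt d j = 0" if "i \<noteq> j" for i j
    using that gram_schmidt_orthogonal by (metis inner_commute linorder_neqE_nat)
  show "gram_schmidt d i \<bullet> gram_schmidt d i = 1" if "gram_schmidt d i \<noteq> 0" for i
    using that gram_schmidt_zero_or_unit by blast
qed

lemma gram_schmidt_in:
  assumes "subspace W" "\<And>n. d n \<in> W" shows "gram_schmidt d n \<in> W"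
proof (induction n rule: less_induct)
  case (less n)
  then show ?case
    using assms by (subst gram_schmidt.simps)
      (auto simp: sgn_div_norm intro!: subspace_scale subspace_diff subspace_sum)
qed

text \<open>Each original vector lies in the span of the first entries, hence is reproduced by a partial Fourier sum.\<close>

lemma gram_schmidt_expand:
  "d n = (\<Sum>i<n. (d n \<bullet> gram_schmidt d i) *\<^sub>R gram_schmidt d i)
         + norm (d n - (\<Sum>i<n. (d n \<bullet> gram_schmidt d i) *\<^sub>R gram_schmidt d i)) *\<^sub>R gram_schmidt d n"
proof -
  have "v = norm v *\<^sub>R sgn v" for v :: 'a
    by (cases "v = 0") (simp_all add: sgn_div_norm)
  from this[of "d n - (\<Sum>i<n. (d n \<bullet> gram_schmidt d i) *\<^sub>R gram_schmidt d i)"]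
  show ?thesis by (simp only: gram_schmidt.simps[of d n, symmetric] algebra_simps)
qed

lemma inner_fourier_sum:
  assumes "orthonormal_or_zero e"
  shows "fourier_sum e k x \<bullet> e j = (if j < k then x \<bullet> e j else 0)"
proof -
  have "fourier_sum e k x \<bullet> e j = (\<Sum>i<k. if i = j then x \<bullet> e j else 0)"
    unfolding fourier_sum_def inner_sum_left
  proof (intro sum.cong refl)
    fix i
    have "e j = 0 \<or> e j \<bullet> e j = 1" "i \<noteq> j \<Longrightarrow> e i \<bullet> e j = 0"
      using assms unfolding orthonormal_or_zero_def by blast+
    then show "((x \<bullet> e i) *\<^sub>R e i) \<bullet> e j = (if i = j then x \<bullet> e j else 0)"
      by auto
  qed
  then show ?thesis by auto
qed

lemma fourier_sum_add: "fourier_sum e k (x + y) = fourier_sum e k x + fourier_sum e k y"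
  by (simp add: fourier_sum_def inner_add_left scaleR_add_left sum.distrib)

lemma fourier_sum_diff: "fourier_sum e k (x - y) = fourier_sum e k x - fourier_sum e k y"
  by (simp add: fourier_sum_def inner_diff_left scaleR_diff_left sum_subtractf)

lemma fourier_sum_scale: "fourier_sum e k (c *\<^sub>R x) = c *\<^sub>R fourier_sum e k x"
  by (simp add: fourier_sum_def scaleR_sum_right)

lemma fourier_sum_sum: "finite A \<Longrightarrow> fourier_sum e k (\<Sum>i\<in>A. f i) = (\<Sum>i\<in>A. fourier_sum e k (f i))"
  by (induction A rule: finite_induct) (auto simp: fourier_sum_add, simp add: fourier_sum_def)

lemma inner_fourier_sum_self:
  "fourier_sum e k x \<bullet> x = (\<Sum>i<k. (x \<bullet> e i)\<^sup>2)"
  unfolding fourier_sum_def inner_sum_left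
  by (intro sum.cong) (auto simp: power2_eq_square inner_commute)

lemma norm_fourier_sum:
  assumes "orthonormal_or_zero e"
  shows "(norm (fourier_sum e k x))\<^sup>2 = (\<Sum>i<k. (x \<bullet> e i)\<^sup>2)"
proof -
  have "fourier_sum e k x \<bullet> fourier_sum e k x = (\<Sum>i<k. (x \<bullet> e i) * (fourier_sum e k x \<bullet> e i))"
    by (subst (2) fourier_sum_def) (simp add: inner_sum_right)
  then show ?thesis
    unfolding power2_norm_eq_inner by (simp add: inner_fourier_sum[OF assms] power2_eq_square)
qed

lemma norm_diff_fourier_sum:
  assumes "orthonormal_or_zero e"
  shows "(norm (x - fourier_sum e k x))\<^sup>2 = (norm x)\<^sup>2 - (\<Sum>i<k. (x \<bullet> e i)\<^sup>2)"
  using norm_fourier_sum[OF assms, of k x] inner_fourier_sum_self[of e k x]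
  by (simp add: power2_norm_eq_inner inner_diff_left inner_diff_right inner_commute)

lemma bessel:
  assumes "orthonormal_or_zero e"
  shows "(\<Sum>i<k. (x \<bullet> e i)\<^sup>2) \<le> (norm x)\<^sup>2"
  using norm_diff_fourier_sum[OF assms, of x k] zero_le_power2[of "norm (x - fourier_sum e k x)"]
  by linarith

lemma norm_diff_fourier_sum_le:
  assumes "orthonormal_or_zero e"
  shows "norm (x - fourier_sum e k x) \<le> norm x"
proof (rule power2_le_imp_le)
  show "(norm (x - fourier_sum e k x))\<^sup>2 \<le> (norm x)\<^sup>2"
    using norm_diff_fourier_sum[OF assms, of x k] sum_nonneg[of "{..<k}" "\<lambda>i. (x \<bullet> e i)\<^sup>2"] by simp
qed simp

lemma fourier_sum_basis:
  assumes "orthonormal_or_zero e" "i < k"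
  shows "fourier_sum e k (e i) = e i"
proof -
  have "fourier_sum e k (e i) = (\<Sum>j<k. if j = i then e i else 0)"
    unfolding fourier_sum_def
  proof (intro sum.cong refl)
    fix j
    have "e i = 0 \<or> e i \<bullet> e i = 1" "i \<noteq> j \<Longrightarrow> e i \<bullet> e j = 0"
      using assms unfolding orthonormal_or_zero_def by blast+
    then show "(e i \<bullet> e j) *\<^sub>R e j = (if j = i then e i else 0)"
      by auto
  qed
  then show ?thesis using assms(2) by simp
qed

lemma fourier_sum_gram_schmidt:
  assumes "n < k"
  shows "fourier_sum (gram_schmidt d) k (d n) = d n"
proof -
  let ?e = "gram_schmidt d"
  note o = orthonormal_or_zero_gram_schmidt[of d]
  define r where "r = norm (d n - (\<Sum>i<n. (d n \<bullet> ?e i) *\<^sub>R ?e i))"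
  have "fourier_sum ?e k ((\<Sum>i<n. (d n \<bullet> ?e i) *\<^sub>R ?e i) + r *\<^sub>R ?e n) = (\<Sum>i<n. (d n \<bullet> ?e i) *\<^sub>R ?e i) + r *\<^sub>R ?e n"
    using assms by (auto simp: fourier_sum_add fourier_sum_scale fourier_sum_sum fourier_sum_basis[OF o]
        intro!: sum.cong)
  then show ?thesis
    using gram_schmidt_expand[of d n] unfolding r_def by metis
qed

text \<open>
  Orthonormalise a dense sequence. The partial sums fix each of its members from some index on, and
  \<open>x \<mapsto> x - fourier_sum e k x\<close> is a contraction, so convergence extends from the sequence to its closure.
\<close>

lemma closed_subspace_basis:
  fixes W :: "'h::{real_inner, second_countable_topology} set"
  assumes W: "subspace W"
  shows "\<exists>e. orthonormal_or_zero e \<and> (\<forall>i. e i \<in> W) \<and>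
    (\<forall>x\<in>W. (\<lambda>k. fourier_sum e k x) \<longlonglongrightarrow> x)"
proof -
  obtain D where D: "countable D" "D \<subseteq> W" "W \<subseteq> closure D"
    using separable[of W] by blast
  have "D \<noteq> {}" using D(3) subspace_0[OF W] by auto
  then obtain d :: "nat \<Rightarrow> 'h" where d: "range d = D"
    using D(1) by (metis range_from_nat_into)
  let ?e = "gram_schmidt d"
  note o = orthonormal_or_zero_gram_schmidt[of d]
  have "(\<lambda>k. fourier_sum ?e k x) \<longlonglongrightarrow> x" if x: "x \<in> W" for x
  proof (rule LIMSEQ_I)
    fix r :: real assume "0 < r"
    then obtain n where n: "norm (x - d n) < r"
      using x D(3) d closure_approachable[of x D] by (metis dist_commute dist_norm imageE subsetD)
    show "\<exists>no. \<forall>k\<ge>no. norm (fourier_sum ?e k x - x) < r"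
    proof (intro exI allI impI)
      fix k assume "Suc n \<le> k"
      then have "fourier_sum ?e k (d n) = d n" by (intro fourier_sum_gram_schmidt) auto
      then have "x - fourier_sum ?e k x = (x - d n) - fourier_sum ?e k (x - d n)"
        by (simp add: fourier_sum_diff)
      then have "norm (x - fourier_sum ?e k x) \<le> norm (x - d n)"
        using norm_diff_fourier_sum_le[OF o] by metis
      then show "norm (fourier_sum ?e k x - x) < r" using n by (simp add: norm_minus_commute)
    qed
  qed
  moreover have "?e i \<in> W" for i
    using gram_schmidt_in[OF W] D(2) d by (metis rangeI subsetD)
  ultimately show ?thesis using o by blast
qed

lemma parseval_limit:
  assumes "orthonormal_or_zero e" "(\<lambda>k. fourier_sum e k x) \<longlonglongrightarrow> x"
  shows "(\<lambda>k. \<Sum>i<k. (x \<bullet> e i)\<^sup>2) \<longlonglongrightarrow> (norm x)\<^sup>2"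
  using tendsto_power[OF tendsto_norm[OF assms(2)], of 2]
  by (simp add: norm_fourier_sum[OF assms(1)])

lemma fourier_sum_convergent:
  fixes x :: "'h::{real_inner, banach}"
  assumes o: "orthonormal_or_zero e"
  shows "convergent (\<lambda>k. fourier_sum e k x)"
proof -
  have "summable (\<lambda>i. (x \<bullet> e i)\<^sup>2)"
    using bessel[OF o, of x] by (intro summableI_nonneg_bounded) auto
  then have C: "Cauchy (\<lambda>k. \<Sum>i<k. (x \<bullet> e i)\<^sup>2)"
    using summable_iff_convergent convergent_Cauchy by blast
  have diff: "(norm (fourier_sum e m x - fourier_sum e n x))\<^sup>2 = \<bar>(\<Sum>i<m. (x \<bullet> e i)\<^sup>2) - (\<Sum>i<n. (x \<bullet> e i)\<^sup>2)\<bar>"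
    if "n \<le> m" for m n
  proof -
    have "fourier_sum e n (fourier_sum e m x) = fourier_sum e n x"
      using that unfolding fourier_sum_def[of e n]
      by (intro sum.cong) (auto simp: inner_fourier_sum[OF o])
    then have "(norm (fourier_sum e m x - fourier_sum e n x))\<^sup>2 =
        (norm (fourier_sum e m x))\<^sup>2 - (\<Sum>i<n. (fourier_sum e m x \<bullet> e i)\<^sup>2)"
      using norm_diff_fourier_sum[OF o, of "fourier_sum e m x" n] by simp
    also have "\<dots> = (\<Sum>i<m. (x \<bullet> e i)\<^sup>2) - (\<Sum>i<n. (x \<bullet> e i)\<^sup>2)"
      using that by (auto simp: norm_fourier_sum[OF o] inner_fourier_sum[OF o] intro!: sum.cong)
    finally show ?thesis by (metis abs_of_nonneg zero_le_power2)
  qed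
  have diff': "(norm (fourier_sum e m x - fourier_sum e n x))\<^sup>2 = \<bar>(\<Sum>i<m. (x \<bullet> e i)\<^sup>2) - (\<Sum>i<n. (x \<bullet> e i)\<^sup>2)\<bar>" for m n
    using diff[of n m] diff[of m n] by (cases "n \<le> m") (auto simp: norm_minus_commute abs_minus_commute)
  have "Cauchy (\<lambda>k. fourier_sum e k x)"
  proof (rule CauchyI)
    fix r :: real assume "0 < r"
    then obtain N where "\<forall>m\<ge>N. \<forall>n\<ge>N. norm ((\<Sum>i<m. (x \<bullet> e i)\<^sup>2) - (\<Sum>i<n. (x \<bullet> e i)\<^sup>2)) < r\<^sup>2"
      using CauchyD[OF C, of "r\<^sup>2"] by auto
    then have "\<forall>m\<ge>N. \<forall>n\<ge>N. (norm (fourier_sum e m x - fourier_sum e n x))\<^sup>2 < r\<^sup>2"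
      by (simp add: diff')
    then show "\<exists>M. \<forall>m\<ge>M. \<forall>n\<ge>M. norm (fourier_sum e m x - fourier_sum e n x) < r"
      using \<open>0 < r\<close> power2_less_imp_less less_imp_le by blast
  qed
  then show ?thesis by (rule Cauchy_convergent)
qed

text \<open>The projection is the limit of the Fourier sums of \<open>x\<close>, which are Cauchy by Bessel's inequality.\<close>

lemma orthogonal_projection_exists:
  fixes W :: "'h::{real_inner, banach, second_countable_topology} set"
  assumes W: "subspace W" "closed W"
  obtains p where "p \<in> W" "x - p \<in> orthogonal_comp W"
proof -
  obtain e where o: "orthonormal_or_zero e" and e: "\<And>i. e i \<in> W"
    and lim: "\<And>x. x \<in> W \<Longrightarrow> (\<lambda>k. fourier_sum e k x) \<longlonglongrightarrow> x"
    using closed_subspace_basis[OF W(1)] by blast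
  obtain p where p: "(\<lambda>k. fourier_sum e k x) \<longlonglongrightarrow> p"
    using fourier_sum_convergent[OF o, of x] by (auto simp: convergent_def)
  have "fourier_sum e k x \<in> W" for k
    unfolding fourier_sum_def using W(1) e by (intro subspace_sum subspace_scale)
  then have "p \<in> W" using closed_sequentially[OF W(2) _ p] by blast
  have orth: "(x - p) \<bullet> e i = 0" for i
  proof -
    have "(\<lambda>k. fourier_sum e k x \<bullet> e i) \<longlonglongrightarrow> p \<bullet> e i" by (intro tendsto_intros p)
    moreover have "(\<lambda>k. fourier_sum e k x \<bullet> e i) \<longlonglongrightarrow> x \<bullet> e i"
      by (intro tendsto_eventually eventually_sequentiallyI[of "Suc i"]) (auto simp: inner_fourier_sum[OF o])
    ultimately have "p \<bullet> e i = x \<bullet> e i" by (rule LIMSEQ_unique)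
    then show ?thesis by (simp add: inner_diff_left)
  qed
  have "(x - p) \<bullet> w = 0" if w: "w \<in> W" for w
  proof -
    have "(\<lambda>k. (x - p) \<bullet> fourier_sum e k w) \<longlonglongrightarrow> (x - p) \<bullet> w" by (intro tendsto_intros lim w)
    moreover have "(\<lambda>k. (x - p) \<bullet> fourier_sum e k w) = (\<lambda>k. 0)"
      by (simp add: fourier_sum_def inner_sum_right orth)
    ultimately show ?thesis using LIMSEQ_unique[OF _ tendsto_const] by metis
  qed
  then have "x - p \<in> orthogonal_comp W"
    by (auto simp: orthogonal_comp_def orthogonal_def inner_commute)
  then show ?thesis using that \<open>p \<in> W\<close> by blast
qed

text \<open>
  An operator on \<open>W\<close> is determined by its form: two candidates agree on \<open>W\<close> because their
  difference lies in \<open>W\<close> and is orthogonal to it, and both vanish on the orthogonal complement.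
\<close>

lemma form_op_eqI:
  fixes W :: "'h::{real_inner, banach, second_countable_topology} set"
  assumes W: "subspace W" "closed W" and T: "operator_on W T"
    and b: "\<And>h g. h \<in> W \<Longrightarrow> g \<in> W \<Longrightarrow> blinfun_apply T h \<bullet> g = b h g"
  shows "form_op W b = T"
  unfolding form_op_def
proof (rule the_equality)
  show "operator_on W T \<and> (\<forall>h\<in>W. \<forall>g\<in>W. blinfun_apply T h \<bullet> g = b h g)"
    using T b by blast
  fix T' assume T': "operator_on W T' \<and> (\<forall>h\<in>W. \<forall>g\<in>W. blinfun_apply T' h \<bullet> g = b h g)"
  show "T' = T"
  proof (rule blinfun_eqI)
    fix x
    obtain p where p: "p \<in> W" "x - p \<in> orthogonal_comp W"
      by (rule orthogonal_projection_exists[OF W])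
    have "(blinfun_apply T' p - blinfun_apply T p) \<bullet> g = 0" if "g \<in> W" for g
      using T' b p that by (simp add: inner_diff_left)
    moreover have "blinfun_apply T' p - blinfun_apply T p \<in> W"
      using T T' W by (auto simp: operator_on_def intro: subspace_diff)
    ultimately have "blinfun_apply T' p = blinfun_apply T p"
      by (metis eq_iff_diff_eq_0 inner_eq_zero_iff)
    moreover have "blinfun_apply T' (x - p) = 0" "blinfun_apply T (x - p) = 0"
      using T T' p by (auto simp: operator_on_def)
    ultimately show "blinfun_apply T' x = blinfun_apply T x"
      by (simp add: blinfun.diff_right)
  qed
qed

text \<open>The component of the integral orthogonal to \<open>W\<close> integrates an inner product that vanishes pointwise.\<close>

lemma integral_in_closed_subspace:
  fixes f :: "'w \<Rightarrow> 'h::{real_inner, banach, second_countable_topology}"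
  assumes W: "subspace W" "closed W" and f: "integrable M f" "\<And>w. w \<in> space M \<Longrightarrow> f w \<in> W"
  shows "(\<integral>w. f w \<partial>M) \<in> W"
proof -
  obtain p where p: "p \<in> W" "(\<integral>w. f w \<partial>M) - p \<in> orthogonal_comp W"
    by (rule orthogonal_projection_exists[OF W])
  define y where "y = (\<integral>w. f w \<partial>M) - p"
  have y: "v \<bullet> y = 0" if "v \<in> W" for v
    using p(2) that by (auto simp: y_def orthogonal_comp_def orthogonal_def)
  have "(\<integral>w. f w \<partial>M) \<bullet> y = (\<integral>w. f w \<bullet> y \<partial>M)"
    using f(1) by simp
  also have "\<dots> = (\<integral>w. 0 \<partial>M)" using f(2) y by (intro Bochner_Integration.integral_cong) auto
  finally have "(y + p) \<bullet> y = 0" unfolding y_def by simp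
  then have "y = 0" using y[OF p(1)] by (simp add: inner_add_left)
  then show ?thesis using p(1) by (simp add: y_def)
qed

text \<open>
  Both \<open>A\<close> and \<open>\<Sigma>\<close> are of this kind. The representing operator is the Bochner integral
  \<open>h \<mapsto> E[(S \<bullet> h) U]\<close>, bounded by the mean of \<open>norm S * norm U\<close>.
\<close>

lemma form_op_cross_moment:
  fixes S U :: "'w \<Rightarrow> 'h::{real_inner, banach, second_countable_topology}"
  assumes W: "subspace W" "closed W"
    and U: "U \<in> borel_measurable P" "\<And>w. w \<in> space P \<Longrightarrow> U w \<in> W"
    and S: "S \<in> borel_measurable P" "\<And>w. w \<in> space P \<Longrightarrow> S w \<in> W"
    and int: "integrable P (\<lambda>w. (norm (U w))\<^sup>2)" "integrable P (\<lambda>w. (norm (S w))\<^sup>2)"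
  defines "T \<equiv> form_op W (\<lambda>h g. \<integral>w. (S w \<bullet> h) * (U w \<bullet> g) \<partial>P)"
  shows "operator_on W T"
    and "h \<in> W \<Longrightarrow> g \<in> W \<Longrightarrow> blinfun_apply T h \<bullet> g = (\<integral>w. (S w \<bullet> h) * (U w \<bullet> g) \<partial>P)"
proof -
  have [measurable]: "U \<in> borel_measurable P" "S \<in> borel_measurable P" by (fact U S)+
  have prod: "integrable P (\<lambda>w. norm (S w) * norm (U w))"
  proof (rule Bochner_Integration.integrable_bound[OF Bochner_Integration.integrable_add[OF int]])
    have "norm (S w) * norm (U w) \<le> (norm (U w))\<^sup>2 + (norm (S w))\<^sup>2" for w
    proof -
      have "0 \<le> norm (S w) * norm (U w)" by simp
      then show ?thesis using sum_squares_bound[of "norm (S w)" "norm (U w)"] by linarith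
    qed
    then show "AE x in P. norm (norm (S x) * norm (U x)) \<le> norm ((norm (U x))\<^sup>2 + (norm (S x))\<^sup>2)"
      by auto
  qed measurable
  have bnd: "norm ((S w \<bullet> h) *\<^sub>R U w) \<le> norm h * (norm (S w) * norm (U w))" for h w
    using mult_right_mono[OF Cauchy_Schwarz_ineq2[of "S w" h], of "norm (U w)"]
    by (simp add: algebra_simps)
  have int1: "integrable P (\<lambda>w. (S w \<bullet> h) *\<^sub>R U w)" for h
    by (rule Bochner_Integration.integrable_bound[OF integrable_mult_right[OF prod, of "norm h"]])
      (use bnd in auto)
  have bl: "bounded_linear (\<lambda>h. \<integral>w. (S w \<bullet> h) *\<^sub>R U w \<partial>P)"
  proof (rule bounded_linear_intro[where K="\<integral>w. norm (S w) * norm (U w) \<partial>P"])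
    show "(\<integral>w. (S w \<bullet> (h + g)) *\<^sub>R U w \<partial>P) = (\<integral>w. (S w \<bullet> h) *\<^sub>R U w \<partial>P) + (\<integral>w. (S w \<bullet> g) *\<^sub>R U w \<partial>P)" for h g
      using int1 by (simp add: inner_add_right scaleR_add_left)
    show "(\<integral>w. (S w \<bullet> (c *\<^sub>R h)) *\<^sub>R U w \<partial>P) = c *\<^sub>R (\<integral>w. (S w \<bullet> h) *\<^sub>R U w \<partial>P)" for c h
      by (simp flip: scaleR_scaleR)
    fix h
    have "norm (\<integral>w. (S w \<bullet> h) *\<^sub>R U w \<partial>P) \<le> (\<integral>w. norm h * (norm (S w) * norm (U w)) \<partial>P)"
      using int1 prod bnd by (intro norm_integral_le) auto
    then show "norm (\<integral>w. (S w \<bullet> h) *\<^sub>R U w \<partial>P) \<le> norm h * (\<integral>w. norm (S w) * norm (U w) \<partial>P)"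
      by simp
  qed
  define T0 where "T0 = Blinfun (\<lambda>h. \<integral>w. (S w \<bullet> h) *\<^sub>R U w \<partial>P)"
  have T0: "blinfun_apply T0 h = (\<integral>w. (S w \<bullet> h) *\<^sub>R U w \<partial>P)" for h
    unfolding T0_def using bounded_linear_Blinfun_apply[OF bl] by simp
  have op: "operator_on W T0"
    unfolding operator_on_def
  proof (intro conjI allI ballI)
    show "blinfun_apply T0 x \<in> W" for x
      unfolding T0 using W U by (intro integral_in_closed_subspace int1) (auto intro: subspace_scale)
    show "blinfun_apply T0 x = 0" if "x \<in> orthogonal_comp W" for x
    proof -
      have "S w \<bullet> x = 0" if "w \<in> space P" for w
        using S(2)[OF that] \<open>x \<in> orthogonal_comp W\<close> by (auto simp: orthogonal_comp_def orthogonal_def)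
      then have "blinfun_apply T0 x = (\<integral>w. 0 \<partial>P)"
        unfolding T0 by (intro Bochner_Integration.integral_cong) auto
      then show ?thesis by simp
    qed
  qed
  have inner: "blinfun_apply T0 h \<bullet> g = (\<integral>w. (S w \<bullet> h) * (U w \<bullet> g) \<partial>P)" for h g
  proof -
    have "(\<integral>w. (S w \<bullet> h) *\<^sub>R U w \<partial>P) \<bullet> g = (\<integral>w. ((S w \<bullet> h) *\<^sub>R U w) \<bullet> g \<partial>P)"
      by (intro integral_inner_left[symmetric] int1)
    then show ?thesis unfolding T0 by simp
  qed
  have "T = T0" unfolding T_def by (intro form_op_eqI W op inner)
  then show "operator_on W T"
    and "h \<in> W \<Longrightarrow> g \<in> W \<Longrightarrow> blinfun_apply T h \<bullet> g = (\<integral>w. (S w \<bullet> h) * (U w \<bullet> g) \<partial>P)"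
    using op inner by auto
qed

lemma form_op_mean_operator:
  fixes V :: "'w \<Rightarrow> ('h::{real_inner, banach, second_countable_topology} \<Rightarrow>\<^sub>L 'h)"
  assumes W: "subspace W" "closed W"
    and V: "\<And>h. (\<lambda>w. blinfun_apply (V w) h) \<in> borel_measurable P"
      "\<And>w. w \<in> space P \<Longrightarrow> operator_on W (V w)"
    and int: "integrable P (\<lambda>w. norm (V w))"
    and h: "h \<in> W" and g: "g \<in> W"
  shows "blinfun_apply (form_op W (\<lambda>h g. \<integral>w. blinfun_apply (V w) h \<bullet> g \<partial>P)) h \<bullet> g
           = (\<integral>w. blinfun_apply (V w) h \<bullet> g \<partial>P)"
proof -
  note [measurable] = V(1)
  have bnd: "norm (blinfun_apply (V w) h) \<le> norm h * norm (V w)" for w h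
    using norm_blinfun[of "V w" h] by (simp add: mult.commute)
  have int1: "integrable P (\<lambda>w. blinfun_apply (V w) h)" for h
    by (rule Bochner_Integration.integrable_bound[OF integrable_mult_right[OF int, of "norm h"]])
      (use bnd in auto)
  have bl: "bounded_linear (\<lambda>h. \<integral>w. blinfun_apply (V w) h \<partial>P)"
  proof (rule bounded_linear_intro[where K="\<integral>w. norm (V w) \<partial>P"])
    show "(\<integral>w. blinfun_apply (V w) (h + g) \<partial>P) = (\<integral>w. blinfun_apply (V w) h \<partial>P) + (\<integral>w. blinfun_apply (V w) g \<partial>P)" for h g
      using int1 by (simp add: blinfun.add_right)
    show "(\<integral>w. blinfun_apply (V w) (c *\<^sub>R h) \<partial>P) = c *\<^sub>R (\<integral>w. blinfun_apply (V w) h \<partial>P)" for c h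
      by (simp add: blinfun.scaleR_right)
    fix h
    have "norm (\<integral>w. blinfun_apply (V w) h \<partial>P) \<le> (\<integral>w. norm h * norm (V w) \<partial>P)"
      using int1 int bnd by (intro norm_integral_le) auto
    then show "norm (\<integral>w. blinfun_apply (V w) h \<partial>P) \<le> norm h * (\<integral>w. norm (V w) \<partial>P)"
      by simp
  qed
  define T0 where "T0 = Blinfun (\<lambda>h. \<integral>w. blinfun_apply (V w) h \<partial>P)"
  have T0: "blinfun_apply T0 h = (\<integral>w. blinfun_apply (V w) h \<partial>P)" for h
    unfolding T0_def using bounded_linear_Blinfun_apply[OF bl] by simp
  have op: "operator_on W T0"
    unfolding operator_on_def
  proof (intro conjI allI ballI)
    show "blinfun_apply T0 x \<in> W" for x
      unfolding T0 using W V by (intro integral_in_closed_subspace int1) (auto simp: operator_on_def)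
    show "blinfun_apply T0 x = 0" if "x \<in> orthogonal_comp W" for x
    proof -
      have "blinfun_apply T0 x = (\<integral>w. 0 \<partial>P)"
        unfolding T0 using V(2) that by (intro Bochner_Integration.integral_cong) (auto simp: operator_on_def)
      then show ?thesis by simp
    qed
  qed
  have inner: "blinfun_apply T0 h \<bullet> g = (\<integral>w. blinfun_apply (V w) h \<bullet> g \<partial>P)" for h g
    unfolding T0 by (intro integral_inner_left[symmetric] int1)
  have "form_op W (\<lambda>h g. \<integral>w. blinfun_apply (V w) h \<bullet> g \<partial>P) = T0"
    by (intro form_op_eqI W op inner)
  then show ?thesis using inner by simp
qed

section \<open>Exponential integrals and Gibbs measures\<close>

lemma exp_le_three_halves: "\<bar>t\<bar> \<le> 1/3 \<Longrightarrow> exp t \<le> 3/2" for t :: real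
proof -
  assume "\<bar>t\<bar> \<le> 1/3"
  then have "2/3 \<le> exp (- t)" using exp_ge_add_one_self[of "- t"] by linarith
  then have "2/3 * exp t \<le> exp (- t) * exp t" by (intro mult_right_mono) auto
  then show ?thesis by (simp add: exp_minus)
qed

lemma exp_taylor2: "\<bar>x\<bar> \<le> 1/3 \<Longrightarrow> \<bar>exp x - 1 - x\<bar> \<le> 3/4 * x\<^sup>2" for x :: real
proof -
  assume x: "\<bar>x\<bar> \<le> 1/3"
  obtain t where t: "\<bar>t\<bar> \<le> \<bar>x\<bar>" "exp x = (\<Sum>m<2. x^m / fact m) + exp t / fact 2 * x^2"
    using Maclaurin_exp_le[of x 2] by blast
  have e: "exp x - 1 - x = exp t / 2 * x\<^sup>2" using t(2) by (simp add: numeral_2_eq_2)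
  have "exp t / 2 * x\<^sup>2 \<le> 3/4 * x\<^sup>2"
    using exp_le_three_halves[of t] t(1) x by (intro mult_right_mono) auto
  then show ?thesis unfolding e by (simp add: abs_mult)
qed

lemma exp_taylor3: "\<bar>x\<bar> \<le> 1/3 \<Longrightarrow> \<bar>exp x - 1 - x - x\<^sup>2 / 2\<bar> \<le> \<bar>x\<bar>^3 / 4" for x :: real
proof -
  assume x: "\<bar>x\<bar> \<le> 1/3"
  obtain t where t: "\<bar>t\<bar> \<le> \<bar>x\<bar>" "exp x = (\<Sum>m<3. x^m / fact m) + exp t / fact 3 * x^3"
    using Maclaurin_exp_le[of x 3] by blast
  have e: "exp x - 1 - x - x\<^sup>2 / 2 = exp t / 6 * x^3"
    using t(2) by (simp add: numeral_3_eq_3 numeral_2_eq_2)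
  have "exp t / 6 * \<bar>x\<bar>^3 \<le> 1/4 * \<bar>x\<bar>^3"
    using exp_le_three_halves[of t] t(1) x by (intro mult_right_mono) auto
  then show ?thesis unfolding e by (simp add: abs_mult power_abs)
qed

lemma (in prob_space) abs_integral_le_bound:
  fixes f :: "'a \<Rightarrow> real"
  assumes "f \<in> borel_measurable M" "\<And>x. x \<in> space M \<Longrightarrow> \<bar>f x\<bar> \<le> B"
  shows "integrable M f" "\<bar>\<integral>x. f x \<partial>M\<bar> \<le> B"
proof -
  show i: "integrable M f"
    using assms by (intro integrable_const_bound[where B=B]) auto
  have "\<bar>\<integral>x. f x \<partial>M\<bar> \<le> (\<integral>x. \<bar>f x\<bar> \<partial>M)" by (rule integral_abs_bound)
  also have "\<dots> \<le> (\<integral>x. B \<partial>M)" using assms i by (intro integral_mono) auto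
  finally show "\<bar>\<integral>x. f x \<partial>M\<bar> \<le> B" by (simp add: prob_space)
qed

lemma (in prob_space) integral_exp_bounds:
  fixes h :: "'a \<Rightarrow> real"
  assumes h: "h \<in> borel_measurable M" "\<And>x. x \<in> space M \<Longrightarrow> \<bar>h x\<bar> \<le> g"
  shows "integrable M (\<lambda>x. exp (h x))" "exp (- g) \<le> (\<integral>x. exp (h x) \<partial>M)" "(\<integral>x. exp (h x) \<partial>M) \<le> exp g"
    "0 < (\<integral>x. exp (h x) \<partial>M)" "\<bar>ln (\<integral>x. exp (h x) \<partial>M)\<bar> \<le> g"
proof -
  have b: "- g \<le> h x" "h x \<le> g" if "x \<in> space M" for x using h(2)[OF that] by auto
  show i: "integrable M (\<lambda>x. exp (h x))"
    using h by (intro abs_integral_le_bound(1)[where B="exp g"]) (auto dest: b)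
  have "(\<integral>x. exp (-g) \<partial>M) \<le> (\<integral>x. exp (h x) \<partial>M)"
    using i b by (intro integral_mono) auto
  then show 1: "exp (- g) \<le> (\<integral>x. exp (h x) \<partial>M)" by (simp add: prob_space)
  have "(\<integral>x. exp (h x) \<partial>M) \<le> (\<integral>x. exp g \<partial>M)"
    using i b by (intro integral_mono) auto
  then show 2: "(\<integral>x. exp (h x) \<partial>M) \<le> exp g" by (simp add: prob_space)
  show 3: "0 < (\<integral>x. exp (h x) \<partial>M)" using 1 exp_gt_zero[of "-g"] by linarith
  have "ln (exp (-g)) \<le> ln (\<integral>x. exp (h x) \<partial>M)" "ln (\<integral>x. exp (h x) \<partial>M) \<le> ln (exp g)"
    using 1 2 3 by (auto simp: ln_le_cancel_iff simp del: ln_exp)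
  then show "\<bar>ln (\<integral>x. exp (h x) \<partial>M)\<bar> \<le> g" by simp
qed

text \<open>
  For \<open>g\<close> above \<open>1/4\<close> every term is at most a multiple of \<open>g\<^sup>3\<close>. Below that the integral \<open>E\<close> of
  \<open>exp h\<close> is compared with \<open>exp q\<close>, where \<open>q\<close> is the second-order cumulant expansion: both have the
  same Taylor polynomial up to order \<open>g\<^sup>3\<close>, and the logarithm is Lipschitz near one.
\<close>

lemma (in prob_space) log_laplace_taylor:
  fixes h :: "'a \<Rightarrow> real"
  assumes h[measurable]: "h \<in> borel_measurable M" and g: "\<And>x. x \<in> space M \<Longrightarrow> \<bar>h x\<bar> \<le> g"
  shows "\<bar>ln (\<integral>x. exp (h x) \<partial>M)
           - ((\<integral>x. h x \<partial>M) + ((\<integral>x. (h x)\<^sup>2 \<partial>M) - (\<integral>x. h x \<partial>M)\<^sup>2) / 2)\<bar> \<le> 34 * g^3"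
proof -
  obtain x0 where "x0 \<in> space M" using not_empty by auto
  then have g0: "0 \<le> g" using g[of x0] by linarith
  define m1 where "m1 = (\<integral>x. h x \<partial>M)"
  define m2 where "m2 = (\<integral>x. (h x)\<^sup>2 \<partial>M)"
  define E where "E = (\<integral>x. exp (h x) \<partial>M)"
  define v where "v = m2 - m1\<^sup>2"
  define q where "q = m1 + v / 2"
  have i1: "integrable M h" and m1: "\<bar>m1\<bar> \<le> g"
    unfolding m1_def using g by (auto intro!: abs_integral_le_bound)
  have sq: "(h x)\<^sup>2 \<le> g\<^sup>2" if "x \<in> space M" for x
    using g[OF that] by (metis abs_ge_zero power2_abs power_mono)
  have i2: "integrable M (\<lambda>x. (h x)\<^sup>2)" and m2: "\<bar>m2\<bar> \<le> g\<^sup>2"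
    unfolding m2_def using sq abs_integral_le_bound[of "\<lambda>x. (h x)\<^sup>2" "g\<^sup>2"] by simp_all
  have m20: "0 \<le> m2" unfolding m2_def by simp
  have iE: "integrable M (\<lambda>x. exp (h x))" and E1: "exp (- g) \<le> E" and E2: "\<bar>ln E\<bar> \<le> g"
    unfolding E_def using integral_exp_bounds[OF h g] by auto
  have m1sq: "m1\<^sup>2 \<le> g\<^sup>2" using m1 by (metis abs_ge_zero power2_abs power_mono)
  have v: "\<bar>v\<bar> \<le> g\<^sup>2" unfolding v_def abs_le_iff using m1sq m2 m20 zero_le_power2[of m1] by linarith
  have "\<bar>ln E - q\<bar> \<le> 34 * g^3"
  proof (cases "1/4 \<le> g")
    case True
    have "1/16 \<le> g\<^sup>2" using power_mono[OF True, of 2] by (simp add: power2_eq_square)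
    then have a: "g * 1 \<le> g * (16 * g\<^sup>2)" using g0 by (intro mult_left_mono) auto
    have b: "g\<^sup>2 * 1 \<le> g\<^sup>2 * (4 * g)" using True by (intro mult_left_mono) auto
    have "\<bar>ln E - q\<bar> \<le> g + g + g\<^sup>2 / 2"
      using E2 m1 v unfolding q_def by linarith
    also have "\<dots> \<le> 34 * g^3" using a b by (simp add: power2_eq_square power3_eq_cube)
    finally show ?thesis .
  next
    case False
    then have g4: "g \<le> 1/4" by simp
    have "g * g \<le> g * (1/4)" using g4 g0 by (intro mult_left_mono)
    then have gg: "g\<^sup>2 \<le> g / 4" by (simp add: power2_eq_square)
    have "\<bar>E - 1 - m1 - m2 / 2\<bar> \<le> g^3 / 4"
    proof -
      have "E - 1 - m1 - m2 / 2 = (\<integral>x. exp (h x) - 1 - h x - (h x)\<^sup>2 / 2 \<partial>M)"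
        unfolding E_def m1_def m2_def using iE i1 i2 by (simp add: prob_space)
      also have "\<bar>\<dots>\<bar> \<le> g^3 / 4"
      proof (rule abs_integral_le_bound(2))
        fix x assume x: "x \<in> space M"
        have "\<bar>h x\<bar> \<le> 1/3" using g[OF x] g4 by linarith
        from exp_taylor3[OF this] show "\<bar>exp (h x) - 1 - h x - (h x)\<^sup>2 / 2\<bar> \<le> g^3 / 4"
          using power_mono[OF g[OF x], of 3] by auto
      qed measurable
      finally show ?thesis .
    qed
    moreover have qg: "\<bar>q\<bar> \<le> 9/8 * g" unfolding q_def using m1 v gg by linarith
    moreover have q3: "\<bar>q\<bar> \<le> 1/3" using qg g4 by linarith
    moreover have "\<bar>exp q - 1 - q - q\<^sup>2 / 2\<bar> \<le> 729/2048 * g^3"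
      using exp_taylor3[OF q3] power_mono[OF qg, of 3] by (simp add: power_mult_distrib power3_eq_cube)
    moreover have "\<bar>m1\<^sup>2 / 2 - q\<^sup>2 / 2\<bar> \<le> 5/8 * g^3"
    proof -
      have "m1\<^sup>2 / 2 - q\<^sup>2 / 2 = - (m1 * v / 2) - v * v / 8"
        unfolding q_def by (simp add: power2_eq_square field_simps)
      moreover have "\<bar>m1 * v\<bar> \<le> g * g\<^sup>2" unfolding abs_mult using m1 v g0 by (intro mult_mono) auto
      moreover have "\<bar>v * v\<bar> \<le> g\<^sup>2 * g\<^sup>2" unfolding abs_mult using v by (intro mult_mono) auto
      moreover have "g\<^sup>2 * g\<^sup>2 \<le> g\<^sup>2 * g" using g4 g0 gg by (intro mult_left_mono) auto
      moreover have "g * g\<^sup>2 = g^3" "g\<^sup>2 * g = g^3" by (simp_all add: power2_eq_square power3_eq_cube)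
      moreover have "\<bar>- (p / 2) - w / 8\<bar> \<le> 5/8 * G" if "\<bar>p\<bar> \<le> G" "\<bar>w\<bar> \<le> G4" "G4 \<le> G" for p w G G4 :: real
        using that by linarith
      ultimately show ?thesis by metis
    qed
    moreover have "1 + m1 + m2/2 - 1 - q - q\<^sup>2/2 = m1\<^sup>2/2 - q\<^sup>2/2"
      unfolding q_def v_def by (simp add: field_simps)
    moreover have "\<bar>A - e\<bar> \<le> 2 * G"
      if "\<bar>A - 1 - m1 - m2 / 2\<bar> \<le> G / 4" "\<bar>e - 1 - q - q2 / 2\<bar> \<le> 729/2048 * G"
        "\<bar>s / 2 - q2 / 2\<bar> \<le> 5/8 * G" "1 + m1 + m2/2 - 1 - q - q2/2 = s/2 - q2/2" "0 \<le> G"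
      for A e G s q2 :: real
      using that by linarith
    ultimately have diff: "\<bar>E - exp q\<bar> \<le> 2 * g^3"
      using zero_le_power[OF g0, of 3] by blast
    have E3: "1/2 \<le> E" using E1 exp_ge_add_one_self[of "-g"] g4 by linarith
    have q2: "1/2 \<le> exp q" using exp_ge_add_one_self[of "q"] q3 by linarith
    have "ln E - ln (exp q) \<le> (E - exp q) / exp q" using E3 by (intro ln_diff_le) auto
    also have "\<dots> \<le> \<bar>E - exp q\<bar> / (1/2)" using q2 by (intro frac_le) auto
    finally have 1: "ln E - q \<le> 4 * g^3" using diff by simp
    have "ln (exp q) - ln E \<le> (exp q - E) / E" using E3 by (intro ln_diff_le) auto
    also have "\<dots> \<le> \<bar>E - exp q\<bar> / (1/2)" using E3 by (intro frac_le) auto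
    finally have 2: "q - ln E \<le> 4 * g^3" using diff by simp
    show ?thesis using 1 2 zero_le_power[OF g0, of 3] by linarith
  qed
  then show ?thesis unfolding q_def v_def E_def m1_def m2_def .
qed

text \<open>
  The first-order change of an expectation under an exponential tilt is a covariance; as in the
  previous lemma only small \<open>g\<close> needs the expansion.
\<close>

lemma (in prob_space) tilted_mean_taylor:
  fixes h y :: "'a \<Rightarrow> real"
  assumes h[measurable]: "h \<in> borel_measurable M" and g: "\<And>x. x \<in> space M \<Longrightarrow> \<bar>h x\<bar> \<le> g"
    and y[measurable]: "y \<in> borel_measurable M" and y0: "\<And>x. x \<in> space M \<Longrightarrow> \<bar>y x\<bar> \<le> y0"
  shows "\<bar>(\<integral>x. y x * exp (h x) \<partial>M) / (\<integral>x. exp (h x) \<partial>M)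
           - ((\<integral>x. y x \<partial>M) + (\<integral>x. y x * h x \<partial>M) - (\<integral>x. y x \<partial>M) * (\<integral>x. h x \<partial>M))\<bar> \<le> 40 * y0 * g\<^sup>2"
    and "\<bar>(\<integral>x. y x * exp (h x) \<partial>M) / (\<integral>x. exp (h x) \<partial>M)\<bar> \<le> y0"
proof -
  obtain x0 where "x0 \<in> space M" using not_empty by auto
  then have g0: "0 \<le> g" and y00: "0 \<le> y0" using g[of x0] y0[of x0] by linarith+
  define m where "m = (\<integral>x. h x \<partial>M)"
  define Y where "Y = (\<integral>x. y x \<partial>M)"
  define c where "c = (\<integral>x. y x * h x \<partial>M)"
  define E where "E = (\<integral>x. exp (h x) \<partial>M)"
  define F where "F = (\<integral>x. y x * exp (h x) \<partial>M)"
  have im: "integrable M h" and m: "\<bar>m\<bar> \<le> g"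
    unfolding m_def using g by (auto intro!: abs_integral_le_bound)
  have iY: "integrable M y" and Y: "\<bar>Y\<bar> \<le> y0"
    unfolding Y_def using y0 by (auto intro!: abs_integral_le_bound)
  have yh: "\<bar>y x * h x\<bar> \<le> y0 * g" if "x \<in> space M" for x
    unfolding abs_mult using y0[OF that] g[OF that] y00 by (intro mult_mono) auto
  have ic: "integrable M (\<lambda>x. y x * h x)" and c: "\<bar>c\<bar> \<le> y0 * g"
    unfolding c_def using yh by (auto intro!: abs_integral_le_bound)
  have iE: "integrable M (\<lambda>x. exp (h x))" and E1: "exp (- g) \<le> E" and E0: "0 < E"
    unfolding E_def using integral_exp_bounds[OF h g] by auto
  have yexp: "\<bar>y x * exp (h x)\<bar> \<le> y0 * exp (h x)" if "x \<in> space M" for x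
    unfolding abs_mult using y0[OF that] by (auto intro!: mult_right_mono)
  have iF: "integrable M (\<lambda>x. y x * exp (h x))"
  proof (rule abs_integral_le_bound(1)[where B="y0 * exp g"])
    fix x assume x: "x \<in> space M"
    have "y0 * exp (h x) \<le> y0 * exp g" using g[OF x] y00 by (intro mult_left_mono) auto
    then show "\<bar>y x * exp (h x)\<bar> \<le> y0 * exp g" using yexp[OF x] by linarith
  qed measurable
  have "\<bar>F\<bar> \<le> (\<integral>x. \<bar>y x * exp (h x)\<bar> \<partial>M)" unfolding F_def by (rule integral_abs_bound)
  also have "\<dots> \<le> (\<integral>x. y0 * exp (h x) \<partial>M)" using iF iE yexp by (intro integral_mono) auto
  finally have "\<bar>F\<bar> \<le> y0 * E" unfolding E_def by simp
  then have FE: "\<bar>F / E\<bar> \<le> y0" using E0 by (simp add: abs_divide pos_divide_le_eq)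
  then show "\<bar>(\<integral>x. y x * exp (h x) \<partial>M) / (\<integral>x. exp (h x) \<partial>M)\<bar> \<le> y0" unfolding F_def E_def .
  have Ym: "\<bar>Y * m\<bar> \<le> y0 * g" unfolding abs_mult using Y m y00 by (intro mult_mono) auto
  have "\<bar>F / E - (Y + c - Y * m)\<bar> \<le> 40 * y0 * g\<^sup>2"
  proof (cases "1/4 \<le> g")
    case True
    have "1/16 \<le> g\<^sup>2" using power_mono[OF True, of 2] by (simp add: power2_eq_square)
    then have a: "y0 * 1 \<le> y0 * (16 * g\<^sup>2)" using y00 by (intro mult_left_mono) auto
    have b: "y0 * (g * 1) \<le> y0 * (g * (4 * g))" using True g0 y00 by (intro mult_left_mono) auto
    have "\<bar>F / E - (Y + c - Y * m)\<bar> \<le> y0 + y0 + y0 * g + y0 * g"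
      using FE Y c Ym by linarith
    also have "\<dots> \<le> 40 * y0 * g\<^sup>2"
    proof -
      have "2 * (y0 * (16 * g\<^sup>2)) + 2 * (y0 * (g * (4 * g))) = 40 * y0 * g\<^sup>2"
        by (simp add: power2_eq_square algebra_simps)
      moreover have "y0 + y0 + y0 * g + y0 * g \<le> 2 * (y0 * (16 * g\<^sup>2)) + 2 * (y0 * (g * (4 * g)))"
        using a b by (simp only: mult_1_right)
      ultimately show ?thesis by linarith
    qed
    finally show ?thesis .
  next
    case False
    then have g4: "g \<le> 1/4" by simp
    have "g * g \<le> g * (1/4)" using g4 g0 by (intro mult_left_mono)
    then have gg: "g\<^sup>2 \<le> g / 4" by (simp add: power2_eq_square)
    have h3: "\<bar>exp (h x) - 1 - h x\<bar> \<le> 3/4 * g\<^sup>2" if x: "x \<in> space M" for x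
    proof -
      have "\<bar>h x\<bar> \<le> 1/3" using g[OF x] g4 by linarith
      from exp_taylor2[OF this] show ?thesis using power_mono[OF g[OF x], of 2] by auto
    qed
    have "E - 1 - m = (\<integral>x. exp (h x) - 1 - h x \<partial>M)"
      unfolding E_def m_def using iE im by (simp add: prob_space)
    then have Em: "\<bar>E - 1 - m\<bar> \<le> 3/4 * g\<^sup>2"
      using abs_integral_le_bound(2)[of "\<lambda>x. exp (h x) - 1 - h x", OF _ h3] by simp
    have "F - Y - c = (\<integral>x. y x * exp (h x) - y x - y x * h x \<partial>M)"
      unfolding F_def Y_def c_def using iF iY ic by simp
    also have "\<dots> = (\<integral>x. y x * (exp (h x) - 1 - h x) \<partial>M)" by (simp add: algebra_simps)
    also have "\<bar>\<dots>\<bar> \<le> y0 * (3/4 * g\<^sup>2)"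
    proof (rule abs_integral_le_bound(2))
      show "\<bar>y x * (exp (h x) - 1 - h x)\<bar> \<le> y0 * (3/4 * g\<^sup>2)" if "x \<in> space M" for x
        unfolding abs_mult using h3[OF that] y0[OF that] y00 by (intro mult_mono) auto
    qed measurable
    finally have Fc: "\<bar>F - Y - c\<bar> \<le> y0 * (3/4 * g\<^sup>2)" .
    have t: "F - E * (Y + c - Y * m) = (F - Y - c) - (E - 1 - m) * (Y + c - Y * m) - m * c + m * (Y * m)"
      by (simp add: algebra_simps)
    have "\<bar>Y + c - Y * m\<bar> \<le> y0 + y0 * g + y0 * g" using Y c Ym by linarith
    also have "\<dots> \<le> 3/2 * y0" using g4 mult_left_mono[OF g4 y00] by linarith
    finally have "\<bar>(E - 1 - m) * (Y + c - Y * m)\<bar> \<le> (3/4 * g\<^sup>2) * (3/2 * y0)"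
      unfolding abs_mult using Em by (intro mult_mono) auto
    also have "\<dots> = 9/8 * (y0 * g\<^sup>2)" by simp
    finally have f1: "\<bar>(E - 1 - m) * (Y + c - Y * m)\<bar> \<le> 9/8 * (y0 * g\<^sup>2)" .
    have f2: "\<bar>m * c\<bar> \<le> g * (y0 * g)" "\<bar>m * (Y * m)\<bar> \<le> g * (y0 * g)"
      unfolding abs_mult[of m] using m c Ym g0 by (auto intro!: mult_mono)
    have "g * (y0 * g) = y0 * g\<^sup>2" by (simp add: power2_eq_square)
    note f2 = f2[unfolded this]
    have f3: "\<bar>F - Y - c\<bar> \<le> 3/4 * (y0 * g\<^sup>2)" using Fc by simp
    have "0 \<le> y0 * g\<^sup>2" using y00 by simp
    then have "\<bar>F - E * (Y + c - Y * m)\<bar> \<le> 4 * (y0 * g\<^sup>2)"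
      unfolding t using f1 f2 f3 by linarith
    moreover have E3: "1/2 \<le> E" using E1 exp_ge_add_one_self[of "-g"] g4 by linarith
    moreover have "F / E - (Y + c - Y * m) = (F - E * (Y + c - Y * m)) / E" using E0 by (simp add: field_simps)
    ultimately have "\<bar>F / E - (Y + c - Y * m)\<bar> \<le> 4 * (y0 * g\<^sup>2) / (1/2)"
      by (simp only: abs_divide) (intro frac_le, auto simp: y00)
    then show ?thesis using mult_nonneg_nonneg[OF y00 zero_le_power2[of g]] by (simp add: mult.assoc)
  qed
  then show "\<bar>(\<integral>x. y x * exp (h x) \<partial>M) / (\<integral>x. exp (h x) \<partial>M)
           - ((\<integral>x. y x \<partial>M) + (\<integral>x. y x * h x \<partial>M) - (\<integral>x. y x \<partial>M) * (\<integral>x. h x \<partial>M))\<bar> \<le> 40 * y0 * g\<^sup>2"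
    unfolding F_def E_def Y_def c_def m_def .
qed

definition bounded_potential :: "'t measure \<Rightarrow> ('t \<Rightarrow> real) \<Rightarrow> bool" where
  "bounded_potential \<pi> Z \<longleftrightarrow> Z \<in> borel_measurable \<pi> \<and> (\<exists>B. \<forall>t\<in>space \<pi>. \<bar>Z t\<bar> \<le> B)"

lemma bounded_potential_add:
  "bounded_potential \<pi> Z \<Longrightarrow> bounded_potential \<pi> Y \<Longrightarrow> bounded_potential \<pi> (\<lambda>t. Z t + Y t)"
  unfolding bounded_potential_def
proof (elim conjE exE, intro conjI)
  fix B B' assume b: "\<forall>t\<in>space \<pi>. \<bar>Z t\<bar> \<le> B" "\<forall>t\<in>space \<pi>. \<bar>Y t\<bar> \<le> B'"
  have "\<forall>t\<in>space \<pi>. \<bar>Z t + Y t\<bar> \<le> B + B'"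
    using b by (metis abs_triangle_ineq add_mono order_trans)
  then show "\<exists>B. \<forall>t\<in>space \<pi>. \<bar>Z t + Y t\<bar> \<le> B" by blast
qed measurable

context
  fixes \<pi> :: "'t measure" and Z :: "'t \<Rightarrow> real"
  assumes \<pi>: "prob_space \<pi>" and Z: "bounded_potential \<pi> Z"
begin

lemma gibbs_partition: "integrable \<pi> (\<lambda>t. exp (Z t))" "0 < (\<integral>t. exp (Z t) \<partial>\<pi>)"
  using Z prob_space.integral_exp_bounds[OF \<pi>] unfolding bounded_potential_def by blast+

lemma sets_gibbs [simp, measurable_cong]: "sets (gibbs \<pi> Z) = sets \<pi>"
  and space_gibbs [simp]: "space (gibbs \<pi> Z) = space \<pi>"
  by (simp_all add: gibbs_def)

lemma Z_measurable [measurable]: "Z \<in> borel_measurable \<pi>"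
  using Z by (simp add: bounded_potential_def)

lemma prob_space_gibbs: "prob_space (gibbs \<pi> Z)"
proof (rule prob_spaceI)
  have "emeasure (gibbs \<pi> Z) (space (gibbs \<pi> Z)) = (\<integral>\<^sup>+t. ennreal (exp (Z t) / (\<integral>s. exp (Z s) \<partial>\<pi>)) \<partial>\<pi>)"
    unfolding gibbs_def by (subst emeasure_density) (auto intro!: nn_integral_cong)
  also have "\<dots> = ennreal (\<integral>t. exp (Z t) / (\<integral>s. exp (Z s) \<partial>\<pi>) \<partial>\<pi>)"
    using gibbs_partition by (intro nn_integral_eq_integral) (auto intro: less_imp_le)
  also have "\<dots> = 1" using gibbs_partition by simp
  finally show "emeasure (gibbs \<pi> Z) (space (gibbs \<pi> Z)) = 1" .
qed

lemma integral_gibbs: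
  fixes y :: "'t \<Rightarrow> real"
  assumes [measurable]: "y \<in> borel_measurable \<pi>"
  shows "(\<integral>t. y t \<partial>gibbs \<pi> Z) = (\<integral>t. y t * exp (Z t) \<partial>\<pi>) / (\<integral>t. exp (Z t) \<partial>\<pi>)"
proof -
  have "(\<integral>t. y t \<partial>gibbs \<pi> Z) = (\<integral>t. (exp (Z t) / (\<integral>s. exp (Z s) \<partial>\<pi>)) *\<^sub>R y t \<partial>\<pi>)"
    unfolding gibbs_def using gibbs_partition by (intro integral_density) auto
  also have "\<dots> = (\<integral>t. y t * exp (Z t) / (\<integral>s. exp (Z s) \<partial>\<pi>) \<partial>\<pi>)"
    by (intro Bochner_Integration.integral_cong) auto
  finally show ?thesis by simp
qed

text \<open>
  Tilting twice is tilting by the sum. A component can therefore be added to a potential by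
  regarding the Gibbs measure of the other components as the new prior.
\<close>

lemma gibbs_gibbs:
  assumes Y: "bounded_potential \<pi> Y"
  shows "gibbs (gibbs \<pi> Z) Y = gibbs \<pi> (\<lambda>t. Z t + Y t)"
proof -
  have [measurable]: "Y \<in> borel_measurable \<pi>" using Y by (simp add: bounded_potential_def)
  let ?c = "\<integral>s. exp (Z s) \<partial>\<pi>" and ?d = "\<integral>s. exp (Z s + Y s) \<partial>\<pi>"
  have p: "0 < ?c" by (rule gibbs_partition)
  have e: "(\<integral>s. exp (Y s) \<partial>gibbs \<pi> Z) = ?d / ?c"
    by (subst integral_gibbs) (auto simp: exp_add mult.commute)
  have "gibbs (gibbs \<pi> Z) Y = density (density \<pi> (\<lambda>t. ennreal (exp (Z t) / ?c))) (\<lambda>t. ennreal (exp (Y t) / (?d / ?c)))"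
    unfolding gibbs_def[of _ Y] e by (simp add: gibbs_def)
  also have "\<dots> = density \<pi> (\<lambda>t. ennreal (exp (Z t) / ?c) * ennreal (exp (Y t) / (?d / ?c)))"
    by (rule density_density_eq) auto
  also have "\<dots> = density \<pi> (\<lambda>t. ennreal (exp (Z t + Y t) / ?d))"
    using p by (intro arg_cong[where f="density \<pi>"] ext)
      (simp add: ennreal_mult'[symmetric] less_imp_le exp_add)
  finally show ?thesis by (simp add: gibbs_def)
qed

lemma ln_partition_add:
  assumes Y: "bounded_potential \<pi> Y"
  shows "ln (\<integral>t. exp (Z t + Y t) \<partial>\<pi>) = ln (\<integral>t. exp (Z t) \<partial>\<pi>) + ln (\<integral>t. exp (Y t) \<partial>gibbs \<pi> Z)"
proof -
  have [measurable]: "Y \<in> borel_measurable \<pi>" using Y by (simp add: bounded_potential_def)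
  have e: "(\<integral>s. exp (Y s) \<partial>gibbs \<pi> Z) = (\<integral>s. exp (Z s + Y s) \<partial>\<pi>) / (\<integral>s. exp (Z s) \<partial>\<pi>)"
    by (subst integral_gibbs) (auto simp: exp_add mult.commute)
  have "bounded_potential \<pi> (\<lambda>t. Z t + Y t)" using bounded_potential_add Z Y by blast
  then have "0 < (\<integral>s. exp (Z s + Y s) \<partial>\<pi>)"
    using prob_space.integral_exp_bounds(4)[OF \<pi>] unfolding bounded_potential_def by blast
  then show ?thesis unfolding e using gibbs_partition(2) by (simp add: ln_div)
qed

text \<open>
  The derivative of the convex function \<open>e \<mapsto> L(Z + e W)\<close> at zero is the Gibbs average of \<open>W\<close>.
  The inequality itself is Jensen's, obtained from the tangent of the exponential at the average.
\<close>

lemma ln_partition_convex: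
  assumes W: "bounded_potential \<pi> W"
  shows "e * (\<integral>t. W t \<partial>gibbs \<pi> Z) \<le> ln (\<integral>t. exp (Z t + e * W t) \<partial>\<pi>) - ln (\<integral>t. exp (Z t) \<partial>\<pi>)"
proof -
  obtain B where B: "\<And>t. t \<in> space \<pi> \<Longrightarrow> \<bar>W t\<bar> \<le> B" and [measurable]: "W \<in> borel_measurable \<pi>"
    using W by (auto simp: bounded_potential_def)
  have eW: "bounded_potential \<pi> (\<lambda>t. e * W t)"
    unfolding bounded_potential_def
  proof (intro conjI exI ballI)
    show "\<bar>e * W t\<bar> \<le> \<bar>e\<bar> * B" if "t \<in> space \<pi>" for t
      using B[OF that] by (simp add: abs_mult mult_left_mono)
  qed measurable
  interpret G: prob_space "gibbs \<pi> Z" by (rule prob_space_gibbs)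
  define w where "w = (\<integral>t. W t \<partial>gibbs \<pi> Z)"
  have iW: "integrable (gibbs \<pi> Z) W"
    using B by (intro G.abs_integral_le_bound(1)[where B=B]) auto
  have iE: "integrable (gibbs \<pi> Z) (\<lambda>t. exp (e * W t))" and pos: "0 < (\<integral>t. exp (e * W t) \<partial>gibbs \<pi> Z)"
    using G.integral_exp_bounds(1,4)[of "\<lambda>t. e * W t"] eW unfolding bounded_potential_def by auto
  have "exp (e * w) = (\<integral>t. exp (e * w) * (1 + e * (W t - w)) \<partial>gibbs \<pi> Z)"
  proof -
    have "(\<integral>t. W t - w \<partial>gibbs \<pi> Z) = 0"
      using iW G.prob_space by (simp add: w_def)
    then have "(\<integral>t. 1 + e * (W t - w) \<partial>gibbs \<pi> Z) = 1"
      using iW G.prob_space by (subst Bochner_Integration.integral_add) auto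
    then show ?thesis by simp
  qed
  also have "\<dots> \<le> (\<integral>t. exp (e * W t) \<partial>gibbs \<pi> Z)"
  proof (rule integral_mono)
    fix t
    have "exp (e * w) * (1 + e * (W t - w)) \<le> exp (e * w) * exp (e * (W t - w))"
      by (intro mult_left_mono exp_ge_add_one_self) auto
    then show "exp (e * w) * (1 + e * (W t - w)) \<le> exp (e * W t)"
      by (simp add: exp_add[symmetric] algebra_simps)
  qed (use iW iE in auto)
  finally have "e * w \<le> ln (\<integral>t. exp (e * W t) \<partial>gibbs \<pi> Z)"
    using pos by (simp add: ln_ge_iff)
  then show ?thesis unfolding w_def ln_partition_add[OF eW] by simp
qed

end

section \<open>Mean log-partition functions of independent components\<close>

text \<open>
  The potential \<open>f w\<close> of a random component is controlled uniformly in the index by \<open>g w\<close>. The cube of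
  \<open>g\<close> is what the third-order Taylor remainders leave.
\<close>

definition cube_envelope ::
  "'w measure \<Rightarrow> 't measure \<Rightarrow> ('w \<Rightarrow> 't \<Rightarrow> real) \<Rightarrow> ('w \<Rightarrow> real) \<Rightarrow> real \<Rightarrow> bool" where
  "cube_envelope P \<pi> f g \<kappa> \<longleftrightarrow>
     (\<lambda>(w, t). f w t) \<in> borel_measurable (P \<Otimes>\<^sub>M \<pi>) \<and> g \<in> borel_measurable P \<and>
     (\<forall>w\<in>space P. \<forall>t\<in>space \<pi>. \<bar>f w t\<bar> \<le> g w) \<and> (\<forall>w\<in>space P. 0 \<le> g w) \<and>
     integrable P (\<lambda>w. g w ^ 3) \<and> (\<integral>w. g w ^ 3 \<partial>P) \<le> \<kappa>"

lemma cube_envelope_cong_sets: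
  "sets \<pi>' = sets \<pi> \<Longrightarrow> cube_envelope P \<pi>' f g \<kappa> = cube_envelope P \<pi> f g \<kappa>"
  using sets_eq_imp_space_eq[of \<pi>' \<pi>] measurable_cong_sets[OF sets_pair_measure_cong[OF refl[of "sets P"], of \<pi>' \<pi>], of borel borel]
  unfolding cube_envelope_def by auto

lemma le_one_plus_cube: "x \<le> 1 + x^3" "x\<^sup>2 \<le> 1 + x^3" if "0 \<le> x" for x :: real
proof -
  have "x^1 \<le> 1 + x^3 \<and> x^2 \<le> 1 + x^3"
  proof (cases "x \<le> 1")
    case True
    then have "x^1 \<le> 1" "x^2 \<le> 1" using that by (auto intro!: power_le_one)
    then show ?thesis using zero_le_power[OF that, of 3] by linarith
  next
    case False
    then have "x^1 \<le> x^3" "x^2 \<le> x^3" by (intro power_increasing; simp)+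
    then show ?thesis by linarith
  qed
  then show "x \<le> 1 + x^3" "x\<^sup>2 \<le> 1 + x^3" by auto
qed

lemma dominated_integrable:
  fixes F :: "'w \<Rightarrow> real"
  assumes "F \<in> borel_measurable P" "integrable P G" "\<And>w. w \<in> space P \<Longrightarrow> \<bar>F w\<bar> \<le> G w"
  shows "integrable P F"
  using assms by (intro Bochner_Integration.integrable_bound[OF assms(2)] AE_I2)
    (auto intro: order_trans[OF _ abs_ge_self])

text \<open>An integrable envelope in the first variable makes \<open>F\<close> integrable on the product with a probability space.\<close>

lemma (in pair_prob_space) dominated_fubini:
  fixes F :: "'a \<Rightarrow> 'b \<Rightarrow> real"
  assumes [measurable]: "(\<lambda>(w, t). F w t) \<in> borel_measurable (M1 \<Otimes>\<^sub>M M2)"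
    and G: "integrable M1 G" "\<And>w t. w \<in> space M1 \<Longrightarrow> t \<in> space M2 \<Longrightarrow> \<bar>F w t\<bar> \<le> G w"
  shows "(\<integral>w. (\<integral>t. F w t \<partial>M2) \<partial>M1) = (\<integral>t. (\<integral>w. F w t \<partial>M1) \<partial>M2)"
    and "integrable M1 (\<lambda>w. \<integral>t. F w t \<partial>M2)"
    and "integrable M2 (\<lambda>t. \<integral>w. F w t \<partial>M1)"
    and "t \<in> space M2 \<Longrightarrow> integrable M1 (\<lambda>w. F w t)"
    and "t \<in> space M2 \<Longrightarrow> \<bar>\<integral>w. F w t \<partial>M1\<bar> \<le> (\<integral>w. G w \<partial>M1)"
    and "w \<in> space M1 \<Longrightarrow> \<bar>\<integral>t. F w t \<partial>M2\<bar> \<le> G w"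
proof -
  have [measurable]: "G \<in> borel_measurable M1" using G(1) by auto
  have b: "w \<in> space M1 \<Longrightarrow> \<bar>\<integral>t. F w t \<partial>M2\<bar> \<le> G w" for w
    using G(2) by (intro M2.abs_integral_le_bound(2)) auto
  then show "w \<in> space M1 \<Longrightarrow> \<bar>\<integral>t. F w t \<partial>M2\<bar> \<le> G w" by blast
  have ii: "integrable (M1 \<Otimes>\<^sub>M M2) (\<lambda>x. G (fst x))"
  proof -
    have "integrable (distr (M1 \<Otimes>\<^sub>M M2) M1 fst) G"
      using G(1) by (subst M2.distr_pair_fst)
    then show ?thesis by (simp add: integrable_distr_eq)
  qed
  have int: "integrable (M1 \<Otimes>\<^sub>M M2) (\<lambda>(w, t). F w t)"
    by (rule dominated_integrable[OF _ ii]) (use G(2) in \<open>auto simp: space_pair_measure\<close>)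
  show "(\<integral>w. (\<integral>t. F w t \<partial>M2) \<partial>M1) = (\<integral>t. (\<integral>w. F w t \<partial>M1) \<partial>M2)"
    using Fubini_integral[OF int] by simp
  show "integrable M1 (\<lambda>w. \<integral>t. F w t \<partial>M2)"
    using b by (intro dominated_integrable[OF _ G(1)]) auto
  show "t \<in> space M2 \<Longrightarrow> integrable M1 (\<lambda>w. F w t)" for t
    using G(2) by (intro dominated_integrable[OF _ G(1)]) auto
  then have c: "t \<in> space M2 \<Longrightarrow> \<bar>\<integral>w. F w t \<partial>M1\<bar> \<le> (\<integral>w. G w \<partial>M1)" for t
    using G by (intro order_trans[OF integral_abs_bound] integral_mono) auto
  then show "t \<in> space M2 \<Longrightarrow> \<bar>\<integral>w. F w t \<partial>M1\<bar> \<le> (\<integral>w. G w \<partial>M1)" by blast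
  show "integrable M2 (\<lambda>t. \<integral>w. F w t \<partial>M1)"
    using c by (intro M2.abs_integral_le_bound(1)) auto
qed

locale component =
  P: prob_space P + T: prob_space \<pi>
  for P :: "'w measure" and \<pi> :: "'t measure" +
  fixes f :: "'w \<Rightarrow> 't \<Rightarrow> real" and g :: "'w \<Rightarrow> real" and \<kappa> :: real
  assumes env: "cube_envelope P \<pi> f g \<kappa>"
begin

lemma f_meas [measurable]: "(\<lambda>(w, t). f w t) \<in> borel_measurable (P \<Otimes>\<^sub>M \<pi>)"
  and g_meas [measurable]: "g \<in> borel_measurable P"
  using env by (simp_all add: cube_envelope_def)

lemma f_le: "w \<in> space P \<Longrightarrow> t \<in> space \<pi> \<Longrightarrow> \<bar>f w t\<bar> \<le> g w"
  and g_nonneg: "w \<in> space P \<Longrightarrow> 0 \<le> g w"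
  and g_cube: "integrable P (\<lambda>w. g w ^ 3)" and g_cube_le: "(\<integral>w. g w ^ 3 \<partial>P) \<le> \<kappa>"
  using env by (simp_all add: cube_envelope_def)

lemma g_int: "integrable P g" and g_sq: "integrable P (\<lambda>w. (g w)\<^sup>2)"
proof -
  have i: "integrable P (\<lambda>w. 1 + g w ^ 3)" using g_cube by simp
  show "integrable P g"
    using g_nonneg le_one_plus_cube(1)[OF g_nonneg]
    by (intro Bochner_Integration.integrable_bound[OF i] AE_I2) (auto intro: order_trans[OF _ abs_ge_self])
  show "integrable P (\<lambda>w. (g w)\<^sup>2)"
    using g_nonneg le_one_plus_cube(2)[OF g_nonneg]
    by (intro Bochner_Integration.integrable_bound[OF i] AE_I2) (auto intro: order_trans[OF _ abs_ge_self])
qed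

lemma bounded_potential_f: "w \<in> space P \<Longrightarrow> bounded_potential \<pi> (f w)"
  unfolding bounded_potential_def using f_le by (auto intro!: exI[of _ "g w"])

sublocale PT: pair_prob_space P \<pi> ..

lemmas swap = PT.dominated_fubini
lemmas integrable_dominated = dominated_integrable

definition mean where "mean t = (\<integral>w. f w t \<partial>P)"
definition second where "second s t = (\<integral>w. f w s * f w t \<partial>P)"

lemma prod_le: "w \<in> space P \<Longrightarrow> s \<in> space \<pi> \<Longrightarrow> t \<in> space \<pi> \<Longrightarrow> \<bar>f w s * f w t\<bar> \<le> (g w)\<^sup>2"
  unfolding abs_mult power2_eq_square using f_le g_nonneg by (intro mult_mono) auto

text \<open>
  Averaging \<open>log_laplace_taylor\<close> over the component: by Fubini the second-order part depends on the
  law of the component through \<open>mean\<close> and \<open>second\<close> only, and the remainders average to \<open>34 * \<kappa>\<close>.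
\<close>

lemma mean_log_laplace:
  shows "integrable P (\<lambda>w. ln (\<integral>t. exp (f w t) \<partial>\<pi>))"
    and "\<bar>(\<integral>w. ln (\<integral>t. exp (f w t) \<partial>\<pi>) \<partial>P)
         - ((\<integral>t. mean t \<partial>\<pi>) + ((\<integral>t. second t t \<partial>\<pi>) - (\<integral>s. (\<integral>t. second s t \<partial>\<pi>) \<partial>\<pi>)) / 2)\<bar> \<le> 34 * \<kappa>"
proof -
  define L where "L w = ln (\<integral>t. exp (f w t) \<partial>\<pi>)" for w
  define A where "A w = (\<integral>t. f w t \<partial>\<pi>)" for w
  have [measurable]: "L \<in> borel_measurable P" "A \<in> borel_measurable P"
    unfolding L_def A_def by measurable
  have fm: "w \<in> space P \<Longrightarrow> f w \<in> borel_measurable \<pi>" for w by measurable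
  have Lb: "w \<in> space P \<Longrightarrow> \<bar>L w\<bar> \<le> g w" for w
    unfolding L_def using f_le by (intro T.integral_exp_bounds(5) fm) auto
  show "integrable P (\<lambda>w. ln (\<integral>t. exp (f w t) \<partial>\<pi>))"
    using integrable_dominated[OF _ g_int, of L] Lb unfolding L_def by auto
  then have iL: "integrable P L" by (simp add: L_def[abs_def])
  note s1 = swap[OF f_meas g_int f_le]
  have s2: "(\<integral>w. (\<integral>t. (f w t)\<^sup>2 \<partial>\<pi>) \<partial>P) = (\<integral>t. (\<integral>w. (f w t)\<^sup>2 \<partial>P) \<partial>\<pi>)"
    "integrable P (\<lambda>w. \<integral>t. (f w t)\<^sup>2 \<partial>\<pi>)"
    using prod_le[of _ t t for t, folded power2_eq_square] by (auto intro!: swap(1,2)[OF _ g_sq])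
  have A_le: "w \<in> space P \<Longrightarrow> \<bar>A w\<bar> \<le> g w" for w
    unfolding A_def using s1(6) by auto
  have fA: "w \<in> space P \<Longrightarrow> s \<in> space \<pi> \<Longrightarrow> \<bar>f w s * A w\<bar> \<le> (g w)\<^sup>2" for w s
    unfolding abs_mult power2_eq_square using f_le A_le g_nonneg by (intro mult_mono) auto
  have AA: "(\<integral>s. f w s * A w \<partial>\<pi>) = (A w)\<^sup>2" for w
    by (simp add: A_def power2_eq_square)
  have sA: "(\<integral>w. (A w)\<^sup>2 \<partial>P) = (\<integral>s. (\<integral>w. f w s * A w \<partial>P) \<partial>\<pi>)" "integrable P (\<lambda>w. (A w)\<^sup>2)"
  proof -
    have m: "(\<lambda>(w, s). f w s * A w) \<in> borel_measurable (P \<Otimes>\<^sub>M \<pi>)" by measurable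
    show "(\<integral>w. (A w)\<^sup>2 \<partial>P) = (\<integral>s. (\<integral>w. f w s * A w \<partial>P) \<partial>\<pi>)" "integrable P (\<lambda>w. (A w)\<^sup>2)"
      using swap(1,2)[OF m g_sq fA] unfolding AA by auto
  qed
  have sB: "(\<integral>w. f w s * A w \<partial>P) = (\<integral>t. second s t \<partial>\<pi>)" if s: "s \<in> space \<pi>" for s
  proof -
    have [measurable]: "(\<lambda>w. f w s) \<in> borel_measurable P" using s by measurable
    have m: "(\<lambda>(w, t). f w s * f w t) \<in> borel_measurable (P \<Otimes>\<^sub>M \<pi>)" by measurable
    show ?thesis
      using swap(1)[OF m g_sq] prod_le s unfolding A_def second_def by auto
  qed
  have sA': "(\<integral>w. (A w)\<^sup>2 \<partial>P) = (\<integral>s. (\<integral>t. second s t \<partial>\<pi>) \<partial>\<pi>)"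
    unfolding sA(1) using sB by (intro Bochner_Integration.integral_cong) auto
  define R where "R w = L w - (A w + ((\<integral>t. (f w t)\<^sup>2 \<partial>\<pi>) - (A w)\<^sup>2) / 2)" for w
  have Rle: "\<bar>R w\<bar> \<le> 34 * g w ^ 3" if w: "w \<in> space P" for w
    unfolding R_def L_def A_def using f_le w by (intro T.log_laplace_taylor fm) auto
  have iA: "integrable P A" using s1(2) unfolding A_def by auto
  have "(\<integral>w. R w \<partial>P) = (\<integral>w. L w \<partial>P) - ((\<integral>w. A w \<partial>P) + ((\<integral>w. \<integral>t. (f w t)\<^sup>2 \<partial>\<pi> \<partial>P) - (\<integral>w. (A w)\<^sup>2 \<partial>P)) / 2)"
    unfolding R_def using iL iA s2(2) sA(2) by simp
  moreover have "\<bar>\<integral>w. R w \<partial>P\<bar> \<le> (\<integral>w. 34 * g w ^ 3 \<partial>P)"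
  proof -
    have "integrable P R" unfolding R_def using iL iA s2(2) sA(2) by auto
    then show ?thesis
      using Rle g_cube by (intro order_trans[OF integral_abs_bound] integral_mono) auto
  qed
  moreover have "(\<integral>w. 34 * g w ^ 3 \<partial>P) \<le> 34 * \<kappa>" using g_cube_le by simp
  moreover have "(\<integral>w. A w \<partial>P) = (\<integral>t. mean t \<partial>\<pi>)" using s1(1) unfolding A_def mean_def by simp
  moreover have "(\<integral>w. \<integral>t. (f w t)\<^sup>2 \<partial>\<pi> \<partial>P) = (\<integral>t. second t t \<partial>\<pi>)"
    unfolding s2(1) second_def by (simp add: power2_eq_square)
  ultimately have "\<bar>(\<integral>w. L w \<partial>P)
         - ((\<integral>t. mean t \<partial>\<pi>) + ((\<integral>t. second t t \<partial>\<pi>) - (\<integral>s. (\<integral>t. second s t \<partial>\<pi>) \<partial>\<pi>)) / 2)\<bar> \<le> 34 * \<kappa>"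
    using sA' by simp
  then show "\<bar>(\<integral>w. ln (\<integral>t. exp (f w t) \<partial>\<pi>) \<partial>P)
         - ((\<integral>t. mean t \<partial>\<pi>) + ((\<integral>t. second t t \<partial>\<pi>) - (\<integral>s. (\<integral>t. second s t \<partial>\<pi>) \<partial>\<pi>)) / 2)\<bar> \<le> 34 * \<kappa>"
    unfolding L_def .
qed

lemma mean_second_measurable:
  "mean \<in> borel_measurable \<pi>" "(\<lambda>t. second t t) \<in> borel_measurable \<pi>"
  "(\<lambda>(s, t). second s t) \<in> borel_measurable (\<pi> \<Otimes>\<^sub>M \<pi>)"
  unfolding mean_def[abs_def] second_def[abs_def] by measurable

lemma abs_second_le: "s \<in> space \<pi> \<Longrightarrow> t \<in> space \<pi> \<Longrightarrow> \<bar>second s t\<bar> \<le> (\<integral>w. (g w)\<^sup>2 \<partial>P)"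
  unfolding second_def
  using prod_le g_sq
  by (intro order_trans[OF integral_abs_bound] integral_mono_AE')
     (auto intro!: AE_I2)

lemma abs_mean_le: "t \<in> space \<pi> \<Longrightarrow> \<bar>mean t\<bar> \<le> (\<integral>w. g w \<partial>P)"
  unfolding mean_def using swap(5)[OF f_meas g_int f_le] by auto

end

text \<open>
  The two averaged expansions differ by at most \<open>2 * \<alpha>\<close>, since the quadratic part contains two second
  moments with weight one half each.
\<close>

lemma log_laplace_exchange:
  assumes "component P \<pi> f g \<kappa>" "component P' \<pi> f' g' \<kappa>"
    and m: "\<And>t. t \<in> space \<pi> \<Longrightarrow> \<bar>(\<integral>w. f w t \<partial>P) - (\<integral>w. f' w t \<partial>P')\<bar> \<le> \<alpha>"
    and k: "\<And>s t. s \<in> space \<pi> \<Longrightarrow> t \<in> space \<pi> \<Longrightarrow>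
      \<bar>(\<integral>w. f w s * f w t \<partial>P) - (\<integral>w. f' w s * f' w t \<partial>P')\<bar> \<le> \<alpha>"
  shows "\<bar>(\<integral>w. ln (\<integral>t. exp (f w t) \<partial>\<pi>) \<partial>P) - (\<integral>w. ln (\<integral>t. exp (f' w t) \<partial>\<pi>) \<partial>P')\<bar> \<le> 68 * \<kappa> + 2 * \<alpha>"
proof -
  interpret C: component P \<pi> f g \<kappa> by fact
  interpret D: component P' \<pi> f' g' \<kappa> by fact
  note [measurable] = C.mean_second_measurable D.mean_second_measurable
  let ?\<pi> = \<pi>
  have diff: "\<bar>(\<integral>t. u t \<partial>\<pi>) - (\<integral>t. u' t \<partial>\<pi>)\<bar> \<le> \<alpha>"
    if "u \<in> borel_measurable \<pi>" "u' \<in> borel_measurable \<pi>"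
      "\<And>t. t \<in> space \<pi> \<Longrightarrow> \<bar>u t - u' t\<bar> \<le> \<alpha>"
      "\<And>t. t \<in> space \<pi> \<Longrightarrow> \<bar>u t\<bar> \<le> B" "\<And>t. t \<in> space \<pi> \<Longrightarrow> \<bar>u' t\<bar> \<le> B'" for u u' B B'
  proof -
    have "integrable \<pi> u" "integrable \<pi> u'" using that by (auto intro!: C.T.abs_integral_le_bound(1))
    moreover have "\<bar>\<integral>t. u t - u' t \<partial>\<pi>\<bar> \<le> \<alpha>" using that by (intro C.T.abs_integral_le_bound(2)) auto
    ultimately show ?thesis by simp
  qed
  have 1: "\<bar>(\<integral>t. C.mean t \<partial>\<pi>) - (\<integral>t. D.mean t \<partial>\<pi>)\<bar> \<le> \<alpha>"
    using m C.abs_mean_le D.abs_mean_le unfolding C.mean_def[symmetric] D.mean_def[symmetric]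
    by (intro diff) auto
  have 2: "\<bar>(\<integral>t. C.second t t \<partial>\<pi>) - (\<integral>t. D.second t t \<partial>\<pi>)\<bar> \<le> \<alpha>"
    using k C.abs_second_le D.abs_second_le unfolding C.second_def[symmetric] D.second_def[symmetric]
    by (intro diff) auto
  have 3: "\<bar>(\<integral>s. (\<integral>t. C.second s t \<partial>\<pi>) \<partial>\<pi>) - (\<integral>s. (\<integral>t. D.second s t \<partial>\<pi>) \<partial>\<pi>)\<bar> \<le> \<alpha>"
  proof (rule diff)
    fix s assume s: "s \<in> space \<pi>"
    show "\<bar>(\<integral>t. C.second s t \<partial>\<pi>) - (\<integral>t. D.second s t \<partial>\<pi>)\<bar> \<le> \<alpha>"
      using s k C.abs_second_le D.abs_second_le unfolding C.second_def[symmetric] D.second_def[symmetric]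
      by (intro diff) auto
    show "\<bar>\<integral>t. C.second s t \<partial>\<pi>\<bar> \<le> (\<integral>w. (g w)\<^sup>2 \<partial>P)" "\<bar>\<integral>t. D.second s t \<partial>\<pi>\<bar> \<le> (\<integral>w. (g' w)\<^sup>2 \<partial>P')"
      using s C.abs_second_le D.abs_second_le by (auto intro!: C.T.abs_integral_le_bound(2))
  qed measurable
  have "\<bar>u - u'\<bar> \<le> 68 * \<kappa> + 2 * \<alpha>"
    if "\<bar>a - a'\<bar> \<le> \<alpha>" "\<bar>b - b'\<bar> \<le> \<alpha>" "\<bar>c - c'\<bar> \<le> \<alpha>"
      "\<bar>u - (a + (b - c) / 2)\<bar> \<le> 34 * \<kappa>" "\<bar>u' - (a' + (b' - c') / 2)\<bar> \<le> 34 * \<kappa>"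
    for u u' a a' b b' c c' :: real
  proof -
    have "a - a' \<le> \<alpha>" "a' - a \<le> \<alpha>" "b - b' \<le> \<alpha>" "b' - b \<le> \<alpha>" "c - c' \<le> \<alpha>" "c' - c \<le> \<alpha>"
      "u - (a + (b - c) / 2) \<le> 34 * \<kappa>" "(a + (b - c) / 2) - u \<le> 34 * \<kappa>"
      "u' - (a' + (b' - c') / 2) \<le> 34 * \<kappa>" "(a' + (b' - c') / 2) - u' \<le> 34 * \<kappa>"
      using that by linarith+
    then show ?thesis by (intro abs_leI) argo+
  qed
  then show ?thesis using 1 2 3 C.mean_log_laplace(2) D.mean_log_laplace(2) by blast
qed

definition log_partition :: "'t measure \<Rightarrow> ('t \<Rightarrow> real) \<Rightarrow> real" where
  "log_partition \<pi> Z = ln (\<integral>t. exp (Z t) \<partial>\<pi>)"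

lemma (in pair_prob_space) integrable_log_partition:
  fixes F :: "'a \<Rightarrow> 'b \<Rightarrow> real"
  assumes [measurable]: "(\<lambda>(w, t). F w t) \<in> borel_measurable (M1 \<Otimes>\<^sub>M M2)"
    and G: "integrable M1 G" "\<And>w t. w \<in> space M1 \<Longrightarrow> t \<in> space M2 \<Longrightarrow> \<bar>F w t\<bar> \<le> G w"
  shows "integrable M1 (\<lambda>w. log_partition M2 (F w))"
proof -
  have "w \<in> space M1 \<Longrightarrow> F w \<in> borel_measurable M2" for w by measurable
  then show ?thesis
    unfolding log_partition_def using G
    by (intro dominated_integrable[OF _ G(1)] M2.integral_exp_bounds(5)) auto
qed

lemma integrable_PiM_component:
  fixes g :: "'w \<Rightarrow> real"
  assumes "\<And>m. prob_space (P m)" "m \<in> I" "integrable (P m) g"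
  shows "integrable (PiM I P) (\<lambda>\<omega>. g (\<omega> m))"
proof -
  interpret product_prob_space P I
    using assms(1) by (simp add: product_prob_space_def product_prob_space_axioms_def product_sigma_finite_def prob_space_imp_sigma_finite)
  have "integrable (distr (PiM I P) (P m) (\<lambda>\<omega>. \<omega> m)) g"
    using assms PiM_component by simp
  then show ?thesis using assms by (subst (asm) integrable_distr_eq) auto
qed

lemma measurable_component_process:
  fixes f :: "'w \<Rightarrow> 't \<Rightarrow> real"
  assumes f[measurable]: "(\<lambda>(w, t). f w t) \<in> borel_measurable (P m \<Otimes>\<^sub>M \<pi>)" and [measurable]: "m \<in> I"
  shows "(\<lambda>(\<omega>, t). f (\<omega> m) t) \<in> borel_measurable (PiM I P \<Otimes>\<^sub>M \<pi>)"
proof -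
  have "(\<lambda>(\<omega>, t). (\<omega> m, t)) \<in> PiM I P \<Otimes>\<^sub>M \<pi> \<rightarrow>\<^sub>M P m \<Otimes>\<^sub>M \<pi>" using assms(2) by measurable
  from measurable_compose[OF this f] show ?thesis by (simp add: case_prod_beta')
qed

text \<open>
  Independence of the components is encoded in the product measure. The measures are probability
  measures at every index, also outside \<open>I\<close>, as product measures of families require.
\<close>

locale component_family =
  T: prob_space \<pi> for \<pi> :: "'t measure" +
  fixes I :: "'i set" and P :: "'i \<Rightarrow> 'w measure" and f :: "'i \<Rightarrow> 'w \<Rightarrow> 't \<Rightarrow> real"
    and g :: "'i \<Rightarrow> 'w \<Rightarrow> real" and \<kappa> :: real
  assumes fin: "finite I" and prob: "\<And>m. prob_space (P m)"
    and env: "\<And>m. m \<in> I \<Longrightarrow> cube_envelope (P m) \<pi> (f m) (g m) \<kappa>"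
begin

lemma component: "m \<in> I \<Longrightarrow> component (P m) \<pi> (f m) (g m) \<kappa>"
  using env prob T.prob_space_axioms by (simp add: component_def component_axioms_def)

lemma subfamily: "J \<subseteq> I \<Longrightarrow> component_family \<pi> J P f g \<kappa>"
  using fin prob env T.prob_space_axioms finite_subset
  by (auto simp: component_family_def component_family_axioms_def)

sublocale PP: product_prob_space P I
  using prob by (simp add: product_prob_space_def product_prob_space_axioms_def product_sigma_finite_def prob_space_imp_sigma_finite)

definition total where "total \<omega> t = (\<Sum>m\<in>I. f m (\<omega> m) t)"
definition total_env where "total_env \<omega> = (\<Sum>m\<in>I. g m (\<omega> m))"

lemma total_measurable [measurable]: "(\<lambda>(\<omega>, t). total \<omega> t) \<in> borel_measurable (PiM I P \<Otimes>\<^sub>M \<pi>)"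
proof -
  have "(\<lambda>x. f m (fst x m) (snd x)) \<in> borel_measurable (PiM I P \<Otimes>\<^sub>M \<pi>)" if "m \<in> I" for m
    using measurable_component_process[of "f m" P m \<pi> I] env[OF that] that
    by (simp add: cube_envelope_def case_prod_beta')
  then show ?thesis unfolding total_def case_prod_beta' by (intro borel_measurable_sum)
qed

lemma total_env_int: "integrable (PiM I P) total_env"
  unfolding total_env_def[abs_def] using prob component.g_int[OF component]
  by (intro Bochner_Integration.integrable_sum integrable_PiM_component) auto

lemma total_le: "\<omega> \<in> space (PiM I P) \<Longrightarrow> t \<in> space \<pi> \<Longrightarrow> \<bar>total \<omega> t\<bar> \<le> total_env \<omega>"
  unfolding total_def total_env_def
  using component.f_le[OF component]
  by (intro order_trans[OF sum_abs] sum_mono) (auto simp: space_PiM PiE_def Pi_def)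

lemma total_bounded: "\<omega> \<in> space (PiM I P) \<Longrightarrow> bounded_potential \<pi> (total \<omega>)"
  unfolding bounded_potential_def using total_le
  by (auto intro!: exI[of _ "total_env \<omega>"])

end

lemma component_family_insert_total:
  assumes "component_family \<pi> (insert i I) P f g \<kappa>" "component_family \<pi> I P f g \<kappa>" "i \<notin> I"
  shows "component_family.total (insert i I) f (x(i := y)) t = f i y t + component_family.total I f x t"
proof -
  have "finite I" using assms(2) by (simp add: component_family_def component_family_axioms_def)
  then show ?thesis
    unfolding component_family.total_def[OF assms(1)] component_family.total_def[OF assms(2)]
    using assms(3) by (auto intro!: sum.cong)
qed

section \<open>The Lindeberg exchange\<close>

lemma integral_insert_PiM:
  fixes F :: "('i \<Rightarrow> 'w) \<Rightarrow> real"
  assumes "finite I" "i \<notin> I" "\<And>m. prob_space (P m)" "integrable (PiM (insert i I) P) F"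
  shows "(\<integral>\<omega>. F \<omega> \<partial>PiM (insert i I) P) = (\<integral>x. (\<integral>y. F (x(i := y)) \<partial>P i) \<partial>PiM I P)"
proof -
  interpret product_sigma_finite P
    using assms(3) by (simp add: product_sigma_finite_def prob_space_imp_sigma_finite)
  show ?thesis by (rule product_integral_insert) (use assms in auto)
qed

lemma pair_prob_spaceI: "prob_space M \<Longrightarrow> prob_space N \<Longrightarrow> pair_prob_space M N"
  by (simp add: pair_prob_space_def pair_sigma_finite_def prob_space_imp_sigma_finite)

text \<open>
  Integrability over the law of the remaining components and of one further component, which
  licenses the exchanges of integrals in the induction over the components.
\<close>

lemma (in component_family) integrable_log_partition_add:
  fixes f' :: "'v \<Rightarrow> 't \<Rightarrow> real"
  assumes c: "bounded_potential \<pi> c" and C: "component P' \<pi> f' g' \<kappa>"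
  defines "\<Phi> \<equiv> (\<lambda>x y. log_partition \<pi> (\<lambda>t. c t + f' y t + total x t))"
  shows "integrable (PiM I P \<Otimes>\<^sub>M P') (\<lambda>(x, y). \<Phi> x y)"
proof -
  interpret C: component P' \<pi> f' g' \<kappa> by fact
  interpret N: pair_prob_space "PiM I P" P' by (intro pair_prob_spaceI PP.prob_space_axioms C.P.prob_space_axioms)
  interpret NT: pair_prob_space "PiM I P \<Otimes>\<^sub>M P'" \<pi>
    by (intro pair_prob_spaceI N.prob_space_axioms T.prob_space_axioms)
  obtain B where B: "\<And>t. t \<in> space \<pi> \<Longrightarrow> \<bar>c t\<bar> \<le> B" and [measurable]: "c \<in> borel_measurable \<pi>"
    using c by (auto simp: bounded_potential_def)
  have [measurable]: "(\<lambda>x. total (fst (fst x)) (snd x)) \<in> borel_measurable ((PiM I P \<Otimes>\<^sub>M P') \<Otimes>\<^sub>M \<pi>)"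
    "(\<lambda>x. f' (snd (fst x)) (snd x)) \<in> borel_measurable ((PiM I P \<Otimes>\<^sub>M P') \<Otimes>\<^sub>M \<pi>)"
    using measurable_compose[OF _ total_measurable, of "\<lambda>x. (fst (fst x), snd x)" "(PiM I P \<Otimes>\<^sub>M P') \<Otimes>\<^sub>M \<pi>"]
      measurable_compose[OF _ C.f_meas, of "\<lambda>x. (snd (fst x), snd x)" "(PiM I P \<Otimes>\<^sub>M P') \<Otimes>\<^sub>M \<pi>"]
    by simp_all
  have "integrable (distr (PiM I P \<Otimes>\<^sub>M P') (PiM I P) fst) total_env"
    using total_env_int by (subst C.P.distr_pair_fst)
  then have 1: "integrable (PiM I P \<Otimes>\<^sub>M P') (\<lambda>z. total_env (fst z))"
    by (simp add: integrable_distr_eq total_env_int[THEN borel_measurable_integrable])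
  have 2: "integrable (PiM I P \<Otimes>\<^sub>M P') (\<lambda>z. g' (snd z))"
  proof -
    interpret S: pair_prob_space P' "PiM I P" by (intro pair_prob_spaceI PP.prob_space_axioms C.P.prob_space_axioms)
    have "integrable (distr (P' \<Otimes>\<^sub>M PiM I P) P' fst) g'"
      using C.g_int by (subst PP.distr_pair_fst)
    then have "integrable (P' \<Otimes>\<^sub>M PiM I P) (\<lambda>z. g' (fst z))" by (simp add: integrable_distr_eq)
    from S.integrable_product_swap[OF this] show ?thesis by (simp add: case_prod_beta')
  qed
  have "integrable (PiM I P \<Otimes>\<^sub>M P') (\<lambda>z. log_partition \<pi> (\<lambda>t. c t + f' (snd z) t + total (fst z) t))"
  proof (rule NT.integrable_log_partition)
    show "integrable (PiM I P \<Otimes>\<^sub>M P') (\<lambda>z. B + g' (snd z) + total_env (fst z))"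
      using 1 2 by simp
    fix z t assume z: "z \<in> space (PiM I P \<Otimes>\<^sub>M P')" and t: "t \<in> space \<pi>"
    have "\<bar>f' (snd z) t\<bar> \<le> g' (snd z)" "\<bar>total (fst z) t\<bar> \<le> total_env (fst z)"
      using z t C.f_le[of "snd z" t] total_le[of "fst z" t] by (auto simp: space_pair_measure)
    then show "\<bar>c t + f' (snd z) t + total (fst z) t\<bar> \<le> B + g' (snd z) + total_env (fst z)"
      using B[OF t] by linarith
  qed measurable
  then show ?thesis by (simp add: \<Phi>_def case_prod_beta')
qed

lemma (in component_family) integrable_log_partition_total:
  assumes c: "bounded_potential \<pi> c"
  shows "integrable (PiM I P) (\<lambda>\<omega>. log_partition \<pi> (\<lambda>t. c t + total \<omega> t))"
proof -
  interpret NT: pair_prob_space "PiM I P" \<pi>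
    by (intro pair_prob_spaceI PP.prob_space_axioms T.prob_space_axioms)
  obtain B where B: "\<And>t. t \<in> space \<pi> \<Longrightarrow> \<bar>c t\<bar> \<le> B" and [measurable]: "c \<in> borel_measurable \<pi>"
    using c by (auto simp: bounded_potential_def)
  show ?thesis
  proof (rule NT.integrable_log_partition)
    show "integrable (PiM I P) (\<lambda>z. B + total_env z)"
      using total_env_int by simp
    show "\<bar>c t + total z t\<bar> \<le> B + total_env z" if "z \<in> space (PiM I P)" "t \<in> space \<pi>" for z t
      using B[OF that(2)] total_le[OF that] by linarith
  qed measurable
qed

text \<open>
  By induction on the set of components. One component is replaced while the others are frozen: their
  potential is absorbed into the Gibbs measure that serves as prior in \<open>log_laplace_exchange\<close>.
  The remaining components are then exchanged with the new component frozen as part of \<open>c\<close>.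
\<close>

lemma lindeberg_exchange:
  fixes f :: "'i \<Rightarrow> 'w \<Rightarrow> 't \<Rightarrow> real" and f' :: "'i \<Rightarrow> 'v \<Rightarrow> 't \<Rightarrow> real"
    and \<kappa> \<alpha> :: real
  assumes F: "component_family \<pi> I P f g \<kappa>" and F': "component_family \<pi> I P' f' g' \<kappa>"
    and m: "\<And>i t. i \<in> I \<Longrightarrow> t \<in> space \<pi> \<Longrightarrow> \<bar>(\<integral>w. f i w t \<partial>P i) - (\<integral>w. f' i w t \<partial>P' i)\<bar> \<le> \<alpha>"
    and k: "\<And>i s t. i \<in> I \<Longrightarrow> s \<in> space \<pi> \<Longrightarrow> t \<in> space \<pi> \<Longrightarrow>
      \<bar>(\<integral>w. f i w s * f i w t \<partial>P i) - (\<integral>w. f' i w s * f' i w t \<partial>P' i)\<bar> \<le> \<alpha>"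
    and c: "bounded_potential \<pi> c"
  shows "\<bar>(\<integral>\<omega>. log_partition \<pi> (\<lambda>t. c t + component_family.total I f \<omega> t) \<partial>PiM I P)
          - (\<integral>\<omega>. log_partition \<pi> (\<lambda>t. c t + component_family.total I f' \<omega> t) \<partial>PiM I P')\<bar>
         \<le> card I * (68 * \<kappa> + 2 * \<alpha>)"
proof -
  have "finite I" using F by (simp add: component_family_def component_family_axioms_def)
  then show ?thesis using F F' m k c
  proof (induction I arbitrary: c rule: finite_induct)
    case empty
    then show ?case
      by (simp add: component_family.total_def[OF empty(1)] component_family.total_def[OF empty(2)] PiM_empty)
  next
    case (insert i I)
    let ?C = "68 * \<kappa> + 2 * \<alpha>"
    interpret A: component_family \<pi> "insert i I" P f g \<kappa> by (rule insert.prems)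
    interpret A': component_family \<pi> "insert i I" P' f' g' \<kappa> by (rule insert.prems)
    interpret J: component_family \<pi> I P f g \<kappa> by (rule A.subfamily) auto
    interpret J': component_family \<pi> I P' f' g' \<kappa> by (rule A'.subfamily) auto
    have Ci: "component (P i) \<pi> (f i) (g i) \<kappa>" and Ci': "component (P' i) \<pi> (f' i) (g' i) \<kappa>"
      by (rule A.component A'.component; simp)+
    interpret Ci: component "P i" \<pi> "f i" "g i" \<kappa> by (rule Ci)
    interpret Ci': component "P' i" \<pi> "f' i" "g' i" \<kappa> by (rule Ci')
    \<comment> \<open>the log-partition functions with component \<open>i\<close> and the others old or new\<close>
    define \<Phi> where "\<Phi> = (\<lambda>x y. log_partition \<pi> (\<lambda>t. c t + f i y t + J.total x t))"
    define \<Psi> where "\<Psi> = (\<lambda>x y. log_partition \<pi> (\<lambda>t. c t + f' i y t + J.total x t))"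
    define \<Psi>' where "\<Psi>' = (\<lambda>x y. log_partition \<pi> (\<lambda>t. c t + f' i y t + J'.total x t))"
    have i1: "integrable (PiM I P \<Otimes>\<^sub>M P i) (\<lambda>(x, y). \<Phi> x y)"
      unfolding \<Phi>_def by (rule J.integrable_log_partition_add[OF insert.prems(5) Ci])
    have i2: "integrable (PiM I P \<Otimes>\<^sub>M P' i) (\<lambda>(x, y). \<Psi> x y)"
      unfolding \<Psi>_def by (rule J.integrable_log_partition_add[OF insert.prems(5) Ci'])
    have i3: "integrable (PiM I P' \<Otimes>\<^sub>M P' i) (\<lambda>(x, y). \<Psi>' x y)"
      unfolding \<Psi>'_def by (rule J'.integrable_log_partition_add[OF insert.prems(5) Ci'])
    interpret N1: pair_prob_space "PiM I P" "P i" by (intro pair_prob_spaceI J.PP.prob_space_axioms A.prob)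
    interpret N2: pair_prob_space "PiM I P" "P' i" by (intro pair_prob_spaceI J.PP.prob_space_axioms A'.prob)
    interpret N3: pair_prob_space "PiM I P'" "P' i" by (intro pair_prob_spaceI J'.PP.prob_space_axioms A'.prob)
    have tot: "A.total (x(i := y)) t = f i y t + J.total x t" for x y t
      by (rule component_family_insert_total[OF insert.prems(1) J.component_family_axioms insert.hyps(2)])
    have tot': "A'.total (x(i := y)) t = f' i y t + J'.total x t" for x y t
      by (rule component_family_insert_total[OF insert.prems(2) J'.component_family_axioms insert.hyps(2)])
    have e1: "(\<integral>\<omega>. log_partition \<pi> (\<lambda>t. c t + A.total \<omega> t) \<partial>PiM (insert i I) P) = (\<integral>x. (\<integral>y. \<Phi> x y \<partial>P i) \<partial>PiM I P)"
      by (subst integral_insert_PiM[OF insert.hyps A.prob A.integrable_log_partition_total[OF insert.prems(5)]])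
        (simp add: tot \<Phi>_def add.assoc)
    have e3: "(\<integral>\<omega>. log_partition \<pi> (\<lambda>t. c t + A'.total \<omega> t) \<partial>PiM (insert i I) P') = (\<integral>x. (\<integral>y. \<Psi>' x y \<partial>P' i) \<partial>PiM I P')"
      by (subst integral_insert_PiM[OF insert.hyps A'.prob A'.integrable_log_partition_total[OF insert.prems(5)]])
        (simp add: tot' \<Psi>'_def add.assoc)
    have f2: "(\<integral>x. (\<integral>y. \<Psi> x y \<partial>P' i) \<partial>PiM I P) = (\<integral>y. (\<integral>x. \<Psi> x y \<partial>PiM I P) \<partial>P' i)"
      using N2.Fubini_integral[OF i2] by simp
    have f3: "(\<integral>x. (\<integral>y. \<Psi>' x y \<partial>P' i) \<partial>PiM I P') = (\<integral>y. (\<integral>x. \<Psi>' x y \<partial>PiM I P') \<partial>P' i)"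
      using N3.Fubini_integral[OF i3] by simp
    have step1: "\<bar>(\<integral>x. (\<integral>y. \<Phi> x y \<partial>P i) \<partial>PiM I P) - (\<integral>x. (\<integral>y. \<Psi> x y \<partial>P' i) \<partial>PiM I P)\<bar> \<le> ?C"
    proof -
      have j: "integrable (PiM I P) (\<lambda>x. \<integral>y. \<Phi> x y \<partial>P i)" "integrable (PiM I P) (\<lambda>x. \<integral>y. \<Psi> x y \<partial>P' i)"
        using N1.integrable_fst'[OF i1] N2.integrable_fst'[OF i2] by simp_all
      have "\<bar>(\<integral>y. \<Phi> x y \<partial>P i) - (\<integral>y. \<Psi> x y \<partial>P' i)\<bar> \<le> ?C" if x: "x \<in> space (PiM I P)" for x
      proof -
        define Z where "Z = (\<lambda>t. c t + J.total x t)"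
        have Z: "bounded_potential \<pi> Z"
          unfolding Z_def by (intro bounded_potential_add insert.prems(5) J.total_bounded x)
        interpret G: prob_space "gibbs \<pi> Z" by (rule prob_space_gibbs[OF A.T.prob_space_axioms Z])
        note sg = sets_gibbs[OF A.T.prob_space_axioms Z] space_gibbs[OF A.T.prob_space_axioms Z]
        have c1: "component (P i) (gibbs \<pi> Z) (f i) (g i) \<kappa>" "component (P' i) (gibbs \<pi> Z) (f' i) (g' i) \<kappa>"
          using Ci.env Ci'.env A.prob A'.prob G.prob_space_axioms
          by (simp_all add: component_def component_axioms_def cube_envelope_cong_sets[OF sg(1)])
        have a: "\<Phi> x y = log_partition \<pi> Z + ln (\<integral>t. exp (f i y t) \<partial>gibbs \<pi> Z)" if "y \<in> space (P i)" for y
          using ln_partition_add[OF A.T.prob_space_axioms Z Ci.bounded_potential_f[OF that]]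
          by (simp add: \<Phi>_def Z_def log_partition_def ac_simps)
        have b: "\<Psi> x y = log_partition \<pi> Z + ln (\<integral>t. exp (f' i y t) \<partial>gibbs \<pi> Z)" if "y \<in> space (P' i)" for y
          using ln_partition_add[OF A.T.prob_space_axioms Z Ci'.bounded_potential_f[OF that]]
          by (simp add: \<Psi>_def Z_def log_partition_def ac_simps)
        have "(\<integral>y. \<Phi> x y \<partial>P i) = (\<integral>y. log_partition \<pi> Z + ln (\<integral>t. exp (f i y t) \<partial>gibbs \<pi> Z) \<partial>P i)"
          using a by (intro Bochner_Integration.integral_cong) auto
        also have "\<dots> = log_partition \<pi> Z + (\<integral>y. ln (\<integral>t. exp (f i y t) \<partial>gibbs \<pi> Z) \<partial>P i)"
          using component.mean_log_laplace(1)[OF c1(1)] prob_space.prob_space[OF A.prob] by simp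
        finally have a': "(\<integral>y. \<Phi> x y \<partial>P i) = \<dots>" .
        have "(\<integral>y. \<Psi> x y \<partial>P' i) = (\<integral>y. log_partition \<pi> Z + ln (\<integral>t. exp (f' i y t) \<partial>gibbs \<pi> Z) \<partial>P' i)"
          using b by (intro Bochner_Integration.integral_cong) auto
        also have "\<dots> = log_partition \<pi> Z + (\<integral>y. ln (\<integral>t. exp (f' i y t) \<partial>gibbs \<pi> Z) \<partial>P' i)"
          using component.mean_log_laplace(1)[OF c1(2)] prob_space.prob_space[OF A'.prob] by simp
        finally have b': "(\<integral>y. \<Psi> x y \<partial>P' i) = \<dots>" .
        show ?thesis unfolding a' b'
          using log_laplace_exchange[OF c1, of \<alpha>] insert.prems(3,4) by (simp add: sg)
      qed
      moreover have "integrable (PiM I P) (\<lambda>x. (\<integral>y. \<Phi> x y \<partial>P i) - (\<integral>y. \<Psi> x y \<partial>P' i))" using j by simp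
      ultimately have "\<bar>\<integral>x. (\<integral>y. \<Phi> x y \<partial>P i) - (\<integral>y. \<Psi> x y \<partial>P' i) \<partial>PiM I P\<bar> \<le> ?C"
        by (intro J.PP.abs_integral_le_bound(2)) auto
      then show ?thesis using j by simp
    qed
    have step2: "\<bar>(\<integral>y. (\<integral>x. \<Psi> x y \<partial>PiM I P) \<partial>P' i) - (\<integral>y. (\<integral>x. \<Psi>' x y \<partial>PiM I P') \<partial>P' i)\<bar> \<le> card I * ?C"
    proof -
      have j: "integrable (P' i) (\<lambda>y. \<integral>x. \<Psi> x y \<partial>PiM I P)" "integrable (P' i) (\<lambda>y. \<integral>x. \<Psi>' x y \<partial>PiM I P')"
        using N2.integrable_snd[OF i2] N3.integrable_snd[OF i3] by simp_all
      have "\<bar>(\<integral>x. \<Psi> x y \<partial>PiM I P) - (\<integral>x. \<Psi>' x y \<partial>PiM I P')\<bar> \<le> card I * ?C" if y: "y \<in> space (P' i)" for y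
        unfolding \<Psi>_def \<Psi>'_def
        by (rule insert.IH[OF J.component_family_axioms J'.component_family_axioms])
          (use insert.prems(3,4) in \<open>auto intro!: bounded_potential_add insert.prems(5) Ci'.bounded_potential_f y\<close>)
      moreover have "integrable (P' i) (\<lambda>y. (\<integral>x. \<Psi> x y \<partial>PiM I P) - (\<integral>x. \<Psi>' x y \<partial>PiM I P'))" using j by simp
      ultimately have "\<bar>\<integral>y. (\<integral>x. \<Psi> x y \<partial>PiM I P) - (\<integral>x. \<Psi>' x y \<partial>PiM I P') \<partial>P' i\<bar> \<le> card I * ?C"
        by (intro prob_space.abs_integral_le_bound(2)[OF A'.prob]) auto
      then show ?thesis using j by simp
    qed
    have "real (card (insert i I)) * ?C = ?C + card I * ?C"
      using insert.hyps by (simp add: algebra_simps)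
    then show ?case unfolding e1 e3 f3 using step1 step2 unfolding f2 by linarith
  qed
qed

section \<open>Approximate integration by parts\<close>

text \<open>
  The failure of the replica identity: if \<open>y\<close> and the potential are jointly Gaussian, \<open>y\<close> is centred
  and \<open>h s t\<close> is the covariance of \<open>y t\<close> with the potential at \<open>s\<close>, then Gaussian integration by parts
  says that this quantity has mean zero.
\<close>

definition ibp_defect :: "'t measure \<Rightarrow> ('t \<Rightarrow> real) \<Rightarrow> ('t \<Rightarrow> 't \<Rightarrow> real) \<Rightarrow> real" where
  "ibp_defect \<mu> y h = (\<integral>t. y t \<partial>\<mu>) - (\<integral>t. (\<integral>s. h t t - h s t \<partial>\<mu>) \<partial>\<mu>)"

lemma (in prob_space) gibbs_mean_change:
  fixes h y :: "'a \<Rightarrow> real"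
  assumes h[measurable]: "h \<in> borel_measurable M" and g: "\<And>x. x \<in> space M \<Longrightarrow> \<bar>h x\<bar> \<le> g"
    and y[measurable]: "y \<in> borel_measurable M" and y0: "\<And>x. x \<in> space M \<Longrightarrow> \<bar>y x\<bar> \<le> y0"
  shows "\<bar>(\<integral>x. y x \<partial>gibbs M h) - (\<integral>x. y x \<partial>M)\<bar> \<le> 42 * y0 * g"
proof -
  obtain x0 where "x0 \<in> space M" using not_empty by auto
  then have g0: "0 \<le> g" and y00: "0 \<le> y0" using g[of x0] y0[of x0] by linarith+
  have hb: "bounded_potential M h" using g by (auto simp: bounded_potential_def)
  have e: "(\<integral>x. y x \<partial>gibbs M h) = (\<integral>x. y x * exp (h x) \<partial>M) / (\<integral>x. exp (h x) \<partial>M)"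
    by (rule integral_gibbs[OF prob_space_axioms hb y])
  have Y: "\<bar>\<integral>x. y x \<partial>M\<bar> \<le> y0" and m: "\<bar>\<integral>x. h x \<partial>M\<bar> \<le> g"
    using y0 g by (auto intro!: abs_integral_le_bound)
  have c: "\<bar>\<integral>x. y x * h x \<partial>M\<bar> \<le> y0 * g"
  proof (rule abs_integral_le_bound(2))
    show "\<bar>y x * h x\<bar> \<le> y0 * g" if "x \<in> space M" for x
      unfolding abs_mult using y0[OF that] g[OF that] y00 by (intro mult_mono) auto
  qed measurable
  have Ym: "\<bar>(\<integral>x. y x \<partial>M) * (\<integral>x. h x \<partial>M)\<bar> \<le> y0 * g"
    unfolding abs_mult using Y m y00 by (intro mult_mono) auto
  show ?thesis
  proof (cases "g \<le> 1")
    case True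
    have "g\<^sup>2 \<le> g" using True g0 by (simp add: power2_eq_square mult_left_le)
    then have "40 * y0 * g\<^sup>2 \<le> 40 * y0 * g" using y00 by (intro mult_left_mono) auto
    then show ?thesis using tilted_mean_taylor(1)[OF h g y y0] c Ym unfolding e by linarith
  next
    case False
    then have "y0 * 1 \<le> y0 * g" using y00 by (intro mult_left_mono) auto
    then show ?thesis using tilted_mean_taylor(2)[OF h g y y0] Y mult_nonneg_nonneg[OF y00 g0] unfolding e by linarith
  qed
qed

lemma ibp_defect_measurable:
  fixes F y :: "'w \<Rightarrow> 't \<Rightarrow> real"
  assumes "prob_space \<pi>"
    and [measurable]: "(\<lambda>(w, t). F w t) \<in> borel_measurable (P \<Otimes>\<^sub>M \<pi>)" "(\<lambda>(w, t). y w t) \<in> borel_measurable (P \<Otimes>\<^sub>M \<pi>)"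
      "(\<lambda>(s, t). h s t) \<in> borel_measurable (\<pi> \<Otimes>\<^sub>M \<pi>)"
    and b: "\<And>w. w \<in> space P \<Longrightarrow> bounded_potential \<pi> (F w)"
  shows "(\<lambda>w. ibp_defect (gibbs \<pi> (F w)) (y w) h) \<in> borel_measurable P"
proof -
  interpret prob_space \<pi> by fact
  define E where "E w = (\<integral>t. exp (F w t) \<partial>\<pi>)" for w
  have [measurable]: "E \<in> borel_measurable P" unfolding E_def by measurable
  have "ibp_defect (gibbs \<pi> (F w)) (y w) h = (\<integral>t. y w t * exp (F w t) \<partial>\<pi>) / E w
      - (\<integral>t. ((\<integral>s. (h t t - h s t) * exp (F w s) \<partial>\<pi>) / E w) * exp (F w t) \<partial>\<pi>) / E w" if w: "w \<in> space P" for w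
  proof -
    have inner: "(\<integral>s. (h t t - h s t) \<partial>gibbs \<pi> (F w)) = (\<integral>s. (h t t - h s t) * exp (F w s) \<partial>\<pi>) / E w"
      if "t \<in> space \<pi>" for t
      unfolding E_def using that by (intro integral_gibbs[OF prob_space_axioms b[OF w]]) measurable
    have "(\<integral>t. (\<integral>s. (h t t - h s t) \<partial>gibbs \<pi> (F w)) \<partial>gibbs \<pi> (F w))
        = (\<integral>t. (\<integral>s. (h t t - h s t) * exp (F w s) \<partial>\<pi>) / E w \<partial>gibbs \<pi> (F w))"
      using inner by (intro Bochner_Integration.integral_cong) (auto simp: space_gibbs[OF prob_space_axioms b[OF w]])
    also have "\<dots> = (\<integral>t. ((\<integral>s. (h t t - h s t) * exp (F w s) \<partial>\<pi>) / E w) * exp (F w t) \<partial>\<pi>) / E w"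
      unfolding E_def using w by (intro integral_gibbs[OF prob_space_axioms b[OF w]]) measurable
    finally show ?thesis
      unfolding ibp_defect_def using w
      by (subst (1) integral_gibbs[OF prob_space_axioms b[OF w]]) (auto simp: E_def)
  qed
  then show ?thesis
    by (subst measurable_cong) (simp, measurable)
qed

lemma (in prob_space) abs_ibp_defect_le:
  assumes [measurable]: "y \<in> borel_measurable M" "(\<lambda>(s, t). h s t) \<in> borel_measurable (M \<Otimes>\<^sub>M M)"
    and y: "\<And>t. t \<in> space M \<Longrightarrow> \<bar>y t\<bar> \<le> y0"
    and h: "\<And>s t. s \<in> space M \<Longrightarrow> t \<in> space M \<Longrightarrow> \<bar>h s t\<bar> \<le> hmax"
  shows "\<bar>ibp_defect M y h\<bar> \<le> y0 + 2 * hmax"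
proof -
  have 1: "\<bar>\<integral>t. y t \<partial>M\<bar> \<le> y0" using y by (intro abs_integral_le_bound(2)) auto
  have 2: "\<bar>\<integral>t. (\<integral>s. h t t - h s t \<partial>M) \<partial>M\<bar> \<le> 2 * hmax"
  proof (rule abs_integral_le_bound(2))
    show "\<bar>\<integral>s. h t t - h s t \<partial>M\<bar> \<le> 2 * hmax" if t: "t \<in> space M" for t
    proof (rule abs_integral_le_bound(2))
      show "\<bar>h t t - h s t\<bar> \<le> 2 * hmax" if "s \<in> space M" for s
        using h[OF t t] h[OF that t] by linarith
    qed (use t in measurable)
  qed measurable
  show ?thesis unfolding ibp_defect_def using 1 2 by linarith
qed

text \<open>
  The Gibbs average of \<open>y\<close> is expanded to second order in the component, which leaves the mean of \<open>y\<close>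
  and its covariance with \<open>f\<close> under the prior. The averages of \<open>h\<close> are replaced by prior averages at a
  cost linear in \<open>g\<close>. After integration over the component the leading terms cancel up to three
  errors of size \<open>\<alpha>\<close>.
\<close>

lemma (in component) mean_ibp_defect:
  assumes y[measurable]: "(\<lambda>(w, t). y w t) \<in> borel_measurable (P \<Otimes>\<^sub>M \<pi>)"
    and y_le: "\<And>w t. w \<in> space P \<Longrightarrow> t \<in> space \<pi> \<Longrightarrow> \<bar>y w t\<bar> \<le> g w"
    and h[measurable]: "(\<lambda>(s, t). h s t) \<in> borel_measurable (\<pi> \<Otimes>\<^sub>M \<pi>)"
    and h_le: "\<And>s t. s \<in> space \<pi> \<Longrightarrow> t \<in> space \<pi> \<Longrightarrow> \<bar>h s t\<bar> \<le> hmax"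
    and m: "\<And>t. t \<in> space \<pi> \<Longrightarrow> \<bar>\<integral>w. y w t \<partial>P\<bar> \<le> \<alpha>"
    and k: "\<And>s t. s \<in> space \<pi> \<Longrightarrow> t \<in> space \<pi> \<Longrightarrow> \<bar>(\<integral>w. y w t * f w s \<partial>P) - h s t\<bar> \<le> \<alpha>"
    and hg: "hmax * (\<integral>w. g w \<partial>P) \<le> \<kappa>"
  shows "\<bar>\<integral>w. ibp_defect (gibbs \<pi> (f w)) (y w) h \<partial>P\<bar> \<le> 166 * \<kappa> + 3 * \<alpha>"
proof -
  have h00: "0 \<le> hmax" using h_le T.not_empty by force
  define D where "D w = ibp_defect (gibbs \<pi> (f w)) (y w) h" for w
  define A where "A w = (\<integral>t. y w t \<partial>\<pi>)" for w
  define Cc where "Cc w = (\<integral>t. y w t * f w t \<partial>\<pi>)" for w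
  define Bb where "Bb w = (\<integral>s. f w s \<partial>\<pi>)" for w
  have [measurable]: "A \<in> borel_measurable P" "Bb \<in> borel_measurable P" "Cc \<in> borel_measurable P"
    unfolding A_def Bb_def Cc_def by measurable
  have [measurable]: "D \<in> borel_measurable P"
    unfolding D_def using bounded_potential_f by (intro ibp_defect_measurable T.prob_space_axioms) measurable
  define h1 where "h1 = (\<integral>t. h t t \<partial>\<pi>)"
  define h2 where "h2 = (\<integral>t. (\<integral>s. h s t \<partial>\<pi>) \<partial>\<pi>)"
  have ym: "w \<in> space P \<Longrightarrow> y w \<in> borel_measurable \<pi>" for w by measurable
  have fm: "w \<in> space P \<Longrightarrow> f w \<in> borel_measurable \<pi>" for w by measurable
  have hh: "integrable \<pi> (\<lambda>s. h s t)" "\<bar>\<integral>s. h s t \<partial>\<pi>\<bar> \<le> hmax" if "t \<in> space \<pi>" for t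
    using that h_le by (auto intro!: T.abs_integral_le_bound[where B=hmax])
  have h2i: "integrable \<pi> (\<lambda>t. \<integral>s. h s t \<partial>\<pi>)"
    using hh(2) by (intro T.abs_integral_le_bound(1)[where B=hmax]) auto
  have h1i: "integrable \<pi> (\<lambda>t. h t t)"
    using h_le by (auto intro!: T.abs_integral_le_bound[where B=hmax])
  have pt: "\<bar>D w - (A w + Cc w - A w * Bb w - (h1 - h2))\<bar> \<le> 40 * g w ^ 3 + 126 * (hmax * g w)"
    if w: "w \<in> space P" for w
  proof -
    let ?G = "gibbs \<pi> (f w)"
    note bp = bounded_potential_f[OF w]
    note sg = space_gibbs[OF T.prob_space_axioms bp]
    interpret G: prob_space ?G by (rule prob_space_gibbs[OF T.prob_space_axioms bp])
    note [measurable_cong] = sets_gibbs[OF T.prob_space_axioms bp]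
    have a: "\<bar>(\<integral>t. y w t \<partial>?G) - (A w + Cc w - A w * Bb w)\<bar> \<le> 40 * g w * (g w)\<^sup>2"
      using T.tilted_mean_taylor(1)[OF fm[OF w] _ ym[OF w], of "g w" "g w"] f_le[OF w] y_le[OF w]
      unfolding integral_gibbs[OF T.prob_space_axioms bp ym[OF w]] A_def Cc_def Bb_def by auto
    have b: "\<bar>(\<integral>t. h t t \<partial>?G) - h1\<bar> \<le> 42 * hmax * g w"
      unfolding h1_def using h_le f_le[OF w] fm[OF w] by (intro T.gibbs_mean_change) auto
    have c1: "\<bar>(\<integral>t. (\<integral>s. h s t \<partial>?G) \<partial>?G) - (\<integral>t. (\<integral>s. h s t \<partial>?G) \<partial>\<pi>)\<bar> \<le> 42 * hmax * g w"
    proof (intro T.gibbs_mean_change)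
      show "\<bar>\<integral>s. h s t \<partial>?G\<bar> \<le> hmax" if "t \<in> space \<pi>" for t
        using h_le that by (intro G.abs_integral_le_bound(2)) (auto simp: sg)
    qed (use f_le[OF w] fm[OF w] in auto)
    have c2: "\<bar>(\<integral>s. h s t \<partial>?G) - (\<integral>s. h s t \<partial>\<pi>)\<bar> \<le> 42 * hmax * g w" if "t \<in> space \<pi>" for t
      using h_le that f_le[OF w] fm[OF w] by (intro T.gibbs_mean_change) auto
    have i3: "integrable \<pi> (\<lambda>t. \<integral>s. h s t \<partial>?G)"
    proof (rule T.abs_integral_le_bound(1))
      show "\<bar>\<integral>s. h s t \<partial>?G\<bar> \<le> hmax" if "t \<in> space \<pi>" for t
        using h_le that by (intro G.abs_integral_le_bound(2)) (auto simp: sg)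
    qed measurable
    have "\<bar>\<integral>t. (\<integral>s. h s t \<partial>?G) - (\<integral>s. h s t \<partial>\<pi>) \<partial>\<pi>\<bar> \<le> 42 * hmax * g w"
      using c2 by (intro T.abs_integral_le_bound(2)) auto
    then have c3: "\<bar>(\<integral>t. (\<integral>s. h s t \<partial>?G) \<partial>\<pi>) - h2\<bar> \<le> 42 * hmax * g w"
      unfolding h2_def using i3 h2i by simp
    have Gi: "integrable ?G (\<lambda>s. h s t)" if "t \<in> space \<pi>" for t
      using h_le that by (intro G.abs_integral_le_bound(1)) (auto simp: sg)
    have "(\<integral>t. (\<integral>s. h t t - h s t \<partial>?G) \<partial>?G) = (\<integral>t. h t t - (\<integral>s. h s t \<partial>?G) \<partial>?G)"
      using Gi by (intro Bochner_Integration.integral_cong) (auto simp: sg G.prob_space G.prob_space[unfolded sg])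
    also have "\<dots> = (\<integral>t. h t t \<partial>?G) - (\<integral>t. (\<integral>s. h s t \<partial>?G) \<partial>?G)"
    proof (rule Bochner_Integration.integral_diff)
      show "integrable ?G (\<lambda>t. h t t)" using h_le by (intro G.abs_integral_le_bound(1)) (auto simp: sg)
      show "integrable ?G (\<lambda>t. \<integral>s. h s t \<partial>?G)"
      proof (rule G.abs_integral_le_bound(1))
        show "\<bar>\<integral>s. h s t \<partial>?G\<bar> \<le> hmax" if "t \<in> space ?G" for t
          using h_le that by (intro G.abs_integral_le_bound(2)) (auto simp: sg)
      qed measurable
    qed
    finally have "D w = (\<integral>t. y w t \<partial>?G) - ((\<integral>t. h t t \<partial>?G) - (\<integral>t. (\<integral>s. h s t \<partial>?G) \<partial>?G))"
      unfolding D_def ibp_defect_def by simp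
    then have "D w - (A w + Cc w - A w * Bb w - (h1 - h2)) =
        ((\<integral>t. y w t \<partial>?G) - (A w + Cc w - A w * Bb w)) - ((\<integral>t. h t t \<partial>?G) - h1)
        + ((\<integral>t. (\<integral>s. h s t \<partial>?G) \<partial>?G) - (\<integral>t. (\<integral>s. h s t \<partial>?G) \<partial>\<pi>))
        + ((\<integral>t. (\<integral>s. h s t \<partial>?G) \<partial>\<pi>) - h2)" by simp
    moreover have "40 * g w * (g w)\<^sup>2 = 40 * g w ^ 3" by (simp add: power2_eq_square power3_eq_cube)
    ultimately show ?thesis using a b c1 c3 by linarith
  qed
  have yf: "w \<in> space P \<Longrightarrow> t \<in> space \<pi> \<Longrightarrow> s \<in> space \<pi> \<Longrightarrow> \<bar>y w t * f w s\<bar> \<le> (g w)\<^sup>2" for w t s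
    unfolding abs_mult power2_eq_square using y_le f_le g_nonneg by (intro mult_mono) auto
  note sA = swap[OF y g_int y_le]
  have mC: "(\<lambda>(w, t). y w t * f w t) \<in> borel_measurable (P \<Otimes>\<^sub>M \<pi>)" by measurable
  note sC = swap[OF mC g_sq yf]
  have Bb_le: "w \<in> space P \<Longrightarrow> \<bar>Bb w\<bar> \<le> g w" for w
    unfolding Bb_def using swap(6)[OF f_meas g_int f_le] by auto
  have mAB: "(\<lambda>(w, t). y w t * Bb w) \<in> borel_measurable (P \<Otimes>\<^sub>M \<pi>)" by measurable
  have yB: "w \<in> space P \<Longrightarrow> t \<in> space \<pi> \<Longrightarrow> \<bar>y w t * Bb w\<bar> \<le> (g w)\<^sup>2" for w t
    unfolding abs_mult power2_eq_square using y_le Bb_le g_nonneg by (intro mult_mono) auto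
  note sAB = swap[OF mAB g_sq yB]
  have e1: "\<bar>\<integral>w. A w \<partial>P\<bar> \<le> \<alpha>"
  proof -
    have "(\<integral>w. A w \<partial>P) = (\<integral>t. (\<integral>w. y w t \<partial>P) \<partial>\<pi>)" using sA(1) unfolding A_def by simp
    moreover have "\<bar>\<integral>t. (\<integral>w. y w t \<partial>P) \<partial>\<pi>\<bar> \<le> \<alpha>" using m by (intro T.abs_integral_le_bound(2)) auto
    ultimately show ?thesis by simp
  qed
  have e2: "\<bar>(\<integral>w. Cc w \<partial>P) - h1\<bar> \<le> \<alpha>"
  proof -
    have "(\<integral>w. Cc w \<partial>P) = (\<integral>t. (\<integral>w. y w t * f w t \<partial>P) \<partial>\<pi>)" unfolding Cc_def using sC(1) by simp
    moreover have "\<bar>\<integral>t. (\<integral>w. y w t * f w t \<partial>P) - h t t \<partial>\<pi>\<bar> \<le> \<alpha>"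
      using k by (intro T.abs_integral_le_bound(2)) auto
    ultimately show ?thesis using sC(3) h1i unfolding h1_def by simp
  qed
  have e3: "\<bar>(\<integral>w. A w * Bb w \<partial>P) - h2\<bar> \<le> \<alpha>"
  proof -
    have in1: "\<bar>(\<integral>w. y w t * Bb w \<partial>P) - (\<integral>s. h s t \<partial>\<pi>)\<bar> \<le> \<alpha>" if t: "t \<in> space \<pi>" for t
    proof -
      have m1: "(\<lambda>(w, s). y w t * f w s) \<in> borel_measurable (P \<Otimes>\<^sub>M \<pi>)" using t by measurable
      note s1 = swap[OF m1 g_sq yf[OF _ t]]
      have "(\<integral>w. y w t * Bb w \<partial>P) = (\<integral>s. (\<integral>w. y w t * f w s \<partial>P) \<partial>\<pi>)"
        using s1(1) unfolding Bb_def by simp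
      moreover have "\<bar>\<integral>s. (\<integral>w. y w t * f w s \<partial>P) - h s t \<partial>\<pi>\<bar> \<le> \<alpha>"
        using k t by (intro T.abs_integral_le_bound(2)) auto
      ultimately show ?thesis using s1(3) hh(1)[OF t] by simp
    qed
    have "(\<integral>w. A w * Bb w \<partial>P) = (\<integral>t. (\<integral>w. y w t * Bb w \<partial>P) \<partial>\<pi>)"
      using sAB(1) unfolding A_def by simp
    moreover have "\<bar>\<integral>t. (\<integral>w. y w t * Bb w \<partial>P) - (\<integral>s. h s t \<partial>\<pi>) \<partial>\<pi>\<bar> \<le> \<alpha>"
      using in1 by (intro T.abs_integral_le_bound(2)) auto
    ultimately show ?thesis using sAB(3) h2i unfolding h2_def by simp
  qed
  have ints: "integrable P A" "integrable P Cc" "integrable P (\<lambda>w. A w * Bb w)"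
    using sA(2) sC(2) sAB(2) unfolding A_def Cc_def by auto
  define R where "R w = A w + Cc w - A w * Bb w - (h1 - h2)" for w
  have iR: "integrable P R" unfolding R_def using ints by simp
  have "integrable P (\<lambda>w. D w - R w)"
    by (rule dominated_integrable[where G="\<lambda>w. 40 * g w ^ 3 + 126 * (hmax * g w)"])
      (use pt g_cube g_int in \<open>auto simp: R_def\<close>)
  then have iD: "integrable P D" using Bochner_Integration.integrable_add[OF _ iR, of "\<lambda>w. D w - R w"] by simp
  have "\<bar>\<integral>w. D w - R w \<partial>P\<bar> \<le> (\<integral>w. 40 * g w ^ 3 + 126 * (hmax * g w) \<partial>P)"
    using pt iD iR g_cube g_int unfolding R_def[symmetric]
    by (intro order_trans[OF integral_abs_bound] integral_mono) auto
  also have "\<dots> = 40 * (\<integral>w. g w ^ 3 \<partial>P) + 126 * (hmax * (\<integral>w. g w \<partial>P))"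
    using g_cube g_int by simp
  also have "\<dots> \<le> 166 * \<kappa>" using g_cube_le hg by linarith
  finally have 1: "\<bar>(\<integral>w. D w \<partial>P) - (\<integral>w. R w \<partial>P)\<bar> \<le> 166 * \<kappa>" using iD iR by simp
  have 2: "(\<integral>w. R w \<partial>P) = (\<integral>w. A w \<partial>P) + (\<integral>w. Cc w \<partial>P) - (\<integral>w. A w * Bb w \<partial>P) - (h1 - h2)"
    unfolding R_def using ints by (simp add: P.prob_space)
  show ?thesis using 1 e1 e2 e3 unfolding 2 D_def[symmetric] by linarith
qed

lemma (in prob_space) ibp_defect_sum:
  assumes I: "finite I"
    and y[measurable]: "\<And>i. i \<in> I \<Longrightarrow> y i \<in> borel_measurable M"
    and h[measurable]: "\<And>i. i \<in> I \<Longrightarrow> (\<lambda>(s, t). h i s t) \<in> borel_measurable (M \<Otimes>\<^sub>M M)"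
    and yb: "\<And>i t. i \<in> I \<Longrightarrow> t \<in> space M \<Longrightarrow> \<bar>y i t\<bar> \<le> Y i"
    and hb: "\<And>i s t. i \<in> I \<Longrightarrow> s \<in> space M \<Longrightarrow> t \<in> space M \<Longrightarrow> \<bar>h i s t\<bar> \<le> H i"
  shows "ibp_defect M (\<lambda>t. \<Sum>i\<in>I. y i t) (\<lambda>s t. \<Sum>i\<in>I. h i s t) = (\<Sum>i\<in>I. ibp_defect M (y i) (h i))"
proof -
  have iy: "integrable M (y i)" if "i \<in> I" for i
    using yb[OF that] y[OF that] by (intro abs_integral_le_bound(1)[where B="Y i"]) auto
  have d: "\<bar>h i t t - h i s t\<bar> \<le> 2 * H i" if "i \<in> I" "t \<in> space M" "s \<in> space M" for i s t
    using hb[OF that(1,2,2)] hb[OF that(1,3,2)] by linarith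
  have dm[measurable]: "(\<lambda>(t, s). h i t t - h i s t) \<in> borel_measurable (M \<Otimes>\<^sub>M M)" if [measurable]: "i \<in> I" for i
  proof -
    note [measurable] = h[OF that]
    show ?thesis by measurable
  qed
  have ih: "integrable M (\<lambda>s. h i t t - h i s t)" "\<bar>\<integral>s. h i t t - h i s t \<partial>M\<bar> \<le> 2 * H i"
    if i: "i \<in> I" and t: "t \<in> space M" for i t
  proof -
    have m: "(\<lambda>s. h i t t - h i s t) \<in> borel_measurable M"
      using measurable_compose[OF measurable_Pair1'[OF t] dm[OF i]] by simp
    show "integrable M (\<lambda>s. h i t t - h i s t)" "\<bar>\<integral>s. h i t t - h i s t \<partial>M\<bar> \<le> 2 * H i"
      using abs_integral_le_bound[OF m, of "2 * H i"] d[OF i t] by auto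
  qed
  have io: "integrable M (\<lambda>t. \<integral>s. h i t t - h i s t \<partial>M)" if i: "i \<in> I" for i
  proof -
    note [measurable] = dm[OF i]
    show ?thesis using ih(2)[OF i] by (intro abs_integral_le_bound(1)[where B="2 * H i"]) auto
  qed
  have "(\<integral>t. (\<integral>s. (\<Sum>i\<in>I. h i t t) - (\<Sum>i\<in>I. h i s t) \<partial>M) \<partial>M) = (\<integral>t. (\<Sum>i\<in>I. \<integral>s. h i t t - h i s t \<partial>M) \<partial>M)"
    using ih(1) by (intro Bochner_Integration.integral_cong) (auto simp: sum_subtractf[symmetric] Bochner_Integration.integral_sum simp del: Bochner_Integration.integral_diff)
  also have "\<dots> = (\<Sum>i\<in>I. \<integral>t. (\<integral>s. h i t t - h i s t \<partial>M) \<partial>M)"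
    using io by (intro Bochner_Integration.integral_sum)
  finally show ?thesis
    unfolding ibp_defect_def using iy by (simp add: sum_subtractf)
qed

text \<open>
  The defect is additive in the components. For each summand the other components are absorbed into
  the prior, and the bound for a single component applies conditionally on them.
\<close>

lemma mean_ibp_defect_sum:
  fixes f :: "'i \<Rightarrow> 'w \<Rightarrow> 't \<Rightarrow> real" and \<kappa> \<alpha> hmax :: real
  assumes F: "component_family \<pi> I P f g \<kappa>"
    and y: "\<And>i. i \<in> I \<Longrightarrow> (\<lambda>(w, t). y i w t) \<in> borel_measurable (P i \<Otimes>\<^sub>M \<pi>)"
    and y_le: "\<And>i w t. i \<in> I \<Longrightarrow> w \<in> space (P i) \<Longrightarrow> t \<in> space \<pi> \<Longrightarrow> \<bar>y i w t\<bar> \<le> g i w"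
    and h: "\<And>i. i \<in> I \<Longrightarrow> (\<lambda>(s, t). h i s t) \<in> borel_measurable (\<pi> \<Otimes>\<^sub>M \<pi>)"
    and h_le: "\<And>i s t. i \<in> I \<Longrightarrow> s \<in> space \<pi> \<Longrightarrow> t \<in> space \<pi> \<Longrightarrow> \<bar>h i s t\<bar> \<le> hmax"
    and m: "\<And>i t. i \<in> I \<Longrightarrow> t \<in> space \<pi> \<Longrightarrow> \<bar>\<integral>w. y i w t \<partial>P i\<bar> \<le> \<alpha>"
    and k: "\<And>i s t. i \<in> I \<Longrightarrow> s \<in> space \<pi> \<Longrightarrow> t \<in> space \<pi> \<Longrightarrow> \<bar>(\<integral>w. y i w t * f i w s \<partial>P i) - h i s t\<bar> \<le> \<alpha>"
    and hg: "\<And>i. i \<in> I \<Longrightarrow> hmax * (\<integral>w. g i w \<partial>P i) \<le> \<kappa>"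
    and c: "bounded_potential \<pi> c"
  defines "G \<equiv> (\<lambda>\<omega>. gibbs \<pi> (\<lambda>t. c t + component_family.total I f \<omega> t))"
  shows "\<bar>\<integral>\<omega>. ibp_defect (G \<omega>) (\<lambda>t. \<Sum>i\<in>I. y i (\<omega> i) t) (\<lambda>s t. \<Sum>i\<in>I. h i s t) \<partial>PiM I P\<bar>
          \<le> card I * (166 * \<kappa> + 3 * \<alpha>)"
proof -
  interpret A: component_family \<pi> I P f g \<kappa> by (rule F)
  have [measurable]: "c \<in> borel_measurable \<pi>" using c by (simp add: bounded_potential_def)
  have bp: "bounded_potential \<pi> (\<lambda>t. c t + A.total \<omega> t)" if "\<omega> \<in> space (PiM I P)" for \<omega>
    by (intro bounded_potential_add c A.total_bounded that)
  have Fm[measurable]: "(\<lambda>(\<omega>, t). c t + A.total \<omega> t) \<in> borel_measurable (PiM I P \<Otimes>\<^sub>M \<pi>)" by measurable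
  define D where "D i \<omega> = ibp_defect (G \<omega>) (y i (\<omega> i)) (h i)" for i \<omega>
  have spc: "\<omega> i \<in> space (P i)" if "\<omega> \<in> space (PiM I P)" "i \<in> I" for \<omega> i
    using that by (auto simp: space_PiM PiE_def Pi_def)
  have ym: "y i w \<in> borel_measurable \<pi>" if "i \<in> I" "w \<in> space (P i)" for i w
    using measurable_compose[OF measurable_Pair1'[OF that(2)] y[OF that(1)]] by simp
  have intD: "integrable (PiM I P) (D i)" if i: "i \<in> I" for i
  proof (rule dominated_integrable)
    show "D i \<in> borel_measurable (PiM I P)"
      unfolding D_def[abs_def] G_def
      by (rule ibp_defect_measurable[OF A.T.prob_space_axioms Fm measurable_component_process[where P=P and m=i and f="y i", OF y[OF i] i] h[OF i] bp])
    show "integrable (PiM I P) (\<lambda>\<omega>. g i (\<omega> i) + 2 * hmax)"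
      using integrable_PiM_component[where P=P and m=i, OF A.prob i component.g_int[OF A.component[OF i]]] by simp
    show "\<bar>D i \<omega>\<bar> \<le> g i (\<omega> i) + 2 * hmax" if w: "\<omega> \<in> space (PiM I P)" for \<omega>
    proof -
      interpret G: prob_space "G \<omega>" unfolding G_def by (rule prob_space_gibbs[OF A.T.prob_space_axioms bp[OF w]])
      have s: "sets (G \<omega>) = sets \<pi>" "space (G \<omega>) = space \<pi>"
        unfolding G_def using sets_gibbs[OF A.T.prob_space_axioms bp[OF w]] space_gibbs[OF A.T.prob_space_axioms bp[OF w]] by auto
      show ?thesis unfolding D_def
        using ym[OF i spc[OF w i]] y_le[OF i spc[OF w i]] h[OF i] h_le[OF i] s(2)
        by (intro G.abs_ibp_defect_le)
          (auto simp: measurable_cong_sets[OF s(1) refl] measurable_cong_sets[OF sets_pair_measure_cong[OF s(1) s(1)] refl])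
    qed
  qed
  have sum: "ibp_defect (G \<omega>) (\<lambda>t. \<Sum>i\<in>I. y i (\<omega> i) t) (\<lambda>s t. \<Sum>i\<in>I. h i s t) = (\<Sum>i\<in>I. D i \<omega>)"
    if w: "\<omega> \<in> space (PiM I P)" for \<omega>
  proof -
    interpret G: prob_space "G \<omega>" unfolding G_def by (rule prob_space_gibbs[OF A.T.prob_space_axioms bp[OF w]])
    have s: "sets (G \<omega>) = sets \<pi>" "space (G \<omega>) = space \<pi>"
      unfolding G_def using sets_gibbs[OF A.T.prob_space_axioms bp[OF w]] space_gibbs[OF A.T.prob_space_axioms bp[OF w]] by auto
    show ?thesis unfolding D_def
      using ym[OF _ spc[OF w]] y_le[OF _ spc[OF w]] h h_le s(2)
      by (intro G.ibp_defect_sum[OF A.fin, where Y="\<lambda>i. g i (\<omega> i)" and H="\<lambda>i. hmax"])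
        (auto simp: measurable_cong_sets[OF s(1) refl] measurable_cong_sets[OF sets_pair_measure_cong[OF s(1) s(1)] refl])
  qed
  have one: "\<bar>\<integral>\<omega>. D i \<omega> \<partial>PiM I P\<bar> \<le> 166 * \<kappa> + 3 * \<alpha>" if i: "i \<in> I" for i
  proof -
    define J where "J = I - {i}"
    have IJ: "I = insert i J" "i \<notin> J" using i by (auto simp: J_def)
    have F': "component_family \<pi> (insert i J) P f g \<kappa>" using F IJ by simp
    interpret J: component_family \<pi> J P f g \<kappa> by (rule A.subfamily) (auto simp: J_def)
    have tot: "A.total (x(i := w)) t = f i w t + J.total x t" for x w t
      using component_family_insert_total[OF F' J.component_family_axioms IJ(2)] IJ(1) by simp
    have e: "(\<integral>\<omega>. D i \<omega> \<partial>PiM I P) = (\<integral>x. (\<integral>w. D i (x(i := w)) \<partial>P i) \<partial>PiM J P)"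
      using integral_insert_PiM[where P=P and F="D i", OF J.fin IJ(2) A.prob] intD[OF i] IJ(1) by simp
    have "\<bar>\<integral>w. D i (x(i := w)) \<partial>P i\<bar> \<le> 166 * \<kappa> + 3 * \<alpha>" if x: "x \<in> space (PiM J P)" for x
    proof -
      define Z where "Z = (\<lambda>t. c t + J.total x t)"
      have Z: "bounded_potential \<pi> Z"
        unfolding Z_def by (intro bounded_potential_add c J.total_bounded x)
      interpret G: prob_space "gibbs \<pi> Z" by (rule prob_space_gibbs[OF A.T.prob_space_axioms Z])
      note sg = sets_gibbs[OF A.T.prob_space_axioms Z] space_gibbs[OF A.T.prob_space_axioms Z]
      interpret C: component "P i" "gibbs \<pi> Z" "f i" "g i" \<kappa>
        using A.env[OF i] A.prob G.prob_space_axioms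
        by (simp add: component_def component_axioms_def cube_envelope_cong_sets[OF sg(1)])
      have "\<bar>\<integral>w. ibp_defect (gibbs (gibbs \<pi> Z) (f i w)) (y i w) (h i) \<partial>P i\<bar> \<le> 166 * \<kappa> + 3 * \<alpha>"
        using y[OF i] h[OF i] y_le[OF i] h_le[OF i] m[OF i] k[OF i] hg[OF i]
        by (intro C.mean_ibp_defect[where hmax=hmax])
          (auto simp: sg measurable_cong_sets[OF sets_pair_measure_cong[OF refl[of "sets (P i)"] sg(1)] refl]
            measurable_cong_sets[OF sets_pair_measure_cong[OF sg(1) sg(1)] refl])
      moreover have "D i (x(i := w)) = ibp_defect (gibbs (gibbs \<pi> Z) (f i w)) (y i w) (h i)" if "w \<in> space (P i)" for w
        using gibbs_gibbs[OF A.T.prob_space_axioms Z component.bounded_potential_f[OF A.component[OF i] that]]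
        unfolding D_def G_def tot Z_def by (simp add: ac_simps)
      then have "(\<integral>w. D i (x(i := w)) \<partial>P i) = (\<integral>w. ibp_defect (gibbs (gibbs \<pi> Z) (f i w)) (y i w) (h i) \<partial>P i)"
        by (intro Bochner_Integration.integral_cong) auto
      ultimately show ?thesis by simp
    qed
    moreover have "(\<lambda>x. \<integral>w. D i (x(i := w)) \<partial>P i) \<in> borel_measurable (PiM J P)"
    proof -
      have DD: "D i \<in> borel_measurable (PiM (insert i J) P)" using intD[OF i] IJ(1) by auto
      interpret Pi: prob_space "P i" by (rule A.prob)
      have "(\<lambda>(x, w). D i (x(i := w))) \<in> borel_measurable (PiM J P \<Otimes>\<^sub>M P i)"
        using measurable_compose[OF measurable_add_dim[of i J P] DD] by (simp add: case_prod_beta')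
      then show ?thesis by measurable
    qed
    ultimately show ?thesis unfolding e by (intro J.PP.abs_integral_le_bound(2))
  qed
  have "(\<integral>\<omega>. ibp_defect (G \<omega>) (\<lambda>t. \<Sum>i\<in>I. y i (\<omega> i) t) (\<lambda>s t. \<Sum>i\<in>I. h i s t) \<partial>PiM I P)
      = (\<integral>\<omega>. (\<Sum>i\<in>I. D i \<omega>) \<partial>PiM I P)"
    using sum by (intro Bochner_Integration.integral_cong) auto
  also have "\<dots> = (\<Sum>i\<in>I. \<integral>\<omega>. D i \<omega> \<partial>PiM I P)" using intD by simp
  also have "\<bar>\<dots>\<bar> \<le> (\<Sum>i\<in>I. \<bar>\<integral>\<omega>. D i \<omega> \<partial>PiM I P\<bar>)" by (rule sum_abs)
  also have "\<dots> \<le> (\<Sum>i\<in>I. 166 * \<kappa> + 3 * \<alpha>)" using one by (rule sum_mono)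
  finally show ?thesis by simp
qed

section \<open>Expectations under a small change of measure\<close>

text \<open>
  The factor \<open>1 + exp x\<close> turns remainders of the likelihood ratio \<open>exp x\<close> into moments under the
  null law plus moments under the tilted law.
\<close>

lemma exp_remainder1: "\<bar>exp x - 1\<bar> \<le> \<bar>x\<bar> * (1 + exp x)" for x :: real
proof (cases "0 \<le> x")
  case True
  have "1 - x \<le> exp (- x)" using exp_ge_add_one_self[of "-x"] by simp
  then have "(1 - x) * exp x \<le> exp (- x) * exp x" by (intro mult_right_mono) auto
  then have "exp x - 1 \<le> x * exp x" by (simp add: exp_minus algebra_simps)
  moreover have "1 \<le> exp x" using True by simp
  ultimately show ?thesis using True by (simp add: algebra_simps)
next
  case False
  then have "exp x \<le> 1" "1 + x \<le> exp x" using exp_ge_add_one_self[of x] by auto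
  moreover have "x * exp x \<le> 0" using False by (intro mult_nonpos_nonneg) auto
  ultimately have "\<bar>exp x - 1\<bar> \<le> \<bar>x\<bar>" using False by linarith
  also have "\<dots> \<le> \<bar>x\<bar> * (1 + exp x)" by (simp add: algebra_simps)
  finally show ?thesis .
qed

lemma exp_remainder2: "\<bar>exp x - 1 - x\<bar> \<le> x\<^sup>2 * (1 + exp x)" for x :: real
proof (cases "0 \<le> x")
  case True
  obtain t where t: "\<bar>t\<bar> \<le> \<bar>x\<bar>" "exp x = (\<Sum>m<2. x^m / fact m) + exp t / fact 2 * x^2"
    using Maclaurin_exp_le[of x 2] by blast
  have e: "exp x - 1 - x = exp t / 2 * x\<^sup>2" using t(2) by (simp add: numeral_2_eq_2)
  have "exp t \<le> exp x" using t(1) True by simp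
  then have "exp t / 2 * x\<^sup>2 \<le> (1 + exp x) * x\<^sup>2"
    using exp_gt_zero[of x] by (intro mult_right_mono; linarith?) simp
  then show ?thesis unfolding e by (simp add: abs_mult algebra_simps)
next
  case False
  define y where "y = - x"
  have y: "0 \<le> y" using False by (simp add: y_def)
  have "1 + y + y\<^sup>2 / 2 \<le> exp y" using exp_lower_Taylor_quadratic[OF y] .
  moreover have "0 \<le> 1 - y + y\<^sup>2 / 2"
    using zero_le_power2[of "y - 1"] by (simp add: power2_eq_square algebra_simps)
  ultimately have "(1 - y + y\<^sup>2 / 2) * (1 + y + y\<^sup>2 / 2) \<le> (1 - y + y\<^sup>2 / 2) * exp y"
    by (intro mult_left_mono) auto
  moreover have "(1 - y + y\<^sup>2 / 2) * (1 + y + y\<^sup>2 / 2) = 1 + (y\<^sup>2)\<^sup>2 / 4"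
    by (simp add: power2_eq_square algebra_simps)
  moreover have "0 \<le> (y\<^sup>2)\<^sup>2 / 4" by simp
  ultimately have "1 \<le> (1 - y + y\<^sup>2 / 2) * exp y" by linarith
  then have "exp (- y) * 1 \<le> exp (- y) * ((1 - y + y\<^sup>2 / 2) * exp y)"
    by (intro mult_left_mono) auto
  also have "\<dots> = (1 - y + y\<^sup>2 / 2) * (exp (- y) * exp y)" by (simp only: mult_ac)
  also have "\<dots> = 1 - y + y\<^sup>2 / 2" by (simp add: exp_minus)
  finally have "exp x \<le> 1 + x + x\<^sup>2 / 2" by (simp add: y_def)
  moreover have "1 + x \<le> exp x" by (rule exp_ge_add_one_self)
  moreover have "x\<^sup>2 / 2 \<le> x\<^sup>2 * (1 + exp x)"
    using exp_gt_zero[of x] mult_nonneg_nonneg[of "x\<^sup>2" "exp x"] by (simp add: algebra_simps)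
  ultimately show ?thesis by linarith
qed

lemma mult3_le_cubes:
  fixes a b c :: real
  assumes "0 \<le> a" "0 \<le> b" "0 \<le> c"
  shows "a * b * c \<le> a^3 + b^3 + c^3"
proof -
  define m where "m = max a (max b c)"
  have "a * b * c \<le> m * m * m" using assms unfolding m_def by (intro mult_mono) auto
  also have "\<dots> = m^3" by (simp add: power3_eq_cube)
  also have "\<dots> \<le> a^3 + b^3 + c^3"
    using zero_le_power[OF assms(1), of 3] zero_le_power[OF assms(2), of 3] zero_le_power[OF assms(3), of 3]
    unfolding m_def max_def by auto
  finally show ?thesis .
qed

lemma cube_add_le: "\<bar>a + b\<bar>^3 \<le> 4 * (\<bar>a\<bar>^3 + \<bar>b\<bar>^3)" for a b :: real
proof -
  define x where "x = \<bar>a\<bar>"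
  define y where "y = \<bar>b\<bar>"
  have xy: "0 \<le> x" "0 \<le> y" by (simp_all add: x_def y_def)
  have "\<bar>a + b\<bar>^3 \<le> (x + y)^3" unfolding x_def y_def by (intro power_mono) auto
  also have "\<dots> \<le> 4 * (x^3 + y^3)"
  proof -
    have "4 * (x^3 + y^3) - (x + y)^3 = 3 * ((x + y) * (x - y)\<^sup>2)"
      by (simp add: power2_eq_square power3_eq_cube algebra_simps)
    moreover have "0 \<le> (x + y) * (x - y)\<^sup>2" using xy by simp
    ultimately show ?thesis by linarith
  qed
  finally show ?thesis by (simp add: x_def y_def)
qed

lemma square_le_cube: "0 \<le> x \<Longrightarrow> 0 < l \<Longrightarrow> x\<^sup>2 \<le> 2/3 * x^3 / l + l\<^sup>2 / 3" for x l :: real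
proof -
  assume x: "0 \<le> x" and l: "0 < l"
  have "0 \<le> (x - l)\<^sup>2 * (2 * x + l)" using x l by simp
  also have "\<dots> = 2 * x^3 - 3 * x\<^sup>2 * l + l^3"
    by (simp add: power2_eq_square power3_eq_cube algebra_simps)
  finally have "3 * x\<^sup>2 * l \<le> 2 * x^3 + l^3" by simp
  then have "x\<^sup>2 \<le> (2 * x^3 + l^3) / (3 * l)" using l by (simp add: field_simps)
  also have "\<dots> = 2/3 * x^3 / l + l\<^sup>2 / 3" using l by (simp add: field_simps power2_eq_square power3_eq_cube)
  finally show ?thesis .
qed

lemma le_square_scaled: "0 < l \<Longrightarrow> x \<le> x\<^sup>2 / (2 * l) + l / 2" for x l :: real
proof -
  assume l: "0 < l"
  have "0 \<le> (x - l)\<^sup>2" by simp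
  then have "2 * x * l \<le> x\<^sup>2 + l\<^sup>2" by (simp add: power2_eq_square algebra_simps)
  then have "x \<le> (x\<^sup>2 + l\<^sup>2) / (2 * l)" using l by (simp add: field_simps)
  also have "\<dots> = x\<^sup>2 / (2 * l) + l / 2" using l by (simp add: field_simps power2_eq_square)
  finally show ?thesis .
qed

text \<open>
  Young's inequality with the length scale \<open>l\<close> of the third moment; Jensen's inequality would put
  fractional powers of \<open>K\<close> into all later bounds.
\<close>

lemma (in prob_space) lower_moments_of_cube:
  fixes f :: "'a \<Rightarrow> real"
  assumes f: "f \<in> borel_measurable M" "integrable M (\<lambda>x. \<bar>f x\<bar>^3)" "(\<integral>x. \<bar>f x\<bar>^3 \<partial>M) \<le> K * l^3"
    and l: "0 < l" and K: "1 \<le> K"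
  shows "integrable M (\<lambda>x. (f x)\<^sup>2)" "(\<integral>x. (f x)\<^sup>2 \<partial>M) \<le> K * l\<^sup>2"
    "integrable M f" "(\<integral>x. \<bar>f x\<bar> \<partial>M) \<le> K * l"
proof -
  note [measurable] = f(1)
  have sq: "(f x)\<^sup>2 \<le> 2/3 * \<bar>f x\<bar>^3 / l + l\<^sup>2 / 3" for x
    using square_le_cube[OF abs_ge_zero[of "f x"] l] by simp
  have i: "integrable M (\<lambda>x. 2/3 * \<bar>f x\<bar>^3 / l + l\<^sup>2 / 3)" using f(2) by simp
  show i2: "integrable M (\<lambda>x. (f x)\<^sup>2)"
    using sq by (intro Bochner_Integration.integrable_bound[OF i] AE_I2) (auto intro: order_trans[OF _ abs_ge_self])
  have "(\<integral>x. (f x)\<^sup>2 \<partial>M) \<le> (\<integral>x. 2/3 * \<bar>f x\<bar>^3 / l + l\<^sup>2 / 3 \<partial>M)"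
    using i2 i sq by (intro integral_mono) auto
  also have "\<dots> = 2/3 * (\<integral>x. \<bar>f x\<bar>^3 \<partial>M) / l + l\<^sup>2 / 3" using f(2) by (simp add: prob_space)
  also have "\<dots> \<le> 2/3 * (K * l^3) / l + l\<^sup>2 / 3"
    using f(3) l by (intro add_right_mono divide_right_mono mult_left_mono) auto
  also have "\<dots> = 2/3 * K * l\<^sup>2 + l\<^sup>2 / 3" using l by (simp add: power2_eq_square power3_eq_cube)
  also have "\<dots> \<le> K * l\<^sup>2"
    using mult_right_mono[OF K zero_le_power2[of l]] by simp
  finally show sq2: "(\<integral>x. (f x)\<^sup>2 \<partial>M) \<le> K * l\<^sup>2" .
  have le: "\<bar>f x\<bar> \<le> (f x)\<^sup>2 / (2 * l) + l / 2" for x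
    using le_square_scaled[OF l, of "\<bar>f x\<bar>"] by simp
  have i3: "integrable M (\<lambda>x. (f x)\<^sup>2 / (2 * l) + l / 2)" using i2 by simp
  show i1: "integrable M f"
    using le by (intro Bochner_Integration.integrable_bound[OF i3] AE_I2) (auto intro: order_trans[OF _ abs_ge_self])
  have "(\<integral>x. \<bar>f x\<bar> \<partial>M) \<le> (\<integral>x. (f x)\<^sup>2 / (2 * l) + l / 2 \<partial>M)"
    using i1 i3 le by (intro integral_mono) auto
  also have "\<dots> = (\<integral>x. (f x)\<^sup>2 \<partial>M) / (2 * l) + l / 2" using i2 by (simp add: prob_space)
  also have "\<dots> \<le> K * l\<^sup>2 / (2 * l) + l / 2"
    using sq2 l by (intro add_right_mono divide_right_mono) auto
  also have "\<dots> = K * l / 2 + l / 2" using l by (simp add: power2_eq_square)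
  also have "\<dots> \<le> K * l"
  proof -
    have "1 * l \<le> K * l" using K l by (intro mult_right_mono) auto
    then show ?thesis by linarith
  qed
  finally show "(\<integral>x. \<bar>f x\<bar> \<partial>M) \<le> K * l" .
qed

locale tilted_law =
  P0: prob_space P + P1: prob_space P'
  for P P' :: "'w measure" +
  fixes L :: "'w \<Rightarrow> real"
  assumes L [measurable]: "L \<in> borel_measurable P"
    and density: "P' = density P (\<lambda>w. ennreal (exp (L w)))"
begin

lemma sets_P' [simp, measurable_cong]: "sets P' = sets P"
  by (simp add: density)

definition cubes :: "real \<Rightarrow> ('w \<Rightarrow> real) \<Rightarrow> bool" where
  "cubes c f \<longleftrightarrow> f \<in> borel_measurable P \<and> integrable P (\<lambda>w. \<bar>f w\<bar>^3) \<and> integrable P' (\<lambda>w. \<bar>f w\<bar>^3) \<and>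
     (\<integral>w. \<bar>f w\<bar>^3 \<partial>P) + (\<integral>w. \<bar>f w\<bar>^3 \<partial>P') \<le> c"

lemma integral_P':
  fixes f :: "'w \<Rightarrow> real"
  assumes "f \<in> borel_measurable P"
  shows "integrable P' f \<longleftrightarrow> integrable P (\<lambda>w. exp (L w) * f w)"
    and "(\<integral>w. f w \<partial>P') = (\<integral>w. exp (L w) * f w \<partial>P)"
  using assms unfolding density
  by (auto simp: integrable_density integral_density)

lemma cubesD:
  assumes "cubes c f"
  shows "f \<in> borel_measurable P" "integrable P (\<lambda>w. \<bar>f w\<bar>^3)" "integrable P' (\<lambda>w. \<bar>f w\<bar>^3)"
    "(\<integral>w. \<bar>f w\<bar>^3 \<partial>P) + (\<integral>w. \<bar>f w\<bar>^3 \<partial>P') \<le> c"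
  using assms by (auto simp: cubes_def)

lemma cubes_split:
  assumes "cubes c f"
  shows "(\<integral>w. \<bar>f w\<bar>^3 \<partial>P) \<le> c" "(\<integral>w. \<bar>f w\<bar>^3 \<partial>P') \<le> c"
proof -
  have "0 \<le> (\<integral>w. \<bar>f w\<bar>^3 \<partial>P)" "0 \<le> (\<integral>w. \<bar>f w\<bar>^3 \<partial>P')" by simp_all
  then show "(\<integral>w. \<bar>f w\<bar>^3 \<partial>P) \<le> c" "(\<integral>w. \<bar>f w\<bar>^3 \<partial>P') \<le> c" using cubesD(4)[OF assms] by linarith+
qed

lemma cubes_add:
  assumes "cubes c f" "cubes c' f'"
  shows "cubes (4 * (c + c')) (\<lambda>w. f w + f' w)"
proof -
  note [measurable] = cubesD(1)[OF assms(1)] cubesD(1)[OF assms(2)]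
  have i: "integrable P (\<lambda>w. 4 * (\<bar>f w\<bar>^3 + \<bar>f' w\<bar>^3))" "integrable P' (\<lambda>w. 4 * (\<bar>f w\<bar>^3 + \<bar>f' w\<bar>^3))"
    using cubesD(2,3)[OF assms(1)] cubesD(2,3)[OF assms(2)] by simp_all
  have j: "integrable P (\<lambda>w. \<bar>f w + f' w\<bar>^3)" "integrable P' (\<lambda>w. \<bar>f w + f' w\<bar>^3)"
    by (intro Bochner_Integration.integrable_bound[OF i(1)] Bochner_Integration.integrable_bound[OF i(2)] AE_I2;
        use cube_add_le in \<open>auto intro: order_trans[OF _ abs_ge_self]\<close>)+
  have "(\<integral>w. \<bar>f w + f' w\<bar>^3 \<partial>P) \<le> (\<integral>w. 4 * (\<bar>f w\<bar>^3 + \<bar>f' w\<bar>^3) \<partial>P)"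
    "(\<integral>w. \<bar>f w + f' w\<bar>^3 \<partial>P') \<le> (\<integral>w. 4 * (\<bar>f w\<bar>^3 + \<bar>f' w\<bar>^3) \<partial>P')"
    using i j cube_add_le by (auto intro!: integral_mono)
  then show ?thesis
    unfolding cubes_def using j cubesD(2,3,4)[OF assms(1)] cubesD(2,3,4)[OF assms(2)] by simp
qed

lemma cubes_add_same: "cubes c f \<Longrightarrow> cubes c f' \<Longrightarrow> cubes (8 * c) (\<lambda>w. f w + f' w)"
  using cubes_add[of c f c f'] by (simp only: mult_2[symmetric]) simp

lemma cubes_dominated:
  assumes "cubes c g" "f \<in> borel_measurable P" "\<And>w. w \<in> space P \<Longrightarrow> \<bar>f w\<bar> \<le> g w"
  shows "cubes c f"
proof -
  note [measurable] = assms(2) cubesD(1)[OF assms(1)]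
  have le: "\<bar>f w\<bar>^3 \<le> \<bar>g w\<bar>^3" if "w \<in> space P" for w
    using assms(3)[OF that] by (intro power_mono) auto
  have sp: "space P' = space P" using sets_P' by (rule sets_eq_imp_space_eq)
  have j: "integrable P (\<lambda>w. \<bar>f w\<bar>^3)" "integrable P' (\<lambda>w. \<bar>f w\<bar>^3)"
    by (intro Bochner_Integration.integrable_bound[OF cubesD(2)[OF assms(1)]]
        Bochner_Integration.integrable_bound[OF cubesD(3)[OF assms(1)]] AE_I2;
        use le sp in auto)+
  have "(\<integral>w. \<bar>f w\<bar>^3 \<partial>P) \<le> (\<integral>w. \<bar>g w\<bar>^3 \<partial>P)" "(\<integral>w. \<bar>f w\<bar>^3 \<partial>P') \<le> (\<integral>w. \<bar>g w\<bar>^3 \<partial>P')"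
    using j cubesD(2,3)[OF assms(1)] le sp by (auto intro!: integral_mono)
  then show ?thesis unfolding cubes_def using j cubesD(4)[OF assms(1)] by auto
qed

lemma cubes_scale:
  assumes "cubes c f" "0 \<le> x" shows "cubes (x^3 * c) (\<lambda>w. x * f w)"
proof -
  have "(\<integral>w. \<bar>x * f w\<bar>^3 \<partial>P) + (\<integral>w. \<bar>x * f w\<bar>^3 \<partial>P') = x^3 * ((\<integral>w. \<bar>f w\<bar>^3 \<partial>P) + (\<integral>w. \<bar>f w\<bar>^3 \<partial>P'))"
    using cubesD[OF assms(1)] assms(2) by (simp add: abs_mult power_mult_distrib distrib_left)
  also have "\<dots> \<le> x^3 * c" using cubesD(4)[OF assms(1)] assms(2) by (intro mult_left_mono) auto
  finally show ?thesis
    unfolding cubes_def using cubesD[OF assms(1)] by (auto simp: abs_mult power_mult_distrib)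
qed

lemma cubes_mono: "cubes c f \<Longrightarrow> c \<le> c' \<Longrightarrow> cubes c' f"
  by (auto simp: cubes_def)

lemma integrable_products:
  assumes "cubes c f" "cubes c' f'"
  shows "integrable P f" "integrable P' f" "integrable P (\<lambda>w. f w * f' w)" "integrable P' (\<lambda>w. f w * f' w)"
proof -
  note [measurable] = cubesD(1)[OF assms(1)] cubesD(1)[OF assms(2)]
  have one: "\<bar>f w\<bar> \<le> \<bar>f w\<bar>^3 + 2" for w
    using mult3_le_cubes[of "\<bar>f w\<bar>" 1 1] by simp
  have two: "\<bar>f w * f' w\<bar> \<le> \<bar>f w\<bar>^3 + \<bar>f' w\<bar>^3 + 1" for w
    using mult3_le_cubes[of "\<bar>f w\<bar>" "\<bar>f' w\<bar>" 1] by (simp add: abs_mult)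
  have i: "integrable P (\<lambda>w. \<bar>f w\<bar>^3 + 2)" "integrable P' (\<lambda>w. \<bar>f w\<bar>^3 + 2)"
    "integrable P (\<lambda>w. \<bar>f w\<bar>^3 + \<bar>f' w\<bar>^3 + 1)" "integrable P' (\<lambda>w. \<bar>f w\<bar>^3 + \<bar>f' w\<bar>^3 + 1)"
    using cubesD(2,3)[OF assms(1)] cubesD(2,3)[OF assms(2)] by simp_all
  show "integrable P f" "integrable P' f"
    by (intro Bochner_Integration.integrable_bound[OF i(1)] Bochner_Integration.integrable_bound[OF i(2)] AE_I2;
        use one in \<open>auto intro: order_trans[OF _ abs_ge_self]\<close>)+
  show "integrable P (\<lambda>w. f w * f' w)" "integrable P' (\<lambda>w. f w * f' w)"
    by (intro Bochner_Integration.integrable_bound[OF i(3)] Bochner_Integration.integrable_bound[OF i(4)] AE_I2;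
        use two in \<open>auto intro: order_trans[OF _ abs_ge_self]\<close>)+
qed

text \<open>First-order expansion in \<open>L\<close>. The remainder \<open>|f| L\<^sup>2 (1 + exp L)\<close> is dominated by cubes under both laws.\<close>

lemma tilted_mean_expansion:
  assumes f: "cubes c f" and L3: "cubes c' L"
  shows "\<bar>(\<integral>w. f w \<partial>P') - (\<integral>w. f w \<partial>P) - (\<integral>w. f w * L w \<partial>P)\<bar> \<le> c + 2 * c'"
proof -
  note [measurable] = cubesD(1)[OF f]
  note i = integrable_products[OF f L3]
  have iE: "integrable P (\<lambda>w. exp (L w) * f w)" using i(2) integral_P'(1)[of f] by simp
  have ic: "integrable P (\<lambda>w. exp (L w) * \<bar>f w\<bar>^3)" "integrable P (\<lambda>w. exp (L w) * \<bar>L w\<bar>^3)"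
    using cubesD(3)[OF f] cubesD(3)[OF L3] integral_P'(1)[of "\<lambda>w. \<bar>f w\<bar>^3"] integral_P'(1)[of "\<lambda>w. \<bar>L w\<bar>^3"] by simp_all
  define B where "B w = (\<bar>f w\<bar>^3 + 2 * \<bar>L w\<bar>^3) * (1 + exp (L w))" for w
  have B_eq: "B w = \<bar>f w\<bar>^3 + 2 * \<bar>L w\<bar>^3 + (exp (L w) * \<bar>f w\<bar>^3 + 2 * (exp (L w) * \<bar>L w\<bar>^3))" for w
    by (simp add: B_def algebra_simps)
  have iB: "integrable P B" unfolding B_eq[abs_def] using cubesD(2)[OF f] cubesD(2)[OF L3] ic by simp
  have pt: "\<bar>exp (L w) * f w - f w - f w * L w\<bar> \<le> B w" for w
  proof -
    have "\<bar>exp (L w) * f w - f w - f w * L w\<bar> = \<bar>f w\<bar> * \<bar>exp (L w) - 1 - L w\<bar>"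
      unfolding abs_mult[symmetric] by (simp add: algebra_simps)
    also have "\<dots> \<le> \<bar>f w\<bar> * ((L w)\<^sup>2 * (1 + exp (L w)))"
      by (intro mult_left_mono exp_remainder2) auto
    also have "\<dots> = (\<bar>f w\<bar> * \<bar>L w\<bar> * \<bar>L w\<bar>) * (1 + exp (L w))" by (simp add: power2_eq_square)
    also have "\<dots> \<le> (\<bar>f w\<bar>^3 + \<bar>L w\<bar>^3 + \<bar>L w\<bar>^3) * (1 + exp (L w))"
      by (intro mult_right_mono mult3_le_cubes) (auto intro: add_nonneg_nonneg)
    finally show ?thesis by (simp add: B_def add.assoc)
  qed
  have "(\<integral>w. f w \<partial>P') - (\<integral>w. f w \<partial>P) - (\<integral>w. f w * L w \<partial>P) = (\<integral>w. exp (L w) * f w - f w - f w * L w \<partial>P)"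
    using integral_P'(2)[of f] iE i by simp
  also have "\<bar>\<dots>\<bar> \<le> (\<integral>w. B w \<partial>P)"
    using iE i iB pt by (intro order_trans[OF integral_abs_bound] integral_mono) auto
  also have "\<dots> = ((\<integral>w. \<bar>f w\<bar>^3 \<partial>P) + (\<integral>w. \<bar>f w\<bar>^3 \<partial>P')) + 2 * ((\<integral>w. \<bar>L w\<bar>^3 \<partial>P) + (\<integral>w. \<bar>L w\<bar>^3 \<partial>P'))"
    unfolding B_eq[abs_def] using cubesD(2)[OF f] cubesD(2)[OF L3] ic
      integral_P'(2)[of "\<lambda>w. \<bar>f w\<bar>^3"] integral_P'(2)[of "\<lambda>w. \<bar>L w\<bar>^3"] by simp
  also have "\<dots> \<le> c + 2 * c'" using cubesD(4)[OF f] cubesD(4)[OF L3] by (intro add_mono mult_left_mono) auto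
  finally show ?thesis .
qed

text \<open>A product is already of second order, so that \<open>L\<close> may be dropped altogether.\<close>

lemma tilted_product_expansion:
  assumes f: "cubes c f" and f': "cubes c'' f'" and L3: "cubes c' L"
  shows "\<bar>(\<integral>w. f w * f' w \<partial>P') - (\<integral>w. f w * f' w \<partial>P)\<bar> \<le> c + c'' + c'"
proof -
  note [measurable] = cubesD(1)[OF f] cubesD(1)[OF f']
  note i = integrable_products[OF f f']
  have iE: "integrable P (\<lambda>w. exp (L w) * (f w * f' w))" using i(4) integral_P'(1)[of "\<lambda>w. f w * f' w"] by simp
  have ic: "integrable P (\<lambda>w. exp (L w) * \<bar>f w\<bar>^3)" "integrable P (\<lambda>w. exp (L w) * \<bar>f' w\<bar>^3)" "integrable P (\<lambda>w. exp (L w) * \<bar>L w\<bar>^3)"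
    using cubesD(3)[OF f] cubesD(3)[OF f'] cubesD(3)[OF L3]
      integral_P'(1)[of "\<lambda>w. \<bar>f w\<bar>^3"] integral_P'(1)[of "\<lambda>w. \<bar>f' w\<bar>^3"] integral_P'(1)[of "\<lambda>w. \<bar>L w\<bar>^3"] by simp_all
  define B where "B w = (\<bar>f w\<bar>^3 + \<bar>f' w\<bar>^3 + \<bar>L w\<bar>^3) * (1 + exp (L w))" for w
  have B_eq: "B w = \<bar>f w\<bar>^3 + \<bar>f' w\<bar>^3 + \<bar>L w\<bar>^3 + (exp (L w) * \<bar>f w\<bar>^3 + exp (L w) * \<bar>f' w\<bar>^3 + exp (L w) * \<bar>L w\<bar>^3)" for w
    by (simp add: B_def algebra_simps)
  have iB: "integrable P B" unfolding B_eq[abs_def] using cubesD(2)[OF f] cubesD(2)[OF f'] cubesD(2)[OF L3] ic by simp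
  have pt: "\<bar>exp (L w) * (f w * f' w) - f w * f' w\<bar> \<le> B w" for w
  proof -
    have "\<bar>exp (L w) * (f w * f' w) - f w * f' w\<bar> = \<bar>f w\<bar> * \<bar>f' w\<bar> * \<bar>exp (L w) - 1\<bar>"
      unfolding abs_mult[symmetric] by (simp add: algebra_simps)
    also have "\<dots> \<le> \<bar>f w\<bar> * \<bar>f' w\<bar> * (\<bar>L w\<bar> * (1 + exp (L w)))"
      by (intro mult_left_mono exp_remainder1) auto
    also have "\<dots> = (\<bar>f w\<bar> * \<bar>f' w\<bar> * \<bar>L w\<bar>) * (1 + exp (L w))" by simp
    also have "\<dots> \<le> (\<bar>f w\<bar>^3 + \<bar>f' w\<bar>^3 + \<bar>L w\<bar>^3) * (1 + exp (L w))"
      by (intro mult_right_mono mult3_le_cubes) (auto intro: add_nonneg_nonneg)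
    finally show ?thesis by (simp add: B_def)
  qed
  have "(\<integral>w. f w * f' w \<partial>P') - (\<integral>w. f w * f' w \<partial>P) = (\<integral>w. exp (L w) * (f w * f' w) - f w * f' w \<partial>P)"
    using integral_P'(2)[of "\<lambda>w. f w * f' w"] iE i by simp
  also have "\<bar>\<dots>\<bar> \<le> (\<integral>w. B w \<partial>P)"
    using iE i iB pt by (intro order_trans[OF integral_abs_bound] integral_mono) auto
  also have "\<dots> = ((\<integral>w. \<bar>f w\<bar>^3 \<partial>P) + (\<integral>w. \<bar>f w\<bar>^3 \<partial>P')) + ((\<integral>w. \<bar>f' w\<bar>^3 \<partial>P) + (\<integral>w. \<bar>f' w\<bar>^3 \<partial>P'))
      + ((\<integral>w. \<bar>L w\<bar>^3 \<partial>P) + (\<integral>w. \<bar>L w\<bar>^3 \<partial>P'))"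
    unfolding B_eq[abs_def] using cubesD(2)[OF f] cubesD(2)[OF f'] cubesD(2)[OF L3] ic
      integral_P'(2)[of "\<lambda>w. \<bar>f w\<bar>^3"] integral_P'(2)[of "\<lambda>w. \<bar>f' w\<bar>^3"] integral_P'(2)[of "\<lambda>w. \<bar>L w\<bar>^3"] by simp
  also have "\<dots> \<le> c + c'' + c'" using cubesD(4)[OF f] cubesD(4)[OF f'] cubesD(4)[OF L3] by linarith
  finally show ?thesis .
qed

end

text \<open>
  The likelihood ratio and the local process consist of a leading part, linear in the scores, and a
  negligible part, smaller by the factor \<open>d\<close> in mean square; \<open>r\<close> is the feature radius and \<open>d\<close> the size of
  the error.
\<close>

locale local_expansion = tilted_law P P' L
  for P P' :: "'w measure" and L +
  fixes r d K :: real
  assumes r: "0 < r" and d: "0 < d" "d \<le> 1" and K: "1 \<le> K"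
begin

definition leading where
  "leading f \<longleftrightarrow> cubes (K * (r\<^sup>2 * d)) f \<and> (\<integral>w. (f w)\<^sup>2 \<partial>P) \<le> K * r\<^sup>2"
definition negligible where
  "negligible f \<longleftrightarrow> cubes (K * (r\<^sup>2 * d)) f \<and> (\<integral>w. (f w)\<^sup>2 \<partial>P) \<le> K * (r\<^sup>2 * d\<^sup>2)"

lemma leading_cubes: "leading f \<Longrightarrow> cubes (K * (r\<^sup>2 * d)) f"
  and negligible_cubes: "negligible f \<Longrightarrow> cubes (K * (r\<^sup>2 * d)) f"
  by (auto simp: leading_def negligible_def)

lemma squares_integrable: "cubes c f \<Longrightarrow> integrable P (\<lambda>w. (f w)\<^sup>2)"
  using integrable_products(3)[of c f c f] by (simp add: power2_eq_square)

text \<open>The weight \<open>d\<close> in Young's inequality balances the mean squares \<open>r\<^sup>2\<close> and \<open>r\<^sup>2 d\<^sup>2\<close>.\<close>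

lemma mixed_product:
  assumes u: "leading u" and w: "negligible w"
  shows "\<bar>\<integral>x. u x * w x \<partial>P\<bar> \<le> K * (r\<^sup>2 * d)"
proof -
  note iu = squares_integrable[OF leading_cubes[OF u]] and iw = squares_integrable[OF negligible_cubes[OF w]]
  have pt: "\<bar>u x * w x\<bar> \<le> d / 2 * (u x)\<^sup>2 + (w x)\<^sup>2 / (2 * d)" for x
  proof -
    have "0 \<le> (d * \<bar>u x\<bar> - \<bar>w x\<bar>)\<^sup>2" by simp
    also have "\<dots> = d\<^sup>2 * (u x)\<^sup>2 - 2 * d * \<bar>u x * w x\<bar> + (w x)\<^sup>2"
      by (simp add: power2_diff power_mult_distrib abs_mult)
    finally have "2 * d * \<bar>u x * w x\<bar> \<le> d\<^sup>2 * (u x)\<^sup>2 + (w x)\<^sup>2" by simp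
    then have "\<bar>u x * w x\<bar> \<le> (d\<^sup>2 * (u x)\<^sup>2 + (w x)\<^sup>2) / (2 * d)" using d by (simp add: field_simps)
    also have "\<dots> = d / 2 * (u x)\<^sup>2 + (w x)\<^sup>2 / (2 * d)" using d by (simp add: field_simps power2_eq_square)
    finally show ?thesis .
  qed
  have "\<bar>\<integral>x. u x * w x \<partial>P\<bar> \<le> (\<integral>x. d / 2 * (u x)\<^sup>2 + (w x)\<^sup>2 / (2 * d) \<partial>P)"
    using iu iw pt integrable_products(3)[OF leading_cubes[OF u] negligible_cubes[OF w]]
    by (intro order_trans[OF integral_abs_bound] integral_mono) auto
  also have "\<dots> = d / 2 * (\<integral>x. (u x)\<^sup>2 \<partial>P) + (\<integral>x. (w x)\<^sup>2 \<partial>P) / (2 * d)" using iu iw by simp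
  also have "\<dots> \<le> d / 2 * (K * r\<^sup>2) + (K * (r\<^sup>2 * d\<^sup>2)) / (2 * d)"
    using u w d unfolding leading_def negligible_def by (intro add_mono mult_left_mono divide_right_mono) auto
  also have "\<dots> = K * (r\<^sup>2 * d)" using d by (simp add: field_simps power2_eq_square)
  finally show ?thesis .
qed

lemma negligible_product:
  assumes u: "negligible u" and w: "negligible w"
  shows "\<bar>\<integral>x. u x * w x \<partial>P\<bar> \<le> K * (r\<^sup>2 * d)"
proof (rule mixed_product)
  have "d\<^sup>2 \<le> 1" using d by (simp add: power_le_one)
  then have "K * (r\<^sup>2 * d\<^sup>2) \<le> K * (r\<^sup>2 * 1)" using K by (intro mult_left_mono) auto
  then show "leading u" using u by (auto simp: leading_def negligible_def)
qed (rule w)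

context
  fixes s \<Delta> :: "'w \<Rightarrow> real"
  assumes L_eq: "\<And>w. L w = s w + \<Delta> w" and s: "leading s" and \<Delta>: "negligible \<Delta>"
begin

lemma cubes_L: "cubes (8 * (K * (r\<^sup>2 * d))) L"
  using cubes_add_same[OF leading_cubes[OF s] negligible_cubes[OF \<Delta>]] by (simp only: L_eq[abs_def])

text \<open>Of the product of \<open>u + w\<close> with \<open>L = s + \<Delta>\<close> only the term \<open>u * s\<close> is not negligible.\<close>

lemma tilted_mean:
  assumes u: "leading u" "(\<integral>x. u x \<partial>P) = 0" and w: "negligible w"
  shows "\<bar>(\<integral>x. u x + w x \<partial>P') - (\<integral>x. u x * s x \<partial>P) - (\<integral>x. w x \<partial>P)\<bar> \<le> 27 * (K * (r\<^sup>2 * d))"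
proof -
  let ?b = "K * (r\<^sup>2 * d)"
  note cu = leading_cubes[OF u(1)] and cw = negligible_cubes[OF w]
    and cs = leading_cubes[OF s] and c\<Delta> = negligible_cubes[OF \<Delta>]
  have "cubes (8 * ?b) (\<lambda>x. u x + w x)" by (rule cubes_add_same[OF cu cw])
  note exp1 = tilted_mean_expansion[OF this cubes_L]
  have "8 * ?b + 2 * (8 * ?b) = 24 * ?b" by simp
  note exp1[unfolded this]
  then have "\<bar>(\<integral>x. u x + w x \<partial>P') - (\<integral>x. u x + w x \<partial>P) - (\<integral>x. (u x + w x) * L x \<partial>P)\<bar> \<le> 24 * ?b" .
  moreover have "(\<integral>x. u x + w x \<partial>P) = (\<integral>x. w x \<partial>P)"
    using u(2) integrable_products(1)[OF cu cw] integrable_products(1)[OF cw cw] by simp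
  moreover have "(\<integral>x. (u x + w x) * L x \<partial>P) = (\<integral>x. u x * s x \<partial>P) + (\<integral>x. u x * \<Delta> x \<partial>P) + (\<integral>x. s x * w x \<partial>P) + (\<integral>x. w x * \<Delta> x \<partial>P)"
  proof -
    have "(\<integral>x. (u x + w x) * L x \<partial>P) = (\<integral>x. u x * s x + u x * \<Delta> x + s x * w x + w x * \<Delta> x \<partial>P)"
      by (simp add: L_eq algebra_simps)
    then show ?thesis
      using integrable_products(3)[OF cu cs] integrable_products(3)[OF cu c\<Delta>]
        integrable_products(3)[OF cs cw] integrable_products(3)[OF cw c\<Delta>] by simp
  qed
  ultimately have 1: "\<bar>(\<integral>x. u x + w x \<partial>P') - (\<integral>x. w x \<partial>P) - ((\<integral>x. u x * s x \<partial>P) + (\<integral>x. u x * \<Delta> x \<partial>P) + (\<integral>x. s x * w x \<partial>P) + (\<integral>x. w x * \<Delta> x \<partial>P))\<bar> \<le> 24 * ?b"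
    by metis
  have tri: "\<bar>a - m - (us + ud + sw + wd)\<bar> \<le> 24 * b \<Longrightarrow> \<bar>ud\<bar> \<le> b \<Longrightarrow> \<bar>sw\<bar> \<le> b \<Longrightarrow> \<bar>wd\<bar> \<le> b \<Longrightarrow> \<bar>a - us - m\<bar> \<le> 27 * b"
    for a m us ud sw wd b :: real by linarith
  show ?thesis
    by (rule tri[OF 1 mixed_product[OF u(1) \<Delta>] mixed_product[OF s w] negligible_product[OF w \<Delta>]])
qed

lemma tilted_covariance:
  assumes u: "leading u" and w: "negligible w" and u': "leading u'" and w': "negligible w'"
  shows "\<bar>(\<integral>x. (u x + w x) * (u' x + w' x) \<partial>P') - (\<integral>x. u x * u' x \<partial>P)\<bar> \<le> 27 * (K * (r\<^sup>2 * d))"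
proof -
  let ?b = "K * (r\<^sup>2 * d)"
  note cu = leading_cubes[OF u] and cw = negligible_cubes[OF w]
    and cu' = leading_cubes[OF u'] and cw' = negligible_cubes[OF w']
  have "cubes (8 * ?b) (\<lambda>x. u x + w x)" "cubes (8 * ?b) (\<lambda>x. u' x + w' x)"
    by (rule cubes_add_same[OF cu cw] cubes_add_same[OF cu' cw'])+
  note exp1 = tilted_product_expansion[OF this cubes_L]
  have "8 * ?b + 8 * ?b + 8 * ?b = 24 * ?b" by simp
  note exp1[unfolded this]
  then have "\<bar>(\<integral>x. (u x + w x) * (u' x + w' x) \<partial>P') - (\<integral>x. (u x + w x) * (u' x + w' x) \<partial>P)\<bar> \<le> 24 * ?b" .
  moreover have "(\<integral>x. (u x + w x) * (u' x + w' x) \<partial>P) = (\<integral>x. u x * u' x \<partial>P) + (\<integral>x. u x * w' x \<partial>P) + (\<integral>x. u' x * w x \<partial>P) + (\<integral>x. w x * w' x \<partial>P)"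
  proof -
    have "(\<integral>x. (u x + w x) * (u' x + w' x) \<partial>P) = (\<integral>x. u x * u' x + u x * w' x + u' x * w x + w x * w' x \<partial>P)"
      by (simp add: algebra_simps)
    then show ?thesis
      using integrable_products(3)[OF cu cu'] integrable_products(3)[OF cu cw']
        integrable_products(3)[OF cu' cw] integrable_products(3)[OF cw cw'] by simp
  qed
  ultimately have 1: "\<bar>(\<integral>x. (u x + w x) * (u' x + w' x) \<partial>P') - ((\<integral>x. u x * u' x \<partial>P) + (\<integral>x. u x * w' x \<partial>P) + (\<integral>x. u' x * w x \<partial>P) + (\<integral>x. w x * w' x \<partial>P))\<bar> \<le> 24 * ?b"
    by metis
  have tri: "\<bar>a - (uu + uw + wu + ww)\<bar> \<le> 24 * b \<Longrightarrow> \<bar>uw\<bar> \<le> b \<Longrightarrow> \<bar>wu\<bar> \<le> b \<Longrightarrow> \<bar>ww\<bar> \<le> b \<Longrightarrow> \<bar>a - uu\<bar> \<le> 27 * b"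
    for a uu uw wu ww b :: real by linarith
  show ?thesis
    by (rule tri[OF 1 mixed_product[OF u w'] mixed_product[OF u' w] negligible_product[OF w w']])
qed

end

end

section \<open>Characteristic functions and product laws\<close>

text \<open>
  These identities serve the nonnegative weights \<open>1 + cos\<close> and \<open>1 + sin\<close>, to which complex weights are
  reduced below: their products with exponentials are again combinations of exponentials.
\<close>

lemma iexp_cos: "iexp (a + y) + iexp (a - y) = 2 * complex_of_real (cos y) * iexp a"
  and iexp_sin: "iexp (a + y) - iexp (a - y) = 2 * \<i> * complex_of_real (sin y) * iexp a"
proof -
  have e: "iexp y = complex_of_real (cos y) + \<i> * complex_of_real (sin y)"
    "iexp (- y) = complex_of_real (cos y) - \<i> * complex_of_real (sin y)" for y
    by (simp_all add: exp_Euler exp_minus_Euler flip: cos_of_real sin_of_real)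
  have s: "iexp (a + y) = iexp a * iexp y" "iexp (a - y) = iexp a * iexp (- y)"
    by (simp_all add: exp_add[symmetric] algebra_simps)
  show "iexp (a + y) + iexp (a - y) = 2 * complex_of_real (cos y) * iexp a"
    "iexp (a + y) - iexp (a - y) = 2 * \<i> * complex_of_real (sin y) * iexp a"
    unfolding s e[of y] by (simp_all only: ring_distribs) (simp_all add: mult_ac)
qed

lemma integrable_weighted_iexp:
  assumes "prob_space M" "w \<in> borel_measurable M" "X \<in> borel_measurable M" "\<And>x. x \<in> space M \<Longrightarrow> \<bar>w x\<bar> \<le> B"
  shows "integrable M (\<lambda>x. w x *\<^sub>R iexp (X x))"
proof -
  interpret prob_space M by fact
  show ?thesis
    using assms(2-4) by (intro integrable_const_bound[where B=B]) auto
qed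

text \<open>
  A nonnegative weight of positive total mass can be normalised to a density, and Levy's theorem applies to the
  image of the resulting probability measure; both masses agree by the case \<open>s = 0\<close>.
\<close>

lemma weighted_levy_uniqueness:
  fixes w X :: "'a \<Rightarrow> real"
  assumes M: "prob_space M" "prob_space M'" and sets: "sets M' = sets M"
    and w[measurable]: "w \<in> borel_measurable M" and X[measurable]: "X \<in> borel_measurable M"
    and wb: "\<And>x. x \<in> space M \<Longrightarrow> 0 \<le> w x \<and> w x \<le> B"
    and eq: "\<And>s. (CLINT x|M. w x *\<^sub>R iexp (s * X x)) = (CLINT x|M'. w x *\<^sub>R iexp (s * X x))"
    and A[measurable]: "A \<in> sets borel"
  shows "(\<integral>x. w x * indicator A (X x) \<partial>M) = (\<integral>x. w x * indicator A (X x) \<partial>M')"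
proof -
  have sp: "space M' = space M" using sets by (rule sets_eq_imp_space_eq)
  note [measurable_cong] = sets
  define m where "m N = (\<integral>x. w x \<partial>N)" for N
  have iw: "integrable N w" if "prob_space N" "sets N = sets M" for N
  proof -
    interpret prob_space N by fact
    have "space N = space M" using that(2) by (rule sets_eq_imp_space_eq)
    then show ?thesis
      using wb w by (intro integrable_const_bound[where B=B]) (auto simp: measurable_cong_sets[OF that(2) refl])
  qed
  have mm: "m M' = m M"
  proof -
    have "complex_of_real (m M) = (CLINT x|M. w x *\<^sub>R iexp (0 * X x))" "complex_of_real (m M') = (CLINT x|M'. w x *\<^sub>R iexp (0 * X x))"
      unfolding m_def using integral_complex_of_real[of M w] integral_complex_of_real[of M' w] by (simp_all add: scaleR_conv_of_real)
    then show ?thesis using eq[of 0] by (metis of_real_eq_iff)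
  qed
  have m0: "0 \<le> m M" unfolding m_def using wb by (intro integral_nonneg_AE AE_I2) auto
  have wX: "\<bar>w x * indicator A (X x)\<bar> \<le> w x" if "x \<in> space M" for x
    using wb[OF that] by (auto simp: indicator_def)
  have bnd: "\<bar>\<integral>x. w x * indicator A (X x) \<partial>N\<bar> \<le> m N" if "prob_space N" "sets N = sets M" for N
  proof -
    have "space N = space M" using that(2) by (rule sets_eq_imp_space_eq)
    moreover have "(\<lambda>x. w x * indicator A (X x)) \<in> borel_measurable N"
      by (simp add: measurable_cong_sets[OF that(2) refl])
    ultimately have "norm (\<integral>x. w x * indicator A (X x) \<partial>N) \<le> m N"
      unfolding m_def using wX iw[OF that]
      by (intro norm_integral_le Bochner_Integration.integrable_bound[OF iw[OF that]] AE_I2)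
        (auto intro: order_trans[OF _ abs_ge_self])
    then show ?thesis by simp
  qed
  show ?thesis
  proof (cases "m M = 0")
    case True
    then show ?thesis using bnd[OF M(1) refl] bnd[OF M(2) sets] mm by simp
  next
    case False
    then have mp: "0 < m M" using m0 by simp
    define R where "R N = distr (density N (\<lambda>x. ennreal (w x / m M))) borel X" for N
    have main: "real_distribution (R N)" "char (R N) s = (1 / m M) *\<^sub>R (CLINT x|N. w x *\<^sub>R iexp (s * X x))"
      "measure (R N) A = (1 / m M) * (\<integral>x. w x * indicator A (X x) \<partial>N)"
      if N: "prob_space N" "sets N = sets M" and N3: "m N = m M" for N s
    proof -
      have spN: "space N = space M" using N(2) by (rule sets_eq_imp_space_eq)
      note [measurable_cong] = N(2)
      have nn: "AE x in N. 0 \<le> w x / m M" using wb mp by (intro AE_I2) (auto simp: spN)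
      have "emeasure (density N (\<lambda>x. ennreal (w x / m M))) (space (density N (\<lambda>x. ennreal (w x / m M)))) = (\<integral>\<^sup>+x. ennreal (w x / m M) \<partial>N)"
        by (subst emeasure_density) (auto intro!: nn_integral_cong)
      also have "\<dots> = ennreal (\<integral>x. w x / m M \<partial>N)"
        using iw[OF N] nn by (intro nn_integral_eq_integral) auto
      also have "(\<integral>x. w x / m M \<partial>N) = m N / m M" by (simp add: m_def)
      also have "m N = m M" using N3 .
      finally have "prob_space (density N (\<lambda>x. ennreal (w x / m M)))" using mp by (intro prob_spaceI) simp
      then interpret D: prob_space "density N (\<lambda>x. ennreal (w x / m M))" .
      show "real_distribution (R N)"
        unfolding R_def by (intro D.real_distribution_distr) simp
      have "char (R N) s = (CLINT x|density N (\<lambda>x. ennreal (w x / m M)). iexp (s * X x))"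
        unfolding char_def R_def by (subst integral_distr) auto
      also have "\<dots> = (CLINT x|N. (w x / m M) *\<^sub>R iexp (s * X x))"
        using nn by (subst integral_density) auto
      also have "\<dots> = (CLINT x|N. (1 / m M) *\<^sub>R (w x *\<^sub>R iexp (s * X x)))" by simp
      finally show "char (R N) s = (1 / m M) *\<^sub>R (CLINT x|N. w x *\<^sub>R iexp (s * X x))"
        by (simp only: integral_scaleR_right)
      have "measure (R N) A = (\<integral>x. indicator A x \<partial>R N)" by (simp add: R_def)
      also have "\<dots> = (\<integral>x. indicator A (X x) \<partial>density N (\<lambda>x. ennreal (w x / m M)))"
        unfolding R_def by (subst integral_distr) auto
      also have "\<dots> = (\<integral>x. (w x / m M) *\<^sub>R indicator A (X x) \<partial>N)"
        using nn by (subst integral_density) auto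
      also have "\<dots> = (\<integral>x. (1 / m M) * (w x * indicator A (X x)) \<partial>N)" by simp
      finally show "measure (R N) A = (1 / m M) * (\<integral>x. w x * indicator A (X x) \<partial>N)"
        by (simp only: integral_mult_right_zero)
    qed
    have "char (R M) = char (R M')" using main(2)[OF M(1) refl refl] main(2)[OF M(2) sets mm] eq by auto
    then have "R M = R M'" by (intro Levy_uniqueness main(1)[OF M(1) refl refl] main(1)[OF M(2) sets mm])
    then have "(1 / m M) * (\<integral>x. w x * indicator A (X x) \<partial>M) = (1 / m M) * (\<integral>x. w x * indicator A (X x) \<partial>M')"
      using main(3)[OF M(1) refl refl] main(3)[OF M(2) sets mm] by metis
    then show ?thesis using mp unfolding mult_cancel_left by auto
  qed
qed

text \<open>
  The joint law of finitely many real variables is determined by the characteristic functions of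
  their linear combinations: one variable at a time is replaced by the indicator of an event, using
  the weighted form of Levy's theorem.
\<close>

lemma charfun_determines_events:
  fixes c :: "'j \<Rightarrow> 'a \<Rightarrow> real"
  assumes M: "prob_space M" "prob_space M'" and sets: "sets M' = sets M"
    and F: "finite F" and c: "\<And>j. j \<in> F \<Longrightarrow> c j \<in> borel_measurable M"
    and eq: "\<And>t. (CLINT x|M. iexp (\<Sum>j\<in>F. t j * c j x)) = (CLINT x|M'. iexp (\<Sum>j\<in>F. t j * c j x))"
    and A: "\<And>j. j \<in> F \<Longrightarrow> A j \<in> sets borel" and K: "K \<subseteq> F"
  shows "(CLINT x|M. (\<Prod>j\<in>K. indicator (A j) (c j x) :: real) *\<^sub>R iexp (\<Sum>j\<in>F. t j * c j x))
       = (CLINT x|M'. (\<Prod>j\<in>K. indicator (A j) (c j x) :: real) *\<^sub>R iexp (\<Sum>j\<in>F. t j * c j x))"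
proof -
  have "finite K" using F K by (rule rev_finite_subset)
  then show ?thesis using K
  proof (induction K arbitrary: t rule: finite_induct)
    case empty
    then show ?case using eq by simp
  next
    case (insert k K)
    have k: "k \<in> F" and ck[measurable]: "c k \<in> borel_measurable M" and Ak[measurable]: "A k \<in> sets borel"
      using insert.prems c A by auto
    note [measurable_cong] = sets
    define W where "W x = (\<Prod>j\<in>K. indicator (A j) (c j x) :: real)" for x
    have Wm[measurable]: "W \<in> borel_measurable M"
      unfolding W_def using insert.prems c A
      by (intro borel_measurable_prod) (auto intro!: measurable_compose[OF c] borel_measurable_indicator)
    have Wb: "0 \<le> W x" "W x \<le> 1" for x
      unfolding W_def by (auto intro!: prod_nonneg prod_le_1 simp: indicator_def)
    define Y where "Y x = (\<Sum>j\<in>F. t j * c j x)" for x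
    have Ym[measurable]: "Y \<in> borel_measurable M"
      unfolding Y_def using c by (intro borel_measurable_sum borel_measurable_times) auto
    have comb: "(\<Sum>j\<in>F. (\<sigma> * t j + (if j = k then s else 0)) * c j x) = s * c k x + \<sigma> * Y x" for \<sigma> s x
    proof -
      have "(\<Sum>j\<in>F. (\<sigma> * t j + (if j = k then s else 0)) * c j x)
        = (\<Sum>j\<in>F. \<sigma> * (t j * c j x)) + (\<Sum>j\<in>F. if j = k then s * c k x else 0)"
        unfolding sum.distrib[symmetric] by (intro sum.cong) (auto simp: algebra_simps)
      then show ?thesis using k F by (simp add: Y_def sum_distrib_left)
    qed
    have IH: "(CLINT x|M. W x *\<^sub>R iexp (s * c k x + \<sigma> * Y x)) = (CLINT x|M'. W x *\<^sub>R iexp (s * c k x + \<sigma> * Y x))" for s \<sigma>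
      using insert.IH[of "\<lambda>j. \<sigma> * t j + (if j = k then s else 0)"] insert.prems
      unfolding comb W_def by auto
    have IHs: "(CLINT x|M. W x *\<^sub>R iexp (s * c k x)) = (CLINT x|M'. W x *\<^sub>R iexp (s * c k x))"
      "(CLINT x|M. W x *\<^sub>R iexp (s * c k x + Y x)) = (CLINT x|M'. W x *\<^sub>R iexp (s * c k x + Y x))"
      "(CLINT x|M. W x *\<^sub>R iexp (s * c k x - Y x)) = (CLINT x|M'. W x *\<^sub>R iexp (s * c k x - Y x))" for s
      using IH[of s 0] IH[of s 1] IH[of s "-1"] by simp_all
    have ii: "integrable N (\<lambda>x. W x *\<^sub>R iexp (V x))" if "prob_space N" "sets N = sets M" "V \<in> borel_measurable M" for N V
      using Wb that by (intro integrable_weighted_iexp[where B=1]) (auto simp: measurable_cong_sets[OF that(2) refl])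
    have cosid: "(CLINT x|N. (W x * (1 + cos (Y x))) *\<^sub>R iexp (s * c k x)) = (CLINT x|N. W x *\<^sub>R iexp (s * c k x))
        + (1/2) *\<^sub>R ((CLINT x|N. W x *\<^sub>R iexp (s * c k x + Y x)) + (CLINT x|N. W x *\<^sub>R iexp (s * c k x - Y x)))"
      and sinid: "(CLINT x|N. (W x * (1 + sin (Y x))) *\<^sub>R iexp (s * c k x)) = (CLINT x|N. W x *\<^sub>R iexp (s * c k x))
        + (1/(2*\<i>)) * ((CLINT x|N. W x *\<^sub>R iexp (s * c k x + Y x)) - (CLINT x|N. W x *\<^sub>R iexp (s * c k x - Y x)))"
      if N: "prob_space N" "sets N = sets M" for N s
    proof -
      have i3: "integrable N (\<lambda>x. W x *\<^sub>R iexp (s * c k x))" "integrable N (\<lambda>x. W x *\<^sub>R iexp (s * c k x + Y x))"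
        "integrable N (\<lambda>x. W x *\<^sub>R iexp (s * c k x - Y x))"
        by (intro ii N; measurable)+
      have "(W x * (1 + cos (Y x))) *\<^sub>R iexp (s * c k x) = W x *\<^sub>R iexp (s * c k x)
          + (1/2) *\<^sub>R (W x *\<^sub>R iexp (s * c k x + Y x) + W x *\<^sub>R iexp (s * c k x - Y x))" for x
        unfolding scaleR_add_right[symmetric, of "W x"] iexp_cos by (simp add: scaleR_conv_of_real algebra_simps)
      then show "(CLINT x|N. (W x * (1 + cos (Y x))) *\<^sub>R iexp (s * c k x)) = (CLINT x|N. W x *\<^sub>R iexp (s * c k x))
        + (1/2) *\<^sub>R ((CLINT x|N. W x *\<^sub>R iexp (s * c k x + Y x)) + (CLINT x|N. W x *\<^sub>R iexp (s * c k x - Y x)))"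
        using i3 by (simp only: Bochner_Integration.integral_add Bochner_Integration.integrable_add integrable_scaleR_right integral_scaleR_right)
      have "(W x * (1 + sin (Y x))) *\<^sub>R iexp (s * c k x) = W x *\<^sub>R iexp (s * c k x)
          + (1/(2*\<i>)) * (W x *\<^sub>R iexp (s * c k x + Y x) - W x *\<^sub>R iexp (s * c k x - Y x))" for x
        unfolding scaleR_diff_right[symmetric, of "W x"] iexp_sin by (simp add: scaleR_conv_of_real algebra_simps)
      then show "(CLINT x|N. (W x * (1 + sin (Y x))) *\<^sub>R iexp (s * c k x)) = (CLINT x|N. W x *\<^sub>R iexp (s * c k x))
        + (1/(2*\<i>)) * ((CLINT x|N. W x *\<^sub>R iexp (s * c k x + Y x)) - (CLINT x|N. W x *\<^sub>R iexp (s * c k x - Y x)))"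
        using i3 by (simp only: Bochner_Integration.integral_add Bochner_Integration.integral_diff Bochner_Integration.integrable_add
          Bochner_Integration.integrable_diff integrable_mult_right integral_mult_right_zero)
    qed
    have bnd: "0 \<le> W x * (1 + y) \<and> W x * (1 + y) \<le> 2" if "\<bar>y\<bar> \<le> 1" for x y
    proof -
      have "0 \<le> 1 + y" "1 + y \<le> 2" using that by auto
      then have "W x * (1 + y) \<le> 1 * 2" using Wb[of x] by (intro mult_mono) auto
      then show ?thesis using Wb[of x] \<open>0 \<le> 1 + y\<close> by simp
    qed
    let ?I = "\<lambda>x. indicator (A k) (c k x) :: real"
    have e0: "(\<integral>x. W x * ?I x \<partial>M) = (\<integral>x. W x * ?I x \<partial>M')"
      using Wb IHs(1) by (intro weighted_levy_uniqueness[OF M sets, where B=1]) auto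
    have e1: "(\<integral>x. (W x * (1 + cos (Y x))) * ?I x \<partial>M) = (\<integral>x. (W x * (1 + cos (Y x))) * ?I x \<partial>M')"
    proof (rule weighted_levy_uniqueness[OF M sets, where B=2])
      show "(CLINT x|M. (W x * (1 + cos (Y x))) *\<^sub>R iexp (s * c k x)) = (CLINT x|M'. (W x * (1 + cos (Y x))) *\<^sub>R iexp (s * c k x))" for s
        unfolding cosid[OF M(1) refl] cosid[OF M(2) sets] IHs ..
    qed (use bnd in auto)
    have e2: "(\<integral>x. (W x * (1 + sin (Y x))) * ?I x \<partial>M) = (\<integral>x. (W x * (1 + sin (Y x))) * ?I x \<partial>M')"
    proof (rule weighted_levy_uniqueness[OF M sets, where B=2])
      show "(CLINT x|M. (W x * (1 + sin (Y x))) *\<^sub>R iexp (s * c k x)) = (CLINT x|M'. (W x * (1 + sin (Y x))) *\<^sub>R iexp (s * c k x))" for s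
        unfolding sinid[OF M(1) refl] sinid[OF M(2) sets] IHs ..
    qed (use bnd in auto)
    have split: "(CLINT x|N. (\<Prod>j\<in>insert k K. indicator (A j) (c j x) :: real) *\<^sub>R iexp (\<Sum>j\<in>F. t j * c j x))
       = Complex ((\<integral>x. (W x * (1 + cos (Y x))) * ?I x \<partial>N) - (\<integral>x. W x * ?I x \<partial>N))
                 ((\<integral>x. (W x * (1 + sin (Y x))) * ?I x \<partial>N) - (\<integral>x. W x * ?I x \<partial>N))"
      if N: "prob_space N" "sets N = sets M" for N
    proof -
      interpret N: prob_space N by (rule N)
      note [measurable_cong] = N(2)
      have jb: "\<bar>W x * y * ?I x\<bar> \<le> 2" if "\<bar>y\<bar> \<le> 2" for x y
      proof -
        have "\<bar>W x * y * ?I x\<bar> \<le> 1 * 2 * 1" unfolding abs_mult using Wb[of x] that by (intro mult_mono) auto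
        then show ?thesis by simp
      qed
      have j: "integrable N (\<lambda>x. W x * ?I x)" "integrable N (\<lambda>x. (W x * (1 + cos (Y x))) * ?I x)"
        "integrable N (\<lambda>x. (W x * (1 + sin (Y x))) * ?I x)"
        using jb[of 1] jb[of "1 + cos (Y x)" for x] jb[of "1 + sin (Y x)" for x]
          abs_cos_le_one abs_sin_le_one
        by (intro N.integrable_const_bound[where B=2] AE_I2; force intro: abs_triangle_ineq[THEN order_trans])+
      let ?f = "\<lambda>x. (\<Prod>j\<in>insert k K. indicator (A j) (c j x) :: real) *\<^sub>R iexp (\<Sum>j\<in>F. t j * c j x)"
      have pr: "(\<Prod>j\<in>insert k K. indicator (A j) (c j x) :: real) = W x * ?I x" for x
        using insert.hyps by (simp add: W_def)
      have f: "?f x = Complex (W x * ?I x * cos (Y x)) (W x * ?I x * sin (Y x))" for x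
        unfolding pr Y_def[symmetric] by (simp add: complex_eq_iff Re_exp Im_exp)
      have fi: "integrable N ?f"
        unfolding pr Y_def[symmetric]
        using jb[of 1] by (intro integrable_weighted_iexp[OF N(1), where B=2]) auto
      have "Re (integral\<^sup>L N ?f) = (\<integral>x. W x * ?I x * cos (Y x) \<partial>N)"
        "Im (integral\<^sup>L N ?f) = (\<integral>x. W x * ?I x * sin (Y x) \<partial>N)"
        using integral_Re[OF fi] integral_Im[OF fi] unfolding f by simp_all
      moreover have "(\<integral>x. W x * ?I x * cos (Y x) \<partial>N) = (\<integral>x. (W x * (1 + cos (Y x))) * ?I x - W x * ?I x \<partial>N)"
        "(\<integral>x. W x * ?I x * sin (Y x) \<partial>N) = (\<integral>x. (W x * (1 + sin (Y x))) * ?I x - W x * ?I x \<partial>N)"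
        by (simp_all add: algebra_simps)
      ultimately show ?thesis using j by (simp add: complex_eq_iff)
    qed
    show ?case unfolding split[OF M(1) refl] split[OF M(2) sets] e0 e1 e2 ..
  qed
qed

lemma charfun_determines_prob:
  fixes c :: "'j \<Rightarrow> 'a \<Rightarrow> real"
  assumes M: "prob_space M" "prob_space M'" and sets: "sets M' = sets M"
    and F: "finite F" and c: "\<And>j. j \<in> F \<Longrightarrow> c j \<in> borel_measurable M"
    and eq: "\<And>t. (CLINT x|M. iexp (\<Sum>j\<in>F. t j * c j x)) = (CLINT x|M'. iexp (\<Sum>j\<in>F. t j * c j x))"
    and A: "\<And>j. j \<in> K \<Longrightarrow> A j \<in> sets borel" and K: "K \<subseteq> F"
  shows "measure M {x \<in> space M. \<forall>j\<in>K. c j x \<in> A j} = measure M' {x \<in> space M. \<forall>j\<in>K. c j x \<in> A j}"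
proof -
  have fK: "finite K" using F K by (rule rev_finite_subset)
  have E: "{x \<in> space M. \<forall>j\<in>K. c j x \<in> A j} \<in> sets M"
    using fK A c K by (intro sets.sets_Collect_finite_All) (auto intro: measurable_sets_Collect[OF c])
  have one: "complex_of_real (measure N {x \<in> space M. \<forall>j\<in>K. c j x \<in> A j}) =
      (CLINT x|N. (\<Prod>j\<in>K. indicator (if j \<in> K then A j else {}) (c j x) :: real) *\<^sub>R iexp (\<Sum>j\<in>F. 0 * c j x))"
    if N: "prob_space N" "sets N = sets M" for N
  proof -
    interpret N: prob_space N by (rule N)
    let ?E = "{x \<in> space M. \<forall>j\<in>K. c j x \<in> A j}"
    have sp: "space N = space M" using N(2) by (rule sets_eq_imp_space_eq)
    have "(CLINT x|N. (\<Prod>j\<in>K. indicator (if j \<in> K then A j else {}) (c j x) :: real) *\<^sub>R iexp (\<Sum>j\<in>F. 0 * c j x))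
        = (CLINT x|N. complex_of_real (indicator ?E x))"
    proof (intro Bochner_Integration.integral_cong refl)
      fix x assume "x \<in> space N"
      have "(\<Prod>j\<in>K. indicator (if j \<in> K then A j else {}) (c j x) :: real) = indicator ?E x"
      proof (cases "\<forall>j\<in>K. c j x \<in> A j")
        case True
        then show ?thesis using \<open>x \<in> space N\<close> sp by (auto simp: indicator_def intro!: prod.neutral)
      next
        case False
        then have "(\<Prod>j\<in>K. indicator (if j \<in> K then A j else {}) (c j x) :: real) = 0"
          using fK by (intro prod_zero) (force simp: indicator_def)+
        then show ?thesis using False by (simp add: indicator_def)
      qed
      then show "(\<Prod>j\<in>K. indicator (if j \<in> K then A j else {}) (c j x) :: real) *\<^sub>R iexp (\<Sum>j\<in>F. 0 * c j x) = complex_of_real (indicator ?E x)"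
        by (simp add: scaleR_conv_of_real)
    qed
    also have "\<dots> = complex_of_real (\<integral>x. indicator ?E x \<partial>N)" by (rule integral_complex_of_real)
    also have "(\<integral>x. indicator ?E x \<partial>N) = measure N ?E" using E N(2) by simp
    finally show ?thesis by simp
  qed
  have "complex_of_real (measure M {x \<in> space M. \<forall>j\<in>K. c j x \<in> A j}) = complex_of_real (measure M' {x \<in> space M. \<forall>j\<in>K. c j x \<in> A j})"
    unfolding one[OF M(1) refl] one[OF M(2) sets]
    by (rule charfun_determines_events[OF M sets F c eq]) (use A K in auto)
  then show ?thesis by (simp only: of_real_eq_iff)
qed

text \<open>
  A random element of a finite product of separable Hilbert spaces has independent components when
  its characteristic functional factorises; the Fourier coefficients of the components with respect
  to orthonormal bases reduce this to a countable family of real variables.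
\<close>

lemma charfun_determines_product_law:
  fixes \<xi> :: "'q \<Rightarrow> nat \<Rightarrow> 'h::{real_inner, banach, second_countable_topology}"
  assumes Q: "prob_space Q" and I: "finite I"
    and W: "\<And>m. m \<in> I \<Longrightarrow> subspace (W m)" "\<And>m. m \<in> I \<Longrightarrow> closed (W m)"
    and \<xi>: "\<And>m. m \<in> I \<Longrightarrow> (\<lambda>q. \<xi> q m) \<in> borel_measurable Q" "\<And>m q. m \<in> I \<Longrightarrow> q \<in> space Q \<Longrightarrow> \<xi> q m \<in> W m"
    and fact: "\<And>h. (\<And>m. m \<in> I \<Longrightarrow> h m \<in> W m) \<Longrightarrow>
      (CLINT q|Q. iexp (\<Sum>m\<in>I. \<xi> q m \<bullet> h m)) = (\<Prod>m\<in>I. CLINT q|Q. iexp (\<xi> q m \<bullet> h m))"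
    and \<gamma>: "\<And>m. prob_space (\<gamma> m)" "\<And>m. m \<in> I \<Longrightarrow> \<gamma> m = distr Q borel (\<lambda>q. \<xi> q m)"
  shows "distr Q (PiM I (\<lambda>m. borel)) (\<lambda>q. \<lambda>m\<in>I. \<xi> q m) = PiM I \<gamma>"
proof -
  interpret Q: prob_space Q by fact
  have pps: "product_prob_space \<gamma>"
    using \<gamma>(1) by (simp add: product_prob_space_def product_prob_space_axioms_def product_sigma_finite_def prob_space_imp_sigma_finite)
  interpret G: product_prob_space \<gamma> I by (rule pps)
  let ?S = "PiM I (\<lambda>m. borel :: 'h measure)"
  define D where "D = distr Q ?S (\<lambda>q. \<lambda>m\<in>I. \<xi> q m)"
  define D' where "D' = PiM I \<gamma>"
  have \<xi>m[measurable]: "(\<lambda>q. \<lambda>m\<in>I. \<xi> q m) \<in> measurable Q ?S"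
    using \<xi>(1) by (intro measurable_restrict) auto
  have sD: "sets D = sets ?S" by (simp add: D_def)
  have s\<gamma>: "sets (\<gamma> m) = sets borel" if "m \<in> I" for m using \<gamma>(2)[OF that] by simp
  have sD': "sets D' = sets ?S" unfolding D'_def by (intro sets_PiM_cong refl s\<gamma>)
  have pD: "prob_space D" unfolding D_def by (rule Q.prob_space_distr) simp
  have pD': "prob_space D'" unfolding D'_def by (rule G.prob_space_axioms)
  have "\<forall>m\<in>I. \<exists>e. orthonormal_or_zero e \<and> (\<forall>i. e i \<in> W m) \<and> (\<forall>x\<in>W m. (\<lambda>k. fourier_sum e k x) \<longlonglongrightarrow> x)"
    using closed_subspace_basis[OF W(1)] by blast
  then obtain e where e: "\<And>m i. m \<in> I \<Longrightarrow> e m i \<in> W m"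
    and lim: "\<And>m x. m \<in> I \<Longrightarrow> x \<in> W m \<Longrightarrow> (\<lambda>k. fourier_sum (e m) k x) \<longlonglongrightarrow> x"
    by metis
  let ?J = "I \<times> (UNIV :: nat set)"
  let ?N = "PiM ?J (\<lambda>j. borel :: real measure)"
  define c where "c j x = x (fst j) \<bullet> e (fst j) (snd j)" for j :: "nat \<times> nat" and x :: "nat \<Rightarrow> 'h"
  have cS: "c j \<in> borel_measurable ?S" if "j \<in> ?J" for j
  proof -
    have [measurable]: "fst j \<in> I" using that by auto
    show ?thesis unfolding c_def by measurable
  qed
  define \<Phi> where "\<Phi> x = (\<lambda>j\<in>?J. c j x)" for x
  have \<Phi>m: "\<Phi> \<in> measurable ?S ?N" unfolding \<Phi>_def using cS by (intro measurable_restrict) auto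
  define \<Psi> where "\<Psi> z = (\<lambda>m\<in>I. lim (\<lambda>k. \<Sum>i<k. z (m, i) *\<^sub>R e m i))" for z :: "nat \<times> nat \<Rightarrow> real"
  have \<Psi>m: "\<Psi> \<in> measurable ?N ?S"
    unfolding \<Psi>_def
  proof (intro measurable_restrict borel_measurable_lim_metric borel_measurable_sum borel_measurable_scaleR borel_measurable_const)
    show "(\<lambda>z. z (m, i)) \<in> borel_measurable ?N" if "m \<in> I" for m i
      using that by (intro measurable_component_singleton) auto
  qed
  have inv: "\<Psi> (\<Phi> x) = x" if "x \<in> space ?S" "\<And>m. m \<in> I \<Longrightarrow> x m \<in> W m" for x
  proof
    fix m
    show "\<Psi> (\<Phi> x) m = x m"
    proof (cases "m \<in> I")
      case True
      then have "(\<lambda>k. \<Sum>i<k. \<Phi> x (m, i) *\<^sub>R e m i) \<longlonglongrightarrow> x m"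
        using lim[OF True that(2)[OF True]] by (simp add: \<Phi>_def c_def fourier_sum_def)
      then show ?thesis using True by (simp add: \<Psi>_def limI)
    next
      case False
      then show ?thesis using that(1) by (auto simp: \<Psi>_def space_PiM PiE_def extensional_def)
    qed
  qed
  have cf: "(CLINT x|D. iexp (\<Sum>m\<in>I. x m \<bullet> h m)) = (CLINT x|D'. iexp (\<Sum>m\<in>I. x m \<bullet> h m))"
    if h: "\<And>m. m \<in> I \<Longrightarrow> h m \<in> W m" for h
  proof -
    have m1: "(\<lambda>x. iexp (\<Sum>m\<in>I. x m \<bullet> h m)) \<in> borel_measurable ?S" by measurable
    have "(CLINT x|D. iexp (\<Sum>m\<in>I. x m \<bullet> h m)) = (CLINT q|Q. iexp (\<Sum>m\<in>I. (\<lambda>m\<in>I. \<xi> q m) m \<bullet> h m))"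
      unfolding D_def by (subst integral_distr[OF \<xi>m m1]) simp
    also have "\<dots> = (CLINT q|Q. iexp (\<Sum>m\<in>I. \<xi> q m \<bullet> h m))" by (intro Bochner_Integration.integral_cong) auto
    also have "\<dots> = (\<Prod>m\<in>I. CLINT q|Q. iexp (\<xi> q m \<bullet> h m))" by (rule fact[OF h])
    also have "\<dots> = (\<Prod>m\<in>I. CLINT x|\<gamma> m. iexp (x \<bullet> h m))"
    proof (rule prod.cong[OF refl])
      fix m assume m: "m \<in> I"
      show "(CLINT q|Q. iexp (\<xi> q m \<bullet> h m)) = (CLINT x|\<gamma> m. iexp (x \<bullet> h m))"
        unfolding \<gamma>(2)[OF m] using \<xi>(1)[OF m] by (subst integral_distr) auto
    qed
    also have "\<dots> = (CLINT x|D'. (\<Prod>m\<in>I. iexp (x m \<bullet> h m)))"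
      unfolding D'_def
    proof (rule G.product_integral_prod[OF I, symmetric])
      fix m assume m: "m \<in> I"
      note [measurable_cong] = s\<gamma>[OF m]
      show "integrable (\<gamma> m) (\<lambda>x. iexp (x \<bullet> h m))" by (intro prob_space.integrable_iexp[OF \<gamma>(1)]) auto
    qed
    also have "\<dots> = (CLINT x|D'. iexp (\<Sum>m\<in>I. x m \<bullet> h m))"
      using I by (simp add: exp_sum[symmetric] sum_distrib_left)
    finally show ?thesis .
  qed
  have NN: "distr D ?N \<Phi> = distr D' ?N \<Phi>"
  proof (rule measure_eqI_PiM_infinite)
    show "finite_measure (distr D ?N \<Phi>)"
      using prob_space.prob_space_distr[OF pD, of \<Phi> ?N] \<Phi>m by (simp add: measurable_cong_sets[OF sD refl] prob_space_def)
    fix A K assume K: "finite K" "K \<subseteq> ?J" and A: "\<And>i. i \<in> K \<Longrightarrow> A i \<in> sets (borel :: real measure)"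
    obtain k where k: "K \<subseteq> I \<times> {..<k}"
    proof -
      obtain k where "snd ` K \<subseteq> {..<k}" using K(1) finite_nat_iff_bounded by blast
      then have "K \<subseteq> I \<times> {..<k}" using K(2) by force
      then show ?thesis using that by blast
    qed
    let ?F = "I \<times> {..<k}"
    have eqF: "(CLINT x|D. iexp (\<Sum>j\<in>?F. t j * c j x)) = (CLINT x|D'. iexp (\<Sum>j\<in>?F. t j * c j x))" for t
    proof -
      have "(\<Sum>j\<in>?F. t j * c j x) = (\<Sum>m\<in>I. x m \<bullet> (\<Sum>i<k. t (m, i) *\<^sub>R e m i))" for x
        by (simp add: inner_sum_right c_def sum.cartesian_product case_prod_beta')
      moreover have "(\<Sum>i<k. t (m, i) *\<^sub>R e m i) \<in> W m" if "m \<in> I" for m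
        using W(1)[OF that] e[OF that] by (intro subspace_sum subspace_scale)
      ultimately show ?thesis using cf[of "\<lambda>m. \<Sum>i<k. t (m, i) *\<^sub>R e m i"] by simp
    qed
    have meas: "measure D {x \<in> space D. \<forall>j\<in>K. c j x \<in> A j} = measure D' {x \<in> space D. \<forall>j\<in>K. c j x \<in> A j}"
    proof (rule charfun_determines_prob[OF pD pD' _ _ _ eqF _ k])
      show "c j \<in> borel_measurable D" if "j \<in> ?F" for j
        using cS[of j] that by (auto simp: measurable_cong_sets[OF sD refl])
    qed (use I A sD sD' in auto)
    have vim: "\<Phi> -` prod_emb ?J (\<lambda>j. borel) K (Pi\<^sub>E K A) \<inter> space ?S = {x \<in> space ?S. \<forall>j\<in>K. c j x \<in> A j}"
    proof -
      have "\<Phi> x \<in> extensional ?J" "\<And>j. j \<in> K \<Longrightarrow> \<Phi> x j = c j x" for x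
        using K(2) by (auto simp: \<Phi>_def)
      then have iff: "\<Phi> x \<in> prod_emb ?J (\<lambda>j. borel) K (Pi\<^sub>E K A) \<longleftrightarrow> (\<forall>j\<in>K. c j x \<in> A j)" for x
        by (simp add: prod_emb_iff restrict_PiE_iff Pi_iff del: mem_Sigma_iff)
      show ?thesis
        by (rule set_eqI) (simp only: vimage_eq Int_iff mem_Collect_eq iff conj_commute)
    qed
    have spD: "space D = space ?S" "space D' = space ?S" by (rule sets_eq_imp_space_eq[OF sD] sets_eq_imp_space_eq[OF sD'])+
    have emb: "prod_emb ?J (\<lambda>j. borel) K (Pi\<^sub>E K A) \<in> sets ?N"
      using K A by (intro sets_PiM_I) auto
    interpret D: prob_space D by (rule pD)
    interpret D': prob_space D' by (rule pD')
    have "emeasure (distr D ?N \<Phi>) (prod_emb ?J (\<lambda>j. borel) K (Pi\<^sub>E K A)) = emeasure D {x \<in> space ?S. \<forall>j\<in>K. c j x \<in> A j}"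
      using \<Phi>m emb vim by (subst emeasure_distr) (auto simp: spD measurable_cong_sets[OF sD refl])
    also have "\<dots> = emeasure D' {x \<in> space ?S. \<forall>j\<in>K. c j x \<in> A j}"
      using meas unfolding spD by (simp add: D.emeasure_eq_measure D'.emeasure_eq_measure)
    also have "\<dots> = emeasure (distr D' ?N \<Phi>) (prod_emb ?J (\<lambda>j. borel) K (Pi\<^sub>E K A))"
      using \<Phi>m emb vim by (subst emeasure_distr) (auto simp: spD measurable_cong_sets[OF sD' refl])
    finally show "emeasure (distr D ?N \<Phi>) (prod_emb ?J (\<lambda>j. borel) K (Pi\<^sub>E K A)) = emeasure (distr D' ?N \<Phi>) (prod_emb ?J (\<lambda>j. borel) K (Pi\<^sub>E K A))" .
  qed simp_all
  have recover: "E = distr (distr E ?N \<Phi>) ?S \<Psi>"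
    if sE: "sets E = sets ?S" and ae: "AE x in E. \<forall>m\<in>I. x m \<in> W m" for E
  proof -
    have spE: "space E = space ?S" using sE by (rule sets_eq_imp_space_eq)
    have mE: "\<Phi> \<in> measurable E ?N" using \<Phi>m by (simp add: measurable_cong_sets[OF sE refl])
    have "distr (distr E ?N \<Phi>) ?S \<Psi> = distr E ?S (\<Psi> \<circ> \<Phi>)" by (rule distr_distr[OF \<Psi>m mE])
    also have "\<dots> = distr E ?S (\<lambda>x. x)"
    proof (rule distr_cong_AE)
      show "AE x in E. (\<Psi> \<circ> \<Phi>) x = x" using ae AE_space[of E] by eventually_elim (auto simp: spE inv)
      show "\<Psi> \<circ> \<Phi> \<in> measurable E ?S" using measurable_comp[OF mE \<Psi>m] .
      show "(\<lambda>x. x) \<in> measurable E ?S" by (simp add: measurable_ident_sets[OF sE])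
    qed simp_all
    also have "\<dots> = E" using sE by (simp add: distr_id2)
    finally show ?thesis by simp
  qed
  have aeD: "AE x in D. \<forall>m\<in>I. x m \<in> W m"
  proof -
    have "{x \<in> space ?S. \<forall>m\<in>I. x m \<in> W m} \<in> sets ?S"
    proof (rule sets.sets_Collect_finite_All[OF _ I])
      fix m assume [measurable]: "m \<in> I"
      have [measurable]: "W m \<in> sets borel" using W(2) \<open>m \<in> I\<close> by auto
      show "{x \<in> space ?S. x m \<in> W m} \<in> sets ?S" by measurable
    qed
    then show ?thesis unfolding D_def using \<xi>(2) by (subst AE_distr_iff[OF \<xi>m]) auto
  qed
  have aeD': "AE x in D'. \<forall>m\<in>I. x m \<in> W m"
  proof (rule AE_finite_allI[OF I])
    fix m assume m: "m \<in> I"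
    have "AE x in \<gamma> m. x \<in> W m"
      unfolding \<gamma>(2)[OF m] using \<xi>(1,2)[OF m] W(2)[OF m] by (subst AE_distr_iff) auto
    then show "AE x in D'. x m \<in> W m" unfolding D'_def by (rule G.AE_component[OF m])
  qed
  show ?thesis using recover[OF sD aeD] recover[OF sD' aeD'] NN unfolding D_def[symmetric] D'_def[symmetric] by simp
qed

section \<open>Moments of Gaussian elements\<close>

lemma centred_normal_facts:
  assumes "0 \<le> v"
  shows "prob_space (centred_normal v)" "sets (centred_normal v) = sets borel"
    and "(CLINT x|centred_normal v. iexp x) = complex_of_real (exp (- v / 2))"
    and "integrable (centred_normal v) (\<lambda>x. x)" "(\<integral>x. x \<partial>centred_normal v) = 0"
    and "integrable (centred_normal v) (\<lambda>x. x\<^sup>2)" "(\<integral>x. x\<^sup>2 \<partial>centred_normal v) = v"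
    and "integrable (centred_normal v) (\<lambda>x. x^4)" "(\<integral>x. x^4 \<partial>centred_normal v) = 3 * v\<^sup>2"
proof -
  have "prob_space (centred_normal v) \<and> sets (centred_normal v) = sets borel \<and>
    (CLINT x|centred_normal v. iexp x) = complex_of_real (exp (- v / 2)) \<and>
    integrable (centred_normal v) (\<lambda>x. x) \<and> (\<integral>x. x \<partial>centred_normal v) = 0 \<and>
    integrable (centred_normal v) (\<lambda>x. x\<^sup>2) \<and> (\<integral>x. x\<^sup>2 \<partial>centred_normal v) = v \<and>
    integrable (centred_normal v) (\<lambda>x. x^4) \<and> (\<integral>x. x^4 \<partial>centred_normal v) = 3 * v\<^sup>2"
  proof (cases "v = 0")
    case True
    have ps: "prob_space (return borel (0::real))" by (rule prob_space_return) simp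
    interpret R: prob_space "return borel (0::real)" by (rule ps)
    have R: "integrable (return borel (0::real)) (\<lambda>x. x ^ n)" for n
    proof (rule R.integrable_const_bound)
      show "AE x in return borel (0::real). norm (x ^ n) \<le> norm ((0::real) ^ n)"
        by (subst AE_return) auto
    qed simp
    have cn: "centred_normal v = return borel 0" using True by (simp add: centred_normal_def)
    have ir: "(\<integral>x. (x::real) ^ n \<partial>return borel 0) = 0 ^ n" for n
      by (rule integral_return) auto
    have ch: "(CLINT x|return borel 0. iexp x) = iexp 0"
      by (rule integral_return) auto
    show ?thesis
      unfolding cn
    proof (intro conjI)
      show "integrable (return borel 0) (\<lambda>x::real. x)" "(\<integral>x. (x::real) \<partial>return borel 0) = 0"
        using R[of 1] ir[of 1] by (simp_all only: power_one_right)
      show "(CLINT x|return borel 0. iexp x) = complex_of_real (exp (- v / 2))"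
        unfolding ch True by simp
    qed (use True ps R[of 2] R[of 4] ir[of 2] ir[of 4] in \<open>simp_all only: sets_return, simp_all\<close>)
  next
    case False
    then have v: "0 < v" using assms by simp
    define \<sigma> where "\<sigma> = sqrt v"
    have \<sigma>: "0 < \<sigma>" "\<sigma>\<^sup>2 = v" using v by (auto simp: \<sigma>_def)
    have N: "centred_normal v = density lborel (\<lambda>x. ennreal (normal_density 0 \<sigma> x))"
      using False by (simp add: centred_normal_def \<sigma>_def)
    have p: "prob_space (centred_normal v)" unfolding N by (rule prob_space_normal_density[OF \<sigma>(1)])
    have mom: "integrable (centred_normal v) (\<lambda>x. x ^ n) \<longleftrightarrow> integrable lborel (\<lambda>x. normal_density 0 \<sigma> x * x ^ n)"
      "(\<integral>x. x ^ n \<partial>centred_normal v) = (\<integral>x. normal_density 0 \<sigma> x * x ^ n \<partial>lborel)" for n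
      unfolding N by (simp_all add: integrable_density integral_density)
    have int: "integrable (centred_normal v) (\<lambda>x. x ^ n)" for n
      using integrable_normal_moment[OF \<sigma>(1), of 0 n] by (simp add: mom)
    have m1: "(\<integral>x. x ^ 1 \<partial>centred_normal v) = 0"
      unfolding mom using integral_normal_moment_odd[OF \<sigma>(1), of 0 0] by simp
    have m2: "(\<integral>x. x ^ 2 \<partial>centred_normal v) = v"
      unfolding mom using integral_normal_moment_even[OF \<sigma>(1), of 0 1] \<sigma> by (simp add: fact_numeral)
    have m4: "(\<integral>x. x ^ 4 \<partial>centred_normal v) = 3 * v\<^sup>2"
      unfolding mom using integral_normal_moment_even[OF \<sigma>(1), of 0 2] \<sigma>
      by (simp add: fact_numeral field_simps power2_eq_square)
    have "(CLINT x|centred_normal v. iexp x) = (CLINT x|lborel. normal_density 0 \<sigma> x *\<^sub>R iexp x)"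
      unfolding N by (simp add: integral_density)
    also have "\<dots> = \<bar>\<sigma>\<bar> *\<^sub>R (CLINT x|lborel. normal_density 0 \<sigma> (0 + \<sigma> * x) *\<^sub>R iexp (0 + \<sigma> * x))"
      using \<sigma> by (intro lborel_integral_real_affine) auto
    also have "\<dots> = (CLINT x|lborel. \<sigma> *\<^sub>R (normal_density 0 \<sigma> (\<sigma> * x) *\<^sub>R iexp (\<sigma> * x)))"
      using \<sigma> by (simp only: integral_scaleR_right add_0 abs_of_pos)
    also have "\<dots> = (CLINT x|lborel. std_normal_density x *\<^sub>R iexp (\<sigma> * x))"
    proof (intro Bochner_Integration.integral_cong refl)
      fix x
      have "\<sigma> * normal_density 0 \<sigma> (\<sigma> * x) = std_normal_density x"
        using \<sigma> v by (simp add: normal_density_def power_mult_distrib real_sqrt_mult flip: \<sigma>_def)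
      then show "\<sigma> *\<^sub>R (normal_density 0 \<sigma> (\<sigma> * x) *\<^sub>R iexp (\<sigma> * x)) = std_normal_density x *\<^sub>R iexp (\<sigma> * x)"
        by simp
    qed
    also have "\<dots> = char std_normal_distribution \<sigma>"
      unfolding char_def by (simp add: integral_density)
    also have "\<dots> = complex_of_real (exp (- v / 2))"
      using \<sigma> by (simp add: char_std_normal_distribution)
    finally have ch: "(CLINT x|centred_normal v. iexp x) = complex_of_real (exp (- v / 2))" .
    show ?thesis using p ch int[of 1] int[of 2] int[of 4] m1 m2 m4 by (simp add: N)
  qed
  then show "prob_space (centred_normal v)" "sets (centred_normal v) = sets borel"
    and "(CLINT x|centred_normal v. iexp x) = complex_of_real (exp (- v / 2))"
    and "integrable (centred_normal v) (\<lambda>x. x)" "(\<integral>x. x \<partial>centred_normal v) = 0"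
    and "integrable (centred_normal v) (\<lambda>x. x\<^sup>2)" "(\<integral>x. x\<^sup>2 \<partial>centred_normal v) = v"
    and "integrable (centred_normal v) (\<lambda>x. x^4)" "(\<integral>x. x^4 \<partial>centred_normal v) = 3 * v\<^sup>2"
    by blast+
qed

text \<open>Fatou's lemma for integrals bounded along a sequence.\<close>

lemma (in prob_space) integrable_limit:
  fixes seq :: "nat \<Rightarrow> 'a \<Rightarrow> real" and lim c
  assumes lim: "\<And>q. q \<in> space M \<Longrightarrow> (\<lambda>k. seq k q) \<longlonglongrightarrow> lim q" and int: "\<And>k. integrable M (seq k)"
    and seq0: "\<And>k q. 0 \<le> seq k q" and c: "\<And>k. (\<integral>q. seq k q \<partial>M) \<le> c"
    and lm[measurable]: "lim \<in> borel_measurable M" and lim0: "\<And>q. 0 \<le> lim q"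
  shows "integrable M lim \<and> (\<integral>q. lim q \<partial>M) \<le> c"
proof -
  have "0 \<le> (\<integral>q. seq 0 q \<partial>M)" using seq0 by (intro integral_nonneg_AE) auto
  then have c0: "0 \<le> c" using c[of 0] by linarith
  have [measurable]: "seq k \<in> borel_measurable M" for k using int by auto
  have "(\<integral>\<^sup>+q. ennreal (lim q) \<partial>M) = (\<integral>\<^sup>+q. liminf (\<lambda>k. ennreal (seq k q)) \<partial>M)"
  proof (intro nn_integral_cong)
    fix q assume "q \<in> space M"
    then have "(\<lambda>k. ennreal (seq k q)) \<longlonglongrightarrow> ennreal (lim q)" using lim by (intro tendsto_ennrealI)
    then show "ennreal (lim q) = liminf (\<lambda>k. ennreal (seq k q))"
      by (intro lim_imp_Liminf[symmetric]) auto
  qed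
  also have "\<dots> \<le> liminf (\<lambda>k. \<integral>\<^sup>+q. ennreal (seq k q) \<partial>M)" by (rule nn_integral_liminf) measurable
  also have "\<dots> \<le> liminf (\<lambda>k. ennreal c)"
  proof (intro Liminf_mono always_eventually allI)
    show "(\<integral>\<^sup>+q. ennreal (seq k q) \<partial>M) \<le> ennreal c" for k
      using int[of k] seq0 c[of k] by (subst nn_integral_eq_integral) (auto intro: ennreal_leI)
  qed
  also have "\<dots> = ennreal c" by (simp add: Liminf_const)
  finally have n: "(\<integral>\<^sup>+q. ennreal (lim q) \<partial>M) \<le> ennreal c" .
  then have i: "integrable M lim"
    using lim0 by (intro integrableI_nonneg) (auto intro: le_less_trans)
  have "ennreal (\<integral>q. lim q \<partial>M) \<le> ennreal c"
    using n i lim0 by (subst (asm) nn_integral_eq_integral) auto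
  then show ?thesis using i c0 by simp
qed

text \<open>\<open>X\<close> is a centred Gaussian element of \<open>W\<close> with the covariance of \<open>U\<close>.\<close>

locale gaussian_copy =
  Q: prob_space Q + P: prob_space P
  for Q :: "'q measure" and P :: "'w measure" +
  fixes X :: "'q \<Rightarrow> 'h::{real_inner, banach, second_countable_topology}" and U :: "'w \<Rightarrow> 'h" and W :: "'h set"
  assumes W: "subspace W" "closed W"
    and X: "X \<in> borel_measurable Q" "\<And>q. q \<in> space Q \<Longrightarrow> X q \<in> W"
    and U: "U \<in> borel_measurable P" "integrable P (\<lambda>w. (norm (U w))\<^sup>2)"
    and law: "\<And>h. h \<in> W \<Longrightarrow> distr Q borel (\<lambda>q. X q \<bullet> h) = centred_normal (\<integral>w. (U w \<bullet> h)\<^sup>2 \<partial>P)"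
begin

lemma U_inner: "integrable P (\<lambda>w. (U w \<bullet> h) * (U w \<bullet> g))"
proof (rule dominated_integrable)
  note [measurable] = U(1)
  show "(\<lambda>w. (U w \<bullet> h) * (U w \<bullet> g)) \<in> borel_measurable P" by measurable
  show "integrable P (\<lambda>w. (norm h * norm g) * (norm (U w))\<^sup>2)" using U(2) by simp
  show "\<bar>(U w \<bullet> h) * (U w \<bullet> g)\<bar> \<le> (norm h * norm g) * (norm (U w))\<^sup>2" for w
  proof -
    have "\<bar>(U w \<bullet> h) * (U w \<bullet> g)\<bar> \<le> (norm (U w) * norm h) * (norm (U w) * norm g)"
      unfolding abs_mult by (intro mult_mono Cauchy_Schwarz_ineq2) auto
    then show ?thesis by (simp add: power2_eq_square mult_ac)
  qed
qed

lemma X_moments: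
  assumes h: "h \<in> W"
  shows "integrable Q (\<lambda>q. X q \<bullet> h)" "(\<integral>q. X q \<bullet> h \<partial>Q) = 0"
    "integrable Q (\<lambda>q. (X q \<bullet> h)\<^sup>2)" "(\<integral>q. (X q \<bullet> h)\<^sup>2 \<partial>Q) = (\<integral>w. (U w \<bullet> h)\<^sup>2 \<partial>P)"
    "integrable Q (\<lambda>q. (X q \<bullet> h)^4)" "(\<integral>q. (X q \<bullet> h)^4 \<partial>Q) = 3 * (\<integral>w. (U w \<bullet> h)\<^sup>2 \<partial>P)\<^sup>2"
proof -
  note [measurable] = X(1)
  have v: "0 \<le> (\<integral>w. (U w \<bullet> h)\<^sup>2 \<partial>P)" by simp
  note f = centred_normal_facts[OF v, folded law[OF h]]
  show "integrable Q (\<lambda>q. X q \<bullet> h)" "(\<integral>q. X q \<bullet> h \<partial>Q) = 0"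
    "integrable Q (\<lambda>q. (X q \<bullet> h)\<^sup>2)" "(\<integral>q. (X q \<bullet> h)\<^sup>2 \<partial>Q) = (\<integral>w. (U w \<bullet> h)\<^sup>2 \<partial>P)"
    "integrable Q (\<lambda>q. (X q \<bullet> h)^4)" "(\<integral>q. (X q \<bullet> h)^4 \<partial>Q) = 3 * (\<integral>w. (U w \<bullet> h)\<^sup>2 \<partial>P)\<^sup>2"
    using f(4-9) by (simp_all add: integrable_distr_eq integral_distr)
qed

text \<open>Covariances follow from variances by polarisation.\<close>

lemma X_covariance:
  assumes "h \<in> W" "g \<in> W"
  shows "integrable Q (\<lambda>q. (X q \<bullet> h) * (X q \<bullet> g))"
    "(\<integral>q. (X q \<bullet> h) * (X q \<bullet> g) \<partial>Q) = (\<integral>w. (U w \<bullet> h) * (U w \<bullet> g) \<partial>P)"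
proof -
  have hg: "h + g \<in> W" using assms W by (intro subspace_add)
  have pol: "(x \<bullet> h) * (x \<bullet> g) = ((x \<bullet> (h + g))\<^sup>2 - (x \<bullet> h)\<^sup>2 - (x \<bullet> g)\<^sup>2) / 2" for x :: 'h
    by (simp add: inner_add_right power2_eq_square algebra_simps)
  note i = X_moments(3)[OF hg] X_moments(3)[OF assms(1)] X_moments(3)[OF assms(2)]
  show "integrable Q (\<lambda>q. (X q \<bullet> h) * (X q \<bullet> g))" unfolding pol using i by auto
  have iU: "integrable P (\<lambda>w. (U w \<bullet> k)\<^sup>2)" for k using U_inner[of k k] by (simp add: power2_eq_square)
  show "(\<integral>q. (X q \<bullet> h) * (X q \<bullet> g) \<partial>Q) = (\<integral>w. (U w \<bullet> h) * (U w \<bullet> g) \<partial>P)"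
    unfolding pol using i iU X_moments(4)[OF hg] X_moments(4)[OF assms(1)] X_moments(4)[OF assms(2)] by simp
qed

text \<open>
  The Cauchy-Schwarz inequality with the weights \<open>v i\<close> and the fourth moment \<open>3 * (v i)\<^sup>2\<close> of each coordinate
  give three times the square of the trace. Coordinates of variance zero vanish almost surely and are left out,
  since the weights are divided by.
\<close>

lemma partial_fourth_moment:
  assumes o: "orthonormal_or_zero e" and e: "\<And>i. e i \<in> W"
  defines "\<tau> \<equiv> (\<integral>w. (norm (U w))\<^sup>2 \<partial>P)"
  shows "integrable Q (\<lambda>q. (\<Sum>i<k. (X q \<bullet> e i)\<^sup>2)\<^sup>2)" "(\<integral>q. (\<Sum>i<k. (X q \<bullet> e i)\<^sup>2)\<^sup>2 \<partial>Q) \<le> 3 * \<tau>\<^sup>2"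
    "(\<integral>q. (\<Sum>i<k. (X q \<bullet> e i)\<^sup>2) \<partial>Q) \<le> \<tau>"
proof -
  note [measurable] = X(1) U(1)
  define v where "v i = (\<integral>w. (U w \<bullet> e i)\<^sup>2 \<partial>P)" for i
  have v0: "0 \<le> v i" for i by (simp add: v_def)
  have iU: "integrable P (\<lambda>w. (U w \<bullet> k)\<^sup>2)" for k using U_inner[of k k] by (simp add: power2_eq_square)
  have sv: "(\<Sum>i<k. v i) \<le> \<tau>"
  proof -
    have "(\<Sum>i<k. v i) = (\<integral>w. (\<Sum>i<k. (U w \<bullet> e i)\<^sup>2) \<partial>P)" unfolding v_def using iU by simp
    also have "\<dots> \<le> \<tau>" unfolding \<tau>_def using iU U(2) bessel[OF o] by (intro integral_mono) auto
    finally show ?thesis .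
  qed
  show "(\<integral>q. (\<Sum>i<k. (X q \<bullet> e i)\<^sup>2) \<partial>Q) \<le> \<tau>"
    using sv X_moments(3,4)[OF e] by (simp add: v_def)
  define J where "J = {i. i < k \<and> 0 < v i}"
  have J: "finite J" "J \<subseteq> {..<k}" by (auto simp: J_def)
  have zero: "AE q in Q. \<forall>i<k. v i = 0 \<longrightarrow> X q \<bullet> e i = 0"
  proof -
    have "AE q in Q. X q \<bullet> e i = 0" if "v i = 0" for i
    proof -
      have "(\<integral>q. (X q \<bullet> e i)\<^sup>2 \<partial>Q) = 0" using X_moments(4)[OF e] that by (simp add: v_def)
      then have "AE q in Q. (X q \<bullet> e i)\<^sup>2 = 0"
        using X_moments(3)[OF e] by (subst (asm) integral_nonneg_eq_0_iff_AE) auto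
      then show ?thesis by simp
    qed
    then show ?thesis by (auto simp: AE_all_countable)
  qed
  define B where "B q = (\<Sum>i\<in>J. v i) * (\<Sum>i\<in>J. (X q \<bullet> e i)^4 / v i)" for q
  have iB: "integrable Q B" unfolding B_def using X_moments(5)[OF e] by simp
  have le: "AE q in Q. (\<Sum>i<k. (X q \<bullet> e i)\<^sup>2)\<^sup>2 \<le> B q"
    using zero
  proof eventually_elim
    fix q assume z: "\<forall>i<k. v i = 0 \<longrightarrow> X q \<bullet> e i = 0"
    have "(\<Sum>i<k. (X q \<bullet> e i)\<^sup>2) = (\<Sum>i\<in>J. (X q \<bullet> e i)\<^sup>2)"
    proof (rule sum.mono_neutral_right)
      show "\<forall>i\<in>{..<k} - J. (X q \<bullet> e i)\<^sup>2 = 0"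
        using z v0 by (auto simp: J_def less_le)
    qed (use J in auto)
    also have "\<dots> = (\<Sum>i\<in>J. sqrt (v i) * ((X q \<bullet> e i)\<^sup>2 / sqrt (v i)))"
      by (intro sum.cong) (auto simp: J_def)
    finally have "(\<Sum>i<k. (X q \<bullet> e i)\<^sup>2)\<^sup>2 \<le> (\<Sum>i\<in>J. (sqrt (v i))\<^sup>2) * (\<Sum>i\<in>J. ((X q \<bullet> e i)\<^sup>2 / sqrt (v i))\<^sup>2)"
      using Cauchy_Schwarz_ineq_sum[of "\<lambda>i. sqrt (v i)" "\<lambda>i. (X q \<bullet> e i)\<^sup>2 / sqrt (v i)" J] by simp
    also have "\<dots> = B q" unfolding B_def using v0 by (simp add: power_divide)
    finally show "(\<Sum>i<k. (X q \<bullet> e i)\<^sup>2)\<^sup>2 \<le> B q" .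
  qed
  show i: "integrable Q (\<lambda>q. (\<Sum>i<k. (X q \<bullet> e i)\<^sup>2)\<^sup>2)"
    using le by (intro Bochner_Integration.integrable_bound[OF iB]) (auto elim!: eventually_mono)
  have "(\<integral>q. (\<Sum>i<k. (X q \<bullet> e i)\<^sup>2)\<^sup>2 \<partial>Q) \<le> (\<integral>q. B q \<partial>Q)"
    using i iB le by (rule integral_mono_AE)
  also have "\<dots> = (\<Sum>i\<in>J. v i) * (\<Sum>i\<in>J. 3 * (v i)\<^sup>2 / v i)"
    unfolding B_def using X_moments(5,6)[OF e] by (simp add: v_def)
  also have "(\<Sum>i\<in>J. 3 * (v i)\<^sup>2 / v i) = 3 * (\<Sum>i\<in>J. v i)"
    unfolding sum_distrib_left by (intro sum.cong) (auto simp: J_def power2_eq_square)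
  also have "(\<Sum>i\<in>J. v i) * (3 * (\<Sum>i\<in>J. v i)) = 3 * (\<Sum>i\<in>J. v i)\<^sup>2" by (simp add: power2_eq_square)
  also have "\<dots> \<le> 3 * \<tau>\<^sup>2"
  proof -
    have "(\<Sum>i\<in>J. v i) \<le> (\<Sum>i<k. v i)" using J v0 by (intro sum_mono2) auto
    then have "(\<Sum>i\<in>J. v i)\<^sup>2 \<le> \<tau>\<^sup>2" using sv v0 by (intro power_mono sum_nonneg) auto
    then show ?thesis by simp
  qed
  finally show "(\<integral>q. (\<Sum>i<k. (X q \<bullet> e i)\<^sup>2)\<^sup>2 \<partial>Q) \<le> 3 * \<tau>\<^sup>2" .
qed

lemma norm_moments:
  defines "\<tau> \<equiv> (\<integral>w. (norm (U w))\<^sup>2 \<partial>P)"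
  shows "integrable Q (\<lambda>q. (norm (X q))^4)" "(\<integral>q. (norm (X q))^4 \<partial>Q) \<le> 3 * \<tau>\<^sup>2"
    "integrable Q (\<lambda>q. (norm (X q))\<^sup>2)" "(\<integral>q. (norm (X q))\<^sup>2 \<partial>Q) \<le> \<tau>"
proof -
  note [measurable] = X(1)
  obtain e where o: "orthonormal_or_zero e" and e: "\<And>i. e i \<in> W"
    and lim: "\<And>x. x \<in> W \<Longrightarrow> (\<lambda>k. fourier_sum e k x) \<longlonglongrightarrow> x"
    using closed_subspace_basis[OF W(1)] by blast
  define s where "s k q = (\<Sum>i<k. (X q \<bullet> e i)\<^sup>2)" for k q
  have s: "(\<lambda>k. s k q) \<longlonglongrightarrow> (norm (X q))\<^sup>2" if "q \<in> space Q" for q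
    unfolding s_def by (intro parseval_limit[OF o] lim X that)
  have [measurable]: "s k \<in> borel_measurable Q" for k unfolding s_def by measurable
  have s0: "0 \<le> s k q" for k q unfolding s_def by (intro sum_nonneg) auto
  have "integrable Q (\<lambda>q. (norm (X q))^4) \<and> (\<integral>q. (norm (X q))^4 \<partial>Q) \<le> 3 * \<tau>\<^sup>2"
  proof (rule Q.integrable_limit[where seq="\<lambda>k q. (s k q)\<^sup>2"])
    show "(\<lambda>k. (s k q)\<^sup>2) \<longlonglongrightarrow> (norm (X q))^4" if "q \<in> space Q" for q
      using tendsto_power[OF s[OF that], of 2] by simp
  qed (use partial_fourth_moment(1,2)[OF o e] in \<open>auto simp: s_def \<tau>_def\<close>)
  moreover have "integrable Q (\<lambda>q. (norm (X q))\<^sup>2) \<and> (\<integral>q. (norm (X q))\<^sup>2 \<partial>Q) \<le> \<tau>"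
  proof (rule Q.integrable_limit[where seq=s])
    show "integrable Q (s k)" for k unfolding s_def using X_moments(3)[OF e] by simp
  qed (use s s0 partial_fourth_moment(3)[OF o e] in \<open>auto simp: s_def \<tau>_def\<close>)
  ultimately show "integrable Q (\<lambda>q. (norm (X q))^4)" "(\<integral>q. (norm (X q))^4 \<partial>Q) \<le> 3 * \<tau>\<^sup>2"
    "integrable Q (\<lambda>q. (norm (X q))\<^sup>2)" "(\<integral>q. (norm (X q))\<^sup>2 \<partial>Q) \<le> \<tau>" by auto
qed

text \<open>
  The third moment lies between the second and the fourth, and for a Gaussian element both are controlled by the
  trace of the covariance, that is, by the second moment of \<open>U\<close>.
\<close>

lemma third_moment:
  assumes l: "0 < l" and r: "0 \<le> r" and K: "1 \<le> K"
    and second: "r\<^sup>2 * (\<integral>w. (norm (U w))\<^sup>2 \<partial>P) \<le> K * l\<^sup>2"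
  shows "integrable Q (\<lambda>q. (r * norm (X q))^3)" "(\<integral>q. (r * norm (X q))^3 \<partial>Q) \<le> 2 * K\<^sup>2 * l^3"
proof -
  note [measurable] = X(1)
  define z where "z q = r * norm (X q)" for q
  have [measurable]: "z \<in> borel_measurable Q" unfolding z_def by measurable
  have z0: "0 \<le> z q" for q using r by (simp add: z_def)
  have z4: "integrable Q (\<lambda>q. (z q)^4)" and z2: "integrable Q (\<lambda>q. (z q)\<^sup>2)"
    unfolding z_def power_mult_distrib using norm_moments by auto
  have b: "(z q)^3 \<le> l / 2 * (z q)\<^sup>2 + (z q)^4 / (2 * l)" for q
  proof -
    have "z q \<le> l / 2 + (z q)\<^sup>2 / (2 * l)" using le_square_scaled[OF l, of "z q"] by simp
    then have "(z q)\<^sup>2 * z q \<le> (z q)\<^sup>2 * (l / 2 + (z q)\<^sup>2 / (2 * l))" by (intro mult_left_mono) auto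
    also have "\<dots> = l / 2 * (z q)\<^sup>2 + (z q)^4 / (2 * l)"
      by (simp only: distrib_left) (simp add: power2_eq_square power4_eq_xxxx mult_ac)
    finally show ?thesis by (simp add: power2_eq_square power3_eq_cube)
  qed
  show i: "integrable Q (\<lambda>q. (r * norm (X q))^3)"
    unfolding z_def[symmetric]
  proof (rule dominated_integrable)
    show "integrable Q (\<lambda>q. l / 2 * (z q)\<^sup>2 + (z q)^4 / (2 * l))" using z2 z4 by simp
    show "\<bar>(z q)^3\<bar> \<le> l / 2 * (z q)\<^sup>2 + (z q)^4 / (2 * l)" for q
      using b[of q] zero_le_power[OF z0, of q 3] by (simp only: abs_of_nonneg)
  qed measurable
  have "(\<integral>q. (z q)^3 \<partial>Q) \<le> (\<integral>q. l / 2 * (z q)\<^sup>2 + (z q)^4 / (2 * l) \<partial>Q)"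
    using i z2 z4 b unfolding z_def[symmetric] by (intro integral_mono) auto
  also have "\<dots> = l / 2 * (\<integral>q. (z q)\<^sup>2 \<partial>Q) + (\<integral>q. (z q)^4 \<partial>Q) / (2 * l)" using z2 z4 by simp
  also have "\<dots> \<le> l / 2 * (K * l\<^sup>2) + 3 * (K * l\<^sup>2)\<^sup>2 / (2 * l)"
  proof (intro add_mono mult_left_mono divide_right_mono)
    have "(\<integral>q. (z q)\<^sup>2 \<partial>Q) = r\<^sup>2 * (\<integral>q. (norm (X q))\<^sup>2 \<partial>Q)" unfolding z_def power_mult_distrib by simp
    also have "\<dots> \<le> r\<^sup>2 * (\<integral>w. (norm (U w))\<^sup>2 \<partial>P)" using norm_moments(4) by (intro mult_left_mono) auto
    finally show "(\<integral>q. (z q)\<^sup>2 \<partial>Q) \<le> K * l\<^sup>2" using second by simp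
    have "(\<integral>q. (z q)^4 \<partial>Q) = r^4 * (\<integral>q. (norm (X q))^4 \<partial>Q)" unfolding z_def power_mult_distrib by simp
    also have "\<dots> \<le> r^4 * (3 * (\<integral>w. (norm (U w))\<^sup>2 \<partial>P)\<^sup>2)" using norm_moments(2) by (intro mult_left_mono) auto
    also have "\<dots> = 3 * (r\<^sup>2 * (\<integral>w. (norm (U w))\<^sup>2 \<partial>P))\<^sup>2" by (simp add: power_mult_distrib)
    also have "\<dots> \<le> 3 * (K * l\<^sup>2)\<^sup>2" using second by (intro mult_left_mono power_mono) auto
    finally show "(\<integral>q. (z q)^4 \<partial>Q) \<le> 3 * (K * l\<^sup>2)\<^sup>2" .
  qed (use l in auto)
  also have "\<dots> = (K / 2 + 3 / 2 * K\<^sup>2) * l^3"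
  proof -
    have "3 * (K * l\<^sup>2)\<^sup>2 / (2 * l) = 3 / 2 * K\<^sup>2 * l^3"
      using l by (simp add: power2_eq_square power3_eq_cube)
    moreover have "l / 2 * (K * l\<^sup>2) = K / 2 * l^3" by (simp add: power2_eq_square power3_eq_cube)
    ultimately show ?thesis by (simp only: distrib_right)
  qed
  also have "\<dots> \<le> 2 * K\<^sup>2 * l^3"
  proof (rule mult_right_mono)
    have "1 * K \<le> K * K" using K by (intro mult_right_mono) auto
    then show "K / 2 + 3 / 2 * K\<^sup>2 \<le> 2 * K\<^sup>2" by (simp add: power2_eq_square)
  qed (use l in simp)
  finally show "(\<integral>q. (r * norm (X q))^3 \<partial>Q) \<le> 2 * K\<^sup>2 * l^3" unfolding z_def .
qed

end

section \<open>Random potentials on a compact metrizable space\<close>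

text \<open>
  Every point of a compact metrizable set is the limit of points chosen measurably from one fixed
  sequence: the first member of a dense sequence within distance \<open>1 / Suc n\<close>.
\<close>

lemma compact_metrizable_selection:
  fixes T :: "'p::topological_space set"
  assumes comp: "compact T" and metr: "metrizable_space (top_of_set T)" and ne: "T \<noteq> {}"
    and sets: "sets \<pi> = sets (restrict_space borel T)"
  shows "\<exists>(u :: nat \<Rightarrow> 'p) (s :: nat \<Rightarrow> 'p \<Rightarrow> nat). range u \<subseteq> T \<and>
    (\<forall>n. s n \<in> measurable \<pi> (count_space UNIV)) \<and>
    (\<forall>g t. continuous_on T g \<longrightarrow> t \<in> T \<longrightarrow> (\<lambda>n. g (u (s n t)) :: real) \<longlonglongrightarrow> g t)"
proof -
  obtain M d where "Metric_space M d" and top: "top_of_set T = Metric_space.mtopology M d"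
    using metr by (auto simp: metrizable_space_def)
  interpret Metric_space M d by fact
  have MT: "M = T" using arg_cong[OF top, of topspace] by simp
  have spT: "space \<pi> = T" using sets_eq_imp_space_eq[OF sets] by (simp add: space_restrict_space)
  have "compact_space mtopology" using comp by (metis compact_space_subtopology compactin_euclidean_iff top)
  then have tb: "mtotally_bounded M" by (simp add: compact_space_eq_mcomplete_mtotally_bounded)
  then have "\<forall>n. \<exists>K. finite K \<and> K \<subseteq> M \<and> M \<subseteq> (\<Union>x\<in>K. mball x (1 / Suc n))"
    unfolding mtotally_bounded_def by simp
  then obtain K where K: "\<And>n. finite (K n)" "\<And>n. K n \<subseteq> M" "\<And>n. M \<subseteq> (\<Union>x\<in>K n. mball x (1 / Suc n))"
    by metis
  define D where "D = (\<Union>n. K n)"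
  have "countable D" unfolding D_def using K(1) by (intro countable_UN) (auto intro: countable_finite)
  moreover have "D \<noteq> {}" unfolding D_def using K(3)[of 0] ne MT by fastforce
  ultimately obtain u :: "nat \<Rightarrow> 'p" where u: "range u = D" by (metis range_from_nat_into)
  have uT: "u k \<in> M" for k using u K(2) by (auto simp: D_def)
  have dense: "\<exists>k. d (u k) t < 1 / Suc n" if "t \<in> T" for t n
  proof -
    have "t \<in> (\<Union>x\<in>K n. mball x (1 / Suc n))" using K(3)[of n] that MT by blast
    then obtain x where "x \<in> K n" "d x t < 1 / Suc n" by auto
    moreover have "x \<in> range u" using u \<open>x \<in> K n\<close> by (auto simp: D_def)
    ultimately show ?thesis by auto
  qed
  define s where "s n t = (LEAST k. d (u k) t < 1 / Suc n)" for n t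
  have s: "d (u (s n t)) t < 1 / Suc n" if "t \<in> T" for n t
    unfolding s_def using dense[OF that] by (rule LeastI_ex)
  have "s n \<in> measurable \<pi> (count_space UNIV)" for n
    unfolding s_def
  proof (intro measurable_Least)
    fix k
    have "openin (top_of_set T) (mball (u k) (1 / Suc n))" unfolding top by simp
    then obtain G where "open G" and G: "mball (u k) (1 / Suc n) = T \<inter> G" by (auto simp: openin_open)
    have "{t \<in> space \<pi>. d (u k) t < 1 / Suc n} = T \<inter> G"
      unfolding G[symmetric] spT unfolding MT[symmetric] using uT by auto
    moreover have "T \<inter> G \<in> sets \<pi>" using \<open>open G\<close> unfolding sets by (auto simp: sets_restrict_space)
    ultimately have "{t \<in> space \<pi>. d (u k) t < 1 / Suc n} \<in> sets \<pi>" by simp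
    then show "Measurable.pred \<pi> (\<lambda>t. d (u k) t < 1 / Suc n)" by (simp add: pred_def)
  qed
  moreover have "(\<lambda>n. g (u (s n t)) :: real) \<longlonglongrightarrow> g t" if g: "continuous_on T g" and t: "t \<in> T" for g t
  proof -
    have "limitin mtopology (\<lambda>n. u (s n t)) t sequentially"
      unfolding limit_metric_sequentially
    proof (intro conjI allI impI)
      show "t \<in> M" using t MT by simp
      fix e :: real assume "0 < e"
      then obtain N where N: "1 / Suc N < e" using nat_approx_posE by blast
      show "\<exists>N. \<forall>n\<ge>N. u (s n t) \<in> M \<and> d (u (s n t)) t < e"
      proof (intro exI allI impI conjI uT)
        fix n assume "N \<le> n"
        then have "1 / real (Suc n) \<le> 1 / Suc N" by (simp add: frac_le)
        then show "d (u (s n t)) t < e" using s[OF t, of n] N by linarith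
      qed
    qed
    moreover have "continuous_map mtopology euclidean g" using g by (simp add: top[symmetric])
    ultimately have "limitin euclidean (g \<circ> (\<lambda>n. u (s n t))) (g t) sequentially"
      by (intro continuous_map_limit) auto
    then show ?thesis by (simp add: o_def)
  qed
  moreover have "range u \<subseteq> T" using uT MT by auto
  ultimately show ?thesis by blast
qed

text \<open>
  A function that is measurable in one variable and continuous in the other is the limit of its values at the
  selected points, which are countably many.
\<close>

lemma caratheodory_measurable:
  fixes f :: "'w \<Rightarrow> 'p::topological_space \<Rightarrow> real"
  assumes comp: "compact T" "metrizable_space (top_of_set T)" "T \<noteq> {}" "sets \<pi> = sets (restrict_space borel T)"
    and m: "\<And>t. t \<in> T \<Longrightarrow> (\<lambda>w. f w t) \<in> borel_measurable P"
    and c: "\<And>w. w \<in> space P \<Longrightarrow> continuous_on T (f w)"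
  shows "(\<lambda>(w, t). f w t) \<in> borel_measurable (P \<Otimes>\<^sub>M \<pi>)"
proof -
  obtain u :: "nat \<Rightarrow> 'p" and s :: "nat \<Rightarrow> 'p \<Rightarrow> nat"
    where u: "range u \<subseteq> T" and s[measurable]: "\<And>n. s n \<in> measurable \<pi> (count_space UNIV)"
    and lim: "\<And>g t. continuous_on T g \<Longrightarrow> t \<in> T \<Longrightarrow> (\<lambda>n. g (u (s n t)) :: real) \<longlonglongrightarrow> g t"
    using compact_metrizable_selection[OF comp] by blast
  have spT: "space \<pi> = T" using sets_eq_imp_space_eq[OF comp(4)] by (simp add: space_restrict_space)
  show ?thesis
  proof (rule borel_measurable_LIMSEQ_real)
    show "(\<lambda>n. case_prod (\<lambda>w t. f w (u (s n t))) x) \<longlonglongrightarrow> case_prod f x" if "x \<in> space (P \<Otimes>\<^sub>M \<pi>)" for x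
      using that lim[OF c] by (auto simp: space_pair_measure spT)
    fix n
    have [measurable]: "(\<lambda>w. f w (u k)) \<in> borel_measurable P" for k using m u by auto
    show "case_prod (\<lambda>w t. f w (u (s n t))) \<in> borel_measurable (P \<Otimes>\<^sub>M \<pi>)"
      unfolding case_prod_beta'
      by (rule measurable_compose_countable[where f="\<lambda>k x. f (fst x) (u k)" and g="\<lambda>x. s n (snd x)"]) measurable
  qed
qed

lemma continuous_on_measurable_restrict:
  assumes "sets \<pi> = sets (restrict_space borel T)" "continuous_on T f"
  shows "f \<in> borel_measurable \<pi>"
  using borel_measurable_continuous_on_restrict[OF assms(2)] measurable_cong_sets[OF assms(1) refl] by blast

text \<open>
  The averaged two-replica measure is a mixture of the kernel \<open>w \<mapsto> gibbs \<pi> (Z w) \<Otimes>\<^sub>M gibbs \<pi> (Z w)\<close>, whose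
  measurability is that of the normalised densities.
\<close>

lemma integral_mean_gibbs2:
  fixes \<phi> :: "'t \<Rightarrow> 't \<Rightarrow> real"
  assumes P: "prob_space P" and \<pi>: "prob_space \<pi>"
    and Z[measurable]: "(\<lambda>(w, t). Z w t) \<in> borel_measurable (P \<Otimes>\<^sub>M \<pi>)"
    and b: "\<And>w. w \<in> space P \<Longrightarrow> bounded_potential \<pi> (Z w)"
    and \<phi>[measurable]: "(\<lambda>(s, t). \<phi> s t) \<in> borel_measurable (\<pi> \<Otimes>\<^sub>M \<pi>)"
    and \<phi>b: "\<And>s t. s \<in> space \<pi> \<Longrightarrow> t \<in> space \<pi> \<Longrightarrow> \<bar>\<phi> s t\<bar> \<le> B"
  shows "(\<integral>(s, t). \<phi> s t \<partial>mean_gibbs2 P \<pi> Z) = (\<integral>w. (\<integral>t. (\<integral>s. \<phi> s t \<partial>gibbs \<pi> (Z w)) \<partial>gibbs \<pi> (Z w)) \<partial>P)"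
proof -
  interpret PP: prob_space P by fact
  interpret \<pi>: prob_space \<pi> by fact
  note G = prob_space_gibbs[OF \<pi> b] and sG = sets_gibbs[OF \<pi> b] and spG = space_gibbs[OF \<pi> b]
  have K1: "(\<lambda>w. gibbs \<pi> (Z w)) \<in> measurable P (subprob_algebra \<pi>)"
  proof (rule measurable_subprob_algebra)
    show "subprob_space (gibbs \<pi> (Z w))" if "w \<in> space P" for w
      using G[OF that] by (rule prob_space_imp_subprob_space)
    show "sets (gibbs \<pi> (Z w)) = sets \<pi>" if "w \<in> space P" for w by (rule sG[OF that])
    fix A assume A[measurable]: "A \<in> sets \<pi>"
    have "(\<lambda>w. \<integral>\<^sup>+t. ennreal (exp (Z w t) / (\<integral>s. exp (Z w s) \<partial>\<pi>)) * indicator A t \<partial>\<pi>) \<in> borel_measurable P"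
      by measurable
    then show "(\<lambda>w. emeasure (gibbs \<pi> (Z w)) A) \<in> borel_measurable P"
    proof (subst measurable_cong)
      fix w assume w: "w \<in> space P"
      have [measurable]: "Z w \<in> borel_measurable \<pi>" using b[OF w] by (simp add: bounded_potential_def)
      show "emeasure (gibbs \<pi> (Z w)) A = (\<integral>\<^sup>+t. ennreal (exp (Z w t) / (\<integral>s. exp (Z w s) \<partial>\<pi>)) * indicator A t \<partial>\<pi>)"
        unfolding gibbs_def by (subst emeasure_density) auto
    qed
  qed
  have K: "(\<lambda>w. gibbs \<pi> (Z w) \<Otimes>\<^sub>M gibbs \<pi> (Z w)) \<in> measurable P (subprob_algebra (\<pi> \<Otimes>\<^sub>M \<pi>))"
    by (rule measurable_pair_measure[OF K1 K1])
  have B0: "0 \<le> B" using \<phi>b \<pi>.not_empty by force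
  have "(\<integral>(s, t). \<phi> s t \<partial>mean_gibbs2 P \<pi> Z) = (\<integral>w. (\<integral>(s, t). \<phi> s t \<partial>(gibbs \<pi> (Z w) \<Otimes>\<^sub>M gibbs \<pi> (Z w))) \<partial>P)"
    unfolding mean_gibbs2_def
  proof (rule integral_bind[where K="\<pi> \<Otimes>\<^sub>M \<pi>" and B=B and B'=1])
    show "AE w in P. emeasure (gibbs \<pi> (Z w) \<Otimes>\<^sub>M gibbs \<pi> (Z w)) (space (gibbs \<pi> (Z w) \<Otimes>\<^sub>M gibbs \<pi> (Z w))) \<le> ennreal 1"
    proof (intro AE_I2)
      fix w assume w: "w \<in> space P"
      interpret GG: pair_prob_space "gibbs \<pi> (Z w)" "gibbs \<pi> (Z w)" by (intro pair_prob_spaceI G w)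
      show "emeasure (gibbs \<pi> (Z w) \<Otimes>\<^sub>M gibbs \<pi> (Z w)) (space (gibbs \<pi> (Z w) \<Otimes>\<^sub>M gibbs \<pi> (Z w))) \<le> ennreal 1"
        using GG.P.emeasure_space_1 by simp
    qed
  qed (use \<phi>b K PP.finite_measure_axioms in \<open>auto simp: space_pair_measure\<close>)
  also have "\<dots> = (\<integral>w. (\<integral>t. (\<integral>s. \<phi> s t \<partial>gibbs \<pi> (Z w)) \<partial>gibbs \<pi> (Z w)) \<partial>P)"
  proof (intro Bochner_Integration.integral_cong refl)
    fix w assume w: "w \<in> space P"
    interpret GG: pair_prob_space "gibbs \<pi> (Z w)" "gibbs \<pi> (Z w)" by (intro pair_prob_spaceI G w)
    note [measurable_cong] = sG[OF w]
    have "integrable (gibbs \<pi> (Z w) \<Otimes>\<^sub>M gibbs \<pi> (Z w)) (\<lambda>(s, t). \<phi> s t)"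
      using \<phi>b by (intro GG.P.abs_integral_le_bound(1)[where B=B]) (auto simp: space_pair_measure spG[OF w])
    from GG.integral_snd[OF this]
    show "(\<integral>(s, t). \<phi> s t \<partial>(gibbs \<pi> (Z w) \<Otimes>\<^sub>M gibbs \<pi> (Z w))) = (\<integral>t. (\<integral>s. \<phi> s t \<partial>gibbs \<pi> (Z w)) \<partial>gibbs \<pi> (Z w))"
      by simp
  qed
  finally show ?thesis .
qed

section \<open>The moment bounds at one parameter\<close>

text \<open>The norm of a strongly measurable random operator is a supremum over a countable dense set.\<close>

lemma measurable_op_norm:
  fixes V :: "'w \<Rightarrow> ('h::{real_inner, second_countable_topology} \<Rightarrow>\<^sub>L 'h)"
  assumes V[measurable]: "\<And>h. (\<lambda>w. blinfun_apply (V w) h) \<in> borel_measurable M"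
  shows "(\<lambda>w. norm (V w)) \<in> borel_measurable M"
  unfolding borel_measurable_iff_le
proof
  fix c :: real
  obtain D :: "'h set" where D: "countable D" "\<And>X. open X \<Longrightarrow> X \<noteq> {} \<Longrightarrow> \<exists>d\<in>D. d \<in> X"
    using countable_dense_setE by blast
  have "D \<noteq> {}" using D(2)[of UNIV] by auto
  then obtain e :: "nat \<Rightarrow> 'h" where e: "range e = D" using D(1) by (metis range_from_nat_into)
  show "{w \<in> space M. norm (V w) \<le> c} \<in> sets M"
  proof (cases "0 \<le> c")
    case True
    have "norm (V w) \<le> c \<longleftrightarrow> (\<forall>x\<in>D. norm (blinfun_apply (V w) x) \<le> c * norm x)" for w
    proof
      assume "norm (V w) \<le> c"
      then show "\<forall>x\<in>D. norm (blinfun_apply (V w) x) \<le> c * norm x"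
        using norm_blinfun[of "V w"] by (meson mult_right_mono norm_ge_zero order_trans)
    next
      assume le: "\<forall>x\<in>D. norm (blinfun_apply (V w) x) \<le> c * norm x"
      show "norm (V w) \<le> c"
      proof (rule norm_blinfun_bound[OF True], rule ccontr)
        fix x assume "\<not> norm (blinfun_apply (V w) x) \<le> c * norm x"
        then have ne: "{y. c * norm y < norm (blinfun_apply (V w) y)} \<noteq> {}" by (auto simp: not_le)
        have "open {y. c * norm y < norm (blinfun_apply (V w) y)}"
          by (intro open_Collect_less continuous_intros)
        from D(2)[OF this ne] show False using le by force
      qed
    qed
    then have "{w \<in> space M. norm (V w) \<le> c} = {w \<in> space M. \<forall>x\<in>D. norm (blinfun_apply (V w) x) \<le> c * norm x}"
      by simp
    also have "\<dots> = {w \<in> space M. \<forall>k. norm (blinfun_apply (V w) (e k)) \<le> c * norm (e k)}"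
      unfolding e[symmetric] by simp
    also have "\<dots> \<in> sets M" by measurable
    finally show ?thesis .
  next
    case False
    have "\<not> norm (V w) \<le> c" for w using False norm_ge_zero[of "V w"] by linarith
    then have "{w \<in> space M. norm (V w) \<le> c} = {}" by blast
    then show ?thesis by (simp only: sets.empty_sets)
  qed
qed

lemma abs_moment_eq:
  assumes "(\<lambda>w. norm (f w)) \<in> borel_measurable M" "abs_moment M k f < \<top>"
  shows "integrable M (\<lambda>w. norm (f w) ^ k)" "abs_moment M k f = ennreal (\<integral>w. norm (f w) ^ k \<partial>M)"
proof -
  show i: "integrable M (\<lambda>w. norm (f w) ^ k)"
    using assms by (intro integrableI_nonneg) (auto simp: abs_moment_def)
  show "abs_moment M k f = ennreal (\<integral>w. norm (f w) ^ k \<partial>M)"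
    unfolding abs_moment_def by (intro nn_integral_eq_integral i) auto
qed

lemma ennreal_scaled_finite:
  assumes "ennreal x * a \<le> ennreal y" "0 < x" shows "a < \<top>"
proof (rule ccontr)
  assume "\<not> a < \<top>"
  then have "a = \<top>" by (metis top.not_eq_extremum)
  then have "ennreal x * a = \<top>" using assms(2) by (simp add: ennreal_mult_eq_top_iff ennreal_mult_top)
  then show False using assms(1) by (simp add: top_unique)
qed

lemma abs_moment_bound:
  assumes f: "(\<lambda>w. norm (f w)) \<in> borel_measurable M" and le: "ennreal x * abs_moment M k f \<le> ennreal y" and x: "0 < x" and y: "0 \<le> y"
  shows "integrable M (\<lambda>w. norm (f w) ^ k)" "x * (\<integral>w. norm (f w) ^ k \<partial>M) \<le> y"
proof -
  note e = abs_moment_eq[OF f ennreal_scaled_finite[OF le x]]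
  show "integrable M (\<lambda>w. norm (f w) ^ k)" by (rule e)
  have "ennreal (x * (\<integral>w. norm (f w) ^ k \<partial>M)) \<le> ennreal y"
    using le x unfolding e(2) by (simp add: ennreal_mult)
  then show "x * (\<integral>w. norm (f w) ^ k \<partial>M) \<le> y" using y by (simp add: ennreal_le_iff)
qed

lemma abs_moment_pair_bound:
  assumes f: "(\<lambda>w. norm (f w)) \<in> borel_measurable M" "(\<lambda>w. norm (f w)) \<in> borel_measurable N"
    and le: "ennreal x * (abs_moment M k f + abs_moment N k f) \<le> ennreal y" and x: "0 < x" and y: "0 \<le> y"
  shows "integrable M (\<lambda>w. norm (f w) ^ k)" "integrable N (\<lambda>w. norm (f w) ^ k)"
    "x * ((\<integral>w. norm (f w) ^ k \<partial>M) + (\<integral>w. norm (f w) ^ k \<partial>N)) \<le> y"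
proof -
  have "abs_moment M k f + abs_moment N k f < \<top>" by (rule ennreal_scaled_finite[OF le x])
  then have fin: "abs_moment M k f < \<top>" "abs_moment N k f < \<top>" by auto
  note e = abs_moment_eq[OF f(1) fin(1)] abs_moment_eq[OF f(2) fin(2)]
  show "integrable M (\<lambda>w. norm (f w) ^ k)" "integrable N (\<lambda>w. norm (f w) ^ k)" by (rule e)+
  have "ennreal (x * ((\<integral>w. norm (f w) ^ k \<partial>M) + (\<integral>w. norm (f w) ^ k \<partial>N))) \<le> ennreal y"
    using le x unfolding e(2) e(4) by (simp add: ennreal_mult ennreal_plus flip: ennreal_plus)
  then show "x * ((\<integral>w. norm (f w) ^ k \<partial>M) + (\<integral>w. norm (f w) ^ k \<partial>N)) \<le> y" using y by (simp add: ennreal_le_iff)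
qed

lemma ennsqrt_moment_bound:
  assumes f: "(\<lambda>w. norm (f w)) \<in> borel_measurable M"
    and le: "ennreal x * ennsqrt (abs_moment M 2 f) \<le> ennreal y" and x: "0 < x" and y: "0 \<le> y"
  shows "integrable M (\<lambda>w. (norm (f w))\<^sup>2)" "x\<^sup>2 * (\<integral>w. (norm (f w))\<^sup>2 \<partial>M) \<le> y\<^sup>2"
proof -
  have "ennsqrt (abs_moment M 2 f) < \<top>" by (rule ennreal_scaled_finite[OF le x])
  then have fin: "abs_moment M 2 f < \<top>" by (auto simp: ennsqrt_def less_top split: if_splits)
  note e = abs_moment_eq[OF f fin]
  show "integrable M (\<lambda>w. (norm (f w))\<^sup>2)" by (rule e)
  let ?I = "\<integral>w. (norm (f w))\<^sup>2 \<partial>M"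
  have I0: "0 \<le> ?I" by simp
  have "ennsqrt (abs_moment M 2 f) = ennreal (sqrt ?I)"
    unfolding e(2) ennsqrt_def by simp
  then have "ennreal (x * sqrt ?I) \<le> ennreal y" using le x by (simp add: ennreal_mult)
  then have "x * sqrt ?I \<le> y" using y by (simp add: ennreal_le_iff)
  then have "(x * sqrt ?I)\<^sup>2 \<le> y\<^sup>2" using x I0 by (intro power_mono) auto
  then show "x\<^sup>2 * ?I \<le> y\<^sup>2" using I0 by (simp add: power_mult_distrib)
qed

text \<open>
  One model, one parameter \<open>\<theta>\<close> and numerical values \<open>c\<close> and \<open>d\<close> of the moment bounds. That \<open>d\<close> is
  strictly positive gives a positive length scale for the third moments.
\<close>

locale likelihood_point = local_likelihood_model E
  for E :: "('p::topological_space, 'w, 'h::{real_inner, banach, second_countable_topology}) lik_model" +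
  fixes \<theta> :: 'p and c d :: real
  assumes \<theta>: "\<theta> \<in> params E" and c: "1 \<le> c" and d: "0 < d"
    and U_mean: "\<And>m. m \<in> comps E \<Longrightarrow> (\<integral>w. Uvec E m w \<partial>null_law E m) = 0"
    and L_bound: "\<And>m. m \<in> comps E \<Longrightarrow> momL E m \<le> ennreal c"
    and err_bound: "\<And>m. m \<in> comps E \<Longrightarrow>
      errU E \<theta> m + errS E \<theta> m + errV E \<theta> m + errR E \<theta> m + errD E \<theta> m \<le> ennreal d"
begin

abbreviation r :: real where "r \<equiv> radius E"
abbreviation W :: "nat \<Rightarrow> 'h set" where "W \<equiv> hspace E"
abbreviation P0 :: "nat \<Rightarrow> 'w measure" where "P0 \<equiv> null_law E"
abbreviation P1 :: "nat \<Rightarrow> 'w measure" where "P1 \<equiv> law E \<theta>"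
abbreviation \<pi> :: "'p measure" where "\<pi> \<equiv> prior E"
abbreviation T :: "'p set" where "T \<equiv> idx E"
abbreviation ll :: "nat \<Rightarrow> 'w \<Rightarrow> real" where
  "ll m w \<equiv> Svec E m w \<bullet> feat E m \<theta> + Drem E m \<theta> w"

lemma finite_comps: "finite (comps E)" and comps_ne: "comps E \<noteq> {}" and card_comps: "card (comps E) = ncomp E"
  using ncomp_pos by (auto simp: comps_def)

lemma r_pos: "0 < r" by (rule radius_pos)

lemma space_prior: "space \<pi> = T"
  using sets_eq_imp_space_eq[OF sets_prior] by (simp add: space_restrict_space)

lemma T_ne: "T \<noteq> {}"
  using prob_space.not_empty[OF prob_prior] by (simp add: space_prior)

lemma T_params: "t \<in> T \<Longrightarrow> t \<in> params E" using idx_subset by auto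

lemma norm_feat_le: "m \<in> comps E \<Longrightarrow> t \<in> params E \<Longrightarrow> norm (feat E m t) \<le> r"
proof -
  assume m: "m \<in> comps E" and t: "t \<in> params E"
  have "compact ((\<lambda>u. norm (feat E m u)) ` params E)"
    using feat_cont[OF m] compact_params by (intro compact_continuous_image continuous_intros)
  then have "bdd_above ((\<lambda>u. norm (feat E m u)) ` params E)" by (intro bounded_imp_bdd_above compact_imp_bounded)
  then have "norm (feat E m t) \<le> (SUP u\<in>params E. norm (feat E m u))" using t by (intro cSUP_upper)
  also have "\<dots> \<le> r" unfolding radius_def using m finite_comps by (intro Max_ge) auto
  finally show ?thesis .
qed

context
  fixes m assumes m: "m \<in> comps E"
begin

lemma U_m [measurable]: "Uvec E m \<in> borel_measurable (P0 m)" and S_m [measurable]: "Svec E m \<in> borel_measurable (P0 m)"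
  and V_m [measurable]: "(\<lambda>w. blinfun_apply (Vop E m w) h) \<in> borel_measurable (P0 m)"
  and V_norm [measurable]: "(\<lambda>w. norm (Vop E m w)) \<in> borel_measurable (P0 m)"
  and D_m [measurable]: "Drem E m \<theta> \<in> borel_measurable (P0 m)"
  using U_meas[OF m] S_meas[OF m] V_meas[OF m] D_meas[OF m \<theta>] measurable_op_norm[OF V_meas[OF m]] by auto

lemma R_m: "t \<in> T \<Longrightarrow> Rrem E m t \<in> borel_measurable (P0 m)"
  by (rule R_meas[OF m])

lemma tilted: "tilted_law (P0 m) (P1 m) (ll m)"
  unfolding tilted_law_def tilted_law_axioms_def
  using prob_null[OF m] prob_law[OF m \<theta>] by (auto simp: law_def)

lemma sets_P1: "sets (P1 m) = sets (P0 m)" and space_P1: "space (P1 m) = space (P0 m)"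
  by (simp_all add: law_def)

lemma P1_meas: "f \<in> borel_measurable (P0 m) \<Longrightarrow> f \<in> borel_measurable (P1 m)"
  by (simp add: measurable_cong_sets[OF sets_P1 refl])

lemma err_parts:
  "errU E \<theta> m \<le> ennreal d" "errS E \<theta> m \<le> ennreal d" "errV E \<theta> m \<le> ennreal d" "errR E \<theta> m \<le> ennreal d" "errD E \<theta> m \<le> ennreal d"
proof -
  have "a + b + x + y + z \<le> e \<Longrightarrow> a \<le> e \<and> b \<le> e \<and> x \<le> e \<and> y \<le> e \<and> z \<le> e" for a b x y z e :: ennreal
    by (meson le_add_same_cancel1 add_increasing add_increasing2 order_trans zero_le order_refl)
  from this[OF err_bound[OF m]]
  show "errU E \<theta> m \<le> ennreal d" "errS E \<theta> m \<le> ennreal d" "errV E \<theta> m \<le> ennreal d" "errR E \<theta> m \<le> ennreal d" "errD E \<theta> m \<le> ennreal d"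
    by auto
qed

lemma second_moments:
  "integrable (P0 m) (\<lambda>w. (norm (Uvec E m w))\<^sup>2)" "(\<integral>w. (norm (Uvec E m w))\<^sup>2 \<partial>P0 m) \<le> c"
  "integrable (P0 m) (\<lambda>w. (norm (Svec E m w))\<^sup>2)" "(\<integral>w. (norm (Svec E m w))\<^sup>2 \<partial>P0 m) \<le> c"
proof -
  have "ennreal 1 * abs_moment (P0 m) 2 (Uvec E m) \<le> ennreal c" "ennreal 1 * abs_moment (P0 m) 2 (Svec E m) \<le> ennreal c"
    using L_bound[OF m] unfolding momL_def by (auto intro: order_trans[rotated])
  then show "integrable (P0 m) (\<lambda>w. (norm (Uvec E m w))\<^sup>2)" "(\<integral>w. (norm (Uvec E m w))\<^sup>2 \<partial>P0 m) \<le> c"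
    "integrable (P0 m) (\<lambda>w. (norm (Svec E m w))\<^sup>2)" "(\<integral>w. (norm (Svec E m w))\<^sup>2 \<partial>P0 m) \<le> c"
    using abs_moment_bound[of "Uvec E m" "P0 m" 1 2 c] abs_moment_bound[of "Svec E m" "P0 m" 1 2 c] c by auto
qed

text \<open>
  All error terms carry powers of \<open>r\<close> which make the corresponding contribution to the local process of
  third moment at most \<open>r\<^sup>2 d\<close>.
\<close>

lemma cubes_scaledI:
  assumes f: "f \<in> borel_measurable (P0 m)"
    and x: "0 < x" and y: "0 \<le> y" and le: "ennreal x * (abs_moment (P0 m) 3 F + abs_moment (P1 m) 3 F) \<le> ennreal d"
    and F: "\<And>w. \<bar>f w\<bar> = y * norm (F w)" "(\<lambda>w. norm (F w)) \<in> borel_measurable (P0 m)" and yx: "y^3 = r\<^sup>2 * x"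
  shows "tilted_law.cubes (P0 m) (P1 m) (r\<^sup>2 * d) f"
proof -
  note b = abs_moment_pair_bound[OF F(2) P1_meas[OF F(2)] le x less_imp_le[OF d]]
  have "(\<integral>w. \<bar>f w\<bar>^3 \<partial>P0 m) + (\<integral>w. \<bar>f w\<bar>^3 \<partial>P1 m) = r\<^sup>2 * (x * ((\<integral>w. norm (F w) ^ 3 \<partial>P0 m) + (\<integral>w. norm (F w) ^ 3 \<partial>P1 m)))"
    unfolding F(1) power_mult_distrib yx using b by (simp add: algebra_simps)
  also have "\<dots> \<le> r\<^sup>2 * d" using b(3) by (intro mult_left_mono) auto
  finally show ?thesis
    unfolding tilted_law.cubes_def[OF tilted] using f b(1,2) by (auto simp: F(1) power_mult_distrib)
qed

lemma cubes_U: "tilted_law.cubes (P0 m) (P1 m) (r\<^sup>2 * d) (\<lambda>w. r * norm (Uvec E m w))"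
  using err_parts(1) r_pos unfolding errU_def
  by (intro cubes_scaledI[where x=r and y=r and F="Uvec E m"]) (auto simp: power2_eq_square power3_eq_cube)

lemma cubes_S: "tilted_law.cubes (P0 m) (P1 m) (r\<^sup>2 * d) (\<lambda>w. r * norm (Svec E m w))"
  using err_parts(2) r_pos unfolding errS_def
  by (intro cubes_scaledI[where x=r and y=r and F="Svec E m"]) (auto simp: power2_eq_square power3_eq_cube)

lemma cubes_V: "tilted_law.cubes (P0 m) (P1 m) (r\<^sup>2 * d) (\<lambda>w. r\<^sup>2 * norm (Vop E m w))"
proof (rule cubes_scaledI[where x="r^4" and y="r\<^sup>2" and F="Vop E m"])
  show "ennreal (r ^ 4) * (abs_moment (P0 m) 3 (Vop E m) + abs_moment (P1 m) 3 (Vop E m)) \<le> ennreal d"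
    using err_parts(3) unfolding errV_def by (rule order_trans[rotated]) simp
  show "(r\<^sup>2) ^ 3 = r\<^sup>2 * r ^ 4" by (simp flip: power_mult power_add)
qed (use r_pos in auto)

lemma V_second: "integrable (P0 m) (\<lambda>w. (r\<^sup>2 * norm (Vop E m w))\<^sup>2)" "(\<integral>w. (r\<^sup>2 * norm (Vop E m w))\<^sup>2 \<partial>P0 m) \<le> r\<^sup>2 * d\<^sup>2"
proof -
  have "ennreal r * ennsqrt (abs_moment (P0 m) 2 (Vop E m)) \<le> ennreal d"
    using err_parts(3) unfolding errV_def by (rule order_trans[rotated]) simp
  note b = ennsqrt_moment_bound[OF V_norm this r_pos less_imp_le[OF d]]
  show "integrable (P0 m) (\<lambda>w. (r\<^sup>2 * norm (Vop E m w))\<^sup>2)" using b(1) by (simp add: power_mult_distrib)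
  have "(\<integral>w. (r\<^sup>2 * norm (Vop E m w))\<^sup>2 \<partial>P0 m) = r\<^sup>2 * (r\<^sup>2 * (\<integral>w. (norm (Vop E m w))\<^sup>2 \<partial>P0 m))"
  proof -
    have "(\<integral>w. (r\<^sup>2 * norm (Vop E m w))\<^sup>2 \<partial>P0 m) = (r\<^sup>2)\<^sup>2 * (\<integral>w. (norm (Vop E m w))\<^sup>2 \<partial>P0 m)"
      by (simp add: power_mult_distrib)
    also have "\<dots> = r\<^sup>2 * (r\<^sup>2 * (\<integral>w. (norm (Vop E m w))\<^sup>2 \<partial>P0 m))" by (simp only: power2_eq_square mult.assoc)
    finally show ?thesis .
  qed
  also have "\<dots> \<le> r\<^sup>2 * d\<^sup>2" using b(2) by (intro mult_left_mono) auto
  finally show "(\<integral>w. (r\<^sup>2 * norm (Vop E m w))\<^sup>2 \<partial>P0 m) \<le> r\<^sup>2 * d\<^sup>2" .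
qed

lemma inverse_r_second:
  fixes f :: "'w \<Rightarrow> real"
  assumes f: "f \<in> borel_measurable (P0 m)" and le: "ennreal (1 / r) * ennsqrt (abs_moment (P0 m) 2 f) \<le> ennreal d"
  shows "(\<integral>w. (f w)\<^sup>2 \<partial>P0 m) \<le> r\<^sup>2 * d\<^sup>2"
proof -
  have "(1 / r)\<^sup>2 * (\<integral>w. (norm (f w))\<^sup>2 \<partial>P0 m) \<le> d\<^sup>2"
    using f by (intro ennsqrt_moment_bound(2)[OF _ le]) (use r_pos d in auto)
  then show ?thesis using r_pos by (simp add: field_simps)
qed

lemma cubes_D: "tilted_law.cubes (P0 m) (P1 m) (r\<^sup>2 * d) (Drem E m \<theta>)"
proof (rule cubes_scaledI[where x="1 / r^2" and y=1 and F="Drem E m \<theta>"])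
  show "ennreal (1 / r\<^sup>2) * (abs_moment (P0 m) 3 (Drem E m \<theta>) + abs_moment (P1 m) 3 (Drem E m \<theta>)) \<le> ennreal d"
    using err_parts(5) unfolding errD_def by (rule order_trans[rotated]) simp
qed (use r_pos in auto)

lemma D_second: "(\<integral>w. (Drem E m \<theta> w)\<^sup>2 \<partial>P0 m) \<le> r\<^sup>2 * d\<^sup>2"
  using err_parts(5) unfolding errD_def by (intro inverse_r_second) (auto intro: order_trans[rotated])

lemma sup_R_bound: "(\<integral>\<^sup>+w. (SUP t\<in>T. ennreal (\<bar>Rrem E m t w\<bar> ^ 3)) \<partial>P1 m) \<le> ennreal (r\<^sup>2 * d)"
proof -
  let ?J = "\<integral>\<^sup>+w. (SUP t\<in>T. ennreal (\<bar>Rrem E m t w\<bar> ^ 3)) \<partial>P1 m"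
  have "ennreal (1 / r\<^sup>2) * ?J \<le> ennreal d"
    using err_parts(4) unfolding errR_def by (rule order_trans[rotated]) simp
  then have "ennreal (r\<^sup>2) * (ennreal (1 / r\<^sup>2) * ?J) \<le> ennreal (r\<^sup>2) * ennreal d" by (intro mult_left_mono) auto
  moreover have "ennreal (r\<^sup>2) * (ennreal (1 / r\<^sup>2) * ?J) = ?J"
    using r_pos by (simp add: mult.assoc[symmetric] ennreal_mult[symmetric])
  ultimately show ?thesis using d by (simp add: ennreal_mult)
qed

context
  fixes t assumes t: "t \<in> T"
begin

lemma R_parts:
  "ennreal (1 / r\<^sup>2) * ennreal \<bar>\<integral>w. Rrem E m t w \<partial>P0 m\<bar>
    + ennreal (1 / r) * ennsqrt (abs_moment (P0 m) 2 (Rrem E m t))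
    + ennreal (1 / r\<^sup>2) * (abs_moment (P0 m) 3 (Rrem E m t) + abs_moment (P1 m) 3 (Rrem E m t)) \<le> ennreal d"
proof -
  have "abs_moment (P1 m) 3 (Rrem E m t) \<le> (\<integral>\<^sup>+w. (SUP t\<in>T. ennreal (\<bar>Rrem E m t w\<bar> ^ 3)) \<partial>P1 m)"
    unfolding abs_moment_def using t by (intro nn_integral_mono) (auto intro!: SUP_upper2[of t])
  then have "ennreal (1 / r\<^sup>2) * ennreal \<bar>\<integral>w. Rrem E m t w \<partial>P0 m\<bar>
    + ennreal (1 / r) * ennsqrt (abs_moment (P0 m) 2 (Rrem E m t))
    + ennreal (1 / r\<^sup>2) * abs_moment (P0 m) 3 (Rrem E m t) + ennreal (1 / r\<^sup>2) * abs_moment (P1 m) 3 (Rrem E m t) \<le> errR E \<theta> m"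
    unfolding errR_def using t by (intro add_mono mult_left_mono SUP_upper2[of t]) auto
  then show ?thesis using err_parts(4) by (simp add: distrib_left add.assoc)
qed

lemma R_mean: "\<bar>\<integral>w. Rrem E m t w \<partial>P0 m\<bar> \<le> r\<^sup>2 * d"
proof -
  have "ennreal (1 / r\<^sup>2) * ennreal \<bar>\<integral>w. Rrem E m t w \<partial>P0 m\<bar> \<le> ennreal d"
    using R_parts by (rule order_trans[rotated]) (simp add: add.assoc)
  then have "ennreal (1 / r\<^sup>2 * \<bar>\<integral>w. Rrem E m t w \<partial>P0 m\<bar>) \<le> ennreal d"
    using r_pos by (subst ennreal_mult) auto
  then have "1 / r\<^sup>2 * \<bar>\<integral>w. Rrem E m t w \<partial>P0 m\<bar> \<le> d" using d by (simp only: ennreal_le_iff less_imp_le)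
  then show ?thesis using r_pos by (simp add: field_simps)
qed

lemma R_second: "(\<integral>w. (Rrem E m t w)\<^sup>2 \<partial>P0 m) \<le> r\<^sup>2 * d\<^sup>2"
proof (rule inverse_r_second[OF R_m[OF t]])
  show "ennreal (1 / r) * ennsqrt (abs_moment (P0 m) 2 (Rrem E m t)) \<le> ennreal d"
    using R_parts by (rule order_trans[rotated]) (simp add: add.assoc add_increasing)
qed

lemma cubes_R: "tilted_law.cubes (P0 m) (P1 m) (r\<^sup>2 * d) (Rrem E m t)"
proof (rule cubes_scaledI[where x="1 / r^2" and y=1 and F="Rrem E m t"])
  show "ennreal (1 / r\<^sup>2) * (abs_moment (P0 m) 3 (Rrem E m t) + abs_moment (P1 m) 3 (Rrem E m t)) \<le> ennreal d"
    using R_parts by (rule order_trans[rotated]) simp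
qed (use r_pos R_m[OF t] in auto)

end

end

end

section \<open>The forms of the Gaussian counterpart\<close>

lemma sum4_cube_le:
  fixes x1 x2 x3 x4 :: real
  assumes "0 \<le> x1" "0 \<le> x2" "0 \<le> x3" "0 \<le> x4"
  shows "(x1 + x2 + x3 + x4)^3 \<le> 64 * (x1^3 + x2^3 + x3^3 + x4^3)"
proof -
  define M where "M = max (max x1 x2) (max x3 x4)"
  have M: "x1 \<le> M" "x2 \<le> M" "x3 \<le> M" "x4 \<le> M" by (auto simp: M_def)
  have "(x1 + x2 + x3 + x4)^3 \<le> (4 * M)^3" using assms M by (intro power_mono) auto
  also have "\<dots> = 64 * M^3" by (simp add: power_mult_distrib)
  also have "M^3 \<le> x1^3 + x2^3 + x3^3 + x4^3"
    using assms zero_le_power[of x1 3] zero_le_power[of x2 3] zero_le_power[of x3 3] zero_le_power[of x4 3]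
    unfolding M_def max_def by auto
  finally show ?thesis by simp
qed

text \<open>As a measurability rule this lemma would match every real function.\<close>

declare Z_measurable [measurable del]

text \<open>The factorisation through \<open>\<Sigma>\<close> enters as \<open>H_fac\<close>; \<open>hb\<close> bounds the norms of the factors.\<close>

locale gaussian_comparison = likelihood_point E \<theta> c d + Q: prob_space Q
  for E :: "('p::topological_space, 'w, 'h::{real_inner, banach, second_countable_topology}) lik_model"
    and \<theta> c d and Q :: "'q measure" +
  fixes \<xi> :: "'q \<Rightarrow> nat \<Rightarrow> 'h" and H B :: "nat \<Rightarrow> 'h \<Rightarrow>\<^sub>L 'h" and a hb :: real
  assumes gauss: "gaussian_element E Q \<xi>"
    and H_sa: "\<And>m. m \<in> comps E \<Longrightarrow> selfadjoint_op (H m)"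
    and B_op: "\<And>m. m \<in> comps E \<Longrightarrow> operator_on (hspace E m) (B m)"
    and H_fac: "\<And>m. m \<in> comps E \<Longrightarrow> H m = Sigmaop E m o\<^sub>L B m"
    and a_le: "\<bar>a\<bar> \<le> 1" and hb: "0 \<le> hb" and B_le: "\<And>m. m \<in> comps E \<Longrightarrow> norm (B m) \<le> hb"
begin

text \<open>
  All later errors are multiples of powers of \<open>K\<close>; the cube accounts for third moments of inner products
  with vectors of norm up to \<open>(1 + hb) * r\<close>, and the factor 8 for sums of two functions.
\<close>

definition K :: real where "K = 8 * (1 + hb)^3 * c"
text \<open>The length scale of one component: third moments are of order \<open>lam\<^sup>3\<close>.\<close>

definition lam :: real where "lam = root 3 (r\<^sup>2 * d)"
definition Bf :: "nat \<Rightarrow> 'p \<Rightarrow> 'h" where "Bf m t = blinfun_apply (B m) (feat E m t)"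
text \<open>Adding \<open>\<beta>\<close> times the perturbation moves the feature \<open>\<eta>(t)\<close> to \<open>\<eta>(t) + \<beta> B \<eta>(t)\<close>.\<close>

definition psi :: "real \<Rightarrow> nat \<Rightarrow> 'p \<Rightarrow> 'h" where "psi \<beta> m t = feat E m t + \<beta> *\<^sub>R Bf m t"
definition aform :: "nat \<Rightarrow> 'h \<Rightarrow> real" where
  "aform m x = (\<integral>w. (Uvec E m w \<bullet> x) * (Svec E m w \<bullet> feat E m \<theta>) \<partial>P0 m)"
definition vq :: "nat \<Rightarrow> 'p \<Rightarrow> 'w \<Rightarrow> real" where
  "vq m t w = - 1 / 2 * (blinfun_apply (Vop E m w) (feat E m t) \<bullet> feat E m t)"
definition kbar :: "nat \<Rightarrow> 'p \<Rightarrow> real" where "kbar m t = (\<integral>w. vq m t w \<partial>P0 m)"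
definition cov :: "nat \<Rightarrow> 'h \<Rightarrow> 'h \<Rightarrow> real" where
  "cov m x y = (\<integral>w. (Uvec E m w \<bullet> x) * (Uvec E m w \<bullet> y) \<partial>P0 m)"
definition rho :: "nat \<Rightarrow> 'p \<Rightarrow> real" where "rho m t = (\<integral>w. Rrem E m t w \<partial>P1 m)"

lemma lam_pos: "0 < lam" and lam3: "lam^3 = r\<^sup>2 * d"
proof -
  have "0 < r\<^sup>2 * d" using r_pos d by simp
  then show "0 < lam" "lam^3 = r\<^sup>2 * d" unfolding lam_def by (auto intro: real_root_pow_pos)
qed

lemma K_ge: "8 \<le> K" "1 \<le> K" "8 * (1 + hb)^3 \<le> K" "(1 + hb)^2 * c \<le> K"
proof -
  have 1: "1 \<le> (1 + hb)^3" "(1 + hb)^2 \<le> (1 + hb)^3" using hb by (auto intro!: one_le_power power_increasing)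
  have "8 * (1 + hb)^3 * 1 \<le> 8 * (1 + hb)^3 * c" using 1 c hb by (intro mult_left_mono) auto
  then show "8 * (1 + hb)^3 \<le> K" by (simp add: K_def)
  then show "8 \<le> K" "1 \<le> K" using 1 by linarith+
  have "(1 + hb)^2 * c \<le> (1 + hb)^3 * c" using 1 c by (intro mult_right_mono) auto
  also have "\<dots> \<le> K" using 1 c hb mult_nonneg_nonneg[of c "(1 + hb)^3"] by (simp add: K_def mult.commute)
  finally show "(1 + hb)^2 * c \<le> K" .
qed

context
  fixes m assumes m: "m \<in> comps E"
begin

lemmas meas_m [measurable] = U_m[OF m] S_m[OF m] V_m[OF m] V_norm[OF m] D_m[OF m] R_m[OF m]

interpretation TL: tilted_law "P0 m" "P1 m" "ll m" by (rule tilted[OF m])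

lemma W_m: "subspace (W m)" "closed (W m)"
  by (rule subspace_hspace[OF m] closed_hspace[OF m])+

lemma Bf_in: "Bf m t \<in> W m"
  using B_op[OF m] by (auto simp: operator_on_def Bf_def)

lemma psi_in: "t \<in> params E \<Longrightarrow> psi \<beta> m t \<in> W m"
  unfolding psi_def by (intro subspace_add subspace_scale W_m feat_in m Bf_in)

lemma norm_Bf_le: "t \<in> params E \<Longrightarrow> norm (Bf m t) \<le> hb * r"
proof -
  assume t: "t \<in> params E"
  have "norm (Bf m t) \<le> norm (B m) * norm (feat E m t)" unfolding Bf_def by (rule norm_blinfun)
  also have "\<dots> \<le> hb * r" using B_le[OF m] norm_feat_le[OF m t] hb by (intro mult_mono) auto
  finally show ?thesis .
qed

lemma norm_feat_le': "t \<in> params E \<Longrightarrow> norm (feat E m t) \<le> (1 + hb) * r"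
proof -
  assume t: "t \<in> params E"
  have "1 * r \<le> (1 + hb) * r" using hb r_pos by (intro mult_right_mono) auto
  then show ?thesis using norm_feat_le[OF m t] by simp
qed

lemma norm_Bf_le': "t \<in> params E \<Longrightarrow> norm (Bf m t) \<le> (1 + hb) * r"
  using norm_Bf_le[of t] r_pos by (simp add: algebra_simps)

lemma norm_psi_le: "t \<in> params E \<Longrightarrow> \<bar>\<beta>\<bar> \<le> 1 \<Longrightarrow> norm (psi \<beta> m t) \<le> (1 + hb) * r"
proof -
  assume t: "t \<in> params E" and b: "\<bar>\<beta>\<bar> \<le> 1"
  have "norm (psi \<beta> m t) \<le> norm (feat E m t) + \<bar>\<beta>\<bar> * norm (Bf m t)"
    unfolding psi_def using norm_triangle_ineq[of "feat E m t" "\<beta> *\<^sub>R Bf m t"] by simp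
  also have "\<bar>\<beta>\<bar> * norm (Bf m t) \<le> 1 * (hb * r)" using b norm_Bf_le[OF t] by (intro mult_mono) auto
  finally show ?thesis using norm_feat_le[OF m t] by (simp add: algebra_simps)
qed

lemma cubes_inner:
  fixes Z :: "'w \<Rightarrow> 'h"
  assumes Z: "Z \<in> borel_measurable (P0 m)" "TL.cubes (r\<^sup>2 * d) (\<lambda>w. r * norm (Z w))"
    and x: "norm x \<le> (1 + hb) * r"
  shows "TL.cubes (K * (r\<^sup>2 * d)) (\<lambda>w. Z w \<bullet> x)"
proof -
  have "TL.cubes ((1 + hb)^3 * (r\<^sup>2 * d)) (\<lambda>w. (1 + hb) * (r * norm (Z w)))"
    using hb by (intro TL.cubes_scale Z) auto
  then have "TL.cubes (K * (r\<^sup>2 * d)) (\<lambda>w. (1 + hb) * (r * norm (Z w)))"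
  proof (rule TL.cubes_mono)
    have "1 * (1 + hb)^3 \<le> K" using K_ge(3) hb zero_le_power[of "1 + hb" 3] by linarith
    then show "(1 + hb)^3 * (r\<^sup>2 * d) \<le> K * (r\<^sup>2 * d)" using d by (intro mult_right_mono) auto
  qed
  then show ?thesis
  proof (rule TL.cubes_dominated)
    show "(\<lambda>w. Z w \<bullet> x) \<in> borel_measurable (P0 m)" using Z(1) by measurable
    fix w
    have "\<bar>Z w \<bullet> x\<bar> \<le> norm (Z w) * norm x" by (rule Cauchy_Schwarz_ineq2)
    also have "\<dots> \<le> norm (Z w) * ((1 + hb) * r)" by (intro mult_left_mono x) auto
    finally show "\<bar>Z w \<bullet> x\<bar> \<le> (1 + hb) * (r * norm (Z w))" by (simp add: mult_ac)
  qed
qed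

lemma second_inner:
  fixes Z :: "'w \<Rightarrow> 'h"
  assumes Z: "Z \<in> borel_measurable (P0 m)" "integrable (P0 m) (\<lambda>w. (norm (Z w))\<^sup>2)" "(\<integral>w. (norm (Z w))\<^sup>2 \<partial>P0 m) \<le> c"
    and x: "norm x \<le> (1 + hb) * r"
  shows "(\<integral>w. (Z w \<bullet> x)\<^sup>2 \<partial>P0 m) \<le> K * r\<^sup>2"
proof -
  have le: "(Z w \<bullet> x)\<^sup>2 \<le> ((1 + hb) * r)\<^sup>2 * (norm (Z w))\<^sup>2" for w
  proof -
    have "\<bar>Z w \<bullet> x\<bar> \<le> norm (Z w) * norm x" by (rule Cauchy_Schwarz_ineq2)
    also have "\<dots> \<le> norm (Z w) * ((1 + hb) * r)" by (intro mult_left_mono x) auto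
    finally have "\<bar>Z w \<bullet> x\<bar>\<^sup>2 \<le> (norm (Z w) * ((1 + hb) * r))\<^sup>2" by (intro power_mono) auto
    then show ?thesis by (simp add: power_mult_distrib mult_ac)
  qed
  have Zx: "(\<lambda>w. Z w \<bullet> x) \<in> borel_measurable (P0 m)" using Z(1) by measurable
  have i: "integrable (P0 m) (\<lambda>w. (Z w \<bullet> x)\<^sup>2)"
    by (rule dominated_integrable[where G="\<lambda>w. ((1 + hb) * r)\<^sup>2 * (norm (Z w))\<^sup>2"])
      (use Z(2) le in \<open>auto intro!: borel_measurable_power Zx\<close>)
  have "(\<integral>w. (Z w \<bullet> x)\<^sup>2 \<partial>P0 m) \<le> (\<integral>w. ((1 + hb) * r)\<^sup>2 * (norm (Z w))\<^sup>2 \<partial>P0 m)"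
    using i Z(2) le by (intro integral_mono) auto
  also have "\<dots> = ((1 + hb)^2 * r\<^sup>2) * (\<integral>w. (norm (Z w))\<^sup>2 \<partial>P0 m)" by (simp add: power_mult_distrib)
  also have "\<dots> \<le> ((1 + hb)^2 * r\<^sup>2) * c" using Z(3) by (intro mult_left_mono) auto
  also have "\<dots> = ((1 + hb)^2 * c) * r\<^sup>2" by simp
  also have "\<dots> \<le> K * r\<^sup>2" using K_ge(4) by (intro mult_right_mono) auto
  finally show ?thesis .
qed

lemma second_lam:
  assumes "norm x \<le> (1 + hb) * r"
  shows "integrable (P0 m) (\<lambda>w. (Uvec E m w \<bullet> x)\<^sup>2)" "(\<integral>w. (Uvec E m w \<bullet> x)\<^sup>2 \<partial>P0 m) \<le> K * lam\<^sup>2"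
    "integrable (P0 m) (\<lambda>w. (Svec E m w \<bullet> x)\<^sup>2)" "(\<integral>w. (Svec E m w \<bullet> x)\<^sup>2 \<partial>P0 m) \<le> K * lam\<^sup>2"
proof -
  note cu = cubes_inner[OF U_m[OF m] cubes_U[OF m] assms] and cs = cubes_inner[OF S_m[OF m] cubes_S[OF m] assms]
  show "integrable (P0 m) (\<lambda>w. (Uvec E m w \<bullet> x)\<^sup>2)" "(\<integral>w. (Uvec E m w \<bullet> x)\<^sup>2 \<partial>P0 m) \<le> K * lam\<^sup>2"
    using TL.P0.lower_moments_of_cube(1,2)[OF TL.cubesD(1,2)[OF cu] _ lam_pos K_ge(2)] TL.cubes_split(1)[OF cu]
    by (simp_all add: lam3)
  show "integrable (P0 m) (\<lambda>w. (Svec E m w \<bullet> x)\<^sup>2)" "(\<integral>w. (Svec E m w \<bullet> x)\<^sup>2 \<partial>P0 m) \<le> K * lam\<^sup>2"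
    using TL.P0.lower_moments_of_cube(1,2)[OF TL.cubesD(1,2)[OF cs] _ lam_pos K_ge(2)] TL.cubes_split(1)[OF cs]
    by (simp_all add: lam3)
qed

lemma product_mean_le:
  fixes f g :: "'w \<Rightarrow> real"
  assumes "f \<in> borel_measurable (P0 m)" "g \<in> borel_measurable (P0 m)"
    "integrable (P0 m) (\<lambda>w. (f w)\<^sup>2)" "integrable (P0 m) (\<lambda>w. (g w)\<^sup>2)"
    "(\<integral>w. (f w)\<^sup>2 \<partial>P0 m) \<le> b" "(\<integral>w. (g w)\<^sup>2 \<partial>P0 m) \<le> b"
  shows "integrable (P0 m) (\<lambda>w. f w * g w)" "\<bar>\<integral>w. f w * g w \<partial>P0 m\<bar> \<le> b"
proof -
  have le: "\<bar>f w * g w\<bar> \<le> (f w)\<^sup>2 / 2 + (g w)\<^sup>2 / 2" for w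
    using sum_squares_bound[of "\<bar>f w\<bar>" "\<bar>g w\<bar>"] by (simp add: abs_mult)
  have i: "integrable (P0 m) (\<lambda>w. (f w)\<^sup>2 / 2 + (g w)\<^sup>2 / 2)" using assms by simp
  show j: "integrable (P0 m) (\<lambda>w. f w * g w)"
    by (rule dominated_integrable[OF _ i le]) (use assms in measurable)
  have "\<bar>\<integral>w. f w * g w \<partial>P0 m\<bar> \<le> (\<integral>w. (f w)\<^sup>2 / 2 + (g w)\<^sup>2 / 2 \<partial>P0 m)"
    using i j le by (intro order_trans[OF integral_abs_bound] integral_mono) auto
  also have "\<dots> = (\<integral>w. (f w)\<^sup>2 \<partial>P0 m) / 2 + (\<integral>w. (g w)\<^sup>2 \<partial>P0 m) / 2" using assms by simp
  finally show "\<bar>\<integral>w. f w * g w \<partial>P0 m\<bar> \<le> b" using assms(5,6) by linarith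
qed

lemma cov_le:
  assumes "norm x \<le> (1 + hb) * r" "norm y \<le> (1 + hb) * r"
  shows "integrable (P0 m) (\<lambda>w. (Uvec E m w \<bullet> x) * (Uvec E m w \<bullet> y))"
    "\<bar>cov m x y\<bar> \<le> K * lam\<^sup>2" "\<bar>cov m x y\<bar> \<le> K * r\<^sup>2"
proof -
  note i = second_lam[OF assms(1)] second_lam[OF assms(2)]
  show "integrable (P0 m) (\<lambda>w. (Uvec E m w \<bullet> x) * (Uvec E m w \<bullet> y))" "\<bar>cov m x y\<bar> \<le> K * lam\<^sup>2"
    unfolding cov_def using i by (auto intro!: product_mean_le)
  show "\<bar>cov m x y\<bar> \<le> K * r\<^sup>2"
    unfolding cov_def using i second_inner[OF U_m[OF m] second_moments(1,2)[OF m]] assms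
    by (intro product_mean_le(2)) auto
qed

lemma aform_le:
  assumes "norm x \<le> (1 + hb) * r"
  shows "integrable (P0 m) (\<lambda>w. (Uvec E m w \<bullet> x) * (Svec E m w \<bullet> feat E m \<theta>))" "\<bar>aform m x\<bar> \<le> K * lam\<^sup>2"
proof -
  note i = second_lam[OF assms] second_lam[OF norm_feat_le'[OF \<theta>]]
  show "integrable (P0 m) (\<lambda>w. (Uvec E m w \<bullet> x) * (Svec E m w \<bullet> feat E m \<theta>))" "\<bar>aform m x\<bar> \<le> K * lam\<^sup>2"
    unfolding aform_def using i by (auto intro!: product_mean_le)
qed

lemma aform_psi:
  assumes "t \<in> params E"
  shows "aform m (psi \<beta> m t) = aform m (feat E m t) + \<beta> * aform m (Bf m t)"
proof -
  have "aform m (psi \<beta> m t) = (\<integral>w. (Uvec E m w \<bullet> feat E m t) * (Svec E m w \<bullet> feat E m \<theta>) + \<beta> * ((Uvec E m w \<bullet> Bf m t) * (Svec E m w \<bullet> feat E m \<theta>)) \<partial>P0 m)"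
    unfolding aform_def psi_def by (intro Bochner_Integration.integral_cong) (auto simp: inner_add_right algebra_simps)
  then show ?thesis
    using aform_le(1)[OF norm_feat_le'[OF assms]] aform_le(1)[OF norm_Bf_le'[OF assms]] unfolding aform_def by simp
qed

lemma cov_psi:
  assumes "s \<in> params E" "t \<in> params E"
  shows "cov m (Bf m t) (psi \<beta> m s) = cov m (Bf m t) (feat E m s) + \<beta> * cov m (Bf m t) (Bf m s)"
proof -
  have "cov m (Bf m t) (psi \<beta> m s) = (\<integral>w. (Uvec E m w \<bullet> Bf m t) * (Uvec E m w \<bullet> feat E m s) + \<beta> * ((Uvec E m w \<bullet> Bf m t) * (Uvec E m w \<bullet> Bf m s)) \<partial>P0 m)"
    unfolding cov_def psi_def by (intro Bochner_Integration.integral_cong) (auto simp: inner_add_right algebra_simps)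
  then show ?thesis
    using cov_le(1)[OF norm_Bf_le'[OF assms(2)] norm_feat_le'[OF assms(1)]]
      cov_le(1)[OF norm_Bf_le'[OF assms(2)] norm_Bf_le'[OF assms(1)]] unfolding cov_def by simp
qed

lemma Sigma_form: "x \<in> W m \<Longrightarrow> y \<in> W m \<Longrightarrow> blinfun_apply (Sigmaop E m) x \<bullet> y = cov m x y"
  unfolding Sigmaop_def cov_def
  using U_in[OF m] second_moments[OF m] by (intro form_op_cross_moment(2) W_m meas_m) auto

lemma A_form: "x \<in> W m \<Longrightarrow> blinfun_apply (Aop E m) (feat E m \<theta>) \<bullet> x = aform m x"
proof -
  assume x: "x \<in> W m"
  have "blinfun_apply (Aop E m) (feat E m \<theta>) \<bullet> x = (\<integral>w. (Svec E m w \<bullet> feat E m \<theta>) * (Uvec E m w \<bullet> x) \<partial>P0 m)"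
    unfolding Aop_def
    using U_in[OF m] S_in[OF m] second_moments[OF m] x feat_in[OF m \<theta>]
    by (intro form_op_cross_moment(2) W_m meas_m) auto
  then show ?thesis unfolding aform_def by (simp add: mult.commute)
qed

lemma V_integrable: "integrable (P0 m) (\<lambda>w. norm (Vop E m w))"
proof -
  have "integrable (P0 m) (\<lambda>w. r\<^sup>2 * norm (Vop E m w))"
    using TL.integrable_products(1)[OF cubes_V[OF m] cubes_V[OF m]] .
  then show ?thesis using r_pos by simp
qed

lemma K_form: "t \<in> params E \<Longrightarrow> - 1 / 2 * (blinfun_apply (Kop E m) (feat E m t) \<bullet> feat E m t) = kbar m t"
proof -
  assume t: "t \<in> params E"
  have "blinfun_apply (Kop E m) (feat E m t) \<bullet> feat E m t = (\<integral>w. blinfun_apply (Vop E m w) (feat E m t) \<bullet> feat E m t \<partial>P0 m)"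
    unfolding Kop_def using V_op[OF m] feat_in[OF m t]
    by (intro form_op_mean_operator W_m V_integrable meas_m) auto
  then show ?thesis unfolding kbar_def vq_def by simp
qed

text \<open>
  This is where \<open>H = \<Sigma> B\<close> and the symmetry of \<open>H\<close> are used: the form of \<open>H\<close> is a covariance of
  linear functionals of the score.
\<close>

lemma H_form:
  assumes s: "s \<in> params E" and t: "t \<in> params E"
  shows "blinfun_apply (H m) (feat E m s) \<bullet> feat E m t = cov m (Bf m t) (feat E m s)"
proof -
  have "blinfun_apply (H m) (feat E m s) \<bullet> feat E m t = feat E m s \<bullet> blinfun_apply (H m) (feat E m t)"
    using H_sa[OF m] by (simp add: selfadjoint_op_def)
  also have "\<dots> = blinfun_apply (Sigmaop E m) (Bf m t) \<bullet> feat E m s"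
    unfolding H_fac[OF m] by (simp add: Bf_def inner_commute)
  also have "\<dots> = cov m (Bf m t) (feat E m s)" by (intro Sigma_form Bf_in feat_in m s)
  finally show ?thesis .
qed

lemma H_form_le:
  assumes s: "s \<in> params E" and t: "t \<in> params E"
  shows "\<bar>blinfun_apply (H m) (feat E m s) \<bullet> feat E m t\<bar> \<le> K * lam\<^sup>2" "\<bar>blinfun_apply (H m) (feat E m s) \<bullet> feat E m t\<bar> \<le> K * r\<^sup>2"
  unfolding H_form[OF s t] by (intro cov_le norm_Bf_le' norm_feat_le' s t)+

lemma vq_le: "t \<in> params E \<Longrightarrow> \<bar>vq m t w\<bar> \<le> r\<^sup>2 * norm (Vop E m w)"
proof -
  assume t: "t \<in> params E"
  have "\<bar>blinfun_apply (Vop E m w) (feat E m t) \<bullet> feat E m t\<bar> \<le> norm (blinfun_apply (Vop E m w) (feat E m t)) * norm (feat E m t)"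
    by (rule Cauchy_Schwarz_ineq2)
  also have "\<dots> \<le> (norm (Vop E m w) * norm (feat E m t)) * norm (feat E m t)"
    by (intro mult_right_mono norm_blinfun) auto
  also have "\<dots> \<le> (norm (Vop E m w) * r) * r"
    using norm_feat_le[OF m t] r_pos by (intro mult_mono) auto
  finally show ?thesis unfolding vq_def by (simp add: power2_eq_square mult_ac)
qed

lemma vq_m [measurable]: "vq m t \<in> borel_measurable (P0 m)"
  unfolding vq_def by measurable

lemma cubes_vq: "t \<in> params E \<Longrightarrow> TL.cubes (r\<^sup>2 * d) (vq m t)"
  by (rule TL.cubes_dominated[OF cubes_V[OF m] vq_m vq_le])

lemma vq_second: "t \<in> params E \<Longrightarrow> (\<integral>w. (vq m t w)\<^sup>2 \<partial>P0 m) \<le> r\<^sup>2 * d\<^sup>2"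
proof -
  assume t: "t \<in> params E"
  have le: "(vq m t w)\<^sup>2 \<le> (r\<^sup>2 * norm (Vop E m w))\<^sup>2" for w
    using power_mono[OF vq_le[OF t, of w] abs_ge_zero, of 2] by simp
  have "integrable (P0 m) (\<lambda>w. (vq m t w)\<^sup>2)"
    by (rule dominated_integrable[OF _ V_second(1)[OF m]]) (use le in auto)
  then have "(\<integral>w. (vq m t w)\<^sup>2 \<partial>P0 m) \<le> (\<integral>w. (r\<^sup>2 * norm (Vop E m w))\<^sup>2 \<partial>P0 m)"
    using V_second(1)[OF m] le by (intro integral_mono) auto
  then show ?thesis using V_second(2)[OF m] by linarith
qed

end

end

section \<open>Moments of a single component\<close>

lemma (in prob_space) square_mean_le:
  fixes f :: "'a \<Rightarrow> real"
  assumes "integrable M f" "integrable M (\<lambda>x. (f x)\<^sup>2)"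
  shows "(\<integral>x. f x \<partial>M)\<^sup>2 \<le> (\<integral>x. (f x)\<^sup>2 \<partial>M)"
proof -
  let ?m = "\<integral>x. f x \<partial>M"
  have "0 \<le> (\<integral>x. (f x - ?m)\<^sup>2 \<partial>M)" by simp
  also have "\<dots> = (\<integral>x. (f x)\<^sup>2 - 2 * ?m * f x + ?m\<^sup>2 \<partial>M)"
    by (intro Bochner_Integration.integral_cong) (auto simp: power2_diff)
  also have "\<dots> = (\<integral>x. (f x)\<^sup>2 \<partial>M) - 2 * ?m * ?m + ?m\<^sup>2" using assms by (simp add: prob_space)
  finally show ?thesis by (simp add: power2_eq_square)
qed

context likelihood_point
begin

text \<open>
  Sample paths are continuous only for the sum over all components, and the remainder of a single component
  need not be. Changing one coordinate of the sample and subtracting removes the other components.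
\<close>

lemma remainder_difference_continuous:
  assumes m: "m \<in> comps E" and w: "w \<in> space (P0 m)" "w' \<in> space (P0 m)"
  shows "continuous_on T (\<lambda>t. Rrem E m t w - Rrem E m t w')"
proof -
  have ne: "space (P0 i) \<noteq> {}" if "i \<in> comps E" for i
    using prob_space.not_empty[OF prob_null[OF that]] .
  define \<omega> where "\<omega> v = (\<lambda>i\<in>comps E. if i = m then v else (SOME x. x \<in> space (P0 i)))" for v
  have \<omega>: "\<omega> v \<in> space (PiM (comps E) P0)" if "v \<in> space (P0 m)" for v
    using that some_in_eq[of "space (P0 i)" for i] ne by (auto simp: \<omega>_def space_PiM)
  have pr: "process E (\<omega> v) t = local_process E m t v + (\<Sum>i\<in>comps E - {m}. local_process E i t (SOME x. x \<in> space (P0 i)))" for v t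
    unfolding process_def using m finite_comps by (subst sum.remove[of _ m]) (auto simp: \<omega>_def intro!: sum.cong)
  have "continuous_on T (\<lambda>t. process E (\<omega> w) t - process E (\<omega> w') t)"
    by (intro continuous_intros process_cont[OF \<omega>] w)
  then have 1: "continuous_on T (\<lambda>t. local_process E m t w - local_process E m t w')" unfolding pr by simp
  have ft: "continuous_on T (feat E m)" using feat_cont[OF m] idx_subset by (rule continuous_on_subset)
  have 2: "continuous_on T (\<lambda>t. (Uvec E m v \<bullet> feat E m t - 1 / 2 * (blinfun_apply (Vop E m v) (feat E m t) \<bullet> feat E m t)))" for v
    by (intro continuous_intros ft)
  have "(\<lambda>t. Rrem E m t w - Rrem E m t w') = (\<lambda>t. (local_process E m t w - local_process E m t w')
     - (Uvec E m w \<bullet> feat E m t - 1 / 2 * (blinfun_apply (Vop E m w) (feat E m t) \<bullet> feat E m t))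
     + (Uvec E m w' \<bullet> feat E m t - 1 / 2 * (blinfun_apply (Vop E m w') (feat E m t) \<bullet> feat E m t)))"
    by (auto simp: local_process_def)
  then show ?thesis by (simp only:) (intro continuous_on_add continuous_on_diff[OF 1] 2)
qed

lemma remainder_integrable: "m \<in> comps E \<Longrightarrow> t \<in> T \<Longrightarrow> integrable (P1 m) (Rrem E m t)"
  using tilted_law.integrable_products(2)[OF tilted cubes_R cubes_R] by blast

text \<open>
  The supremum over the index set need not be measurable, since \<open>Rrem\<close> itself is not continuous. The
  supremum \<open>N\<close> over a dense sequence is measurable and its cube is bounded by the assumed uniform moment.
  Differences of the remainder at two sample points are continuous in the index, hence bounded by the
  values at the sequence; averaging the second sample point gives the bound for the recentred remainder.
  Subtracting the value at a fixed good sample point \<open>w0\<close> makes the remainder jointly measurable.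
\<close>

lemma remainder_envelope:
  assumes m: "m \<in> comps E"
  defines "\<rho> \<equiv> (\<lambda>t. \<integral>w. Rrem E m t w \<partial>P1 m)"
  shows "\<exists>N. N \<in> borel_measurable (P1 m) \<and> (\<forall>w\<in>space (P1 m). 0 \<le> N w) \<and>
    (\<forall>w\<in>space (P1 m). \<forall>t\<in>T. \<bar>Rrem E m t w - \<rho> t\<bar> \<le> N w + (\<integral>w. N w \<partial>P1 m)) \<and>
    integrable (P1 m) (\<lambda>w. N w ^ 3) \<and> (\<integral>w. N w ^ 3 \<partial>P1 m) \<le> r\<^sup>2 * d \<and>
    (\<lambda>(w, t). Rrem E m t w - \<rho> t) \<in> borel_measurable (P1 m \<Otimes>\<^sub>M \<pi>)"
proof -
  let ?R = "Rrem E m"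
  interpret P1: prob_space "P1 m" by (rule prob_law[OF m \<theta>])
  note sp1 = space_P1[OF m]
  note car = compact_idx metrizable_idx T_ne sets_prior
  obtain u :: "nat \<Rightarrow> 'p" and s :: "nat \<Rightarrow> 'p \<Rightarrow> nat" where u: "range u \<subseteq> T"
    and lim: "\<And>g t. continuous_on T g \<Longrightarrow> t \<in> T \<Longrightarrow> (\<lambda>n. g (u (s n t)) :: real) \<longlonglongrightarrow> g t"
    using compact_metrizable_selection[OF car] by blast
  have uT: "u k \<in> T" for k using u by auto
  have dense: "\<bar>g t\<bar> \<le> b" if "continuous_on T g" "t \<in> T" "\<And>k. \<bar>g (u k)\<bar> \<le> b" for g :: "'p \<Rightarrow> real" and t b
    using tendsto_rabs[OF lim[OF that(1,2)]] that(3) by (intro LIMSEQ_le_const2[where X="\<lambda>n. \<bar>g (u (s n t))\<bar>"]) auto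
  define S where "S w = (SUP t\<in>T. ennreal (\<bar>?R t w\<bar> ^ 3))" for w
  have S_int: "(\<integral>\<^sup>+w. S w \<partial>P1 m) \<le> ennreal (r\<^sup>2 * d)" unfolding S_def by (rule sup_R_bound[OF m])
  have "\<exists>w0\<in>space (P1 m). S w0 \<noteq> \<top>"
  proof (rule ccontr)
    assume "\<not> ?thesis"
    then have "(\<integral>\<^sup>+w. S w \<partial>P1 m) = (\<integral>\<^sup>+w. \<top> \<partial>P1 m)" by (intro nn_integral_cong) auto
    also have "\<dots> = \<top>" by (simp add: P1.emeasure_space_1)
    finally show False using S_int by (simp add: top_unique)
  qed
  then obtain w0 where w0: "w0 \<in> space (P1 m)" "S w0 \<noteq> \<top>" by blast
  have S_root: "\<bar>?R t w\<bar> ^ 3 \<le> enn2real (S w)" if "S w \<noteq> \<top>" "t \<in> T" for t w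
  proof -
    have "ennreal (\<bar>?R t w\<bar> ^ 3) \<le> S w" unfolding S_def using that(2) by (intro SUP_upper)
    also have "\<dots> = ennreal (enn2real (S w))" using that(1) by (simp add: ennreal_enn2real_if)
    finally show ?thesis by (simp add: ennreal_le_iff)
  qed
  have b0: "\<bar>?R t w0\<bar> \<le> 1 + enn2real (S w0)" if "t \<in> T" for t
    using S_root[OF w0(2) that] le_one_plus_cube(1)[OF abs_ge_zero, of "?R t w0"] by linarith
  have cont: "continuous_on T (\<lambda>t. ?R t w - ?R t w')" if "w \<in> space (P1 m)" "w' \<in> space (P1 m)" for w w'
    using remainder_difference_continuous[OF m] that sp1 by auto
  have bdd: "bdd_above (range (\<lambda>k. \<bar>?R (u k) w\<bar>))" if w: "w \<in> space (P1 m)" for w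
  proof -
    have "bounded ((\<lambda>t. ?R t w - ?R t w0) ` T)"
      by (intro compact_imp_bounded compact_continuous_image compact_idx cont w w0)
    then obtain b where b: "\<And>t. t \<in> T \<Longrightarrow> \<bar>?R t w - ?R t w0\<bar> \<le> b" by (auto simp: bounded_iff)
    have "\<bar>?R (u k) w\<bar> \<le> b + (1 + enn2real (S w0))" for k
      using b[OF uT, of k] b0[OF uT, of k] by linarith
    then show ?thesis by (intro bdd_aboveI2)
  qed
  define N where "N w = (SUP k. \<bar>?R (u k) w\<bar>)" for w
  have Rm: "?R t \<in> borel_measurable (P1 m)" if "t \<in> T" for t using P1_meas[OF m R_m[OF m that]] .
  have Nm[measurable]: "N \<in> borel_measurable (P1 m)"
    unfolding N_def using bdd Rm[OF uT] by (intro borel_measurable_cSUP) auto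
  have N_ge: "\<bar>?R (u k) w\<bar> \<le> N w" if "w \<in> space (P1 m)" for k w
    unfolding N_def by (rule cSUP_upper[OF UNIV_I bdd[OF that]])
  have N0: "0 \<le> N w" if "w \<in> space (P1 m)" for w using N_ge[OF that, of 0] by linarith
  have N3: "ennreal (N w ^ 3) \<le> S w" if w: "w \<in> space (P1 m)" for w
  proof (cases "S w = \<top>")
    case False
    have "\<bar>?R (u k) w\<bar> \<le> root 3 (enn2real (S w))" for k
    proof -
      have "root 3 (\<bar>?R (u k) w\<bar> ^ 3) \<le> root 3 (enn2real (S w))"
        using S_root[OF False uT] by (intro real_root_le_mono) auto
      then show ?thesis by (simp add: real_root_power_cancel)
    qed
    then have "N w \<le> root 3 (enn2real (S w))" unfolding N_def by (intro cSUP_least) auto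
    then have "N w ^ 3 \<le> root 3 (enn2real (S w)) ^ 3" using N0[OF w] by (intro power_mono)
    also have "\<dots> = enn2real (S w)" by (simp add: odd_real_root_pow)
    finally have "ennreal (N w ^ 3) \<le> ennreal (enn2real (S w))" by (rule ennreal_leI)
    then show ?thesis using False by (simp add: ennreal_enn2real_if)
  qed simp
  have NN: "(\<integral>\<^sup>+w. ennreal (N w ^ 3) \<partial>P1 m) \<le> ennreal (r\<^sup>2 * d)"
    using N3 by (intro order_trans[OF nn_integral_mono S_int])
  have iN3: "integrable (P1 m) (\<lambda>w. N w ^ 3)"
    using NN N0 by (intro integrableI_nonneg AE_I2) (auto intro: le_less_trans)
  have "ennreal (\<integral>w. N w ^ 3 \<partial>P1 m) \<le> ennreal (r\<^sup>2 * d)"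
    using NN iN3 N0 by (subst (asm) nn_integral_eq_integral) (auto intro!: AE_I2)
  then have N3_le: "(\<integral>w. N w ^ 3 \<partial>P1 m) \<le> r\<^sup>2 * d" using d by (simp add: ennreal_le_iff)
  have iN: "integrable (P1 m) N"
  proof (rule dominated_integrable)
    show "integrable (P1 m) (\<lambda>w. 1 + N w ^ 3)" using iN3 by simp
    show "\<bar>N w\<bar> \<le> 1 + N w ^ 3" if "w \<in> space (P1 m)" for w
      using le_one_plus_cube(1)[OF N0[OF that]] N0[OF that] by simp
  qed measurable
  have osc: "\<bar>?R t w - ?R t w'\<bar> \<le> N w + N w'" if "w \<in> space (P1 m)" "w' \<in> space (P1 m)" "t \<in> T" for w w' t
  proof (rule dense[OF cont[OF that(1,2)] that(3)])
    show "\<bar>?R (u k) w - ?R (u k) w'\<bar> \<le> N w + N w'" for k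
      using N_ge[OF that(1), of k] N_ge[OF that(2), of k] by linarith
  qed
  have env: "\<bar>?R t w - \<rho> t\<bar> \<le> N w + (\<integral>w. N w \<partial>P1 m)" if w: "w \<in> space (P1 m)" and t: "t \<in> T" for w t
  proof -
    have iR: "integrable (P1 m) (?R t)" by (rule remainder_integrable[OF m t])
    have "?R t w - \<rho> t = (\<integral>w'. ?R t w - ?R t w' \<partial>P1 m)" unfolding \<rho>_def using iR by (simp add: P1.prob_space)
    also have "\<bar>\<dots>\<bar> \<le> (\<integral>w'. N w + N w' \<partial>P1 m)"
      using iR iN osc[OF w _ t] by (intro order_trans[OF integral_abs_bound] integral_mono) auto
    finally show ?thesis using iN by (simp add: P1.prob_space)
  qed
  define g where "g w t = ?R t w - ?R t w0" for w t
  have gm: "(\<lambda>(w, t). g w t) \<in> borel_measurable (P1 m \<Otimes>\<^sub>M \<pi>)"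
    using Rm cont w0(1) unfolding g_def by (intro caratheodory_measurable[OF car]) auto
  have gm'[measurable]: "(\<lambda>(t, w). g w t) \<in> borel_measurable (\<pi> \<Otimes>\<^sub>M P1 m)"
    using measurable_compose[OF measurable_pair_swap' gm] by (simp add: case_prod_beta')
  note gm[measurable]
  have "(\<lambda>(w, t). g w t - (\<integral>w'. g w' t \<partial>P1 m)) \<in> borel_measurable (P1 m \<Otimes>\<^sub>M \<pi>)" by measurable
  moreover have "g w t - (\<integral>w'. g w' t \<partial>P1 m) = ?R t w - \<rho> t" if "t \<in> T" for w t
    unfolding g_def \<rho>_def using remainder_integrable[OF m that] by (simp add: P1.prob_space)
  ultimately have "(\<lambda>(w, t). ?R t w - \<rho> t) \<in> borel_measurable (P1 m \<Otimes>\<^sub>M \<pi>)"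
    by (subst measurable_cong[where g="\<lambda>(w, t). g w t - (\<integral>w'. g w' t \<partial>P1 m)"]) (auto simp: space_pair_measure space_prior)
  then show ?thesis using Nm N0 env iN3 N3_le by blast
qed

end

context gaussian_comparison
begin

text \<open>
  The component of the potential \<open>X + \<beta> W\<close> after removal of the mean \<open>rho\<close> of the remainder. The
  perturbation \<open>yX\<close> is centred by its leading mean, so that \<open>fX\<close> and \<open>fY\<close> have matching means for every \<open>\<beta>\<close>.
\<close>

definition fX :: "real \<Rightarrow> nat \<Rightarrow> 'w \<Rightarrow> 'p \<Rightarrow> real" where
  "fX \<beta> m w t = Uvec E m w \<bullet> psi \<beta> m t + (vq m t w + Rrem E m t w) - rho m t - \<beta> * aform m (Bf m t)"
definition yX :: "nat \<Rightarrow> 'w \<Rightarrow> 'p \<Rightarrow> real" where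
  "yX m w t = Uvec E m w \<bullet> Bf m t - aform m (Bf m t)"
definition fY :: "real \<Rightarrow> nat \<Rightarrow> 'h \<Rightarrow> 'p \<Rightarrow> real" where
  "fY \<beta> m x t = x \<bullet> psi \<beta> m t + (aform m (feat E m t) + kbar m t)"
definition yY :: "nat \<Rightarrow> 'h \<Rightarrow> 'p \<Rightarrow> real" where
  "yY m x t = x \<bullet> Bf m t"

end

text \<open>The regime in which all moments are small enough for the expansions.\<close>

locale gaussian_comparison_small = gaussian_comparison E \<theta> c d Q \<xi> H B a hb
  for E :: "('p::topological_space, 'w, 'h::{real_inner, banach, second_countable_topology}) lik_model"
    and \<theta> c d and Q :: "'q measure" and \<xi> H B a hb +
  assumes d1: "d \<le> 1" and lam1: "lam \<le> 1"
begin

context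
  fixes m assumes m: "m \<in> comps E"
begin

interpretation TL: tilted_law "P0 m" "P1 m" "ll m" by (rule tilted[OF m])

interpretation LE: local_expansion "P0 m" "P1 m" "ll m" r d K
  using TL.tilted_law_axioms r_pos d d1 K_ge by (simp add: local_expansion_def local_expansion_axioms_def)

lemmas meas_m' [measurable] = U_m[OF m] S_m[OF m] V_m[OF m] V_norm[OF m] D_m[OF m] R_m[OF m] vq_m[OF m]

lemma r2d2_le: "r\<^sup>2 * d\<^sup>2 \<le> r\<^sup>2 * d"
  using d d1 by (intro mult_left_mono) (auto simp: power2_eq_square mult_left_le)

lemma K_bounds: "x * (r\<^sup>2 * d) \<le> K * (r\<^sup>2 * d)" "x * (r\<^sup>2 * d\<^sup>2) \<le> K * (r\<^sup>2 * d\<^sup>2)" if "x \<le> 8" for x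
  using that K_ge(1) d by (auto intro!: mult_right_mono)

lemma leading_lin: "norm x \<le> (1 + hb) * r \<Longrightarrow> LE.leading (\<lambda>w. Uvec E m w \<bullet> x)"
  unfolding LE.leading_def
  using cubes_inner[OF m U_m[OF m] cubes_U[OF m]] second_inner[OF m U_m[OF m] second_moments(1,2)[OF m]] by blast

lemma leading_s: "LE.leading (\<lambda>w. Svec E m w \<bullet> feat E m \<theta>)"
  unfolding LE.leading_def
  using cubes_inner[OF m S_m[OF m] cubes_S[OF m] norm_feat_le'[OF m \<theta>]]
    second_inner[OF m S_m[OF m] second_moments(3,4)[OF m] norm_feat_le'[OF m \<theta>]] by blast

lemma mean_lin: "(\<integral>w. Uvec E m w \<bullet> x \<partial>P0 m) = 0"
proof -
  have "integrable (P0 m) (\<lambda>w. norm (Uvec E m w))"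
  proof (rule dominated_integrable)
    show "integrable (P0 m) (\<lambda>w. 1 + (norm (Uvec E m w))\<^sup>2)" using second_moments(1)[OF m] by simp
    show "\<bar>norm (Uvec E m w)\<bar> \<le> 1 + (norm (Uvec E m w))\<^sup>2" for w
    proof -
      have "norm (Uvec E m w) \<le> (norm (Uvec E m w))\<^sup>2 / 2 + 1 / 2"
        using le_square_scaled[of 1 "norm (Uvec E m w)"] by simp
      moreover have "0 \<le> (norm (Uvec E m w))\<^sup>2" by simp
      ultimately have "norm (Uvec E m w) \<le> 1 + (norm (Uvec E m w))\<^sup>2" by linarith
      then show ?thesis by simp
    qed
  qed measurable
  then have "integrable (P0 m) (Uvec E m)" by (rule integrable_norm_cancel) measurable
  then have "(\<integral>w. Uvec E m w \<bullet> x \<partial>P0 m) = (\<integral>w. Uvec E m w \<partial>P0 m) \<bullet> x" by (rule integral_inner_left)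
  then show ?thesis using U_mean[OF m] by simp
qed

lemma negligible_D: "LE.negligible (Drem E m \<theta>)"
  unfolding LE.negligible_def
  using TL.cubes_mono[OF cubes_D[OF m] K_bounds(1)[of 1, simplified]] D_second[OF m] K_bounds(2)[of 1] by auto

lemma negligible_R: "t \<in> T \<Longrightarrow> LE.negligible (Rrem E m t)"
  unfolding LE.negligible_def
  using TL.cubes_mono[OF cubes_R[OF m] K_bounds(1)[of 1, simplified]] R_second[OF m] K_bounds(2)[of 1] by fastforce

lemma leading_0: "LE.leading (\<lambda>w. 0)" and negligible_0: "LE.negligible (\<lambda>w. 0)"
  unfolding LE.leading_def LE.negligible_def TL.cubes_def using K_ge(2) d by auto

lemma negligible_w: "t \<in> T \<Longrightarrow> LE.negligible (\<lambda>w. vq m t w + Rrem E m t w)"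
proof -
  assume t: "t \<in> T"
  note tp = T_params[OF t]
  have "TL.cubes (8 * (r\<^sup>2 * d)) (\<lambda>w. vq m t w + Rrem E m t w)"
    by (rule TL.cubes_add_same[OF cubes_vq[OF m tp] cubes_R[OF m t]])
  then have c3: "TL.cubes (K * (r\<^sup>2 * d)) (\<lambda>w. vq m t w + Rrem E m t w)"
    by (rule TL.cubes_mono) (rule K_bounds(1), simp)
  note i = LE.squares_integrable[OF cubes_vq[OF m tp]] LE.squares_integrable[OF cubes_R[OF m t]]
  have "(\<integral>w. (vq m t w + Rrem E m t w)\<^sup>2 \<partial>P0 m) \<le> (\<integral>w. 2 * (vq m t w)\<^sup>2 + 2 * (Rrem E m t w)\<^sup>2 \<partial>P0 m)"
  proof (rule integral_mono)
    show "integrable (P0 m) (\<lambda>w. (vq m t w + Rrem E m t w)\<^sup>2)" by (rule LE.squares_integrable[OF c3])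
    show "(vq m t w + Rrem E m t w)\<^sup>2 \<le> 2 * (vq m t w)\<^sup>2 + 2 * (Rrem E m t w)\<^sup>2" for w
      using sum_squares_bound[of "vq m t w" "Rrem E m t w"] by (simp add: power2_sum)
  qed (use i in simp)
  also have "\<dots> = 2 * (\<integral>w. (vq m t w)\<^sup>2 \<partial>P0 m) + 2 * (\<integral>w. (Rrem E m t w)\<^sup>2 \<partial>P0 m)" using i by simp
  also have "\<dots> \<le> 4 * (r\<^sup>2 * d\<^sup>2)" using vq_second[OF m tp] R_second[OF m t] by simp
  also have "\<dots> \<le> K * (r\<^sup>2 * d\<^sup>2)" by (rule K_bounds(2)) simp
  finally show ?thesis unfolding LE.negligible_def using c3 by blast
qed

lemmas tm = LE.tilted_mean[OF refl leading_s negligible_D]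
lemmas tc = LE.tilted_covariance[OF refl leading_s negligible_D]

lemma lam_powers: "lam^3 \<le> lam\<^sup>2" "lam\<^sup>2 \<le> lam" "lam^3 \<le> lam" "lam^4 \<le> lam^3"
proof -
  have "lam^3 \<le> lam^2" "lam^2 \<le> lam^1" "lam^3 \<le> lam^1" "lam^4 \<le> lam^3"
    using lam_pos lam1 by (intro power_decreasing; simp)+
  then show "lam^3 \<le> lam\<^sup>2" "lam\<^sup>2 \<le> lam" "lam^3 \<le> lam" "lam^4 \<le> lam^3" by auto
qed

text \<open>
  Although \<open>kbar\<close> is only of order \<open>r d\<close>, its square is of order \<open>lam\<^sup>3\<close>, so that products of drifts
  are negligible.
\<close>

lemma kbar_sq: "t \<in> params E \<Longrightarrow> (kbar m t)\<^sup>2 \<le> lam^3" and kbar_le: "t \<in> params E \<Longrightarrow> \<bar>kbar m t\<bar> \<le> lam"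
proof -
  assume t: "t \<in> params E"
  have "(kbar m t)\<^sup>2 \<le> (\<integral>w. (vq m t w)\<^sup>2 \<partial>P0 m)"
    unfolding kbar_def
    using TL.integrable_products(1)[OF cubes_vq[OF m t] cubes_vq[OF m t]] LE.squares_integrable[OF cubes_vq[OF m t]]
    by (rule TL.P0.square_mean_le)
  also have "\<dots> \<le> lam^3" using vq_second[OF m t] r2d2_le by (simp add: lam3)
  finally show 1: "(kbar m t)\<^sup>2 \<le> lam^3" .
  then have "\<bar>kbar m t\<bar>\<^sup>2 \<le> lam\<^sup>2" using lam_powers by simp
  then show "\<bar>kbar m t\<bar> \<le> lam" by (rule power2_le_imp_le) (use lam_pos in simp)
qed

lemma rho_R: "t \<in> T \<Longrightarrow> \<bar>rho m t - (\<integral>w. Rrem E m t w \<partial>P0 m)\<bar> \<le> 27 * (K * lam^3)"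
  using tm[OF leading_0 _ negligible_R] by (simp add: rho_def lam3)

lemma rho_le: "t \<in> T \<Longrightarrow> \<bar>rho m t\<bar> \<le> 28 * (K * lam^3)"
proof -
  assume t: "t \<in> T"
  have "1 * lam^3 \<le> K * lam^3" using K_ge lam_pos by (intro mult_right_mono) auto
  then show ?thesis using rho_R[OF t] R_mean[OF m t] unfolding lam3[symmetric] by linarith
qed

lemma mean_F:
  assumes t: "t \<in> T" and x: "norm x \<le> (1 + hb) * r"
  shows "\<bar>(\<integral>w. Uvec E m w \<bullet> x + (vq m t w + Rrem E m t w) \<partial>P1 m) - aform m x - (kbar m t + (\<integral>w. Rrem E m t w \<partial>P0 m))\<bar> \<le> 27 * (K * lam^3)"
proof -
  have "(\<integral>w. vq m t w + Rrem E m t w \<partial>P0 m) = kbar m t + (\<integral>w. Rrem E m t w \<partial>P0 m)"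
    unfolding kbar_def
    using TL.integrable_products(1)[OF cubes_vq[OF m T_params[OF t]] cubes_vq[OF m T_params[OF t]]]
      TL.integrable_products(1)[OF cubes_R[OF m t] cubes_R[OF m t]] by simp
  then show ?thesis using tm[OF leading_lin[OF x] mean_lin negligible_w[OF t]] by (simp add: lam3 aform_def)
qed

lemma mean_B: "t \<in> T \<Longrightarrow> \<bar>(\<integral>w. Uvec E m w \<bullet> Bf m t \<partial>P1 m) - aform m (Bf m t)\<bar> \<le> 27 * (K * lam^3)"
  using tm[OF leading_lin[OF norm_Bf_le'[OF m]] mean_lin negligible_0] T_params by (simp add: lam3 aform_def)

lemma integrable_F:
  assumes t: "t \<in> T" and x: "norm x \<le> (1 + hb) * r"
  shows "TL.cubes (8 * (K * (r\<^sup>2 * d))) (\<lambda>w. Uvec E m w \<bullet> x + (vq m t w + Rrem E m t w))"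
  by (rule TL.cubes_add_same[OF LE.leading_cubes[OF leading_lin[OF x]] LE.negligible_cubes[OF negligible_w[OF t]]])

lemma mean_F_le:
  assumes t: "t \<in> T" and x: "norm x \<le> (1 + hb) * r"
  shows "\<bar>\<integral>w. Uvec E m w \<bullet> x + (vq m t w + Rrem E m t w) \<partial>P1 m\<bar> \<le> 30 * (K * lam)"
proof -
  have "K * lam^3 \<le> K * lam" "K * lam\<^sup>2 \<le> K * lam" "1 * lam \<le> K * lam"
    using lam_powers K_ge lam_pos by (auto intro!: mult_left_mono mult_right_mono)
  moreover have "\<bar>\<integral>w. Rrem E m t w \<partial>P0 m\<bar> \<le> lam" using R_mean[OF m t] lam_powers(3) by (simp add: lam3)
  ultimately show ?thesis using mean_F[OF t x] aform_le(2)[OF m x] kbar_le[OF T_params[OF t]] by linarith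
qed

lemma shifted_product:
  assumes F: "TL.cubes C F" and G: "TL.cubes C' G"
  shows "(\<integral>w. (F w - e) * (G w - e') \<partial>P1 m) = (\<integral>w. F w * G w \<partial>P1 m) - e' * (\<integral>w. F w \<partial>P1 m) - e * (\<integral>w. G w \<partial>P1 m) + e * e'"
proof -
  have "(\<integral>w. (F w - e) * (G w - e') \<partial>P1 m) = (\<integral>w. F w * G w - e' * F w - e * G w + e * e' \<partial>P1 m)"
    by (simp add: algebra_simps)
  then show ?thesis
    using TL.integrable_products(2,4)[OF F G] TL.integrable_products(2)[OF G F] TL.P1.prob_space by simp
qed

lemma shift_le:
  assumes "t \<in> T" "\<bar>\<beta>\<bar> \<le> 1"
  shows "\<bar>rho m t + \<beta> * aform m (Bf m t)\<bar> \<le> 29 * (K * lam\<^sup>2)"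
proof -
  have "\<bar>\<beta> * aform m (Bf m t)\<bar> \<le> 1 * (K * lam\<^sup>2)"
    unfolding abs_mult using assms aform_le(2)[OF m norm_Bf_le'[OF m T_params[OF assms(1)]]] by (intro mult_mono) auto
  moreover have "K * lam^3 \<le> K * lam\<^sup>2" using lam_powers K_ge by (intro mult_left_mono) auto
  ultimately show ?thesis using rho_le[OF assms(1)] by linarith
qed

lemma fX_eq: "fX \<beta> m w t = (Uvec E m w \<bullet> psi \<beta> m t + (vq m t w + Rrem E m t w)) - (rho m t + \<beta> * aform m (Bf m t))"
  by (simp add: fX_def)

lemma fX_mean:
  assumes t: "t \<in> T" and \<beta>: "\<bar>\<beta>\<bar> \<le> 1"
  shows "\<bar>(\<integral>w. fX \<beta> m w t \<partial>P1 m) - (aform m (feat E m t) + kbar m t)\<bar> \<le> 54 * (K * lam^3)"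
proof -
  note x = norm_psi_le[OF m T_params[OF t] \<beta>]
  have "(\<integral>w. fX \<beta> m w t \<partial>P1 m) = (\<integral>w. Uvec E m w \<bullet> psi \<beta> m t + (vq m t w + Rrem E m t w) \<partial>P1 m) - (rho m t + \<beta> * aform m (Bf m t))"
    unfolding fX_eq using TL.integrable_products(2)[OF integrable_F[OF t x] integrable_F[OF t x]] TL.P1.prob_space by simp
  then show ?thesis using mean_F[OF t x] rho_R[OF t] unfolding aform_psi[OF m T_params[OF t]] by linarith
qed

lemma mult_bound: "\<bar>x\<bar> \<le> p * (K * lam\<^sup>2) \<Longrightarrow> \<bar>y\<bar> \<le> q * (K * lam) \<Longrightarrow> 0 \<le> p \<Longrightarrow> 0 \<le> q \<Longrightarrow> \<bar>x * y\<bar> \<le> p * q * (K\<^sup>2 * lam^3)" for x y p q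
proof -
  assume a: "\<bar>x\<bar> \<le> p * (K * lam\<^sup>2)" "\<bar>y\<bar> \<le> q * (K * lam)" "0 \<le> p" "0 \<le> q"
  have "\<bar>x * y\<bar> \<le> (p * (K * lam\<^sup>2)) * (q * (K * lam))"
    unfolding abs_mult using a K_ge lam_pos by (intro mult_mono) auto
  then show ?thesis by (simp add: power2_eq_square power3_eq_cube mult_ac)
qed

lemma K_square: "K * lam^3 \<le> K\<^sup>2 * lam^3"
proof -
  have "1 * (K * lam^3) \<le> K * (K * lam^3)" using K_ge lam_pos by (intro mult_right_mono) auto
  then show ?thesis by (simp add: power2_eq_square)
qed

lemma le_lam: "\<bar>x\<bar> \<le> p * (K * lam\<^sup>2) \<Longrightarrow> 0 \<le> p \<Longrightarrow> \<bar>x\<bar> \<le> p * (K * lam)" for x p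
proof -
  assume a: "\<bar>x\<bar> \<le> p * (K * lam\<^sup>2)" "0 \<le> p"
  have "p * (K * lam\<^sup>2) \<le> p * (K * lam)" using a K_ge lam_powers by (intro mult_left_mono) auto
  then show ?thesis using a by linarith
qed

text \<open>Recentring changes second moments only by products of means, each of order \<open>lam\<close> and \<open>lam\<^sup>2\<close>.\<close>

lemma fX_second:
  assumes s: "s \<in> T" and t: "t \<in> T" and \<beta>: "\<bar>\<beta>\<bar> \<le> 1"
  shows "\<bar>(\<integral>w. fX \<beta> m w s * fX \<beta> m w t \<partial>P1 m) - cov m (psi \<beta> m s) (psi \<beta> m t)\<bar> \<le> 2608 * (K\<^sup>2 * lam^3)"
proof -
  note xs = norm_psi_le[OF m T_params[OF s] \<beta>] and xt = norm_psi_le[OF m T_params[OF t] \<beta>]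
  note sp = shifted_product[OF integrable_F[OF s xs] integrable_F[OF t xt]]
  have c: "\<bar>(\<integral>w. (Uvec E m w \<bullet> psi \<beta> m s + (vq m s w + Rrem E m s w)) * (Uvec E m w \<bullet> psi \<beta> m t + (vq m t w + Rrem E m t w)) \<partial>P1 m) - cov m (psi \<beta> m s) (psi \<beta> m t)\<bar> \<le> 27 * (K * lam^3)"
    using tc[OF leading_lin[OF xs] negligible_w[OF s] leading_lin[OF xt] negligible_w[OF t]] by (simp add: lam3 cov_def)
  note es = shift_le[OF s \<beta>] and et = shift_le[OF t \<beta>]
  have tri: "\<bar>A - C\<bar> \<le> 27 * k \<Longrightarrow> \<bar>p1\<bar> \<le> 29 * 30 * k2 \<Longrightarrow> \<bar>p2\<bar> \<le> 29 * 30 * k2 \<Longrightarrow> \<bar>p3\<bar> \<le> 29 * 29 * k2 \<Longrightarrow> k \<le> k2 \<Longrightarrow>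
     \<bar>A - p1 - p2 + p3 - C\<bar> \<le> 2608 * k2" for A C p1 p2 p3 k k2 :: real by linarith
  show ?thesis unfolding fX_eq sp
    by (rule tri[OF c mult_bound[OF et mean_F_le[OF s xs]] mult_bound[OF es mean_F_le[OF t xt]] mult_bound[OF es le_lam[OF et]] K_square]) auto
qed

lemma yX_mean: "t \<in> T \<Longrightarrow> \<bar>\<integral>w. yX m w t \<partial>P1 m\<bar> \<le> 27 * (K * lam^3)"
proof -
  assume t: "t \<in> T"
  note cb = LE.leading_cubes[OF leading_lin[OF norm_Bf_le'[OF m T_params[OF t]]]]
  show ?thesis using mean_B[OF t] TL.integrable_products(2)[OF cb cb] TL.P1.prob_space unfolding yX_def by simp
qed

lemma yX_fX:
  assumes s: "s \<in> T" and t: "t \<in> T"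
  shows "\<bar>(\<integral>w. yX m w t * fX 0 m w s \<partial>P1 m) - cov m (Bf m t) (feat E m s)\<bar> \<le> 2608 * (K\<^sup>2 * lam^3)"
proof -
  have p0: "psi 0 m s = feat E m s" by (simp add: psi_def)
  note xs = norm_feat_le'[OF m T_params[OF s]] and xt = norm_Bf_le'[OF m T_params[OF t]]
  have cB: "TL.cubes (K * (r\<^sup>2 * d)) (\<lambda>w. Uvec E m w \<bullet> Bf m t)" by (rule LE.leading_cubes[OF leading_lin[OF xt]])
  note sp = shifted_product[OF cB integrable_F[OF s xs], of "aform m (Bf m t)" "rho m s"]
  have c: "\<bar>(\<integral>w. (Uvec E m w \<bullet> Bf m t) * (Uvec E m w \<bullet> feat E m s + (vq m s w + Rrem E m s w)) \<partial>P1 m) - cov m (Bf m t) (feat E m s)\<bar> \<le> 27 * (K * lam^3)"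
    using tc[OF leading_lin[OF xt] negligible_0 leading_lin[OF xs] negligible_w[OF s]] by (simp add: lam3 cov_def)
  have ea: "\<bar>aform m (Bf m t)\<bar> \<le> 1 * (K * lam\<^sup>2)" using aform_le(2)[OF m xt] by simp
  have er: "\<bar>rho m s\<bar> \<le> 29 * (K * lam\<^sup>2)" using shift_le[OF s, of 0] by simp
  have eB: "\<bar>\<integral>w. Uvec E m w \<bullet> Bf m t \<partial>P1 m\<bar> \<le> 28 * (K * lam)"
  proof -
    have "K * lam^3 \<le> K * lam" "K * lam\<^sup>2 \<le> K * lam" using lam_powers K_ge by (auto intro!: mult_left_mono)
    then show ?thesis using mean_B[OF t] ea by linarith
  qed
  have tri: "\<bar>A - C\<bar> \<le> 27 * k \<Longrightarrow> \<bar>p1\<bar> \<le> 29 * 28 * k2 \<Longrightarrow> \<bar>p2\<bar> \<le> 1 * 30 * k2 \<Longrightarrow> \<bar>p3\<bar> \<le> 1 * 29 * k2 \<Longrightarrow> k \<le> k2 \<Longrightarrow> 0 \<le> k2 \<Longrightarrow>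
     \<bar>A - p1 - p2 + p3 - C\<bar> \<le> 2608 * k2" for A C p1 p2 p3 k k2 :: real by linarith
  have e: "(\<integral>w. yX m w t * fX 0 m w s \<partial>P1 m) = (\<integral>w. (Uvec E m w \<bullet> Bf m t - aform m (Bf m t)) * (Uvec E m w \<bullet> feat E m s + (vq m s w + Rrem E m s w) - rho m s) \<partial>P1 m)"
    by (simp add: fX_eq yX_def p0)
  show ?thesis unfolding e sp
    by (rule tri[OF c mult_bound[OF er eB] mult_bound[OF ea mean_F_le[OF s xs]] mult_bound[OF ea le_lam[OF er]] K_square])
      (use lam_pos in auto)
qed

end

end

section \<open>Differentiating along a perturbation\<close>

lemma cube_envelope_mono: "cube_envelope P \<pi> f g \<kappa> \<Longrightarrow> \<kappa> \<le> \<kappa>' \<Longrightarrow> cube_envelope P \<pi> f g \<kappa>'"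
  by (auto simp: cube_envelope_def)

lemma gibbs_cong: "(\<And>t. t \<in> space \<pi> \<Longrightarrow> Z t = Z' t) \<Longrightarrow> gibbs \<pi> Z = gibbs \<pi> Z'"
proof -
  assume eq: "\<And>t. t \<in> space \<pi> \<Longrightarrow> Z t = Z' t"
  have 0: "(\<integral>s. exp (Z s) \<partial>\<pi>) = (\<integral>s. exp (Z' s) \<partial>\<pi>)"
    using eq by (intro Bochner_Integration.integral_cong) auto
  have 1: "(\<integral>\<^sup>+t. ennreal (exp (Z t) / x) * indicator A t \<partial>\<pi>) = (\<integral>\<^sup>+t. ennreal (exp (Z' t) / x) * indicator A t \<partial>\<pi>)" for A x
    by (intro nn_integral_cong) (simp add: eq)
  show ?thesis unfolding gibbs_def density_def 0 1 ..
qed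

lemma bounded_potential_scale: "bounded_potential \<pi> Z \<Longrightarrow> bounded_potential \<pi> (\<lambda>t. b * Z t)"
  unfolding bounded_potential_def
proof (elim conjE exE, intro conjI)
  fix B assume "\<forall>t\<in>space \<pi>. \<bar>Z t\<bar> \<le> B"
  then have "\<forall>t\<in>space \<pi>. \<bar>b * Z t\<bar> \<le> \<bar>b\<bar> * B" by (auto simp: abs_mult intro!: mult_left_mono)
  then show "\<exists>B. \<forall>t\<in>space \<pi>. \<bar>b * Z t\<bar> \<le> B" by blast
qed measurable

text \<open>
  The first inequality is the replica identity for the perturbation \<open>W\<close>: its mean is the mean of the test
  function up to the integration-by-parts error. The second says that \<open>mW\<close> is a subgradient of the mean
  log-partition function.
\<close>

lemma (in component_family) mean_tilt:
  fixes \<alpha> hmax b :: real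
  assumes y: "\<And>i. i \<in> I \<Longrightarrow> (\<lambda>(w, t). y i w t) \<in> borel_measurable (P i \<Otimes>\<^sub>M \<pi>)"
    and y_le: "\<And>i w t. i \<in> I \<Longrightarrow> w \<in> space (P i) \<Longrightarrow> t \<in> space \<pi> \<Longrightarrow> \<bar>y i w t\<bar> \<le> g i w"
    and h: "\<And>i. i \<in> I \<Longrightarrow> (\<lambda>(s, t). h i s t) \<in> borel_measurable (\<pi> \<Otimes>\<^sub>M \<pi>)"
    and h_le: "\<And>i s t. i \<in> I \<Longrightarrow> s \<in> space \<pi> \<Longrightarrow> t \<in> space \<pi> \<Longrightarrow> \<bar>h i s t\<bar> \<le> hmax"
    and m: "\<And>i t. i \<in> I \<Longrightarrow> t \<in> space \<pi> \<Longrightarrow> \<bar>\<integral>w. y i w t \<partial>P i\<bar> \<le> \<alpha>"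
    and k: "\<And>i s t. i \<in> I \<Longrightarrow> s \<in> space \<pi> \<Longrightarrow> t \<in> space \<pi> \<Longrightarrow> \<bar>(\<integral>w. y i w t * f i w s \<partial>P i) - h i s t\<bar> \<le> \<alpha>"
    and hg: "\<And>i. i \<in> I \<Longrightarrow> hmax * (\<integral>w. g i w \<partial>P i) \<le> \<kappa>"
    and c: "bounded_potential \<pi> c" and l: "bounded_potential \<pi> l"
  defines "Z \<equiv> (\<lambda>\<omega> t. c t + total \<omega> t)" and "W \<equiv> (\<lambda>\<omega> t. (\<Sum>i\<in>I. y i (\<omega> i) t) + l t)"
    and "test \<equiv> (\<lambda>s t. l t + (\<Sum>i\<in>I. h i t t) - (\<Sum>i\<in>I. h i s t))"
  defines "mW \<equiv> (\<integral>\<omega>. (\<integral>t. W \<omega> t \<partial>gibbs \<pi> (Z \<omega>)) \<partial>PiM I P)"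
  shows "\<bar>mW - (\<integral>\<omega>. (\<integral>t. (\<integral>s. test s t \<partial>gibbs \<pi> (Z \<omega>)) \<partial>gibbs \<pi> (Z \<omega>)) \<partial>PiM I P)\<bar> \<le> card I * (166 * \<kappa> + 3 * \<alpha>)"
    and "b * mW \<le> (\<integral>\<omega>. log_partition \<pi> (\<lambda>t. Z \<omega> t + b * W \<omega> t) \<partial>PiM I P) - (\<integral>\<omega>. log_partition \<pi> (Z \<omega>) \<partial>PiM I P)"
proof -
  let ?N = "PiM I P"
  interpret NT: pair_prob_space ?N \<pi> by (intro pair_prob_spaceI PP.prob_space_axioms T.prob_space_axioms)
  obtain Bc where Bc: "\<And>t. t \<in> space \<pi> \<Longrightarrow> \<bar>c t\<bar> \<le> Bc" and [measurable]: "c \<in> borel_measurable \<pi>"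
    using c by (auto simp: bounded_potential_def)
  obtain Bl where Bl: "\<And>t. t \<in> space \<pi> \<Longrightarrow> \<bar>l t\<bar> \<le> Bl" and lm[measurable]: "l \<in> borel_measurable \<pi>"
    using l by (auto simp: bounded_potential_def)
  define Y where "Y \<omega> t = (\<Sum>i\<in>I. y i (\<omega> i) t)" for \<omega> t
  define HH where "HH s t = (\<Sum>i\<in>I. h i s t)" for s t
  have Zm[measurable]: "(\<lambda>(\<omega>, t). Z \<omega> t) \<in> borel_measurable (?N \<Otimes>\<^sub>M \<pi>)" unfolding Z_def by measurable
  have Ym[measurable]: "(\<lambda>(\<omega>, t). Y \<omega> t) \<in> borel_measurable (?N \<Otimes>\<^sub>M \<pi>)"
  proof -
    have "(\<lambda>x. y i (fst x i) (snd x)) \<in> borel_measurable (?N \<Otimes>\<^sub>M \<pi>)" if "i \<in> I" for i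
      using measurable_component_process[where P=P and m=i and f="y i", OF y[OF that] that] by (simp add: case_prod_beta')
    then show ?thesis unfolding Y_def case_prod_beta' by (intro borel_measurable_sum)
  qed
  have Wm[measurable]: "(\<lambda>(\<omega>, t). W \<omega> t) \<in> borel_measurable (?N \<Otimes>\<^sub>M \<pi>)"
    unfolding W_def Y_def[symmetric] by measurable
  have HHm[measurable]: "(\<lambda>(s, t). HH s t) \<in> borel_measurable (\<pi> \<Otimes>\<^sub>M \<pi>)"
    using h unfolding HH_def case_prod_beta' by (intro borel_measurable_sum) auto
  have spc: "\<omega> i \<in> space (P i)" if "\<omega> \<in> space ?N" "i \<in> I" for \<omega> i
    using that by (auto simp: space_PiM PiE_def Pi_def)
  have Yb: "\<bar>Y \<omega> t\<bar> \<le> total_env \<omega>" if "\<omega> \<in> space ?N" "t \<in> space \<pi>" for \<omega> t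
    unfolding Y_def total_env_def using y_le spc that by (intro order_trans[OF sum_abs] sum_mono) auto
  define hb where "hb = card I * hmax"
  have HHb: "\<bar>HH s t\<bar> \<le> hb" if "s \<in> space \<pi>" "t \<in> space \<pi>" for s t
  proof -
    have "\<bar>HH s t\<bar> \<le> (\<Sum>i\<in>I. hmax)" unfolding HH_def using h_le that by (intro order_trans[OF sum_abs] sum_mono) auto
    then show ?thesis by (simp add: hb_def)
  qed
  have bZ: "bounded_potential \<pi> (Z \<omega>)" if "\<omega> \<in> space ?N" for \<omega>
    unfolding Z_def by (intro bounded_potential_add c total_bounded that)
  have bY: "bounded_potential \<pi> (Y \<omega>)" if "\<omega> \<in> space ?N" for \<omega>
    unfolding bounded_potential_def using Yb[OF that] measurable_compose[OF measurable_Pair1'[OF that] Ym]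
    by (auto intro!: exI[of _ "total_env \<omega>"])
  have bW: "bounded_potential \<pi> (W \<omega>)" if "\<omega> \<in> space ?N" for \<omega>
    unfolding W_def Y_def[symmetric] by (intro bounded_potential_add bY that l)
  have Wb: "\<bar>W \<omega> t\<bar> \<le> total_env \<omega> + Bl" if "\<omega> \<in> space ?N" "t \<in> space \<pi>" for \<omega> t
    using Yb[OF that] Bl[OF that(2)] unfolding W_def Y_def[symmetric] by linarith
  let ?G = "\<lambda>\<omega>. gibbs \<pi> (Z \<omega>)"
  define D where "D \<omega> = ibp_defect (?G \<omega>) (Y \<omega>) HH" for \<omega>
  define R where "R \<omega> = ibp_defect (?G \<omega>) (\<lambda>t. - l t) HH" for \<omega>
  have Dm: "D \<in> borel_measurable ?N" unfolding D_def[abs_def]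
    by (rule ibp_defect_measurable[OF T.prob_space_axioms Zm Ym HHm bZ])
  have lm2: "(\<lambda>(\<omega>, t). - l t) \<in> borel_measurable (?N \<Otimes>\<^sub>M \<pi>)" by measurable
  have Rm: "R \<in> borel_measurable ?N" unfolding R_def[abs_def]
    by (rule ibp_defect_measurable[OF T.prob_space_axioms Zm lm2 HHm bZ])
  have pt: "\<bar>D \<omega>\<bar> \<le> total_env \<omega> + 2 * hb" "\<bar>R \<omega>\<bar> \<le> Bl + 2 * hb"
    "(\<integral>t. W \<omega> t \<partial>?G \<omega>) = D \<omega> - R \<omega>" "(\<integral>t. (\<integral>s. test s t \<partial>?G \<omega>) \<partial>?G \<omega>) = - R \<omega>" if w: "\<omega> \<in> space ?N" for \<omega>
  proof -
    interpret G: prob_space "?G \<omega>" by (rule prob_space_gibbs[OF T.prob_space_axioms bZ[OF w]])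
    note sp = space_gibbs[OF T.prob_space_axioms bZ[OF w]]
    note [measurable_cong] = sets_gibbs[OF T.prob_space_axioms bZ[OF w]]
    have [measurable]: "Y \<omega> \<in> borel_measurable \<pi>" using bY[OF w] by (simp add: bounded_potential_def)
    show "\<bar>D \<omega>\<bar> \<le> total_env \<omega> + 2 * hb"
      unfolding D_def using Yb[OF w] HHb by (intro G.abs_ibp_defect_le) (auto simp: sp)
    show "\<bar>R \<omega>\<bar> \<le> Bl + 2 * hb"
      unfolding R_def using Bl HHb by (intro G.abs_ibp_defect_le) (auto simp: sp)
    have iY: "integrable (?G \<omega>) (Y \<omega>)" using Yb[OF w] by (intro G.abs_integral_le_bound(1)) (auto simp: sp)
    have il: "integrable (?G \<omega>) l" using Bl by (intro G.abs_integral_le_bound(1)) (auto simp: sp)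
    show "(\<integral>t. W \<omega> t \<partial>?G \<omega>) = D \<omega> - R \<omega>"
      unfolding W_def Y_def[symmetric] D_def R_def ibp_defect_def using iY il by simp
    have dm[measurable]: "(\<lambda>(t, s). HH t t - HH s t) \<in> borel_measurable (\<pi> \<Otimes>\<^sub>M \<pi>)" by measurable
    have ih: "integrable (?G \<omega>) (\<lambda>s. HH t t - HH s t)" "\<bar>\<integral>s. HH t t - HH s t \<partial>?G \<omega>\<bar> \<le> 2 * hb" if t: "t \<in> space \<pi>" for t
    proof -
      have b: "\<bar>HH t t - HH s t\<bar> \<le> 2 * hb" if "s \<in> space (?G \<omega>)" for s
        using HHb[OF t t] HHb[OF that[unfolded sp] t] by linarith
      have "(\<lambda>s. HH t t - HH s t) \<in> borel_measurable \<pi>"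
        using measurable_compose[OF measurable_Pair2'[OF t] HHm] by (intro borel_measurable_diff) auto
      then have me: "(\<lambda>s. HH t t - HH s t) \<in> borel_measurable (?G \<omega>)"
        by (simp add: measurable_cong_sets[OF sets_gibbs[OF T.prob_space_axioms bZ[OF w]] refl])
      show "integrable (?G \<omega>) (\<lambda>s. HH t t - HH s t)" "\<bar>\<integral>s. HH t t - HH s t \<partial>?G \<omega>\<bar> \<le> 2 * hb"
        by (rule G.abs_integral_le_bound[OF me b]; assumption)+
    qed
    have "(\<integral>t. (\<integral>s. test s t \<partial>?G \<omega>) \<partial>?G \<omega>) = (\<integral>t. l t + (\<integral>s. HH t t - HH s t \<partial>?G \<omega>) \<partial>?G \<omega>)"
    proof (intro Bochner_Integration.integral_cong refl)
      fix t assume "t \<in> space (?G \<omega>)"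
      then have t: "t \<in> space \<pi>" by (simp add: sp)
      have "(\<integral>s. test s t \<partial>?G \<omega>) = (\<integral>s. l t + (HH t t - HH s t) \<partial>?G \<omega>)"
        unfolding test_def HH_def by (simp add: algebra_simps)
      also have "\<dots> = l t + (\<integral>s. HH t t - HH s t \<partial>?G \<omega>)"
        using ih(1)[OF t] G.prob_space by (subst Bochner_Integration.integral_add) auto
      finally show "(\<integral>s. test s t \<partial>?G \<omega>) = l t + (\<integral>s. HH t t - HH s t \<partial>?G \<omega>)" .
    qed
    also have "\<dots> = (\<integral>t. l t \<partial>?G \<omega>) + (\<integral>t. (\<integral>s. HH t t - HH s t \<partial>?G \<omega>) \<partial>?G \<omega>)"
    proof (rule Bochner_Integration.integral_add[OF il])
      show "integrable (?G \<omega>) (\<lambda>t. \<integral>s. HH t t - HH s t \<partial>?G \<omega>)"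
        using ih(2) by (intro G.abs_integral_le_bound(1)[where B="2 * hb"]) (auto simp: sp)
    qed
    finally show "(\<integral>t. (\<integral>s. test s t \<partial>?G \<omega>) \<partial>?G \<omega>) = - R \<omega>"
      unfolding R_def ibp_defect_def using il by simp
  qed
  have iD: "integrable ?N D"
    by (rule dominated_integrable[where G="\<lambda>\<omega>. total_env \<omega> + 2 * hb"]) (use Dm pt(1) total_env_int in auto)
  have iR: "integrable ?N R"
    by (rule dominated_integrable[where G="\<lambda>\<omega>. Bl + 2 * hb"]) (use Rm pt(2) in auto)
  have mW: "mW = (\<integral>\<omega>. D \<omega> \<partial>?N) - (\<integral>\<omega>. R \<omega> \<partial>?N)"
  proof -
    have "mW = (\<integral>\<omega>. D \<omega> - R \<omega> \<partial>?N)" unfolding mW_def using pt(3) by (intro Bochner_Integration.integral_cong) auto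
    then show ?thesis using iD iR by simp
  qed
  have mT: "(\<integral>\<omega>. (\<integral>t. (\<integral>s. test s t \<partial>?G \<omega>) \<partial>?G \<omega>) \<partial>?N) = - (\<integral>\<omega>. R \<omega> \<partial>?N)"
  proof -
    have "(\<integral>\<omega>. (\<integral>t. (\<integral>s. test s t \<partial>?G \<omega>) \<partial>?G \<omega>) \<partial>?N) = (\<integral>\<omega>. - R \<omega> \<partial>?N)"
      using pt(4) by (intro Bochner_Integration.integral_cong) auto
    then show ?thesis by simp
  qed
  show "\<bar>mW - (\<integral>\<omega>. (\<integral>t. (\<integral>s. test s t \<partial>?G \<omega>) \<partial>?G \<omega>) \<partial>?N)\<bar> \<le> card I * (166 * \<kappa> + 3 * \<alpha>)"
    unfolding mT mW
    using mean_ibp_defect_sum[OF component_family_axioms y y_le h h_le m k hg c]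
    unfolding D_def Y_def HH_def[abs_def] Z_def by simp
  have i0: "integrable ?N (\<lambda>\<omega>. log_partition \<pi> (Z \<omega>))"
    unfolding Z_def by (rule integrable_log_partition_total[OF c])
  have i1: "integrable ?N (\<lambda>\<omega>. log_partition \<pi> (\<lambda>t. Z \<omega> t + b * W \<omega> t))"
  proof (rule NT.integrable_log_partition)
    show "integrable ?N (\<lambda>\<omega>. (Bc + total_env \<omega>) + \<bar>b\<bar> * (total_env \<omega> + Bl))" using total_env_int by simp
    fix \<omega> t assume w: "\<omega> \<in> space ?N" and t: "t \<in> space \<pi>"
    have "\<bar>b * W \<omega> t\<bar> \<le> \<bar>b\<bar> * (total_env \<omega> + Bl)" unfolding abs_mult by (intro mult_left_mono Wb w t) simp
    moreover have "\<bar>Z \<omega> t\<bar> \<le> Bc + total_env \<omega>" unfolding Z_def using Bc[OF t] total_le[OF w t] by linarith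
    ultimately show "\<bar>Z \<omega> t + b * W \<omega> t\<bar> \<le> (Bc + total_env \<omega>) + \<bar>b\<bar> * (total_env \<omega> + Bl)" by linarith
  qed measurable
  have "b * mW = (\<integral>\<omega>. b * (\<integral>t. W \<omega> t \<partial>?G \<omega>) \<partial>?N)" unfolding mW_def by simp
  also have "\<dots> \<le> (\<integral>\<omega>. log_partition \<pi> (\<lambda>t. Z \<omega> t + b * W \<omega> t) - log_partition \<pi> (Z \<omega>) \<partial>?N)"
  proof (rule integral_mono)
    have "integrable ?N (\<lambda>\<omega>. b * (D \<omega> - R \<omega>))" using iD iR by simp
    then show "integrable ?N (\<lambda>\<omega>. b * (\<integral>t. W \<omega> t \<partial>?G \<omega>))"
      by (rule iffD1[OF Bochner_Integration.integrable_cong[OF refl], rotated]) (simp add: pt(3))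
    show "b * (\<integral>t. W \<omega> t \<partial>?G \<omega>) \<le> log_partition \<pi> (\<lambda>t. Z \<omega> t + b * W \<omega> t) - log_partition \<pi> (Z \<omega>)" if "\<omega> \<in> space ?N" for \<omega>
      unfolding log_partition_def by (rule ln_partition_convex[OF T.prob_space_axioms bZ[OF that] bW[OF that]])
  qed (use i0 i1 in simp)
  also have "\<dots> = (\<integral>\<omega>. log_partition \<pi> (\<lambda>t. Z \<omega> t + b * W \<omega> t) \<partial>?N) - (\<integral>\<omega>. log_partition \<pi> (Z \<omega>) \<partial>?N)"
    using i0 i1 by simp
  finally show "b * mW \<le> (\<integral>\<omega>. log_partition \<pi> (\<lambda>t. Z \<omega> t + b * W \<omega> t) \<partial>?N) - (\<integral>\<omega>. log_partition \<pi> (Z \<omega>) \<partial>?N)" .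
qed

context gaussian_comparison
begin

abbreviation M where "M \<equiv> ncomp E"
definition hh :: "nat \<Rightarrow> 'p \<Rightarrow> 'p \<Rightarrow> real" where "hh m s t = blinfun_apply (H m) (feat E m s) \<bullet> feat E m t"
definition loss :: "'p \<Rightarrow> real" where "loss t = loss_form E H \<theta> t"

lemma continuous_bounded_potential:
  assumes c: "continuous_on T f"
  shows "bounded_potential \<pi> f"
proof -
  have "bounded (f ` T)" by (intro compact_imp_bounded compact_continuous_image compact_idx c)
  then have "\<exists>B. \<forall>t\<in>T. \<bar>f t\<bar> \<le> B" by (auto simp: bounded_iff)
  then show ?thesis
    unfolding bounded_potential_def space_prior using continuous_on_measurable_restrict[OF sets_prior c] by blast
qed

lemma one_comp: "1 \<in> comps E" using ncomp_pos by (auto simp: comps_def)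

lemma dsum_inner_comps: "dsum_inner M x y = (\<Sum>m\<in>comps E. x m \<bullet> y m)"
  by (simp add: dsum_inner_def comps_def)

lemma loss_eq: "loss t = (\<Sum>m\<in>comps E. blinfun_apply (H m) (feat E m \<theta> - feat E m t) \<bullet> (feat E m \<theta> - feat E m t))"
  by (simp add: loss_def loss_form_def dsum_inner_comps dsum_op_def eta_def)

lemma test_fun_eq: "test_fun E H a \<theta> s t = a * loss t + (\<Sum>m\<in>comps E. hh m t t) - (\<Sum>m\<in>comps E. hh m s t)"
  by (simp add: test_fun_def loss_def dsum_inner_comps dsum_op_def eta_def hh_def)

lemma feat_continuous: "m \<in> comps E \<Longrightarrow> continuous_on T (feat E m)"
  using feat_cont idx_subset by (metis continuous_on_subset)

lemma feat_meas: "m \<in> comps E \<Longrightarrow> feat E m \<in> borel_measurable \<pi>"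
  by (rule continuous_on_measurable_restrict[OF sets_prior feat_continuous])

lemma Bf_meas: "m \<in> comps E \<Longrightarrow> Bf m \<in> borel_measurable \<pi>"
  unfolding Bf_def by (rule continuous_on_measurable_restrict[OF sets_prior]) (intro continuous_intros feat_continuous)

lemma hh_meas: "m \<in> comps E \<Longrightarrow> (\<lambda>(s, t). hh m s t) \<in> borel_measurable (\<pi> \<Otimes>\<^sub>M \<pi>)"
proof -
  assume m: "m \<in> comps E"
  have [measurable]: "(\<lambda>s. blinfun_apply (H m) (feat E m s)) \<in> borel_measurable \<pi>"
    by (rule continuous_on_measurable_restrict[OF sets_prior]) (intro continuous_intros feat_continuous m)
  note [measurable] = feat_meas[OF m]
  show ?thesis unfolding hh_def by measurable
qed

lemma hh_le:
  assumes "m \<in> comps E" "s \<in> params E" "t \<in> params E"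
  shows "\<bar>hh m s t\<bar> \<le> K * lam\<^sup>2" "\<bar>hh m s t\<bar> \<le> K * r\<^sup>2"
  unfolding hh_def by (rule H_form_le[OF assms])+

text \<open>The loss and the test function are combinations of the forms \<open>hh\<close>, whose bounds they inherit.\<close>

lemma loss_hh: "loss t = (\<Sum>m\<in>comps E. hh m \<theta> \<theta> - hh m \<theta> t - hh m t \<theta> + hh m t t)"
  unfolding loss_eq hh_def by (intro sum.cong) (auto simp: blinfun.diff_right inner_diff_left inner_diff_right)

lemma loss_le:
  fixes x :: real
  assumes "\<And>m s t. m \<in> comps E \<Longrightarrow> s \<in> params E \<Longrightarrow> t \<in> params E \<Longrightarrow> \<bar>hh m s t\<bar> \<le> x" and t: "t \<in> T"
  shows "\<bar>loss t\<bar> \<le> 4 * M * x"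
proof -
  have "\<bar>loss t\<bar> \<le> (\<Sum>m\<in>comps E. 4 * x)"
    unfolding loss_hh
  proof (intro order_trans[OF sum_abs] sum_mono)
    fix m assume m: "m \<in> comps E"
    note a = assms(1)[OF m]
    show "\<bar>hh m \<theta> \<theta> - hh m \<theta> t - hh m t \<theta> + hh m t t\<bar> \<le> 4 * x"
      using a[OF \<theta> \<theta>] a[OF \<theta> T_params[OF t]] a[OF T_params[OF t] \<theta>] a[OF T_params[OF t] T_params[OF t]] by linarith
  qed
  then show ?thesis by (simp add: card_comps)
qed

lemma loss_continuous: "continuous_on T loss"
  unfolding loss_eq by (intro continuous_intros feat_continuous)

lemmas loss_bounded = continuous_bounded_potential[OF loss_continuous]

lemma test_fun_le:
  fixes x :: real
  assumes x: "\<And>m s t. m \<in> comps E \<Longrightarrow> s \<in> params E \<Longrightarrow> t \<in> params E \<Longrightarrow> \<bar>hh m s t\<bar> \<le> x" and s: "s \<in> T" and t: "t \<in> T"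
  shows "\<bar>test_fun E H a \<theta> s t\<bar> \<le> 6 * M * x"
proof -
  have "\<bar>\<Sum>m\<in>comps E. hh m u t\<bar> \<le> M * x" if "u \<in> T" for u
  proof -
    have "\<bar>\<Sum>m\<in>comps E. hh m u t\<bar> \<le> (\<Sum>m\<in>comps E. x)"
      using x T_params that t by (intro order_trans[OF sum_abs] sum_mono) auto
    then show ?thesis by (simp add: card_comps)
  qed
  from this[OF s] this[OF t]
  have 1: "\<bar>\<Sum>m\<in>comps E. hh m s t\<bar> \<le> M * x" "\<bar>\<Sum>m\<in>comps E. hh m t t\<bar> \<le> M * x" .
  have "\<bar>a * loss t\<bar> \<le> 1 * (4 * M * x)"
    unfolding abs_mult using a_le loss_le[OF x t] by (intro mult_mono) auto
  then show ?thesis unfolding test_fun_eq using 1 by linarith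
qed

lemma test_fun_meas: "(\<lambda>(s, t). test_fun E H a \<theta> s t) \<in> borel_measurable (\<pi> \<Otimes>\<^sub>M \<pi>)"
proof -
  have [measurable]: "loss \<in> borel_measurable \<pi>" using loss_bounded by (simp add: bounded_potential_def)
  have [measurable]: "(\<lambda>(s, t). \<Sum>m\<in>comps E. hh m s t) \<in> borel_measurable (\<pi> \<Otimes>\<^sub>M \<pi>)"
    unfolding case_prod_beta' using hh_meas by (intro borel_measurable_sum) (auto simp: case_prod_beta')
  show ?thesis unfolding test_fun_eq by measurable
qed

lemma space_joint_law: "space (joint_law E \<theta>) = space (PiM (comps E) P0)" and sets_joint_law: "sets (joint_law E \<theta>) = sets (PiM (comps E) P0)"
proof -
  show "sets (joint_law E \<theta>) = sets (PiM (comps E) P0)" unfolding joint_law_def by (intro sets_PiM_cong refl sets_P1)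
  then show "space (joint_law E \<theta>) = space (PiM (comps E) P0)" by (rule sets_eq_imp_space_eq)
qed

lemma prob_joint_law: "prob_space (joint_law E \<theta>)"
  unfolding joint_law_def by (rule prob_space_PiM) (rule prob_law[OF _ \<theta>])

lemma process_meas: "(\<lambda>(\<omega>, t). process E \<omega> t) \<in> borel_measurable (joint_law E \<theta> \<Otimes>\<^sub>M \<pi>)"
proof (rule caratheodory_measurable[OF compact_idx metrizable_idx T_ne sets_prior])
  show "continuous_on T (process E \<omega>)" if "\<omega> \<in> space (joint_law E \<theta>)" for \<omega>
    using that by (intro process_cont) (simp add: space_joint_law)
  fix t assume t: "t \<in> T"
  have "(\<lambda>\<omega>. process E \<omega> t) \<in> borel_measurable (PiM (comps E) P0)"
    unfolding process_def
  proof (intro borel_measurable_sum)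
    fix m assume m: "m \<in> comps E"
    note [measurable] = U_m[OF m] V_m[OF m] R_m[OF m t]
    have "(\<lambda>w. local_process E m t w) \<in> borel_measurable (P0 m)" unfolding local_process_def by measurable
    moreover have "(\<lambda>\<omega>. \<omega> m) \<in> measurable (PiM (comps E) P0) (P0 m)" using m by measurable
    ultimately show "(\<lambda>\<omega>. local_process E m t (\<omega> m)) \<in> borel_measurable (PiM (comps E) P0)"
      by (rule measurable_compose[rotated])
  qed
  then show "(\<lambda>\<omega>. process E \<omega> t) \<in> borel_measurable (joint_law E \<theta>)"
    by (simp add: measurable_cong_sets[OF sets_joint_law refl])
qed

lemma process_bounded: "\<omega> \<in> space (joint_law E \<theta>) \<Longrightarrow> bounded_potential \<pi> (process E \<omega>)"
  by (rule continuous_bounded_potential[OF process_cont]) (simp add: space_joint_law)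

end

section \<open>The Gaussian process and its replica average\<close>

lemma gibbs_pair_measurable:
  fixes F :: "'w \<Rightarrow> 't \<Rightarrow> real" and \<phi> :: "'t \<Rightarrow> 't \<Rightarrow> real"
  assumes "prob_space \<pi>"
    and F[measurable]: "(\<lambda>(w, t). F w t) \<in> borel_measurable (P \<Otimes>\<^sub>M \<pi>)"
    and \<phi>[measurable]: "(\<lambda>(s, t). \<phi> s t) \<in> borel_measurable (\<pi> \<Otimes>\<^sub>M \<pi>)"
    and b: "\<And>w. w \<in> space P \<Longrightarrow> bounded_potential \<pi> (F w)"
  shows "(\<lambda>w. \<integral>t. (\<integral>s. \<phi> s t \<partial>gibbs \<pi> (F w)) \<partial>gibbs \<pi> (F w)) \<in> borel_measurable P"
proof -
  interpret prob_space \<pi> by fact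
  define E where "E w = (\<integral>t. exp (F w t) \<partial>\<pi>)" for w
  have [measurable]: "E \<in> borel_measurable P" unfolding E_def by measurable
  have "(\<integral>t. (\<integral>s. \<phi> s t \<partial>gibbs \<pi> (F w)) \<partial>gibbs \<pi> (F w))
      = (\<integral>t. ((\<integral>s. \<phi> s t * exp (F w s) \<partial>\<pi>) / E w) * exp (F w t) \<partial>\<pi>) / E w" if w: "w \<in> space P" for w
  proof -
    have inner: "(\<integral>s. \<phi> s t \<partial>gibbs \<pi> (F w)) = (\<integral>s. \<phi> s t * exp (F w s) \<partial>\<pi>) / E w" if "t \<in> space \<pi>" for t
      unfolding E_def using that by (intro integral_gibbs[OF prob_space_axioms b[OF w]]) measurable
    have "(\<integral>t. (\<integral>s. \<phi> s t \<partial>gibbs \<pi> (F w)) \<partial>gibbs \<pi> (F w))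
        = (\<integral>t. (\<integral>s. \<phi> s t * exp (F w s) \<partial>\<pi>) / E w \<partial>gibbs \<pi> (F w))"
      using inner by (intro Bochner_Integration.integral_cong) (auto simp: space_gibbs[OF prob_space_axioms b[OF w]])
    also have "\<dots> = (\<integral>t. ((\<integral>s. \<phi> s t * exp (F w s) \<partial>\<pi>) / E w) * exp (F w t) \<partial>\<pi>) / E w"
      unfolding E_def using w by (intro integral_gibbs[OF prob_space_axioms b[OF w]]) measurable
    finally show ?thesis .
  qed
  then show ?thesis
    by (subst measurable_cong) (simp, measurable)
qed

lemma gibbs_pair_le:
  fixes \<phi> :: "'t \<Rightarrow> 't \<Rightarrow> real"
  assumes \<pi>: "prob_space \<pi>" and P: "prob_space P"
    and F: "(\<lambda>(w, t). F w t) \<in> borel_measurable (P \<Otimes>\<^sub>M \<pi>)"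
    and \<phi>[measurable]: "(\<lambda>(s, t). \<phi> s t) \<in> borel_measurable (\<pi> \<Otimes>\<^sub>M \<pi>)"
    and b: "\<And>w. w \<in> space P \<Longrightarrow> bounded_potential \<pi> (F w)"
    and le: "\<And>s t. s \<in> space \<pi> \<Longrightarrow> t \<in> space \<pi> \<Longrightarrow> \<bar>\<phi> s t\<bar> \<le> x"
  shows "\<bar>\<integral>w. (\<integral>t. (\<integral>s. \<phi> s t \<partial>gibbs \<pi> (F w)) \<partial>gibbs \<pi> (F w)) \<partial>P\<bar> \<le> x"
proof (rule prob_space.abs_integral_le_bound(2)[OF P gibbs_pair_measurable[OF \<pi> F \<phi> b]])
  fix w assume w: "w \<in> space P"
  interpret G: prob_space "gibbs \<pi> (F w)" by (rule prob_space_gibbs[OF \<pi> b[OF w]])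
  note sp = space_gibbs[OF \<pi> b[OF w]]
  note [measurable_cong] = sets_gibbs[OF \<pi> b[OF w]]
  have m: "(\<lambda>t. \<integral>s. \<phi> s t \<partial>gibbs \<pi> (F w)) \<in> borel_measurable (gibbs \<pi> (F w))" by measurable
  show "\<bar>\<integral>t. (\<integral>s. \<phi> s t \<partial>gibbs \<pi> (F w)) \<partial>gibbs \<pi> (F w)\<bar> \<le> x"
  proof (rule G.abs_integral_le_bound(2)[OF m])
    fix t assume "t \<in> space (gibbs \<pi> (F w))"
    then have t: "t \<in> space \<pi>" by (simp only: sp)
    have "(\<lambda>s. \<phi> s t) \<in> borel_measurable (gibbs \<pi> (F w))"
      using measurable_compose[OF measurable_Pair2'[OF t] \<phi>]
      by (simp add: measurable_cong_sets[OF sets_gibbs[OF \<pi> b[OF w]] refl])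
    then show "\<bar>\<integral>s. \<phi> s t \<partial>gibbs \<pi> (F w)\<bar> \<le> x"
      by (rule G.abs_integral_le_bound(2)) (simp only: sp le t)
  qed
qed

context gaussian_comparison
begin

lemma gauss_meas: "m \<in> comps E \<Longrightarrow> (\<lambda>q. \<xi> q m) \<in> borel_measurable Q"
  and gauss_in: "m \<in> comps E \<Longrightarrow> q \<in> space Q \<Longrightarrow> \<xi> q m \<in> W m"
  using gauss by (auto simp: gaussian_element_def)

lemma gauss_law:
  assumes "\<And>m. m \<in> comps E \<Longrightarrow> h m \<in> W m"
  shows "distr Q borel (\<lambda>q. \<Sum>m\<in>comps E. \<xi> q m \<bullet> h m) = centred_normal (\<Sum>m\<in>comps E. cov m (h m) (h m))"
proof -
  have "(\<Sum>m\<in>comps E. blinfun_apply (Sigmaop E m) (h m) \<bullet> h m) = (\<Sum>m\<in>comps E. cov m (h m) (h m))"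
    by (intro sum.cong refl Sigma_form assms)
  then show ?thesis
    using gauss assms unfolding gaussian_element_def dsum_inner_comps dsum_op_def by simp
qed

lemma gauss_law_component:
  assumes m: "m \<in> comps E" and x: "x \<in> W m"
  shows "distr Q borel (\<lambda>q. \<xi> q m \<bullet> x) = centred_normal (cov m x x)"
proof -
  define h where "h i = (if i = m then x else 0)" for i
  have h: "h i \<in> W i" if "i \<in> comps E" for i using x subspace_0[OF W_m(1)[OF that]] by (simp add: h_def)
  have 1: "(\<Sum>i\<in>comps E. \<xi> q i \<bullet> h i) = \<xi> q m \<bullet> x" for q
    using m finite_comps by (subst sum.remove[of _ m]) (auto simp: h_def)
  have 2: "cov i 0 0 = 0" for i by (simp add: cov_def)
  have "(\<Sum>i\<in>comps E. cov i (h i) (h i)) = cov m x x"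
    using m finite_comps by (subst sum.remove[of _ m]) (auto simp: h_def 2 intro!: sum.neutral)
  then show ?thesis using gauss_law[OF h] unfolding 1 by simp
qed

lemma cov_nonneg: "0 \<le> cov m x x" by (simp add: cov_def)

lemma gauss_copy: "m \<in> comps E \<Longrightarrow> gaussian_copy Q (P0 m) (\<lambda>q. \<xi> q m) (Uvec E m) (W m)"
proof -
  assume m: "m \<in> comps E"
  have c: "cov m x x = (\<integral>w. (Uvec E m w \<bullet> x)\<^sup>2 \<partial>P0 m)" for x by (simp add: cov_def power2_eq_square)
  show ?thesis
    unfolding gaussian_copy_def gaussian_copy_axioms_def
    using gauss_law_component[OF m] Q.prob_space_axioms prob_null[OF m] W_m[OF m] gauss_meas[OF m] gauss_in[OF m]
      U_meas[OF m] second_moments(1)[OF m] by (simp add: c)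
qed

text \<open>The value at indices outside the components only serves to make every \<open>gam m\<close> a probability measure.\<close>

definition gam :: "nat \<Rightarrow> 'h measure" where
  "gam m = distr Q borel (\<lambda>q. \<xi> q (if m \<in> comps E then m else 1))"

lemma prob_gam: "prob_space (gam m)"
  unfolding gam_def using gauss_meas one_comp by (intro Q.prob_space_distr) auto

lemma sets_gam [measurable_cong]: "sets (gam m) = sets borel" and space_gam [simp]: "space (gam m) = UNIV"
  by (simp_all add: gam_def)

lemma gam_eq: "m \<in> comps E \<Longrightarrow> gam m = distr Q borel (\<lambda>q. \<xi> q m)" by (simp add: gam_def)

text \<open>
  The components of the Gaussian element are independent: its characteristic function factorises,
  because the variance of a linear functional is the sum over the components.
\<close>

lemma gauss_product_law: "distr Q (PiM (comps E) (\<lambda>m. borel)) (\<lambda>q. \<lambda>m\<in>comps E. \<xi> q m) = PiM (comps E) gam"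
proof (rule charfun_determines_product_law[OF Q.prob_space_axioms finite_comps W_m gauss_meas gauss_in _ prob_gam gam_eq])
  fix h assume h: "\<And>m. m \<in> comps E \<Longrightarrow> h m \<in> W m"
  have cf: "(CLINT q|Q. iexp (f q)) = complex_of_real (exp (- v / 2))"
    if "distr Q borel f = centred_normal v" "f \<in> borel_measurable Q" "0 \<le> v" for f v
  proof -
    have "(CLINT q|Q. iexp (f q)) = (CLINT x|distr Q borel f. iexp x)" using that(2) by (subst integral_distr) auto
    then show ?thesis using centred_normal_facts(3)[OF that(3)] that(1) by simp
  qed
  have s: "(\<lambda>q. \<xi> q m \<bullet> h m) \<in> borel_measurable Q" if "m \<in> comps E" for m
    using gauss_meas[OF that] by measurable
  have "(CLINT q|Q. iexp (\<Sum>m\<in>comps E. \<xi> q m \<bullet> h m)) = complex_of_real (exp (- (\<Sum>m\<in>comps E. cov m (h m) (h m)) / 2))"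
    using gauss_law[OF h] s cov_nonneg by (intro cf) (auto intro!: sum_nonneg)
  also have "\<dots> = complex_of_real (exp (\<Sum>m\<in>comps E. - cov m (h m) (h m) / 2))"
    by (simp add: sum_negf sum_divide_distrib)
  also have "\<dots> = (\<Prod>m\<in>comps E. complex_of_real (exp (- cov m (h m) (h m) / 2)))"
    using finite_comps by (simp add: exp_sum)
  also have "\<dots> = (\<Prod>m\<in>comps E. CLINT q|Q. iexp (\<xi> q m \<bullet> h m))"
    using cf[OF gauss_law_component[OF _ h] s cov_nonneg] by (intro prod.cong) auto
  finally show "(CLINT q|Q. iexp (\<Sum>m\<in>comps E. \<xi> q m \<bullet> h m)) = (\<Prod>m\<in>comps E. CLINT q|Q. iexp (\<xi> q m \<bullet> h m))" .
qed

text \<open>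
  The deterministic part of the Gaussian process; through the operators \<open>A\<close> and \<open>K\<close> it is continuous in
  the index.
\<close>

definition drift :: "nat \<Rightarrow> 'p \<Rightarrow> real" where "drift m t = aform m (feat E m t) + kbar m t"

lemma drift_eq: "m \<in> comps E \<Longrightarrow> t \<in> T \<Longrightarrow>
  drift m t = blinfun_apply (Aop E m) (feat E m \<theta>) \<bullet> feat E m t - 1 / 2 * (blinfun_apply (Kop E m) (feat E m t) \<bullet> feat E m t)"
  using A_form[of m "feat E m t"] K_form[of m t] feat_in[of m t] T_params[of t] by (simp add: drift_def)

lemma drift_continuous: "m \<in> comps E \<Longrightarrow> continuous_on T (drift m)"
proof -
  assume m: "m \<in> comps E"
  have "continuous_on T (\<lambda>t. blinfun_apply (Aop E m) (feat E m \<theta>) \<bullet> feat E m t - 1 / 2 * (blinfun_apply (Kop E m) (feat E m t) \<bullet> feat E m t))"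
    by (intro continuous_intros feat_continuous m)
  then show ?thesis by (subst continuous_on_cong[OF refl drift_eq[OF m]])
qed

lemma fY_drift: "fY \<beta> m x t = x \<bullet> psi \<beta> m t + drift m t" by (simp add: fY_def drift_def)

lemma psi_continuous: "m \<in> comps E \<Longrightarrow> continuous_on T (psi \<beta> m)"
  unfolding psi_def[abs_def] Bf_def by (intro continuous_intros feat_continuous)

lemma psi_meas: "m \<in> comps E \<Longrightarrow> psi \<beta> m \<in> borel_measurable \<pi>"
  by (rule continuous_on_measurable_restrict[OF sets_prior psi_continuous])

lemma fY_meas:
  assumes m: "m \<in> comps E"
  shows "(\<lambda>(x, t). fY \<beta> m x t) \<in> borel_measurable (gam m \<Otimes>\<^sub>M \<pi>)"
proof -
  note [measurable] = psi_meas[OF m] continuous_on_measurable_restrict[OF sets_prior drift_continuous[OF m]]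
  show ?thesis unfolding fY_drift by measurable
qed

definition pert :: "real \<Rightarrow> (nat \<Rightarrow> 'h) \<Rightarrow> 'p \<Rightarrow> real" where
  "pert \<beta> x t = \<beta> * (a * loss t) + (\<Sum>m\<in>comps E. fY \<beta> m (x m) t)"

lemma pert_eq:
  assumes t: "t \<in> T"
  shows "perturbed_process E H B a \<theta> \<beta> x t = pert \<beta> x t"
proof -
  have "(\<Sum>m\<in>comps E. fY \<beta> m (x m) t) = (\<Sum>m\<in>comps E. x m \<bullet> feat E m t + blinfun_apply (Aop E m) (feat E m \<theta>) \<bullet> feat E m t
      - 1 / 2 * (blinfun_apply (Kop E m) (feat E m t) \<bullet> feat E m t) + \<beta> * (x m \<bullet> Bf m t))"
    by (intro sum.cong refl) (simp add: fY_drift drift_eq t psi_def inner_add_right)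
  also have "\<dots> = (\<Sum>m\<in>comps E. x m \<bullet> feat E m t) + (\<Sum>m\<in>comps E. blinfun_apply (Aop E m) (feat E m \<theta>) \<bullet> feat E m t)
      - 1 / 2 * (\<Sum>m\<in>comps E. blinfun_apply (Kop E m) (feat E m t) \<bullet> feat E m t) + \<beta> * (\<Sum>m\<in>comps E. x m \<bullet> Bf m t)"
    by (simp only: sum.distrib sum_subtractf sum_distrib_left)
  finally show ?thesis
    unfolding pert_def perturbed_process_def gauss_process_def dsum_inner_comps dsum_op_def eta_def loss_def Bf_def
    by (simp add: algebra_simps)
qed

lemma pert_bounded: "bounded_potential \<pi> (pert \<beta> x)"
  by (rule continuous_bounded_potential, unfold pert_def[abs_def] fY_drift)
    (intro continuous_intros psi_continuous drift_continuous loss_continuous)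

lemma pert_meas: "(\<lambda>(x, t). pert \<beta> x t) \<in> borel_measurable (PiM (comps E) gam \<Otimes>\<^sub>M \<pi>)"
proof -
  have [measurable]: "loss \<in> borel_measurable \<pi>" using loss_bounded by (simp add: bounded_potential_def)
  have "(\<lambda>x. fY \<beta> m (fst x m) (snd x)) \<in> borel_measurable (PiM (comps E) gam \<Otimes>\<^sub>M \<pi>)" if "m \<in> comps E" for m
    using measurable_component_process[where P=gam and m=m and f="fY \<beta> m", OF fY_meas[OF that] that] by (simp add: case_prod_beta')
  then have [measurable]: "(\<lambda>x. \<Sum>m\<in>comps E. fY \<beta> m (fst x m) (snd x)) \<in> borel_measurable (PiM (comps E) gam \<Otimes>\<^sub>M \<pi>)"
    by (intro borel_measurable_sum)
  show ?thesis unfolding pert_def case_prod_beta' by measurable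
qed

definition JX :: real where
  "JX = (\<integral>(s, t). test_fun E H a \<theta> s t \<partial>mean_gibbs2 (joint_law E \<theta>) \<pi> (process E))"
definition JG :: "real \<Rightarrow> real" where
  "JG \<beta> = (\<integral>(s, t). test_fun E H a \<theta> s t \<partial>mean_gibbs2 Q \<pi> (\<lambda>q. perturbed_process E H B a \<theta> \<beta> (\<xi> q)))"

lemma test_fun_le_r:
  "s \<in> space \<pi> \<Longrightarrow> t \<in> space \<pi> \<Longrightarrow> \<bar>test_fun E H a \<theta> s t\<bar> \<le> 6 * M * (K * r\<^sup>2)"
  "s \<in> space \<pi> \<Longrightarrow> t \<in> space \<pi> \<Longrightarrow> \<bar>test_fun E H a \<theta> s t\<bar> \<le> 6 * M * (K * lam\<^sup>2)"
  unfolding space_prior by (rule test_fun_le; simp add: hh_le)+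

lemma JX_eq: "JX = (\<integral>\<omega>. (\<integral>t. (\<integral>s. test_fun E H a \<theta> s t \<partial>gibbs \<pi> (process E \<omega>)) \<partial>gibbs \<pi> (process E \<omega>)) \<partial>joint_law E \<theta>)"
  unfolding JX_def
  by (rule integral_mean_gibbs2[OF prob_joint_law prob_prior process_meas process_bounded test_fun_meas test_fun_le_r(1)])

text \<open>
  The Gaussian average depends on the law of the components of \<open>\<xi>\<close> only, which is a product measure. This puts
  the Gaussian side in the form required by the Lindeberg exchange.
\<close>

lemma JG_eq: "JG \<beta> = (\<integral>x. (\<integral>t. (\<integral>s. test_fun E H a \<theta> s t \<partial>gibbs \<pi> (pert \<beta> x)) \<partial>gibbs \<pi> (pert \<beta> x)) \<partial>PiM (comps E) gam)"
proof -
  let ?res = "\<lambda>q. \<lambda>m\<in>comps E. \<xi> q m"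
  let ?J = "\<lambda>Z. \<integral>t. (\<integral>s. test_fun E H a \<theta> s t \<partial>gibbs \<pi> Z) \<partial>gibbs \<pi> Z"
  have res: "?res \<in> measurable Q (PiM (comps E) gam)"
    using gauss_meas by (intro measurable_restrict) (simp add: measurable_cong_sets[OF refl sets_gam])
  have pe: "perturbed_process E H B a \<theta> \<beta> (\<xi> q) t = pert \<beta> (?res q) t" if "t \<in> space \<pi>" for q t
    using pert_eq that by (simp add: space_prior pert_def)
  have "(\<lambda>x. (?res (fst x), snd x)) \<in> measurable (Q \<Otimes>\<^sub>M \<pi>) (PiM (comps E) gam \<Otimes>\<^sub>M \<pi>)"
    by (intro measurable_Pair measurable_compose[OF measurable_fst res] measurable_snd)
  from measurable_compose[OF this pert_meas]
  have "(\<lambda>(q, t). pert \<beta> (?res q) t) \<in> borel_measurable (Q \<Otimes>\<^sub>M \<pi>)" by (simp add: case_prod_beta')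
  then have pm: "(\<lambda>(q, t). perturbed_process E H B a \<theta> \<beta> (\<xi> q) t) \<in> borel_measurable (Q \<Otimes>\<^sub>M \<pi>)"
    by (rule iffD2[OF measurable_cong, rotated]) (auto simp: space_pair_measure pe)
  have pb: "bounded_potential \<pi> (perturbed_process E H B a \<theta> \<beta> (\<xi> q))" for q
    using pert_bounded[of \<beta> "?res q"] pe[of _ q] unfolding bounded_potential_def
    by (auto cong: measurable_cong)
  have "JG \<beta> = (\<integral>q. ?J (perturbed_process E H B a \<theta> \<beta> (\<xi> q)) \<partial>Q)"
    unfolding JG_def by (rule integral_mean_gibbs2[OF Q.prob_space_axioms prob_prior pm pb test_fun_meas test_fun_le_r(1)])
  also have "\<dots> = (\<integral>q. ?J (pert \<beta> (?res q)) \<partial>Q)"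
    by (simp only: gibbs_cong[OF pe])
  also have "\<dots> = (\<integral>x. ?J (pert \<beta> x) \<partial>distr Q (PiM (comps E) gam) ?res)"
    by (rule integral_distr[symmetric, OF res])
      (rule gibbs_pair_measurable[OF prob_prior pert_meas test_fun_meas pert_bounded])
  also have "distr Q (PiM (comps E) gam) ?res = PiM (comps E) gam"
  proof -
    have "distr Q (PiM (comps E) gam) ?res = distr Q (PiM (comps E) (\<lambda>m. borel)) ?res"
      by (intro distr_cong refl sets_PiM_cong sets_gam)
    then show ?thesis using gauss_product_law by simp
  qed
  finally show ?thesis .
qed

lemma J_le:
  "\<bar>JX\<bar> \<le> 6 * M * (K * r\<^sup>2)" "\<bar>JX\<bar> \<le> 6 * M * (K * lam\<^sup>2)"
  "\<bar>JG \<beta>\<bar> \<le> 6 * M * (K * r\<^sup>2)" "\<bar>JG \<beta>\<bar> \<le> 6 * M * (K * lam\<^sup>2)"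
  unfolding JX_eq JG_eq
  by (rule gibbs_pair_le[OF prob_prior prob_joint_law process_meas test_fun_meas process_bounded test_fun_le_r(1)]
      gibbs_pair_le[OF prob_prior prob_joint_law process_meas test_fun_meas process_bounded test_fun_le_r(2)]
      gibbs_pair_le[OF prob_prior prob_space_PiM[OF prob_gam] pert_meas test_fun_meas pert_bounded test_fun_le_r(1)]
      gibbs_pair_le[OF prob_prior prob_space_PiM[OF prob_gam] pert_meas test_fun_meas pert_bounded test_fun_le_r(2)];
     assumption)+

end

section \<open>Envelopes and matching moments\<close>

text \<open>Log-partition functions are Lipschitz in the supremum norm, which permits dropping a small deterministic potential.\<close>

lemma log_partition_shift:
  assumes \<pi>: "prob_space \<pi>" and Z: "bounded_potential \<pi> Z" and c: "bounded_potential \<pi> c"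
    and le: "\<And>t. t \<in> space \<pi> \<Longrightarrow> \<bar>c t\<bar> \<le> x"
  shows "\<bar>log_partition \<pi> (\<lambda>t. c t + Z t) - log_partition \<pi> Z\<bar> \<le> x"
proof -
  note i = gibbs_partition[OF \<pi> Z] and j = gibbs_partition[OF \<pi> bounded_potential_add[OF c Z]]
  have "(\<integral>t. exp (c t + Z t) \<partial>\<pi>) \<le> (\<integral>t. exp x * exp (Z t) \<partial>\<pi>)"
  proof (intro integral_mono j(1))
    show "exp (c t + Z t) \<le> exp x * exp (Z t)" if "t \<in> space \<pi>" for t
      using le[OF that] by (simp add: exp_add[symmetric])
  qed (use i in auto)
  moreover have "(\<integral>t. exp (- x) * exp (Z t) \<partial>\<pi>) \<le> (\<integral>t. exp (c t + Z t) \<partial>\<pi>)"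
  proof (intro integral_mono j(1))
    show "exp (- x) * exp (Z t) \<le> exp (c t + Z t)" if "t \<in> space \<pi>" for t
      using le[OF that] by (simp add: exp_add[symmetric])
  qed (use i in auto)
  ultimately have "ln (\<integral>t. exp (c t + Z t) \<partial>\<pi>) \<le> ln (exp x * (\<integral>t. exp (Z t) \<partial>\<pi>))"
    "ln (exp (- x) * (\<integral>t. exp (Z t) \<partial>\<pi>)) \<le> ln (\<integral>t. exp (c t + Z t) \<partial>\<pi>)"
    using i(2) j(2) by (auto intro!: iffD2[OF ln_le_cancel_iff] mult_pos_pos)
  then show ?thesis unfolding log_partition_def using i(2) by (simp add: ln_mult)
qed

context gaussian_comparison
begin

lemma gam_moments:
  assumes m: "m \<in> comps E" and x: "x \<in> W m" and y: "y \<in> W m"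
  shows "(\<integral>z. z \<bullet> x + b \<partial>gam m) = b" "(\<integral>z. (z \<bullet> x + b) * (z \<bullet> y + b') \<partial>gam m) = cov m x y + b * b'"
proof -
  note copy = gauss_copy[OF m]
  note [measurable] = gauss_meas[OF m]
  note i = gaussian_copy.X_moments(1,2)[OF copy x] gaussian_copy.X_moments(1,2)[OF copy y] gaussian_copy.X_covariance[OF copy x y]
  show "(\<integral>z. z \<bullet> x + b \<partial>gam m) = b"
    unfolding gam_eq[OF m] using i by (subst integral_distr) (auto simp: Q.prob_space)
  have "(\<integral>z. (z \<bullet> x + b) * (z \<bullet> y + b') \<partial>gam m) = (\<integral>q. (\<xi> q m \<bullet> x + b) * (\<xi> q m \<bullet> y + b') \<partial>Q)"
    unfolding gam_eq[OF m] by (subst integral_distr) auto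
  also have "\<dots> = (\<integral>q. (\<xi> q m \<bullet> x) * (\<xi> q m \<bullet> y) + b' * (\<xi> q m \<bullet> x) + b * (\<xi> q m \<bullet> y) + b * b' \<partial>Q)"
    by (simp add: algebra_simps)
  also have "\<dots> = cov m x y + b * b'" using i by (simp add: Q.prob_space cov_def)
  finally show "(\<integral>z. (z \<bullet> x + b) * (z \<bullet> y + b') \<partial>gam m) = cov m x y + b * b'" .
qed

lemma fX_yX: "fX 0 m w t + \<beta> * yX m w t = fX \<beta> m w t"
  by (simp add: fX_def yX_def psi_def inner_add_right algebra_simps)

lemma fY_yY: "fY \<beta> m x t + (- \<beta>) * yY m x t = fY 0 m x t"
  by (simp add: fY_def yY_def psi_def inner_add_right algebra_simps)

lemma local_process_fX: "local_process E m t w = fX 0 m w t + rho m t"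
  by (simp add: local_process_def fX_def psi_def vq_def)

lemma aform_Bf_continuous:
  assumes m: "m \<in> comps E"
  shows "continuous_on T (\<lambda>t. aform m (Bf m t))"
proof -
  have "continuous_on T (\<lambda>t. blinfun_apply (Aop E m) (feat E m \<theta>) \<bullet> Bf m t)"
    unfolding Bf_def by (intro continuous_intros feat_continuous m)
  then show ?thesis unfolding A_form[OF m Bf_in[OF m]] .
qed

definition PX :: "nat \<Rightarrow> 'w measure" where "PX m = (if m \<in> comps E then P1 m else P1 1)"

lemma prob_PX: "prob_space (PX m)" unfolding PX_def using prob_law[OF _ \<theta>] one_comp by auto

lemma joint_law_PX: "joint_law E \<theta> = PiM (comps E) PX"
  unfolding joint_law_def by (intro PiM_cong refl) (simp add: PX_def)

lemma yY_meas:
  assumes m: "m \<in> comps E"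
  shows "(\<lambda>(x, t). yY m x t) \<in> borel_measurable (gam m \<Otimes>\<^sub>M \<pi>)"
proof -
  note [measurable] = Bf_meas[OF m]
  show ?thesis unfolding yY_def by measurable
qed

lemma a_loss_bounded: "bounded_potential \<pi> (\<lambda>t. a * loss t)"
  by (rule bounded_potential_scale[OF loss_bounded])

end

context gaussian_comparison_small
begin

text \<open>64 from the cube of a sum of four terms, times 11 from their third moments \<open>1 + 1 + 1 + 2\<^sup>3\<close>.\<close>

definition cub :: real where "cub = 704 * (K^3 * lam^3)"

lemma powers_K: "K \<le> K\<^sup>2" "K\<^sup>2 \<le> K^3" "K^3 \<le> K^4"
  using power_increasing[of 1 2 K] power_increasing[of 2 3 K] power_increasing[of 3 4 K] K_ge(2) by auto

lemma K_lam_le: "K * lam\<^sup>2 \<le> K * lam" "lam \<le> K * lam"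
proof -
  show "K * lam\<^sup>2 \<le> K * lam" using K_ge lam_powers[OF one_comp] by (intro mult_left_mono) auto
  have "1 * lam \<le> K * lam" using K_ge lam_pos by (intro mult_right_mono) auto
  then show "lam \<le> K * lam" by simp
qed

lemma tilt_aform_le:
  assumes "m \<in> comps E" "t \<in> T" "\<bar>\<beta>\<bar> \<le> 1"
  shows "\<bar>\<beta> * aform m (Bf m t)\<bar> \<le> K * lam"
proof -
  have "\<bar>\<beta> * aform m (Bf m t)\<bar> \<le> 1 * (K * lam\<^sup>2)"
    unfolding abs_mult using assms aform_le(2)[OF assms(1) norm_Bf_le'[OF assms(1) T_params[OF assms(2)]]] by (intro mult_mono) auto
  then show ?thesis using K_lam_le by linarith
qed

text \<open>
  One envelope serves all \<open>\<beta>\<close> in the unit interval and the perturbation \<open>yX\<close>; the deterministic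
  terms are of order \<open>lam\<close>.
\<close>

lemma X_envelope:
  assumes m: "m \<in> comps E"
  shows "\<exists>g. (\<forall>\<beta>. \<bar>\<beta>\<bar> \<le> 1 \<longrightarrow> cube_envelope (P1 m) \<pi> (fX \<beta> m) g cub) \<and>
    (\<lambda>(w, t). yX m w t) \<in> borel_measurable (P1 m \<Otimes>\<^sub>M \<pi>) \<and> (\<forall>w\<in>space (P1 m). \<forall>t\<in>T. \<bar>yX m w t\<bar> \<le> g w)"
proof -
  interpret TL: tilted_law "P0 m" "P1 m" "ll m" by (rule tilted[OF m])
  obtain N where Nm: "N \<in> borel_measurable (P1 m)" and N0: "\<And>w. w \<in> space (P1 m) \<Longrightarrow> 0 \<le> N w"
    and N_le: "\<And>w t. w \<in> space (P1 m) \<Longrightarrow> t \<in> T \<Longrightarrow> \<bar>Rrem E m t w - rho m t\<bar> \<le> N w + (\<integral>w. N w \<partial>P1 m)"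
    and N3: "integrable (P1 m) (\<lambda>w. N w ^ 3)" "(\<integral>w. N w ^ 3 \<partial>P1 m) \<le> lam^3"
    and RNm: "(\<lambda>(w, t). Rrem E m t w - rho m t) \<in> borel_measurable (P1 m \<Otimes>\<^sub>M \<pi>)"
    using remainder_envelope[OF m] unfolding rho_def lam3 by blast
  have iN3: "integrable (P1 m) (\<lambda>w. \<bar>N w\<bar> ^ 3)" "(\<integral>w. \<bar>N w\<bar> ^ 3 \<partial>P1 m) \<le> 1 * lam^3"
  proof -
    have e: "\<bar>N w\<bar> ^ 3 = N w ^ 3" if "w \<in> space (P1 m)" for w using N0[OF that] by simp
    show "integrable (P1 m) (\<lambda>w. \<bar>N w\<bar> ^ 3)" using N3(1) by (subst Bochner_Integration.integrable_cong[OF refl e])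
    have "(\<integral>w. \<bar>N w\<bar> ^ 3 \<partial>P1 m) = (\<integral>w. N w ^ 3 \<partial>P1 m)" using e by (intro Bochner_Integration.integral_cong) auto
    then show "(\<integral>w. \<bar>N w\<bar> ^ 3 \<partial>P1 m) \<le> 1 * lam^3" using N3(2) by simp
  qed
  have "(\<integral>w. \<bar>N w\<bar> \<partial>P1 m) \<le> 1 * lam"
    by (rule TL.P1.lower_moments_of_cube(4)[OF Nm iN3 lam_pos]) simp
  moreover have "(\<integral>w. N w \<partial>P1 m) = (\<integral>w. \<bar>N w\<bar> \<partial>P1 m)" using N0 by (intro Bochner_Integration.integral_cong) auto
  ultimately have IN: "(\<integral>w. N w \<partial>P1 m) \<le> K * lam" using K_lam_le by linarith
  define x1 where "x1 w = (1 + hb) * (r * norm (Uvec E m w))" for w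
  define x2 where "x2 w = r\<^sup>2 * norm (Vop E m w)" for w
  define g where "g w = x1 w + x2 w + N w + 2 * (K * lam)" for w
  have x0: "0 \<le> x1 w" "0 \<le> x2 w" for w unfolding x1_def x2_def using hb r_pos by auto
  note [measurable] = P1_meas[OF m U_m[OF m]] P1_meas[OF m V_norm[OF m]] Nm
  have gm[measurable]: "g \<in> borel_measurable (P1 m)" unfolding g_def x1_def x2_def by measurable
  have Um: "\<bar>Uvec E m w \<bullet> x\<bar> \<le> x1 w" if "norm x \<le> (1 + hb) * r" for x w
  proof -
    have "\<bar>Uvec E m w \<bullet> x\<bar> \<le> norm (Uvec E m w) * norm x" by (rule Cauchy_Schwarz_ineq2)
    also have "\<dots> \<le> norm (Uvec E m w) * ((1 + hb) * r)" by (intro mult_left_mono that) auto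
    finally show ?thesis by (simp add: x1_def mult_ac)
  qed
  have c1: "TL.cubes ((1 + hb)^3 * (r\<^sup>2 * d)) x1" unfolding x1_def using hb by (intro TL.cubes_scale cubes_U m) auto
  have c2: "TL.cubes (r\<^sup>2 * d) x2" unfolding x2_def by (rule cubes_V[OF m])
  have "integrable (P1 m) (\<lambda>w. g w ^ 3)" "(\<integral>w. g w ^ 3 \<partial>P1 m) \<le> cub"
  proof -
    have i: "integrable (P1 m) (\<lambda>w. x1 w ^ 3)" "integrable (P1 m) (\<lambda>w. x2 w ^ 3)"
      "(\<integral>w. x1 w ^ 3 \<partial>P1 m) \<le> (1 + hb)^3 * lam^3" "(\<integral>w. x2 w ^ 3 \<partial>P1 m) \<le> lam^3"
      using TL.cubesD(3)[OF c1] TL.cubesD(3)[OF c2] TL.cubes_split(2)[OF c1] TL.cubes_split(2)[OF c2] x0 by (simp_all add: lam3)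
    have kl: "0 \<le> 2 * (K * lam)" using K_ge lam_pos by simp
    have le: "g w ^ 3 \<le> 64 * (x1 w ^ 3 + x2 w ^ 3 + N w ^ 3 + (2 * (K * lam)) ^ 3)" if "w \<in> space (P1 m)" for w
      unfolding g_def by (rule sum4_cube_le[OF x0 N0[OF that] kl])
    have g0: "0 \<le> g w" if "w \<in> space (P1 m)" for w unfolding g_def using x0[of w] N0[OF that] kl by linarith
    have ib: "integrable (P1 m) (\<lambda>w. 64 * (x1 w ^ 3 + x2 w ^ 3 + N w ^ 3 + (2 * (K * lam)) ^ 3))" using i N3 by simp
    show ig: "integrable (P1 m) (\<lambda>w. g w ^ 3)"
      by (rule dominated_integrable[OF _ ib]) (use le g0 in auto)
    have "(\<integral>w. g w ^ 3 \<partial>P1 m) \<le> (\<integral>w. 64 * (x1 w ^ 3 + x2 w ^ 3 + N w ^ 3 + (2 * (K * lam)) ^ 3) \<partial>P1 m)"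
      using ig ib le by (rule integral_mono)
    also have "\<dots> = 64 * ((\<integral>w. x1 w ^ 3 \<partial>P1 m) + (\<integral>w. x2 w ^ 3 \<partial>P1 m) + (\<integral>w. N w ^ 3 \<partial>P1 m) + (2 * (K * lam)) ^ 3)"
      using i N3 by (simp add: TL.P1.prob_space)
    also have "\<dots> \<le> 64 * (K^3 * lam^3 + K^3 * lam^3 + K^3 * lam^3 + 8 * (K^3 * lam^3))"
    proof -
      have "1 \<le> K^3" using K_ge(2) by (rule one_le_power)
      moreover have "(1 + hb)^3 \<le> K^3" using powers_K K_ge(3) zero_le_power[of "1 + hb" 3] hb by linarith
      ultimately have "1 * lam^3 \<le> K^3 * lam^3" "(1 + hb)^3 * lam^3 \<le> K^3 * lam^3"
        using lam_pos by (auto intro!: mult_right_mono)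
      moreover have "(2 * (K * lam)) ^ 3 = 8 * (K^3 * lam^3)" by (simp add: power_mult_distrib)
      moreover have "u \<le> hl \<Longrightarrow> v \<le> l \<Longrightarrow> n \<le> l \<Longrightarrow> 1 * l \<le> k \<Longrightarrow> hl \<le> k \<Longrightarrow> q = 8 * k \<Longrightarrow> 64 * (u + v + n + q) \<le> 64 * (k + k + k + 8 * k)"
        for u v n hl l k q :: real by (intro mult_left_mono add_mono) linarith+
      ultimately show ?thesis using i(3,4) N3(2) by blast
    qed
    finally show "(\<integral>w. g w ^ 3 \<partial>P1 m) \<le> cub" by (simp add: cub_def)
  qed
  note g3 = this
  have f_le: "\<bar>fX \<beta> m w t\<bar> \<le> g w" if "w \<in> space (P1 m)" "t \<in> T" "\<bar>\<beta>\<bar> \<le> 1" for \<beta> w t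
  proof -
    have tri: "\<bar>u\<bar> \<le> a1 \<Longrightarrow> \<bar>v\<bar> \<le> a2 \<Longrightarrow> \<bar>R - q\<bar> \<le> a3 + i \<Longrightarrow> i \<le> k \<Longrightarrow> \<bar>b\<bar> \<le> k \<Longrightarrow> \<bar>u + (v + R) - q - b\<bar> \<le> a1 + a2 + a3 + 2 * k"
      for u v R q b a1 a2 a3 i k :: real by linarith
    have v: "\<bar>vq m t w\<bar> \<le> x2 w" unfolding x2_def by (rule vq_le[OF m T_params[OF that(2)]])
    show ?thesis unfolding fX_def g_def
      by (rule tri[OF Um[OF norm_psi_le[OF m T_params[OF that(2)] that(3)]] v N_le[OF that(1,2)] IN tilt_aform_le[OF m that(2,3)]])
  qed
  have y_le: "\<bar>yX m w t\<bar> \<le> g w" if "w \<in> space (P1 m)" "t \<in> T" for w t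
  proof -
    have tri: "\<bar>u\<bar> \<le> a1 \<Longrightarrow> 0 \<le> a2 \<Longrightarrow> 0 \<le> a3 \<Longrightarrow> 0 \<le> k \<Longrightarrow> \<bar>1 * b\<bar> \<le> k \<Longrightarrow> \<bar>u - b\<bar> \<le> a1 + a2 + a3 + 2 * k"
      for u b a1 a2 a3 k :: real by linarith
    show ?thesis unfolding yX_def g_def
      by (rule tri[OF Um[OF norm_Bf_le'[OF m T_params[OF that(2)]]] x0(2) N0[OF that(1)] _ tilt_aform_le[OF m that(2)]])
        (use K_ge lam_pos in auto)
  qed
  have vm: "(\<lambda>(w, t). vq m t w) \<in> borel_measurable (P1 m \<Otimes>\<^sub>M \<pi>)"
  proof (rule caratheodory_measurable[OF compact_idx metrizable_idx T_ne sets_prior])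
    show "(\<lambda>w. vq m t w) \<in> borel_measurable (P1 m)" for t by (rule P1_meas[OF m vq_m[OF m]])
    show "continuous_on T (\<lambda>t. vq m t w)" for w unfolding vq_def by (intro continuous_intros feat_continuous m)
  qed
  note [measurable] = vm RNm psi_meas[OF m] Bf_meas[OF m] continuous_on_measurable_restrict[OF sets_prior aform_Bf_continuous[OF m]]
  have fm: "(\<lambda>(w, t). fX \<beta> m w t) \<in> borel_measurable (P1 m \<Otimes>\<^sub>M \<pi>)" for \<beta>
  proof -
    have "(\<lambda>(w, t). Uvec E m w \<bullet> psi \<beta> m t + vq m t w + (Rrem E m t w - rho m t) - \<beta> * aform m (Bf m t)) \<in> borel_measurable (P1 m \<Otimes>\<^sub>M \<pi>)"
      by measurable
    then show ?thesis by (simp add: fX_def algebra_simps)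
  qed
  have ym: "(\<lambda>(w, t). yX m w t) \<in> borel_measurable (P1 m \<Otimes>\<^sub>M \<pi>)" unfolding yX_def by measurable
  have g0: "0 \<le> g w" if "w \<in> space (P1 m)" for w
    unfolding g_def using x0[of w] N0[OF that] K_ge lam_pos by (intro add_nonneg_nonneg) auto
  have "cube_envelope (P1 m) \<pi> (fX \<beta> m) g cub" if "\<bar>\<beta>\<bar> \<le> 1" for \<beta>
    unfolding cube_envelope_def using fm gm f_le[OF _ _ that] g0 g3 by (simp add: space_prior)
  then show ?thesis using ym y_le by blast
qed

definition gX :: "nat \<Rightarrow> 'w \<Rightarrow> real" where
  "gX m = (SOME g. (\<forall>\<beta>. \<bar>\<beta>\<bar> \<le> 1 \<longrightarrow> cube_envelope (P1 m) \<pi> (fX \<beta> m) g cub) \<and>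
    (\<lambda>(w, t). yX m w t) \<in> borel_measurable (P1 m \<Otimes>\<^sub>M \<pi>) \<and> (\<forall>w\<in>space (P1 m). \<forall>t\<in>T. \<bar>yX m w t\<bar> \<le> g w))"

lemma gX:
  assumes m: "m \<in> comps E"
  shows "\<bar>\<beta>\<bar> \<le> 1 \<Longrightarrow> cube_envelope (P1 m) \<pi> (fX \<beta> m) (gX m) cub"
    "(\<lambda>(w, t). yX m w t) \<in> borel_measurable (P1 m \<Otimes>\<^sub>M \<pi>)"
    "w \<in> space (P1 m) \<Longrightarrow> t \<in> T \<Longrightarrow> \<bar>yX m w t\<bar> \<le> gX m w"
  using someI_ex[OF X_envelope[OF m], folded gX_def] by auto

definition gY :: "nat \<Rightarrow> 'h \<Rightarrow> real" where "gY m x = (1 + hb) * r * norm x + 2 * (K * lam)"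

lemma drift_parts: "m \<in> comps E \<Longrightarrow> t \<in> T \<Longrightarrow> \<bar>aform m (feat E m t)\<bar> \<le> K * lam\<^sup>2"
  by (intro aform_le(2) norm_feat_le' T_params)

lemma Y_inner_le:
  fixes x y :: "'z::real_inner"
  assumes "norm y \<le> (1 + hb) * r"
  shows "\<bar>x \<bullet> y\<bar> \<le> (1 + hb) * r * norm x"
proof -
  have "\<bar>x \<bullet> y\<bar> \<le> norm x * norm y" by (rule Cauchy_Schwarz_ineq2)
  also have "\<dots> \<le> norm x * ((1 + hb) * r)" by (intro mult_left_mono assms) auto
  finally show ?thesis by (simp add: mult_ac)
qed

lemma gY:
  assumes m: "m \<in> comps E"
  shows "\<bar>\<beta>\<bar> \<le> 1 \<Longrightarrow> cube_envelope (gam m) \<pi> (fY \<beta> m) (gY m) cub"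
    "t \<in> T \<Longrightarrow> \<bar>yY m x t\<bar> \<le> gY m x"
proof -
  interpret TL: tilted_law "P0 m" "P1 m" "ll m" by (rule tilted[OF m])
  have kl: "0 \<le> 2 * (K * lam)" using K_ge lam_pos by simp
  have r1: "0 \<le> (1 + hb) * r" using hb r_pos by simp
  show "\<bar>yY m x t\<bar> \<le> gY m x" if "t \<in> T"
    unfolding yY_def gY_def using Y_inner_le[OF norm_Bf_le'[OF m T_params[OF that]], of x] kl by linarith
  have f_le: "\<bar>fY \<beta> m x t\<bar> \<le> gY m x" if "\<bar>\<beta>\<bar> \<le> 1" "t \<in> T" for \<beta> x t
    unfolding fY_def gY_def
    using Y_inner_le[OF norm_psi_le[OF m T_params[OF that(2)] that(1)], of x] drift_parts[OF m that(2)] kbar_le[OF m T_params[OF that(2)]] K_lam_le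
    by linarith
  have sec: "((1 + hb) * r)\<^sup>2 * (\<integral>w. (norm (Uvec E m w))\<^sup>2 \<partial>P0 m) \<le> K * lam\<^sup>2"
  proof -
    have "(\<integral>w. (r * norm (Uvec E m w))\<^sup>2 \<partial>P0 m) \<le> 1 * lam\<^sup>2"
      using TL.P0.lower_moments_of_cube(2)[OF TL.cubesD(1,2)[OF cubes_U[OF m]] _ lam_pos, of 1] TL.cubes_split(1)[OF cubes_U[OF m]]
      by (simp add: lam3)
    then have 1: "r\<^sup>2 * (\<integral>w. (norm (Uvec E m w))\<^sup>2 \<partial>P0 m) \<le> lam\<^sup>2" by (simp add: power_mult_distrib)
    have 2: "(1 + hb)\<^sup>2 \<le> K"
    proof -
      have "(1 + hb)\<^sup>2 \<le> (1 + hb)^3" using hb by (intro power_increasing) auto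
      moreover have "0 \<le> (1 + hb)^3" using hb by simp
      ultimately show ?thesis using K_ge(3) by linarith
    qed
    have "((1 + hb) * r)\<^sup>2 * (\<integral>w. (norm (Uvec E m w))\<^sup>2 \<partial>P0 m) = (1 + hb)\<^sup>2 * (r\<^sup>2 * (\<integral>w. (norm (Uvec E m w))\<^sup>2 \<partial>P0 m))"
      by (simp add: power_mult_distrib)
    also have "\<dots> \<le> K * lam\<^sup>2" using 1 2 K_ge by (intro mult_mono) auto
    finally show ?thesis .
  qed
  note tm = gaussian_copy.third_moment[OF gauss_copy[OF m] lam_pos r1 K_ge(2) sec]
  note [measurable] = gauss_meas[OF m]
  have gm[measurable]: "gY m \<in> borel_measurable borel" unfolding gY_def by measurable
  have i: "integrable (gam m) (\<lambda>x. ((1 + hb) * r * norm x)^3)" "(\<integral>x. ((1 + hb) * r * norm x)^3 \<partial>gam m) \<le> 2 * K\<^sup>2 * lam^3"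
    unfolding gam_eq[OF m] using tm by (simp_all add: integrable_distr_eq integral_distr)
  interpret G: prob_space "gam m" by (rule prob_gam)
  have prob_gam_UNIV: "measure (gam m) UNIV = 1" using G.prob_space by simp
  have g0: "0 \<le> gY m x" for x unfolding gY_def using r1 kl by (intro add_nonneg_nonneg mult_nonneg_nonneg[OF r1]) auto
  have le: "gY m x ^ 3 \<le> 64 * (((1 + hb) * r * norm x)^3 + (2 * (K * lam)) ^ 3)" for x
    using sum4_cube_le[of "(1 + hb) * r * norm x" 0 0 "2 * (K * lam)"] r1 kl mult_nonneg_nonneg[OF r1 norm_ge_zero[of x]] unfolding gY_def by simp
  have ib: "integrable (gam m) (\<lambda>x. 64 * (((1 + hb) * r * norm x)^3 + (2 * (K * lam)) ^ 3))" using i(1) by simp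
  have ig: "integrable (gam m) (\<lambda>x. gY m x ^ 3)"
  proof (rule dominated_integrable[OF _ ib])
    show "(\<lambda>x. gY m x ^ 3) \<in> borel_measurable (gam m)" by (simp add: measurable_cong_sets[OF sets_gam refl])
    show "\<bar>gY m x ^ 3\<bar> \<le> 64 * (((1 + hb) * r * norm x)^3 + (2 * (K * lam)) ^ 3)" for x
      unfolding abs_of_nonneg[OF zero_le_power[OF g0]] by (rule le)
  qed
  have "(\<integral>x. gY m x ^ 3 \<partial>gam m) \<le> (\<integral>x. 64 * (((1 + hb) * r * norm x)^3 + (2 * (K * lam)) ^ 3) \<partial>gam m)"
    using ig ib le by (rule integral_mono)
  also have "\<dots> = 64 * ((\<integral>x. ((1 + hb) * r * norm x)^3 \<partial>gam m) + (2 * (K * lam)) ^ 3)" using i(1) by (simp add: prob_gam_UNIV)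
  also have "\<dots> \<le> 64 * (2 * (K^3 * lam^3) + 8 * (K^3 * lam^3))"
  proof -
    have "K\<^sup>2 * lam^3 \<le> K^3 * lam^3" using powers_K lam_pos by (intro mult_right_mono) auto
    moreover have "(2 * (K * lam)) ^ 3 = 8 * (K^3 * lam^3)" by (simp add: power_mult_distrib)
    moreover have "2 * K\<^sup>2 * lam^3 = 2 * (K\<^sup>2 * lam^3)" by simp
    ultimately show ?thesis using i(2) by (intro mult_left_mono add_mono) linarith+
  qed
  also have "\<dots> \<le> cub" unfolding cub_def using K_ge lam_pos by simp
  finally show "cube_envelope (gam m) \<pi> (fY \<beta> m) (gY m) cub" if "\<bar>\<beta>\<bar> \<le> 1"
    unfolding cube_envelope_def using fY_meas[OF m] gm f_le[OF that] g0 ig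
    by (simp add: space_prior measurable_cong_sets[OF sets_gam refl])
qed

definition kap :: real where "kap = 704 * (K^4 * lam^3)"
definition alp :: real where "alp = 2612 * (K\<^sup>2 * lam^3)"

lemma cub_kap: "cub \<le> kap"
  unfolding cub_def kap_def using powers_K lam_pos by (auto intro!: mult_right_mono)

lemma envelope_mean:
  assumes "prob_space P" "cube_envelope P \<pi> f g cub"
  shows "K * lam\<^sup>2 * (\<integral>w. g w \<partial>P) \<le> kap"
proof -
  interpret P: prob_space P by fact
  have g: "g \<in> borel_measurable P" "\<And>w. w \<in> space P \<Longrightarrow> 0 \<le> g w" "integrable P (\<lambda>w. g w ^ 3)" "(\<integral>w. g w ^ 3 \<partial>P) \<le> cub"
    using assms(2) by (auto simp: cube_envelope_def)
  have e: "\<bar>g w\<bar> ^ 3 = g w ^ 3" if "w \<in> space P" for w using g(2)[OF that] by simp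
  have 1: "integrable P (\<lambda>w. \<bar>g w\<bar> ^ 3)" using g(3) by (subst Bochner_Integration.integrable_cong[OF refl e])
  have "(\<integral>w. \<bar>g w\<bar> ^ 3 \<partial>P) = (\<integral>w. g w ^ 3 \<partial>P)" using e by (intro Bochner_Integration.integral_cong) auto
  then have 2: "(\<integral>w. \<bar>g w\<bar> ^ 3 \<partial>P) \<le> (704 * K^3) * lam^3" using g(4) by (simp add: cub_def)
  have 3: "1 \<le> 704 * K^3" using one_le_power[OF K_ge(2), of 3] by linarith
  have "(\<integral>w. \<bar>g w\<bar> \<partial>P) \<le> (704 * K^3) * lam" by (rule P.lower_moments_of_cube(4)[OF g(1) 1 2 lam_pos 3])
  moreover have "(\<integral>w. g w \<partial>P) = (\<integral>w. \<bar>g w\<bar> \<partial>P)" using g(2) by (intro Bochner_Integration.integral_cong) auto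
  ultimately have "K * lam\<^sup>2 * (\<integral>w. g w \<partial>P) \<le> K * lam\<^sup>2 * ((704 * K^3) * lam)"
    using K_ge by (intro mult_left_mono) auto
  also have "\<dots> = kap" unfolding kap_def by (simp add: power2_eq_square power3_eq_cube power4_eq_xxxx)
  finally show ?thesis .
qed

lemma family_X: "\<bar>\<beta>\<bar> \<le> 1 \<Longrightarrow> component_family \<pi> (comps E) PX (fX \<beta>) gX kap"
  unfolding component_family_def component_family_axioms_def
  using prob_prior finite_comps prob_PX cube_envelope_mono[OF gX(1) cub_kap] by (simp add: PX_def)

lemma family_Y: "\<bar>\<beta>\<bar> \<le> 1 \<Longrightarrow> component_family \<pi> (comps E) gam (fY \<beta>) gY kap"
  unfolding component_family_def component_family_axioms_def
  using prob_prior finite_comps prob_gam cube_envelope_mono[OF gY(1) cub_kap] by simp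

lemma fX_fY_mean:
  assumes m: "m \<in> comps E" and t: "t \<in> T" and \<beta>: "\<bar>\<beta>\<bar> \<le> 1"
  shows "\<bar>(\<integral>w. fX \<beta> m w t \<partial>PX m) - (\<integral>x. fY \<beta> m x t \<partial>gam m)\<bar> \<le> alp"
proof -
  have "(\<integral>x. fY \<beta> m x t \<partial>gam m) = aform m (feat E m t) + kbar m t"
    unfolding fY_def by (rule gam_moments(1)[OF m psi_in[OF m T_params[OF t]] psi_in[OF m T_params[OF t]]])
  moreover have "54 * (K * lam^3) \<le> alp"
  proof -
    have "0 \<le> K\<^sup>2 * lam^3" using lam_pos by simp
    then show ?thesis using K_square[OF m] unfolding alp_def by linarith
  qed
  ultimately show ?thesis using fX_mean[OF m t \<beta>] m by (simp add: PX_def)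
qed

text \<open>
  The Gaussian component has the exact covariance plus a product of drifts, so this product must be
  of the order of the errors.
\<close>

lemma drift_product_le:
  assumes m: "m \<in> comps E" and s: "s \<in> T" and t: "t \<in> T"
  shows "\<bar>(aform m (feat E m s) + kbar m s) * (aform m (feat E m t) + kbar m t)\<bar> \<le> 4 * (K\<^sup>2 * lam^3)"
proof -
  note a = drift_parts[OF m s] drift_parts[OF m t]
  note k = kbar_le[OF m T_params[OF s]] kbar_le[OF m T_params[OF t]]
  note l3 = K_square[OF m]
  have k1: "1 * lam^3 \<le> K * lam^3" using K_ge lam_pos by (intro mult_right_mono) auto
  have mb: "\<bar>u * v\<bar> \<le> K\<^sup>2 * lam^3" if "\<bar>u\<bar> \<le> K * lam\<^sup>2" "\<bar>v\<bar> \<le> K * lam" for u v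
    using mult_bound[OF m, of u 1 v 1] that by simp
  have kk: "\<bar>kbar m s * kbar m t\<bar> \<le> K\<^sup>2 * lam^3"
  proof -
    have "2 * \<bar>kbar m s * kbar m t\<bar> \<le> (kbar m s)\<^sup>2 + (kbar m t)\<^sup>2"
      using sum_squares_bound[of "\<bar>kbar m s\<bar>" "\<bar>kbar m t\<bar>"] by (simp add: abs_mult)
    then show ?thesis using kbar_sq[OF m T_params[OF s]] kbar_sq[OF m T_params[OF t]] k1 l3 by linarith
  qed
  have 1: "\<bar>aform m (feat E m s) * aform m (feat E m t)\<bar> \<le> K\<^sup>2 * lam^3"
    using a K_lam_le by (intro mb) linarith+
  have 2: "\<bar>aform m (feat E m s) * kbar m t\<bar> \<le> K\<^sup>2 * lam^3"
    using a k K_lam_le by (intro mb) linarith+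
  have 3: "\<bar>aform m (feat E m t) * kbar m s\<bar> \<le> K\<^sup>2 * lam^3"
    using a k K_lam_le by (intro mb) linarith+
  have "(aform m (feat E m s) + kbar m s) * (aform m (feat E m t) + kbar m t)
     = aform m (feat E m s) * aform m (feat E m t) + aform m (feat E m s) * kbar m t + aform m (feat E m t) * kbar m s + kbar m s * kbar m t"
    by (simp add: algebra_simps)
  then show ?thesis using 1 2 3 kk by linarith
qed

lemma fX_fY_second:
  assumes m: "m \<in> comps E" and s: "s \<in> T" and t: "t \<in> T" and \<beta>: "\<bar>\<beta>\<bar> \<le> 1"
  shows "\<bar>(\<integral>w. fX \<beta> m w s * fX \<beta> m w t \<partial>PX m) - (\<integral>x. fY \<beta> m x s * fY \<beta> m x t \<partial>gam m)\<bar> \<le> alp"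
proof -
  have "(\<integral>x. fY \<beta> m x s * fY \<beta> m x t \<partial>gam m) = cov m (psi \<beta> m s) (psi \<beta> m t)
      + (aform m (feat E m s) + kbar m s) * (aform m (feat E m t) + kbar m t)"
    unfolding fY_def by (rule gam_moments(2)[OF m psi_in[OF m T_params[OF s]] psi_in[OF m T_params[OF t]]])
  then show ?thesis
    using fX_second[OF m s t \<beta>] drift_product_le[OF m s t] m unfolding alp_def PX_def by simp
qed

end

section \<open>Comparison of the replica averages\<close>

context gaussian_comparison_small
begin

definition crho :: "'p \<Rightarrow> real" where "crho t = (\<Sum>m\<in>comps E. rho m t)"

lemma process_eq: "process E \<omega> t = crho t + (\<Sum>m\<in>comps E. fX 0 m (\<omega> m) t)"
  by (simp add: process_def crho_def local_process_fX sum.distrib)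

lemma crho_le: "t \<in> space \<pi> \<Longrightarrow> \<bar>crho t\<bar> \<le> M * (28 * (K * lam^3))"
proof -
  assume "t \<in> space \<pi>"
  then have t: "t \<in> T" by (simp add: space_prior)
  have "\<bar>crho t\<bar> \<le> (\<Sum>m\<in>comps E. 28 * (K * lam^3))"
    unfolding crho_def using rho_le t by (intro order_trans[OF sum_abs] sum_mono) auto
  then show ?thesis by (simp add: card_comps)
qed

text \<open>
  Measurability of the mean remainder in the index is inherited from the process and the recentred components at
  an arbitrary sample point.
\<close>

lemma crho_bounded: "bounded_potential \<pi> crho"
proof -
  obtain \<omega> where \<omega>: "\<omega> \<in> space (joint_law E \<theta>)" using prob_space.not_empty[OF prob_joint_law] by blast
  have "(\<lambda>t. fX 0 m (\<omega> m) t) \<in> borel_measurable \<pi>" if m: "m \<in> comps E" for m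
  proof -
    have "\<omega> m \<in> space (P1 m)" using \<omega> m by (auto simp: joint_law_def space_PiM PiE_def Pi_def)
    moreover have "(\<lambda>(w, t). fX 0 m w t) \<in> borel_measurable (P1 m \<Otimes>\<^sub>M \<pi>)"
      using gX(1)[OF m, of 0] by (simp add: cube_envelope_def)
    ultimately show ?thesis using measurable_compose[OF measurable_Pair1'] by fastforce
  qed
  then have "(\<lambda>t. \<Sum>m\<in>comps E. fX 0 m (\<omega> m) t) \<in> borel_measurable \<pi>" by (intro borel_measurable_sum)
  moreover have "process E \<omega> \<in> borel_measurable \<pi>" using process_bounded[OF \<omega>] by (simp add: bounded_potential_def)
  ultimately have "(\<lambda>t. process E \<omega> t - (\<Sum>m\<in>comps E. fX 0 m (\<omega> m) t)) \<in> borel_measurable \<pi>" by (intro borel_measurable_diff)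
  then have "crho \<in> borel_measurable \<pi>" unfolding process_eq by simp
  then show ?thesis unfolding bounded_potential_def using crho_le by blast
qed

lemma total_X: "\<bar>\<beta>\<bar> \<le> 1 \<Longrightarrow> component_family.total (comps E) (fX \<beta>) \<omega> t = (\<Sum>m\<in>comps E. fX \<beta> m (\<omega> m) t)"
  by (rule component_family.total_def[OF family_X])

lemma total_Y: "\<bar>\<beta>\<bar> \<le> 1 \<Longrightarrow> component_family.total (comps E) (fY \<beta>) x t = (\<Sum>m\<in>comps E. fY \<beta> m (x m) t)"
  by (rule component_family.total_def[OF family_Y])

lemma test_fun_hh: "a * loss t + (\<Sum>i\<in>comps E. hh i t t) - (\<Sum>i\<in>comps E. hh i s t) = test_fun E H a \<theta> s t"
  by (rule test_fun_eq[symmetric])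

text \<open>
  The mean Gibbs averages of the perturbations, and the mean log-partition functions: \<open>LXr\<close> and \<open>LYr\<close> contain the
  mean remainder \<open>crho\<close>, \<open>LY\<close> does not.
\<close>

definition mX :: real where
  "mX = (\<integral>\<omega>. (\<integral>t. (\<Sum>m\<in>comps E. yX m (\<omega> m) t) + a * loss t \<partial>gibbs \<pi> (process E \<omega>)) \<partial>PiM (comps E) PX)"
definition mY :: "real \<Rightarrow> real" where
  "mY \<beta> = (\<integral>x. (\<integral>t. (\<Sum>m\<in>comps E. yY m (x m) t) + a * loss t \<partial>gibbs \<pi> (pert \<beta> x)) \<partial>PiM (comps E) gam)"
definition LXr :: "real \<Rightarrow> real" where
  "LXr \<beta> = (\<integral>\<omega>. log_partition \<pi> (\<lambda>t. (crho t + \<beta> * (a * loss t)) + (\<Sum>m\<in>comps E. fX \<beta> m (\<omega> m) t)) \<partial>PiM (comps E) PX)"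
definition LYr :: "real \<Rightarrow> real" where
  "LYr \<beta> = (\<integral>x. log_partition \<pi> (\<lambda>t. (crho t + \<beta> * (a * loss t)) + (\<Sum>m\<in>comps E. fY \<beta> m (x m) t)) \<partial>PiM (comps E) gam)"
definition LY :: "real \<Rightarrow> real" where
  "LY \<beta> = (\<integral>x. log_partition \<pi> (pert \<beta> x) \<partial>PiM (comps E) gam)"

lemma alp_ge: "2608 * (K\<^sup>2 * lam^3) \<le> alp" "27 * (K * lam^3) \<le> alp"
proof -
  have "0 \<le> K\<^sup>2 * lam^3" using lam_pos by simp
  then show "2608 * (K\<^sup>2 * lam^3) \<le> alp" "27 * (K * lam^3) \<le> alp"
    using K_square[OF one_comp] unfolding alp_def by linarith+
qed

lemma X_tilt:
  fixes \<beta> :: real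
  shows "\<bar>mX - JX\<bar> \<le> M * (166 * kap + 3 * alp)" and "\<beta> * mX \<le> LXr \<beta> - LXr 0"
proof -
  have y: "(\<lambda>(w, t). yX i w t) \<in> borel_measurable (PX i \<Otimes>\<^sub>M \<pi>)" if "i \<in> comps E" for i
    using gX(2)[OF that] that by (simp add: PX_def)
  have y_le: "\<bar>yX i w t\<bar> \<le> gX i w" if "i \<in> comps E" "w \<in> space (PX i)" "t \<in> space \<pi>" for i w t
    using gX(3)[OF that(1)] that by (simp add: PX_def space_prior)
  have h_le: "\<bar>hh i s t\<bar> \<le> K * lam\<^sup>2" if "i \<in> comps E" "s \<in> space \<pi>" "t \<in> space \<pi>" for i s t
    using that T_params by (intro hh_le(1)) (auto simp: space_prior)
  have m: "\<bar>\<integral>w. yX i w t \<partial>PX i\<bar> \<le> alp" if "i \<in> comps E" "t \<in> space \<pi>" for i t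
    using order_trans[OF yX_mean[OF that(1)] alp_ge(2)] that by (simp add: PX_def space_prior)
  have k: "\<bar>(\<integral>w. yX i w t * fX 0 i w s \<partial>PX i) - hh i s t\<bar> \<le> alp" if "i \<in> comps E" "s \<in> space \<pi>" "t \<in> space \<pi>" for i s t
  proof -
    have st: "s \<in> T" "t \<in> T" using that by (auto simp: space_prior)
    show ?thesis
      using order_trans[OF yX_fX[OF that(1) st] alp_ge(1)] that(1)
      unfolding hh_def H_form[OF that(1) T_params[OF st(1)] T_params[OF st(2)]] by (simp add: PX_def)
  qed
  have hg: "K * lam\<^sup>2 * (\<integral>w. gX i w \<partial>PX i) \<le> kap" if "i \<in> comps E" for i
    using envelope_mean[OF prob_law[OF that \<theta>] gX(1)[OF that, of 0]] that by (simp add: PX_def)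
  have fam: "component_family \<pi> (comps E) PX (fX 0) gX kap" by (rule family_X) simp
  note mt = component_family.mean_tilt[OF fam y y_le hh_meas h_le m k hg crho_bounded a_loss_bounded,
      unfolded total_X[of 0, simplified] test_fun_hh process_eq[symmetric] card_comps]
  show "\<bar>mX - JX\<bar> \<le> M * (166 * kap + 3 * alp)"
    unfolding mX_def JX_eq joint_law_PX by (rule mt(1))
  have 1: "process E \<omega> t + \<beta> * ((\<Sum>i\<in>comps E. yX i (\<omega> i) t) + a * loss t)
      = (crho t + \<beta> * (a * loss t)) + (\<Sum>m\<in>comps E. fX \<beta> m (\<omega> m) t)" for \<omega> t
    unfolding fX_yX[symmetric, where \<beta>=\<beta>] process_eq sum.distrib sum_distrib_left[symmetric] by (simp add: algebra_simps)
  have 2: "process E \<omega> = (\<lambda>t. (crho t + 0 * (a * loss t)) + (\<Sum>m\<in>comps E. fX 0 m (\<omega> m) t))" for \<omega>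
    by (rule ext) (simp add: process_eq)
  show "\<beta> * mX \<le> LXr \<beta> - LXr 0"
    using mt(2)[where b=\<beta>] unfolding mX_def LXr_def 1[symmetric] 2[symmetric] .
qed

text \<open>
  On the Gaussian side the perturbation is removed rather than added: starting from \<open>pert \<beta>\<close> the step is \<open>- \<beta>\<close>.
  The covariance with the perturbed potential differs from \<open>hh\<close> by \<open>\<beta> * cov m (Bf m t) (Bf m s)\<close>.
\<close>

lemma Y_tilt:
  assumes \<beta>: "\<bar>\<beta>\<bar> \<le> 1"
  shows "\<bar>mY \<beta> - JG \<beta>\<bar> \<le> M * (166 * kap + 3 * (\<bar>\<beta>\<bar> * (K * r\<^sup>2)))" and "- \<beta> * mY \<beta> \<le> LY 0 - LY \<beta>"
proof -
  have y_le: "\<bar>yY i x t\<bar> \<le> gY i x" if "i \<in> comps E" "x \<in> space (gam i)" "t \<in> space \<pi>" for i x t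
    using gY(2)[OF that(1)] that by (simp add: space_prior)
  have h_le: "\<bar>hh i s t\<bar> \<le> K * lam\<^sup>2" if "i \<in> comps E" "s \<in> space \<pi>" "t \<in> space \<pi>" for i s t
    using that T_params by (intro hh_le(1)) (auto simp: space_prior)
  have m: "\<bar>\<integral>x. yY i x t \<partial>gam i\<bar> \<le> \<bar>\<beta>\<bar> * (K * r\<^sup>2)" if "i \<in> comps E" "t \<in> space \<pi>" for i t
    using gam_moments(1)[OF that(1) Bf_in[OF that(1)] Bf_in[OF that(1)], of t 0] K_ge by (simp add: yY_def)
  have k: "\<bar>(\<integral>x. yY i x t * fY \<beta> i x s \<partial>gam i) - hh i s t\<bar> \<le> \<bar>\<beta>\<bar> * (K * r\<^sup>2)"
    if i: "i \<in> comps E" and "s \<in> space \<pi>" "t \<in> space \<pi>" for i s t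
  proof -
    have st: "s \<in> params E" "t \<in> params E" using that T_params by (auto simp: space_prior)
    have "(\<integral>x. yY i x t * fY \<beta> i x s \<partial>gam i) = cov i (Bf i t) (psi \<beta> i s)"
      unfolding fY_def yY_def using gam_moments(2)[OF i Bf_in[OF i, of t] psi_in[OF i st(1)], of 0] by simp
    also have "\<dots> = hh i s t + \<beta> * cov i (Bf i t) (Bf i s)"
      unfolding cov_psi[OF i st] hh_def H_form[OF i st] ..
    finally show ?thesis
      using cov_le(3)[OF i norm_Bf_le'[OF i st(2)] norm_Bf_le'[OF i st(1)]] by (simp add: abs_mult mult_left_mono)
  qed
  have hg: "K * lam\<^sup>2 * (\<integral>w. gY i w \<partial>gam i) \<le> kap" if "i \<in> comps E" for i
    by (rule envelope_mean[OF prob_gam gY(1)[OF that, of 0]]) simp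
  have bb: "bounded_potential \<pi> (\<lambda>t. \<beta> * (a * loss t))" by (intro bounded_potential_scale loss_bounded)
  note mt = component_family.mean_tilt[OF family_Y[OF \<beta>] yY_meas y_le hh_meas h_le m k hg bb a_loss_bounded,
      unfolded total_Y[OF \<beta>] test_fun_hh pert_def[symmetric] card_comps]
  show "\<bar>mY \<beta> - JG \<beta>\<bar> \<le> M * (166 * kap + 3 * (\<bar>\<beta>\<bar> * (K * r\<^sup>2)))"
    unfolding mY_def JG_eq by (rule mt(1))
  have 1: "pert \<beta> x t + (- \<beta>) * ((\<Sum>i\<in>comps E. yY i (x i) t) + a * loss t) = pert 0 x t" for x t
    unfolding pert_def fY_yY[symmetric, where \<beta>=\<beta>] sum.distrib sum_distrib_left[symmetric] by (simp add: algebra_simps)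
  have "(\<lambda>t. pert \<beta> x t + (- \<beta>) * ((\<Sum>i\<in>comps E. yY i (x i) t) + a * loss t)) = pert 0 x" for x
    by (rule ext) (rule 1)
  then show "- \<beta> * mY \<beta> \<le> LY 0 - LY \<beta>"
    using mt(2)[where b="- \<beta>"] unfolding mY_def LY_def by simp
qed

lemma exchange_components:
  assumes \<beta>: "\<bar>\<beta>\<bar> \<le> 1"
  shows "\<bar>LXr \<beta> - LYr \<beta>\<bar> \<le> M * (68 * kap + 2 * alp)"
proof -
  have c: "bounded_potential \<pi> (\<lambda>t. crho t + \<beta> * (a * loss t))"
    by (intro bounded_potential_add crho_bounded bounded_potential_scale loss_bounded)
  show ?thesis
    using lindeberg_exchange[OF family_X[OF \<beta>] family_Y[OF \<beta>] _ _ c] fX_fY_mean[OF _ _ \<beta>] fX_fY_second[OF _ _ _ \<beta>]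
    unfolding LXr_def LYr_def total_X[OF \<beta>] total_Y[OF \<beta>] card_comps space_prior by blast
qed

lemma drop_remainder_mean:
  assumes \<beta>: "\<bar>\<beta>\<bar> \<le> 1"
  shows "\<bar>LYr \<beta> - LY \<beta>\<bar> \<le> M * (28 * (K * lam^3))"
proof -
  let ?N = "PiM (comps E) gam"
  interpret N: prob_space ?N by (rule prob_space_PiM) (rule prob_gam)
  have b: "bounded_potential \<pi> (\<lambda>t. \<beta> * (a * loss t))" by (intro bounded_potential_scale loss_bounded)
  have e: "(\<lambda>t. (crho t + \<beta> * (a * loss t)) + (\<Sum>m\<in>comps E. fY \<beta> m (x m) t)) = (\<lambda>t. crho t + pert \<beta> x t)" for x
    by (simp add: pert_def add.assoc)
  have i: "integrable ?N (\<lambda>x. log_partition \<pi> (\<lambda>t. crho t + pert \<beta> x t))"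
    using component_family.integrable_log_partition_total[OF family_Y[OF \<beta>] bounded_potential_add[OF crho_bounded b]]
    unfolding total_Y[OF \<beta>] e .
  have j: "integrable ?N (\<lambda>x. log_partition \<pi> (pert \<beta> x))"
    using component_family.integrable_log_partition_total[OF family_Y[OF \<beta>] b]
    unfolding total_Y[OF \<beta>] pert_def[symmetric] .
  have "LYr \<beta> - LY \<beta> = (\<integral>x. log_partition \<pi> (\<lambda>t. crho t + pert \<beta> x t) - log_partition \<pi> (pert \<beta> x) \<partial>?N)"
    unfolding LYr_def LY_def e using i j by simp
  also have "\<bar>\<dots>\<bar> \<le> M * (28 * (K * lam^3))"
  proof (rule N.abs_integral_le_bound(2))
    show "(\<lambda>x. log_partition \<pi> (\<lambda>t. crho t + pert \<beta> x t) - log_partition \<pi> (pert \<beta> x)) \<in> borel_measurable ?N"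
      using i j by (intro borel_measurable_diff borel_measurable_integrable)
  qed (rule log_partition_shift[OF prob_prior pert_bounded crho_bounded crho_le])
  finally show ?thesis .
qed

text \<open>
  The telescoping \<open>LXr \<beta> - LXr 0\<close> to \<open>LY \<beta> - LY 0\<close> costs two exchanges and two removals of \<open>crho\<close>; the passage
  from perturbations to test functions costs two integration-by-parts errors, with the factor \<open>\<beta>\<close>.
\<close>

lemma comparison_small:
  assumes \<beta>: "\<bar>\<beta>\<bar> \<le> 1"
  shows "\<beta> * (JX - JG \<beta>) \<le> M * r\<^sup>2 * (106248 * (K^4 * d) + \<bar>\<beta>\<bar> * (241564 * (K^4 * d) + 3 * (\<bar>\<beta>\<bar> * K)))"
proof -
  define k where "k = K^4 * lam^3"
  have k0: "K\<^sup>2 * lam^3 \<le> k" "K * lam^3 \<le> k"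
  proof -
    have "K\<^sup>2 \<le> K^4" "K \<le> K^4" using powers_K by linarith+
    then show "K\<^sup>2 * lam^3 \<le> k" "K * lam^3 \<le> k" unfolding k_def using lam_pos by (auto intro!: mult_right_mono)
  qed
  have k1: "kap = 704 * k" "alp \<le> 2612 * k" using k0 by (auto simp: kap_def k_def alp_def)
  have "68 * kap + 2 * alp \<le> 53096 * k" "28 * (K * lam^3) \<le> 28 * k" "166 * kap + 3 * alp \<le> 124700 * k"
    using k0 k1 by linarith+
  then have e: "M * (68 * kap + 2 * alp) \<le> M * (53096 * k)" "M * (28 * (K * lam^3)) \<le> M * (28 * k)"
    "M * (166 * kap + 3 * alp) \<le> M * (124700 * k)"
    by (intro mult_left_mono; simp)+
  have e4: "166 * kap = 116864 * k" using k1 by simp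
  have z: "\<bar>0::real\<bar> \<le> 1" by simp
  have p: "\<beta> * (mX - mY \<beta>) \<le> M * (106248 * k)"
  proof -
    have "\<beta> * (mX - mY \<beta>) = \<beta> * mX + (- \<beta> * mY \<beta>)" by (simp add: algebra_simps)
    moreover have "M * (106248 * k) = 2 * (M * (53096 * k)) + 2 * (M * (28 * k))" by simp
    ultimately show ?thesis
      using X_tilt(2)[of \<beta>] Y_tilt(2)[OF \<beta>] exchange_components[OF \<beta>] exchange_components[OF z]
        drop_remainder_mean[OF \<beta>] drop_remainder_mean[OF z] e(1,2)
      by linarith
  qed
  have q: "\<beta> * (u - v) \<le> \<bar>\<beta>\<bar> * w" if "\<bar>u - v\<bar> \<le> w" for u v w
  proof -
    have "\<beta> * (u - v) \<le> \<bar>\<beta>\<bar> * \<bar>u - v\<bar>" by (metis abs_ge_self abs_mult)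
    also have "\<dots> \<le> \<bar>\<beta>\<bar> * w" using that by (intro mult_left_mono) auto
    finally show ?thesis .
  qed
  have x: "\<beta> * (JX - mX) \<le> \<bar>\<beta>\<bar> * (M * (124700 * k))"
    using X_tilt(1) e(3) by (intro q) linarith
  have y: "\<beta> * (mY \<beta> - JG \<beta>) \<le> \<bar>\<beta>\<bar> * (M * (116864 * k + 3 * (\<bar>\<beta>\<bar> * (K * r\<^sup>2))))"
    using Y_tilt(1)[OF \<beta>] unfolding e4 by (rule q)
  have "\<beta> * (JX - JG \<beta>) = \<beta> * (mX - mY \<beta>) + \<beta> * (JX - mX) + \<beta> * (mY \<beta> - JG \<beta>)" by (simp add: algebra_simps)
  also have "\<dots> \<le> M * (106248 * k) + \<bar>\<beta>\<bar> * (M * (124700 * k)) + \<bar>\<beta>\<bar> * (M * (116864 * k + 3 * (\<bar>\<beta>\<bar> * (K * r\<^sup>2))))"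
    using p x y by linarith
  also have "\<dots> = M * r\<^sup>2 * (106248 * (K^4 * d) + \<bar>\<beta>\<bar> * (241564 * (K^4 * d) + 3 * (\<bar>\<beta>\<bar> * K)))"
    unfolding k_def lam3 by (simp add: algebra_simps)
  finally show ?thesis .
qed

end

context gaussian_comparison
begin

text \<open>
  Dividing by \<open>\<beta> = \<epsilon>\<close> and \<open>\<beta> = - \<epsilon>\<close> gives the two sides. If \<open>d\<close> or \<open>lam\<close> exceeds one, both averages are
  themselves bounded by the error.
\<close>

lemma comparison:
  assumes \<epsilon>: "0 < \<epsilon>" "\<epsilon> \<le> 1"
  defines "err \<equiv> 350000 * K^4 * (M * r\<^sup>2 * (\<epsilon> + d / \<epsilon>))"
  shows "JG (- \<epsilon>) - err \<le> JX" "JX \<le> JG \<epsilon> + err"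
proof -
  have Mr: "0 \<le> M * r\<^sup>2" by simp
  have K4: "1 \<le> K^4" "K \<le> K^4"
    using K_ge(2) one_le_power[OF K_ge(2), of 4] power_increasing[of 1 4 K] by auto
  have "JG (- \<epsilon>) - err \<le> JX \<and> JX \<le> JG \<epsilon> + err"
  proof (cases "d \<le> 1 \<and> lam \<le> 1")
    case True
    then interpret gaussian_comparison_small by unfold_locales auto
    have m: "106248 * (K^4 * d) + \<epsilon> * (241564 * (K^4 * d) + 3 * (\<epsilon> * K)) \<le> 350000 * K^4 * (\<epsilon> * \<epsilon> + d)"
    proof -
      have "\<epsilon> * (K^4 * d) \<le> 1 * (K^4 * d)" using \<epsilon> d by (intro mult_right_mono) auto
      moreover have "\<epsilon> * \<epsilon> * K \<le> \<epsilon> * \<epsilon> * K^4" using K4 \<epsilon> by (intro mult_left_mono) auto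
      moreover have "0 \<le> K^4 * d" "0 \<le> \<epsilon> * \<epsilon> * K^4" using d \<epsilon> by auto
      moreover have "106248 * (K^4 * d) + \<epsilon> * (241564 * (K^4 * d) + 3 * (\<epsilon> * K))
          = 106248 * (K^4 * d) + 241564 * (\<epsilon> * (K^4 * d)) + 3 * (\<epsilon> * \<epsilon> * K)" by (simp add: algebra_simps)
      moreover have "350000 * K^4 * (\<epsilon> * \<epsilon> + d) = 350000 * (\<epsilon> * \<epsilon> * K^4) + 350000 * (K^4 * d)" by (simp add: algebra_simps)
      ultimately show ?thesis by linarith
    qed
    have "M * r\<^sup>2 * (106248 * (K^4 * d) + \<epsilon> * (241564 * (K^4 * d) + 3 * (\<epsilon> * K))) \<le> M * r\<^sup>2 * (350000 * K^4 * (\<epsilon> * \<epsilon> + d))"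
      by (rule mult_left_mono[OF m Mr])
    also have "\<dots> = \<epsilon> * err" unfolding err_def using \<epsilon> by (simp add: field_simps)
    finally have b: "M * r\<^sup>2 * (106248 * (K^4 * d) + \<epsilon> * (241564 * (K^4 * d) + 3 * (\<epsilon> * K))) \<le> \<epsilon> * err" .
    have "\<epsilon> * (JX - JG \<epsilon>) \<le> \<epsilon> * err"
      using comparison_small[of \<epsilon>, unfolded abs_of_pos[OF \<epsilon>(1)], OF \<epsilon>(2)] b by (rule order_trans)
    moreover have "\<epsilon> * (JG (- \<epsilon>) - JX) \<le> \<epsilon> * err"
    proof -
      have "\<epsilon> * (JG (- \<epsilon>) - JX) = (- \<epsilon>) * (JX - JG (- \<epsilon>))" by (simp add: algebra_simps)
      moreover have "(- \<epsilon>) * (JX - JG (- \<epsilon>)) \<le> \<epsilon> * err"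
        using comparison_small[of "- \<epsilon>", unfolded abs_minus_cancel abs_of_pos[OF \<epsilon>(1)], OF \<epsilon>(2)] b by (rule order_trans)
      ultimately show ?thesis by linarith
    qed
    ultimately have "JX - JG \<epsilon> \<le> err" "JG (- \<epsilon>) - JX \<le> err" using \<epsilon> by simp_all
    then show ?thesis by linarith
  next
    case False
    have l: "6 * M * x \<le> err / 2" if "x \<le> K * (r\<^sup>2 * d)" for x :: real
    proof -
      have "6 * M * x \<le> 6 * M * (K * (r\<^sup>2 * d))" using that by (intro mult_left_mono) auto
      also have "\<dots> = 6 * K * (M * r\<^sup>2 * d)" by simp
      also have "\<dots> \<le> (175000 * K^4) * (M * r\<^sup>2 * (\<epsilon> + d / \<epsilon>))"
      proof (rule mult_mono)
        show "6 * K \<le> 175000 * K^4" using K4 by linarith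
        have "d * \<epsilon> \<le> d * 1" using \<epsilon> d by (intro mult_left_mono) auto
        then have "d \<le> d / \<epsilon>" using \<epsilon> by (simp add: le_divide_eq)
        then have "d \<le> \<epsilon> + d / \<epsilon>" using \<epsilon> by linarith
        then show "M * r\<^sup>2 * d \<le> M * r\<^sup>2 * (\<epsilon> + d / \<epsilon>)" by (rule mult_left_mono) simp
      qed (use K4 d in auto)
      also have "\<dots> = err / 2" by (simp add: err_def)
      finally show ?thesis .
    qed
    have tri: "\<bar>JX\<bar> \<le> e \<Longrightarrow> \<bar>JG \<epsilon>\<bar> \<le> e \<Longrightarrow> \<bar>JG (- \<epsilon>)\<bar> \<le> e \<Longrightarrow> e \<le> err / 2 \<Longrightarrow> ?thesis" for e by linarith
    show ?thesis
    proof (cases "d \<le> 1")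
      case True
      with False have l1: "1 \<le> lam" by simp
      have "K * lam\<^sup>2 \<le> K * lam^3" using K_ge l1 by (intro mult_left_mono power_increasing) auto
      then have "K * lam\<^sup>2 \<le> K * (r\<^sup>2 * d)" by (simp add: lam3)
      from tri[OF J_le(2) J_le(4) J_le(4) l[OF this]] show ?thesis .
    next
      case False
      then have "K * r\<^sup>2 * 1 \<le> K * r\<^sup>2 * d" using K_ge by (intro mult_left_mono) auto
      then have "K * r\<^sup>2 \<le> K * (r\<^sup>2 * d)" by simp
      from tri[OF J_le(1) J_le(3) J_le(3) l[OF this]] show ?thesis .
    qed
  qed
  then show "JG (- \<epsilon>) - err \<le> JX" "JX \<le> JG \<epsilon> + err" by auto
qed

end

section \<open>Uniform constants\<close>

theorem theorem9:
  fixes E :: "nat \<Rightarrow>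
      ('p::topological_space, 'w, 'h::{real_inner, banach, second_countable_topology}) lik_model"
    and \<delta> :: "nat \<Rightarrow> 'p \<Rightarrow> real"
    and Q :: "nat \<Rightarrow> 'p \<Rightarrow> 'q measure"
    and \<xi> :: "nat \<Rightarrow> 'q \<Rightarrow> nat \<Rightarrow> 'h"
    and H B :: "nat \<Rightarrow> nat \<Rightarrow> ('h \<Rightarrow>\<^sub>L 'h)"
    and a :: real
  assumes model: "\<And>n. n \<ge> 1 \<Longrightarrow> local_likelihood_model (E n)"
    and moments: "local_moment_bounds E \<delta>"
    and radius_bound:
      "\<exists>c::real. \<forall>n\<ge>1. radius (E n) \<le> c * sqrt (real n / real (ncomp (E n)))"
    and gauss_prob: "\<And>n \<theta>. n \<ge> 1 \<Longrightarrow> \<theta> \<in> params (E n) \<Longrightarrow> prob_space (Q n \<theta>)"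
    and gauss_law: "\<And>n \<theta>. n \<ge> 1 \<Longrightarrow> \<theta> \<in> params (E n) \<Longrightarrow> gaussian_element (E n) (Q n \<theta>) (\<xi> n)"
    and H_op: "\<And>n m. n \<ge> 1 \<Longrightarrow> m \<in> comps (E n) \<Longrightarrow> operator_on (hspace (E n) m) (H n m)"
    and H_selfadjoint: "\<And>n m. n \<ge> 1 \<Longrightarrow> m \<in> comps (E n) \<Longrightarrow> selfadjoint_op (H n m)"
    and H_range: "\<And>n m. n \<ge> 1 \<Longrightarrow> m \<in> comps (E n) \<Longrightarrow>
      range (blinfun_apply (H n m)) \<subseteq> range (blinfun_apply (Sigmaop (E n) m))"
    and B_op: "\<And>n m. n \<ge> 1 \<Longrightarrow> m \<in> comps (E n) \<Longrightarrow> operator_on (hspace (E n) m) (B n m)"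
    and H_factor: "\<And>n m. n \<ge> 1 \<Longrightarrow> m \<in> comps (E n) \<Longrightarrow> H n m = Sigmaop (E n) m o\<^sub>L B n m"
    and a_cases: "a \<in> {-1, 0}"
    and h_bounded: "(\<lambda>n. op_size (E n) (H n) (B n)) \<in> O(\<lambda>_. 1)"
  shows "\<exists>\<epsilon>\<^sub>0>0. \<exists>C::real. \<forall>\<epsilon>. 0 < \<epsilon> \<and> \<epsilon> < \<epsilon>\<^sub>0 \<longrightarrow>
    (\<forall>n\<ge>1. \<forall>\<theta>\<in>params (E n).
       PhiG n (E n) (Q n) (\<xi> n) (H n) (B n) a \<theta> (-\<epsilon>) - C * (\<epsilon> + delta_tilde \<delta> n \<theta> / \<epsilon>)
         \<le> Phi n (E n) (H n) a \<theta> \<and>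
       Phi n (E n) (H n) a \<theta>
         \<le> PhiG n (E n) (Q n) (\<xi> n) (H n) (B n) a \<theta> \<epsilon> + C * (\<epsilon> + delta_tilde \<delta> n \<theta> / \<epsilon>))"
proof -
  obtain cL where cL: "\<And>n m. n \<ge> 1 \<Longrightarrow> m \<in> comps (E n) \<Longrightarrow> momL (E n) m \<le> ennreal cL"
    using moments unfolding local_moment_bounds_def by blast
  obtain cE where cE: "\<And>n \<theta> m. n \<ge> 1 \<Longrightarrow> \<theta> \<in> params (E n) \<Longrightarrow> m \<in> comps (E n) \<Longrightarrow>
      errU (E n) \<theta> m + errS (E n) \<theta> m + errV (E n) \<theta> m + errR (E n) \<theta> m + errD (E n) \<theta> m \<le> ennreal (cE * \<delta> n \<theta>)"
    using moments unfolding local_moment_bounds_def by blast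
  obtain cr where cr: "\<And>n. n \<ge> 1 \<Longrightarrow> radius (E n) \<le> cr * sqrt (real n / real (ncomp (E n)))"
    using radius_bound by blast
  \<comment> \<open>an eventual bound on a real sequence is a bound on the whole sequence, after enlarging the constant\<close>
  obtain hb where hb: "0 < hb" "\<And>n. norm (op_size (E n) (H n) (B n)) \<le> hb"
  proof -
    from h_bounded obtain x where "eventually (\<lambda>n. norm (op_size (E n) (H n) (B n)) \<le> x * norm (1::real)) sequentially"
      by (rule landau_o.bigE)
    then have "Bseq (\<lambda>n. op_size (E n) (H n) (B n))" by (intro BfunI[of _ x]) simp
    then obtain K where "0 < K" "\<forall>n. norm (op_size (E n) (H n) (B n)) \<le> K" by (rule BseqE)
    then show ?thesis using that[of K] by blast
  qed
  define c where "c = max 1 cL"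
  define ce where "ce = max 0 cE"
  define k where "k = 350000 * (8 * (1 + hb)^3 * c)^4"
  define C where "C = k * cr\<^sup>2 * (2 + ce)"
  have k0: "0 \<le> k" unfolding k_def using hb(1) by (simp add: c_def)
  have main: "PhiG n (E n) (Q n) (\<xi> n) (H n) (B n) a \<theta> (-\<epsilon>) - C * (\<epsilon> + delta_tilde \<delta> n \<theta> / \<epsilon>) \<le> Phi n (E n) (H n) a \<theta>
      \<and> Phi n (E n) (H n) a \<theta> \<le> PhiG n (E n) (Q n) (\<xi> n) (H n) (B n) a \<theta> \<epsilon> + C * (\<epsilon> + delta_tilde \<delta> n \<theta> / \<epsilon>)"
    if n: "1 \<le> n" and \<theta>: "\<theta> \<in> params (E n)" and \<epsilon>: "0 < \<epsilon>" "\<epsilon> \<le> 1" for n \<theta> \<epsilon>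
  proof -
    have \<delta>0: "0 \<le> \<delta> n \<theta>" using moments n \<theta> by (auto simp: local_moment_bounds_def)
    \<comment> \<open>the summand \<open>\<epsilon>\<^sup>2\<close> makes \<open>d\<close> positive and contributes only \<open>\<epsilon>\<close> to \<open>d / \<epsilon>\<close>\<close>
    define d where "d = ce * \<delta> n \<theta> + \<epsilon>\<^sup>2"
    have "0 \<le> ce * \<delta> n \<theta>" using \<delta>0 by (simp add: ce_def)
    then have d: "0 < d" unfolding d_def using \<epsilon> by (simp add: add_nonneg_pos)
    have "cE * \<delta> n \<theta> \<le> ce * \<delta> n \<theta>" using \<delta>0 by (intro mult_right_mono) (auto simp: ce_def)
    then have "cE * \<delta> n \<theta> \<le> d" unfolding d_def using zero_le_power2[of \<epsilon>] by linarith
    then have err_le: "ennreal (cE * \<delta> n \<theta>) \<le> ennreal d" by (rule ennreal_leI)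
    have L_le: "ennreal cL \<le> ennreal c" unfolding c_def by (intro ennreal_leI) simp
    have B_le: "norm (B n m) \<le> hb" if m: "m \<in> comps (E n)" for m
    proof -
      have "norm (H n m) + norm (B n m) \<le> op_size (E n) (H n) (B n)"
        unfolding op_size_def using m by (intro Max_ge) (auto simp: comps_def)
      moreover have "op_size (E n) (H n) (B n) \<le> hb" using hb(2)[of n] by simp
      ultimately show ?thesis using norm_ge_zero[of "H n m"] by linarith
    qed
    interpret G: gaussian_comparison "E n" \<theta> c d "Q n \<theta>" "\<xi> n" "H n" "B n" a hb
    proof (intro gaussian_comparison.intro likelihood_point.intro likelihood_point_axioms.intro gaussian_comparison_axioms.intro)
      show "(\<integral>w. Uvec (E n) m w \<partial>null_law (E n) m) = 0" if "m \<in> comps (E n)" for m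
        using moments n that by (auto simp: local_moment_bounds_def)
      show "momL (E n) m \<le> ennreal c" if "m \<in> comps (E n)" for m
        using order_trans[OF cL[OF n that] L_le] .
      show "errU (E n) \<theta> m + errS (E n) \<theta> m + errV (E n) \<theta> m + errR (E n) \<theta> m + errD (E n) \<theta> m \<le> ennreal d"
        if "m \<in> comps (E n)" for m
        using order_trans[OF cE[OF n \<theta> that] err_le] .
    qed (use model n \<theta> d gauss_prob gauss_law H_selfadjoint B_op H_factor a_cases hb B_le in \<open>auto simp: c_def\<close>)
    let ?M = "real (ncomp (E n))" and ?r = "radius (E n)"
    define err where "err = k * (?M * ?r\<^sup>2 * (\<epsilon> + d / \<epsilon>))"
    have cmp: "G.JG (- \<epsilon>) - err \<le> G.JX" "G.JX \<le> G.JG \<epsilon> + err"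
      using G.comparison[OF \<epsilon>] unfolding err_def k_def G.K_def by auto
    have n0: "0 < real n" and M0: "0 < ?M" using n G.ncomp_pos by auto
    have "?r\<^sup>2 \<le> (cr * sqrt (real n / ?M))\<^sup>2" using cr[OF n] G.r_pos by (intro power_mono) auto
    also have "\<dots> = cr\<^sup>2 * (real n / ?M)" using n0 M0 by (simp add: power_mult_distrib)
    finally have Mr: "?M * ?r\<^sup>2 \<le> cr\<^sup>2 * real n" using M0 by (simp add: field_simps)
    have de: "\<epsilon> + d / \<epsilon> \<le> (2 + ce) * (\<epsilon> + delta_tilde \<delta> n \<theta> / \<epsilon>)"
    proof -
      have ce0: "0 \<le> ce" by (simp add: ce_def)
      have dt: "\<delta> n \<theta> \<le> delta_tilde \<delta> n \<theta>" using \<delta>0 by (simp add: delta_tilde_def algebra_simps)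
      have "\<epsilon> + d / \<epsilon> = 2 * \<epsilon> + ce * (\<delta> n \<theta> / \<epsilon>)" unfolding d_def using \<epsilon> by (simp add: field_simps power2_eq_square)
      also have "\<dots> \<le> 2 * \<epsilon> + ce * (delta_tilde \<delta> n \<theta> / \<epsilon>)"
        using dt \<epsilon> ce0 by (intro add_left_mono mult_left_mono divide_right_mono) auto
      also have "\<dots> \<le> 2 * \<epsilon> + ce * (delta_tilde \<delta> n \<theta> / \<epsilon>) + (ce * \<epsilon> + 2 * (delta_tilde \<delta> n \<theta> / \<epsilon>))"
        using \<epsilon> ce0 \<delta>0 dt by simp
      also have "\<dots> = (2 + ce) * (\<epsilon> + delta_tilde \<delta> n \<theta> / \<epsilon>)" by (simp add: algebra_simps add_divide_distrib)
      finally show ?thesis .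
    qed
    have "err \<le> k * ((cr\<^sup>2 * real n) * ((2 + ce) * (\<epsilon> + delta_tilde \<delta> n \<theta> / \<epsilon>)))"
      unfolding err_def using Mr de k0 \<epsilon> d by (intro mult_left_mono[OF mult_mono[OF Mr de]]) auto
    also have "\<dots> = real n * (C * (\<epsilon> + delta_tilde \<delta> n \<theta> / \<epsilon>))" by (simp add: C_def)
    finally have e: "err / real n \<le> C * (\<epsilon> + delta_tilde \<delta> n \<theta> / \<epsilon>)" using n0 by (simp add: field_simps)
    have Phi: "Phi n (E n) (H n) a \<theta> = G.JX / real n" by (simp add: Phi_def G.JX_def)
    have PhiG: "PhiG n (E n) (Q n) (\<xi> n) (H n) (B n) a \<theta> \<beta> = G.JG \<beta> / real n" for \<beta> by (simp add: PhiG_def G.JG_def)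
    have "(G.JG (- \<epsilon>) - err) / real n \<le> G.JX / real n" "G.JX / real n \<le> (G.JG \<epsilon> + err) / real n"
      using cmp n0 by (auto intro!: divide_right_mono)
    then show ?thesis unfolding Phi PhiG using e by (auto simp: diff_divide_distrib add_divide_distrib)
  qed
  show ?thesis
    by (intro exI[of _ 1] conjI[OF zero_less_one] exI[of _ C] allI impI ballI main) auto
qed

end
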